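(* Let $u^0\equiv0$ and let $\mu>-1$. Suppose that $f\in L^1(0,T;L^2(\Omega))$ is such that, for some $\theta\in(\pi/2,\pi)$ and some small $\varepsilon>0$, its Laplace transform $\hat f$ with respect to $t$ is analytic within $\Sigma_\theta^\varepsilon=\{z\in\mathbb{C}:|z|\ge\varepsilon,\ |\arg z|<\theta\}$ and satisfies $\|\hat f(s)\|\le c_f|s|^{-\mu-1}$ there, with a constant $c_f$. Let $u_h$ be the solution of the semidiscrete finite element problem and let $\tilde u_h^n$ be the solution of the fully discrete scheme (CN-II) with step size $\tau=T/N$ (both defined in the context). Then there is a constant $c>0$, independent of $\tau$, $n$ and $h$, such that $$\|u_h(t_n)-\tilde u_h^n\|\le c\,t_n^{\alpha+\mu-2}\tau^2,\qquad n=1,2,\dots,N.$$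
   Context: Let $0<\alpha<1$, $T>0$, and let $\Omega\subset\mathbb{R}^d$ ($d=1,2$) be a bounded domain. $A$ is a self-adjoint positive definite second-order elliptic partial differential operator in $\Omega$ with homogeneous Dirichlet boundary condition, with associated bilinear form $A(\cdot,\cdot)$. $(\cdot,\cdot)$ and $\|\cdot\|$ are the inner product and norm of $L^2(\Omega)$. The underlying problem is ${}^{C}D_t^\alpha u+Au=f$ in $\Omega\times(0,T]$, $u=0$ on $\partial\Omega\times(0,T]$, $u(0)=u^0$, where ${}^{C}D_t^{\alpha}u(t)=\frac{1}{\Gamma(1-\alpha)}\int_0^t(t-\zeta)^{-\alpha}u'(\zeta)\,d\zeta$ is the Caputo derivative. For the Laplace transform, $f$ is understood as a function of $t\in(0,\infty)$, $\hat f(s)=\int_0^\infty e^{-st}f(t)\,dt$ for $\Re s$ sufficiently large, and $\hat f$ also denotes the analytic continuation. Semidiscrete problem. $X_h\subset H_0^1(\Omega)$ is the space of continuous piecewise linear finite elements on a regular triangulation of $\Omega$ of maximal diameter $h$; $P_h:L^2(\Omega)\to X_h$ is the $L^2$-projection; $A_h:X_h\to X_h$ is defined by $(A_h\varphi,\psi)=A(\varphi,\psi)$ for all $\varphi,\psi\in X_h$; $f_h=P_hf$. $u_h$ solves ${}^{C}D_t^\alpha u_h(t)+A_hu_h(t)=f_h(t)$ for $t>0$, $u_h(0)=P_hu^0$; when $u^0=0$ this solution is given by $u_h(t)=\int_0^tE_h(t-s)f_h(s)\,ds$, where $E_h(t)=\frac1{2\pi i}\int_{\sigma-i\infty}^{\sigma+i\infty}e^{st}(s^\alpha+A_h)^{-1}ds$,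 $\sigma>0$ (the contour may be deformed to one going to infinity along the rays $\arg s=\pm\vartheta$ for any $\vartheta\in(\pi/2,\pi)$). Scheme (CN-II). Let $N\in\mathbb{N}$, $\tau=T/N$, $t_n=n\tau$. Let $F_h(t)=\int_0^tf_h(\xi)\,d\xi$, $\tilde F_h(t)=\int_0^tF_h(\xi)\,d\xi$ and $\tilde F_h^n=\tilde F_h(t_n)$. Let $\sigma_0=1$, $\sigma_j=(1-\frac{\alpha+1}{j})\sigma_{j-1}$ for $j\ge1$, i.e. $\sum_{j\ge0}\sigma_jz^j=(1-z)^\alpha$. Let $D_\tau$ be the second-order BDF operator $D_\tau\varphi(t)=\frac1\tau\big(\frac32\varphi(t)-2\varphi(t-\tau)+\frac12\varphi(t-2\tau)\big)$, with $D_\tau\tilde F_h^n=D_\tau\tilde F_h(t_n)$; all functions (including $t^{2-\alpha}$, $\tilde F_h$, $\tilde U_h$) are taken to be $0$ for $t\le0$, so $\tilde U_h^{0}=\tilde U_h^{-1}=0$. For $n=1,\dots,N$ the scheme determines $\tilde U_h^n,\tilde u_h^n\in X_h$ by $$\tau^{-\alpha}\sum_{j=0}^{n}\sigma_j\tilde U_h^{n-j}+(1-\tfrac\alpha2)A_h\tilde U_h^n+\tfrac\alpha2A_h\tilde U_h^{n-1}=(1-\tfrac\alpha2)D_\tau\tilde F_h^n+\tfrac\alpha2D_\tau\tilde F_h^{n-1}+(1-\tfrac\alpha2)D_\tau\frac{t_n^{2-\alpha}}{\Gamma(3-\alpha)}u_h(0)+\tfrac\alpha2D_\tau\frac{t_{n-1}^{2-\alpha}}{\Gamma(3-\alpha)}u_h(0),$$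 $$\tilde u_h^n=\frac1\tau\Big(\frac32\tilde U_h^n-2\tilde U_h^{n-1}+\frac12\tilde U_h^{n-2}\Big).$$ *)

theory Defs
  imports "HOL-Complex_Analysis.Complex_Analysis"
begin

section \<open>The Hilbert space of square integrable functions\<close>

text \<open>
  Laplace transforms force complex scalars, so all function spaces are complex. Elements of
  the \<open>L\<^sup>2\<close> space are represented by functions, and everything stated about them is
  invariant under changes on null sets.
\<close>

definition L2 :: "(real^'d::finite) set \<Rightarrow> (real^'d \<Rightarrow> complex) set" where
  "L2 \<Omega> = {v. v \<in> borel_measurable (lebesgue_on \<Omega>) \<and>
              integrable (lebesgue_on \<Omega>) (\<lambda>x. (cmod (v x))\<^sup>2)}"

definition L2_inner :: "(real^'d::finite) set \<Rightarrow> (real^'d \<Rightarrow> complex) \<Rightarrow> (real^'d \<Rightarrow> complex) \<Rightarrow> complex" where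
  "L2_inner \<Omega> u v = (LINT x|lebesgue_on \<Omega>. u x * cnj (v x))"

definition L2_norm :: "(real^'d::finite) set \<Rightarrow> (real^'d \<Rightarrow> complex) \<Rightarrow> real" where
  "L2_norm \<Omega> v = sqrt (LINT x|lebesgue_on \<Omega>. (cmod (v x))\<^sup>2)"


section \<open>Bochner integration and holomorphy with values in that space\<close>

text \<open>
  The library's Bochner integral needs a Banach space as a type. The following copies its
  definition for functions of \<open>t\<close> whose values are elements of \<^term>\<open>L2 \<Omega>\<close>.
\<close>

definition L2_simple :: "(real^'d::finite) set \<Rightarrow> real measure \<Rightarrow> (real \<Rightarrow> real^'d \<Rightarrow> complex) \<Rightarrow> bool" where
  "L2_simple \<Omega> M s \<longleftrightarrow> simple_function M s \<and> (\<forall>t\<in>space M. s t \<in> L2 \<Omega>) \<and>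
     emeasure M {t\<in>space M. s t \<noteq> (\<lambda>_. 0)} \<noteq> \<infinity>"

definition L2_simple_integral :: "real measure \<Rightarrow> (real \<Rightarrow> real^'d::finite \<Rightarrow> complex) \<Rightarrow> real^'d \<Rightarrow> complex" where
  "L2_simple_integral M s x = (\<Sum>v\<in>s ` space M. measure M {t\<in>space M. s t = v} *\<^sub>R v x)"

definition L2_strongly_measurable :: "(real^'d::finite) set \<Rightarrow> real measure \<Rightarrow> (real \<Rightarrow> real^'d \<Rightarrow> complex) \<Rightarrow> bool" where
  "L2_strongly_measurable \<Omega> M f \<longleftrightarrow> (\<forall>t\<in>space M. f t \<in> L2 \<Omega>) \<and>
     (\<exists>s. (\<forall>k::nat. L2_simple \<Omega> M (s k)) \<and>
          (AE t in M. (\<lambda>k. L2_norm \<Omega> (\<lambda>x. f t x - s k t x)) \<longlonglongrightarrow> 0))"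

definition L2_integrable :: "(real^'d::finite) set \<Rightarrow> real measure \<Rightarrow> (real \<Rightarrow> real^'d \<Rightarrow> complex) \<Rightarrow> bool" where
  "L2_integrable \<Omega> M f \<longleftrightarrow> L2_strongly_measurable \<Omega> M f \<and> integrable M (\<lambda>t. L2_norm \<Omega> (f t))"

definition has_L2_integral :: "(real^'d::finite) set \<Rightarrow> real measure \<Rightarrow> (real \<Rightarrow> real^'d \<Rightarrow> complex) \<Rightarrow> (real^'d \<Rightarrow> complex) \<Rightarrow> bool" where
  "has_L2_integral \<Omega> M f I \<longleftrightarrow> L2_integrable \<Omega> M f \<and> I \<in> L2 \<Omega> \<and>
     (\<exists>s. (\<forall>k::nat. L2_simple \<Omega> M (s k)) \<and>
          (\<lambda>k. \<integral>\<^sup>+t. ennreal (L2_norm \<Omega> (\<lambda>x. f t x - s k t x)) \<partial>M) \<longlonglongrightarrow> 0 \<and>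
          (\<lambda>k. L2_norm \<Omega> (\<lambda>x. L2_simple_integral M (s k) x - I x)) \<longlonglongrightarrow> 0)"

definition L2_holomorphic_on :: "(real^'d::finite) set \<Rightarrow> (complex \<Rightarrow> real^'d \<Rightarrow> complex) \<Rightarrow> complex set \<Rightarrow> bool" where
  "L2_holomorphic_on \<Omega> F S \<longleftrightarrow> (\<forall>z\<in>S. F z \<in> L2 \<Omega> \<and>
     (\<exists>g\<in>L2 \<Omega>. ((\<lambda>w. L2_norm \<Omega> (\<lambda>x. (F w x - F z x) / (w - z) - g x)) \<longlongrightarrow> 0) (at z within S)))"

text \<open>\<open>F\<close> is the Laplace transform of \<open>f\<close> for \<open>Re s\<close> sufficiently large; elsewhere \<open>F\<close> is
  only pinned down by an additional requirement of holomorphy (analytic continuation).\<close>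

definition L2_laplace_transform :: "(real^'d::finite) set \<Rightarrow> (real \<Rightarrow> real^'d \<Rightarrow> complex) \<Rightarrow> (complex \<Rightarrow> real^'d \<Rightarrow> complex) \<Rightarrow> bool" where
  "L2_laplace_transform \<Omega> f F \<longleftrightarrow> (\<exists>\<rho>. \<forall>s. Re s > \<rho> \<longrightarrow>
     has_L2_integral \<Omega> (lebesgue_on {0<..}) (\<lambda>t x. exp (- s * of_real t) * f t x) (F s))"

definition trunc_sector :: "real \<Rightarrow> real \<Rightarrow> complex set" where
  "trunc_sector \<theta> \<epsilon> = {z. \<epsilon> \<le> cmod z \<and> \<bar>Arg z\<bar> < \<theta>}"


section \<open>The elliptic operator\<close>

definition partial_deriv :: "'d::finite \<Rightarrow> (real^'d \<Rightarrow> complex) \<Rightarrow> real^'d \<Rightarrow> complex" where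
  "partial_deriv i v x = frechet_derivative v (at x) (axis i 1)"

definition C1_compact_support :: "(real^'d::finite) set \<Rightarrow> (real^'d \<Rightarrow> complex) \<Rightarrow> bool" where
  "C1_compact_support \<Omega> v \<longleftrightarrow> (\<forall>x. v differentiable (at x)) \<and>
     (\<forall>i. continuous_on UNIV (partial_deriv i v)) \<and>
     (\<exists>K. compact K \<and> K \<subseteq> \<Omega> \<and> (\<forall>x. x \<notin> K \<longrightarrow> v x = 0))"

text \<open>
  \<open>H\<^sub>0\<^sup>1\<close> is the closure of the compactly supported \<open>C\<^sup>1\<close> functions in the \<open>H\<^sup>1\<close> norm.
  The limit \<open>g\<close> of the gradients is the weak gradient of \<open>v\<close>, hence unique almost everywhere.
\<close>

definition has_H01_gradient :: "(real^'d::finite) set \<Rightarrow> (real^'d \<Rightarrow> complex) \<Rightarrow> (real^'d \<Rightarrow> complex^'d) \<Rightarrow> bool" where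
  "has_H01_gradient \<Omega> v g \<longleftrightarrow> v \<in> L2 \<Omega> \<and> (\<forall>i. (\<lambda>x. g x $ i) \<in> L2 \<Omega>) \<and>
     (\<exists>\<eta>. (\<forall>k::nat. C1_compact_support \<Omega> (\<eta> k)) \<and>
          (\<lambda>k. L2_norm \<Omega> (\<lambda>x. \<eta> k x - v x)) \<longlonglongrightarrow> 0 \<and>
          (\<forall>i. (\<lambda>k. L2_norm \<Omega> (\<lambda>x. partial_deriv i (\<eta> k) x - g x $ i)) \<longlonglongrightarrow> 0))"

definition H01 :: "(real^'d::finite) set \<Rightarrow> (real^'d \<Rightarrow> complex) set" where
  "H01 \<Omega> = {v. \<exists>g. has_H01_gradient \<Omega> v g}"

text \<open>
  \<open>A\<close> is the sesquilinear form on \<^term>\<open>H01 \<Omega>\<close> of a self-adjoint, uniformly elliptic operator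
  \<open>u \<mapsto> - \<Sum>i j. \<partial>\<^sub>i (a\<^sub>i\<^sub>j \<partial>\<^sub>j u) + b u\<close> with bounded measurable real coefficients
  and homogeneous Dirichlet condition, and this operator is positive definite. The sign of
  \<open>b\<close> is not restricted. Values of \<open>A\<close> outside \<^term>\<open>H01 \<Omega>\<close> are irrelevant.
\<close>

definition elliptic_form :: "(real^'d::finite) set \<Rightarrow> ((real^'d \<Rightarrow> complex) \<Rightarrow> (real^'d \<Rightarrow> complex) \<Rightarrow> complex) \<Rightarrow> bool" where
  "elliptic_form \<Omega> A \<longleftrightarrow>
     (\<exists>(a :: real^'d \<Rightarrow> real^'d^'d) (b :: real^'d \<Rightarrow> real) \<kappa> B.
        (\<forall>i j. (\<lambda>x. a x $ i $ j) \<in> borel_measurable (lebesgue_on \<Omega>)) \<and>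
        b \<in> borel_measurable (lebesgue_on \<Omega>) \<and>
        (\<forall>x\<in>\<Omega>. (\<forall>i j. \<bar>a x $ i $ j\<bar> \<le> B) \<and> \<bar>b x\<bar> \<le> B) \<and>
        (\<forall>x\<in>\<Omega>. transpose (a x) = a x) \<and>
        \<kappa> > 0 \<and> (\<forall>x\<in>\<Omega>. \<forall>\<xi>. \<xi> \<bullet> (a x *v \<xi>) \<ge> \<kappa> * (norm \<xi>)\<^sup>2) \<and>
        (\<forall>\<phi> \<psi> p q. has_H01_gradient \<Omega> \<phi> p \<longrightarrow> has_H01_gradient \<Omega> \<psi> q \<longrightarrow>
           A \<phi> \<psi> = (LINT x|lebesgue_on \<Omega>.
              (\<Sum>i\<in>UNIV. \<Sum>j\<in>UNIV. of_real (a x $ i $ j) * p x $ j * cnj (q x $ i))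
              + of_real (b x) * \<phi> x * cnj (\<psi> x)))) \<and>
     (\<forall>v\<in>H01 \<Omega>. L2_norm \<Omega> v \<noteq> 0 \<longrightarrow> Re (A v v) > 0)"


section \<open>Finite elements and the semidiscrete problem\<close>

text \<open>Face-to-face (\<^const>\<open>triangulation\<close>) and shape regular with constant \<open>\<gamma>\<close>.\<close>

definition regular_triangulation :: "(real^'d::finite) set \<Rightarrow> real \<Rightarrow> real \<Rightarrow> (real^'d) set set \<Rightarrow> bool" where
  "regular_triangulation \<Omega> \<gamma> h \<T> \<longleftrightarrow> triangulation \<T> \<and>
     (\<forall>K\<in>\<T>. int CARD('d) simplex K) \<and> \<Union>\<T> = closure \<Omega> \<and>
     (\<forall>K\<in>\<T>. \<exists>z r. r > 0 \<and> cball z r \<subseteq> K \<and> diameter K \<le> \<gamma> * r) \<and>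
     h = Max (diameter ` \<T>)"

text \<open>Finite element functions are extended by \<open>0\<close> outside \<open>\<Omega>\<close>, so that each of them is
  determined by its \<open>L\<^sup>2\<close> class.\<close>

definition fe_space :: "(real^'d::finite) set \<Rightarrow> (real^'d) set set \<Rightarrow> (real^'d \<Rightarrow> complex) set" where
  "fe_space \<Omega> \<T> = {v \<in> H01 \<Omega>. continuous_on (closure \<Omega>) v \<and> (\<forall>x. x \<notin> \<Omega> \<longrightarrow> v x = 0) \<and>
     (\<forall>K\<in>\<T>. \<exists>c L. linear L \<and> (\<forall>x\<in>K. v x = c + L x))}"

definition L2_proj :: "(real^'d::finite) set \<Rightarrow> (real^'d \<Rightarrow> complex) set \<Rightarrow> (real^'d \<Rightarrow> complex) \<Rightarrow> real^'d \<Rightarrow> complex" where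
  "L2_proj \<Omega> X v = (THE w. w \<in> X \<and> (\<forall>\<psi>\<in>X. L2_inner \<Omega> w \<psi> = L2_inner \<Omega> v \<psi>))"

definition discrete_op :: "(real^'d::finite) set \<Rightarrow> ((real^'d \<Rightarrow> complex) \<Rightarrow> (real^'d \<Rightarrow> complex) \<Rightarrow> complex) \<Rightarrow>
    (real^'d \<Rightarrow> complex) set \<Rightarrow> (real^'d \<Rightarrow> complex) \<Rightarrow> real^'d \<Rightarrow> complex" where
  "discrete_op \<Omega> A X \<phi> = (THE w. w \<in> X \<and> (\<forall>\<psi>\<in>X. L2_inner \<Omega> w \<psi> = A \<phi> \<psi>))"

text \<open>\<open>(z + A\<^sub>h)\<^sup>-\<^sup>1 v\<close> for \<open>v\<close> in \<open>X\<close>\<close>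

definition discrete_resolvent :: "(real^'d::finite) set \<Rightarrow> ((real^'d \<Rightarrow> complex) \<Rightarrow> (real^'d \<Rightarrow> complex) \<Rightarrow> complex) \<Rightarrow>
    (real^'d \<Rightarrow> complex) set \<Rightarrow> complex \<Rightarrow> (real^'d \<Rightarrow> complex) \<Rightarrow> real^'d \<Rightarrow> complex" where
  "discrete_resolvent \<Omega> A X z v = (THE w. w \<in> X \<and> (\<forall>x. z * w x + discrete_op \<Omega> A X w x = v x))"

text \<open>
  The Bromwich integral converges only conditionally. Integrals of functions with values in
  the finite-dimensional space \<open>X\<close> are taken pointwise in \<open>x\<close>, here and below.
\<close>

definition solution_op :: "(real^'d::finite) set \<Rightarrow> ((real^'d \<Rightarrow> complex) \<Rightarrow> (real^'d \<Rightarrow> complex) \<Rightarrow> complex) \<Rightarrow>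
    (real^'d \<Rightarrow> complex) set \<Rightarrow> real \<Rightarrow> real \<Rightarrow> real \<Rightarrow> (real^'d \<Rightarrow> complex) \<Rightarrow> real^'d \<Rightarrow> complex" where
  "solution_op \<Omega> A X \<alpha> \<sigma> t v x = Lim at_top (\<lambda>R.
     1 / (2 * of_real pi * \<i>) *
     contour_integral (linepath (Complex \<sigma> (- R)) (Complex \<sigma> R))
       (\<lambda>s. exp (s * of_real t) * discrete_resolvent \<Omega> A X (s powr of_real \<alpha>) v x))"

text \<open>Solution for vanishing initial value, by Duhamel's formula. For data behaving like
  \<open>t\<^sup>\<mu>\<close> with \<open>\<alpha> + \<mu> < 0\<close> it is unbounded at \<open>0\<close>, so the pointwise Caputo initial value problem
  would be too narrow a definition.\<close>

definition semidiscrete_solution :: "(real^'d::finite) set \<Rightarrow> ((real^'d \<Rightarrow> complex) \<Rightarrow> (real^'d \<Rightarrow> complex) \<Rightarrow> complex) \<Rightarrow>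
    (real^'d \<Rightarrow> complex) set \<Rightarrow> real \<Rightarrow> real \<Rightarrow> (real \<Rightarrow> real^'d \<Rightarrow> complex) \<Rightarrow> real \<Rightarrow> real^'d \<Rightarrow> complex" where
  "semidiscrete_solution \<Omega> A X \<alpha> \<sigma> f t x =
     (LINT r|lebesgue_on {0..t}. solution_op \<Omega> A X \<alpha> \<sigma> (t - r) (L2_proj \<Omega> X (f r)) x)"


section \<open>The fully discrete scheme\<close>

primrec cn_weight :: "real \<Rightarrow> nat \<Rightarrow> real" where
  "cn_weight \<alpha> 0 = 1"
| "cn_weight \<alpha> (Suc j) = (1 - (\<alpha> + 1) / real (Suc j)) * cn_weight \<alpha> j"

definition bdf2 :: "real \<Rightarrow> (real \<Rightarrow> complex) \<Rightarrow> real \<Rightarrow> complex" where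
  "bdf2 \<tau> \<phi> t = 1 / of_real \<tau> * (3/2 * \<phi> t - 2 * \<phi> (t - \<tau>) + 1/2 * \<phi> (t - 2 * \<tau>))"

definition primitive :: "(real \<Rightarrow> real^'d::finite \<Rightarrow> complex) \<Rightarrow> real \<Rightarrow> real^'d \<Rightarrow> complex" where
  "primitive g t x = (LINT r|lebesgue_on {0..t}. g r x)"

definition power_pos :: "real \<Rightarrow> real \<Rightarrow> real" where
  "power_pos \<beta> t = (if t \<le> 0 then 0 else t powr \<beta>)"

text \<open>\<open>U k\<close> is indexed by integers because the first step refers to \<open>U (-1)\<close>.\<close>

definition CN_II :: "(real^'d::finite) set \<Rightarrow> ((real^'d \<Rightarrow> complex) \<Rightarrow> (real^'d \<Rightarrow> complex) \<Rightarrow> complex) \<Rightarrow>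
    (real^'d \<Rightarrow> complex) set \<Rightarrow> real \<Rightarrow> real \<Rightarrow> nat \<Rightarrow> (real \<Rightarrow> real^'d \<Rightarrow> complex) \<Rightarrow> (real^'d \<Rightarrow> complex) \<Rightarrow>
    (int \<Rightarrow> real^'d \<Rightarrow> complex) \<Rightarrow> (nat \<Rightarrow> real^'d \<Rightarrow> complex) \<Rightarrow> bool" where
  "CN_II \<Omega> A X \<alpha> \<tau> N f u0 U u \<longleftrightarrow>
    (let Ah = discrete_op \<Omega> A X;
         Ft = primitive (primitive (\<lambda>t. L2_proj \<Omega> X (f t)));
         uh0 = L2_proj \<Omega> X u0;
         DF = (\<lambda>k x. bdf2 \<tau> (\<lambda>t. Ft t x) (of_int k * \<tau>));
         DG = (\<lambda>k x. bdf2 \<tau> (\<lambda>t. of_real (power_pos (2 - \<alpha>) t / Gamma (3 - \<alpha>)) * uh0 x) (of_int k * \<tau>))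
     in (\<forall>k\<le>0. U k = (\<lambda>_. 0)) \<and>
        (\<forall>n\<in>{1..N}. U (int n) \<in> X \<and> u n \<in> X \<and>
          (\<forall>x. of_real (\<tau> powr (- \<alpha>)) * (\<Sum>j\<le>n. of_real (cn_weight \<alpha> j) * U (int n - int j) x)
               + of_real (1 - \<alpha>/2) * Ah (U (int n)) x + of_real (\<alpha>/2) * Ah (U (int n - 1)) x
             = of_real (1 - \<alpha>/2) * DF (int n) x + of_real (\<alpha>/2) * DF (int n - 1) x
               + of_real (1 - \<alpha>/2) * DG (int n) x + of_real (\<alpha>/2) * DG (int n - 1) x) \<and>
          (\<forall>x. u n x = 1 / of_real \<tau> *
             (3/2 * U (int n) x - 2 * U (int n - 1) x + 1/2 * U (int n - 2) x))))"

end

theory Submission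
  imports Defs "HOL-Real_Asymp.Real_Asymp" "HOL-Computational_Algebra.Fundamental_Theorem_Algebra"
begin

text \<open>
  In an eigenbasis of \<open>A\<^sub>h\<close> the semidiscrete solution and the scheme are both convolutions of the
  components of \<open>f\<close>: with the Mittag-Leffler kernel of the eigenvalue \<open>\<lambda>\<close>, and with the piecewise
  linear interpolant of the grid values obtained from the generating function of the scheme (the
  double primitive and the two differences cancel into hat functions). Uniformly in \<open>\<lambda>\<close>, the
  difference \<open>K\<close> of the two kernels is \<open>O(\<tau>\<^sup>2 x powr (\<alpha> - 3))\<close> and its moments of order 0 and 1
  vanish. By Laplace inversion \<open>f\<close> is a superposition of exponentials along a contour through
  \<open>1 / t\<close> that opens into the sector of analyticity. The two vanishing moments allow the convolution
  of \<open>K\<close> with each of them to be estimated by integrals of \<open>x powr (\<alpha> - 3)\<close> away from \<open>0\<close>, and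
  integration along the contour gives the factor \<open>t powr (\<alpha> + \<mu> - 2)\<close>.
\<close>

section \<open>The power function cut along the negative half line\<close>

text \<open>Every constant has to be independent of the eigenvalue \<open>l\<close>, through which
  the mesh enters. This is why the kernels are handled by boundary values on the cut: there |z^a +
  l| >= sin(a pi) |z|^a for every l >= 0. The scheme replaces z^a by b(z) = (1 - e^(-z))^a / (1 -
  a/2 + (a/2) e^(-z)), and the weight a/2 is what makes b(z) = z^a (1 + O(z^2)). The factor e^(-z)
  (3 - e^(-z))^2 / 4 left by the two BDF operators is 1 + O(z^2) as well. This order gives the
  exponent a - 3 and, for z tending to 0, the vanishing moments. The step size enters by scaling:
  step \<tau> with eigenvalue l is step 1 with eigenvalue l \<tau>^a.

  The data are the second obstacle. For \<mu> near -1 the bound on the transform is not integrable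
  along a vertical line, so inversion is carried out for the second primitive of f, where s^(-2)
  gives absolute convergence, and f is recovered almost everywhere by differencing. The vertex of
  the contour must stay to the right of the excluded disc, hence the vertex A0 / t with A0
  proportional to T, through which the final constant depends on T.\<close>

abbreviation set_lint :: "real set \<Rightarrow> (real \<Rightarrow> 'b::{banach, second_countable_topology}) \<Rightarrow> bool" where
  "set_lint S f \<equiv> set_integrable lborel S f"

abbreviation damp :: "real \<Rightarrow> real \<Rightarrow> real \<Rightarrow> real" where
  "damp m y x \<equiv> exp (- (m * \<bar>y\<bar>) * x)"

abbreviation vline :: "real \<Rightarrow> real \<Rightarrow> real \<Rightarrow> complex" where
  "vline \<sigma> R \<equiv> linepath (Complex \<sigma> (- R)) (Complex \<sigma> R)"

text \<open>The derivative is taken within \<open>S\<close> only, so the line may run along the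
  boundary of \<open>S\<close>. In the applications \<open>S\<close> is a closed half plane or strip
  whose boundary carries the upper edge of the cut.\<close>

lemma line_integral_primitive:
 fixes G f :: "complex => complex" and x1 x2 :: real
 assumes der: "!!z. z \<in> S ==> (G has_field_derivative f z) (at z within S)"
  and sub: "!!x. x1 <= x ==> x <= x2 ==> p + of_real x * d \<in> S" and le: "x1 <= x2"
 shows "((%x. f (p + of_real x * d) * d) has_integral (G (p + of_real x2 * d) - G (p + of_real x1 * d))) {x1..x2}"
proof -
 have "((%x. G (p + of_real x * d)) has_vector_derivative f (p + of_real x * d) * d) (at x within {x1..x2})"
  if "x \<in> {x1..x2}" for x
 proof -
  have 1: "((%x. p + of_real x * d) has_vector_derivative d) (at x within {x1..x2})"
   by (auto intro!: derivative_eq_intros)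
  have "(%x. p + complex_of_real x * d) ` {x1..x2} \<subseteq> S" using sub by auto
  then have 2: "(G has_field_derivative f (p + of_real x * d)) (at (p + of_real x * d) within (%x. p + complex_of_real x * d) ` {x1..x2})"
   using der sub that by (meson DERIV_subset atLeastAtMost_iff)
  show ?thesis using field_vector_diff_chain_within[OF 1 2] by (simp add: o_def mult.commute)
 qed
 then show ?thesis using fundamental_theorem_of_calculus[OF le, of "%x. G (p + of_real x * d)"] by simp
qed

text \<open>Multiplication by -i moves the closed upper half plane into the closed right half plane,
  where the principal power is continuous for a > 0. This is therefore the branch of p^a that
  extends continuously from the upper half plane to the upper edge of the cut.\<close>

definition cutpow :: "real => complex => complex" where
 "cutpow a p = cis (pi * a / 2) * ((- \<i> * p) powr of_real a)"

lemma cutpow_0 [simp]: "cutpow a 0 = 0"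
 by (simp add: cutpow_def)

lemma cutpow_polar:
 assumes "0 <= R" "0 <= \<phi>" "\<phi> <= pi"
 shows "cutpow a (of_real R * cis \<phi>) = of_real (R powr a) * cis (a * \<phi>)"
proof (cases "R = 0")
 case True then show ?thesis by simp
next
 case False
 then have R: "R > 0" using assms by simp
 have 1: "- \<i> * (of_real R * cis \<phi>) = of_real R * cis (\<phi> - pi/2)"
  by (simp add: complex_eq_iff cos_diff sin_diff)
 have "Ln (of_real R * cis (\<phi> - pi/2)) = of_real (ln R) + \<i> * of_real (\<phi> - pi/2)"
  using R assms pi_gt_zero by (intro Ln_unique) (auto simp: exp_add exp_of_real cis_conv_exp simp del: pi_gt_zero)
 then have "(- \<i> * (of_real R * cis \<phi>)) powr of_real a = exp (of_real a * (of_real (ln R) + \<i> * of_real (\<phi> - pi/2)))"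
  unfolding 1 powr_def using R by simp
 also have "... = of_real (R powr a) * cis (a * (\<phi> - pi/2))"
  using R by (simp add: powr_def cis_conv_exp exp_of_real[symmetric] exp_add[symmetric] algebra_simps)
 finally show ?thesis
  unfolding cutpow_def by (simp add: cis_mult algebra_simps)
qed

lemma upper_polar:
 assumes "Im p >= 0"
 obtains \<phi> where "0 <= \<phi>" "\<phi> <= pi" "p = of_real (cmod p) * cis \<phi>"
proof (cases "p = 0")
 case True then show ?thesis using that[of 0] by simp
next
 case False
 have "0 <= Arg p" using assms by (simp add: Arg_less_0[symmetric] not_less)
 then show ?thesis using that[of "Arg p"] Arg_le_pi[of p] rcis_cmod_Arg[of p]
  by (simp add: rcis_def)
qed

lemma cutpow_of_real: "x >= 0 ==> cutpow a (of_real x) = of_real (x powr a)"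
 using cutpow_polar[of x 0 a] by simp

lemma cutpow_neg: "x >= 0 ==> cutpow a (- of_real x) = of_real (x powr a) * cis (a * pi)"
 using cutpow_polar[of x pi a] by (simp add: cis_pi)

lemma cutpow_eq_powr:
 assumes "Im p >= 0" "p \<notin> \<real>\<^sub>\<le>\<^sub>0"
 shows "cutpow a p = p powr of_real a"
proof -
 obtain \<phi> where \<phi>: "0 <= \<phi>" "\<phi> <= pi" "p = of_real (cmod p) * cis \<phi>" using upper_polar assms by blast
 have "p ~= 0" using assms by auto
 have "\<phi> ~= pi"
 proof
  assume "\<phi> = pi"
  then have "p = - of_real (cmod p)" using \<phi>(3) by (simp add: cis_pi)
  then have "Re p = - cmod p" "Im p = 0" by (metis uminus_complex.sel(1) Re_complex_of_real, metis uminus_complex.sel(2) Im_complex_of_real minus_zero)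
  then show False using assms(2) by (simp add: complex_nonpos_Reals_iff)
 qed
 then have "Ln p = of_real (ln (cmod p)) + \<i> * of_real \<phi>"
  using \<phi> \<open>p ~= 0\<close> by (intro Ln_unique) (auto simp: exp_add exp_of_real cis_conv_exp)
 then have "p powr of_real a = exp (of_real a * (of_real (ln (cmod p)) + \<i> * of_real \<phi>))"
  using \<open>p ~= 0\<close> by (simp add: powr_def)
 also have "... = of_real (cmod p powr a) * cis (a * \<phi>)"
  using \<open>p ~= 0\<close> by (simp add: powr_def cis_conv_exp exp_of_real[symmetric] exp_add[symmetric] algebra_simps)
 also have "... = cutpow a p" using cutpow_polar[of "cmod p" \<phi> a] \<phi> by simp
 finally show ?thesis by simp
qed

lemma continuous_on_cutpow:
 assumes "0 < a"
 shows "continuous_on {p. Im p >= 0} (cutpow a)"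
 unfolding cutpow_def using assms
 by (auto intro!: continuous_intros continuous_on_powr_complex simp: complex_nonpos_Reals_iff)

lemma cutpow_field_differentiable:
 assumes "Im p > 0" shows "cutpow a field_differentiable at p"
proof -
 have "(cutpow a) holomorphic_on {p. Im p > 0}"
  unfolding cutpow_def by (intro holomorphic_intros) (auto simp: complex_nonpos_Reals_iff)
 then show ?thesis using assms
  by (intro holomorphic_on_imp_differentiable_at[of _ "{p. Im p > 0}"]) (auto simp: open_halfspace_Im_gt)
qed

lemma sin_pi_pos: "0 < a ==> a < 1 ==> 0 < sin (a * pi)"
 by (intro sin_gt_zero) auto

text \<open>The argument of p^a lies in [0, a pi]. Up to pi / 2 adding \<open>l\<close> cannot
  decrease the modulus; beyond pi / 2 the imaginary part, which \<open>l\<close> does not change, is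
  at least sin(a pi) |p|^a because sine decreases there. The bound does not see \<open>l\<close>,
  and all uniformity in the eigenvalue starts here.\<close>

lemma cmod_cutpow_add_ge:
 assumes "0 < a" "a < 1" "0 <= l" "Im p >= 0"
 shows "sin (a * pi) * cmod p powr a <= cmod (cutpow a p + of_real l)"
proof -
 obtain \<phi> where \<phi>: "0 <= \<phi>" "\<phi> <= pi" "p = of_real (cmod p) * cis \<phi>" using upper_polar assms by blast
 have e: "cutpow a p = of_real (cmod p powr a) * cis (a * \<phi>)" using cutpow_polar[of "cmod p" \<phi> a] \<phi> by simp
 have ap: "0 <= a * \<phi>" "a * \<phi> <= a * pi" "a * pi < pi" using assms \<phi> by auto
 show ?thesis
 proof (cases "a * \<phi> <= pi / 2")
  case True
  then have c: "cos (a * \<phi>) >= 0" using ap by (intro cos_ge_zero) auto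
  have "(cmod p powr a)\<^sup>2 <= (cmod (cutpow a p + of_real l))\<^sup>2"
  proof -
   have "(cmod (cutpow a p + of_real l))\<^sup>2 = (cmod p powr a * cos (a*\<phi>) + l)\<^sup>2 + (cmod p powr a * sin (a*\<phi>))\<^sup>2"
    by (simp add: e cmod_power2)
   moreover have "(cmod p powr a * cos (a*\<phi>) + l)\<^sup>2 >= (cmod p powr a * cos (a*\<phi>))\<^sup>2"
    using c assms by (intro power_mono) auto
   moreover have "(cmod p powr a * cos (a*\<phi>))\<^sup>2 + (cmod p powr a * sin (a*\<phi>))\<^sup>2 = (cmod p powr a)\<^sup>2"
    by (simp add: power_mult_distrib distrib_left[symmetric])
   ultimately show ?thesis by linarith
  qed
  then have "cmod p powr a <= cmod (cutpow a p + of_real l)"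
   by (rule power2_le_imp_le) simp
  moreover have "sin (a*pi) * cmod p powr a <= 1 * cmod p powr a" by (intro mult_right_mono) auto
  ultimately show ?thesis by simp
 next
  case False
  have "sin (a * pi) <= sin (a * \<phi>)"
  proof -
   \<comment> \<open>Monotonicity of sine on [pi/2, pi], written as that of cosine after a shift by
     pi/2.\<close>
   have "cos (a * pi - pi/2) <= cos (a * \<phi> - pi/2)"
    using False ap pi_gt_zero by (intro cos_monotone_0_pi_le) linarith+
   then show ?thesis by (simp add: cos_diff)
  qed
  then have "sin (a * pi) * cmod p powr a <= sin (a*\<phi>) * cmod p powr a" by (intro mult_right_mono) auto
  also have "... = Im (cutpow a p + of_real l)" by (simp add: e)
  also have "... <= cmod (cutpow a p + of_real l)" by (metis abs_Im_le_cmod abs_le_D1)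
  finally show ?thesis .
 qed
qed

lemma cutpow_add_nonzero:
 assumes "0 < a" "a < 1" "0 < l" "Im p >= 0"
 shows "cutpow a p + of_real l ~= 0"
proof (cases "p = 0")
 case True then show ?thesis using assms by simp
next
 case False
 then have "0 < sin (a * pi) * cmod p powr a" using sin_pi_pos[OF assms(1,2)] by simp
 then show ?thesis using cmod_cutpow_add_ge[of a l p] assms by force
qed

section \<open>The Mittag-Leffler kernel\<close>

text \<open>Antiderivatives are evaluated by gauge integrals; for nonnegative integrands both
  existence and value carry over to the Lebesgue integral.\<close>

lemma set_integrable_lborelI_nonneg:
 fixes f :: "real => real"
 assumes "(f has_integral I) S" "S \<in> sets borel" "f \<in> borel_measurable borel" "!!x. x \<in> S ==> 0 <= f x"
 shows "set_lint S f" "(LBINT x:S. f x) = I"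
proof -
 have "f absolutely_integrable_on S"
  using assms by (intro nonnegative_absolutely_integrable_1) (auto simp: integrable_on_def)
 then show 1: "set_lint S f"
  using assms by (simp add: set_integrable_def integrable_completion)
 show "(LBINT x:S. f x) = I"
  using set_borel_integral_eq_integral(2)[OF 1] assms(1) by (simp add: integral_unique)
qed

lemma exp_powr_integral:
 fixes c s :: real
 assumes "0 < c" "-1 < s"
 shows "set_lint {0..} (%r. exp (- r * c) * r powr s)"
  "(LBINT r:{0..}. exp (- r * c) * r powr s) = Gamma (s + 1) * c powr (- s - 1)"
proof -
 have "((%t. t powr s / exp t) has_integral Gamma (s + 1)) {0..}"
  using Gamma_integral_real[of "s+1"] assms by simp
 then have g: "set_lint {0..} (%t. t powr s / exp t)" "(LBINT t:{0..}. t powr s / exp t) = Gamma (s + 1)"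
  by (intro set_integrable_lborelI_nonneg; auto)+
 have e: "indicator {0..} (0 + c * r) *\<^sub>R ((0 + c * r) powr s / exp (0 + c * r)) = c powr s *\<^sub>R (indicator {0..} r *\<^sub>R (exp (- r * c) * r powr s))" for r
  using assms by (auto simp: indicator_def zero_le_mult_iff powr_mult exp_minus field_simps)
 have "integrable lborel (%r. c powr s *\<^sub>R (indicator {0..} r *\<^sub>R (exp (- r * c) * r powr s)))"
  unfolding e[symmetric] using assms g(1) by (intro lborel_integrable_real_affine) (auto simp: set_integrable_def)
 then show "set_lint {0..} (%r. exp (- r * c) * r powr s)"
  using assms by (auto simp: set_integrable_def)
 have "Gamma (s+1) = \<bar>c\<bar> *\<^sub>R (LBINT r. c powr s *\<^sub>R (indicator {0..} r *\<^sub>R (exp (- r * c) * r powr s)))"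
  unfolding e[symmetric] using assms g(2) lborel_integral_real_affine[of c "%r. indicator {0..} r *\<^sub>R (r powr s / exp r)" 0]
  by (auto simp: set_lebesgue_integral_def)
 also have "... = c * c powr s * (LBINT r:{0..}. exp (- r * c) * r powr s)"
  using assms by (simp add: set_lebesgue_integral_def)
 finally show "(LBINT r:{0..}. exp (- r * c) * r powr s) = Gamma (s + 1) * c powr (- s - 1)"
  using assms by (simp add: powr_diff powr_minus field_simps)
qed

text \<open>Minus the imaginary part of 1 / (z^a + l) at z = -r on the upper edge of the cut
  (\<open>Im_cutpow_neg_inverse\<close>), that is, pi times the spectral density of the
  Mittag-Leffler kernel.\<close>

definition cutdens :: "real => real => real => real" where
 "cutdens a l r = r powr a * sin (a * pi) / (cmod (of_real (r powr a) * cis (a * pi) + of_real l))\<^sup>2"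

text \<open>The function x^(a-1) E_{a,a}(-l x^a), introduced through its representation as the
  Laplace transform of a nonnegative density. Positivity, the power bound and the interpolation
  error are then read off under the integral sign.\<close>

definition mlk :: "real => real => real => real" where
 "mlk a l x = (1 / pi) * (LBINT r:{0..}. exp (- r * x) * cutdens a l r)"

lemma Im_cutpow_neg_inverse:
 assumes "0 <= r"
 shows "Im (1 / (cutpow a (- of_real r) + of_real l)) = - cutdens a l r"
 using assms by (simp add: cutpow_neg cutdens_def Im_divide cmod_power2)

context
 fixes a l :: real
 assumes a: "0 < a" "a < 1" and l: "0 < l"
begin

lemma cutdens_measurable [measurable]: "cutdens a l \<in> borel_measurable borel"
 unfolding cutdens_def by measurable

lemma cutdens_nonneg: "0 <= cutdens a l r"
 unfolding cutdens_def using sin_pi_pos[OF a] by auto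

lemma cutdens_le: 
 assumes "0 <= r" shows "cutdens a l r <= r powr (-a) / sin (a * pi)"
proof (cases "r = 0")
 case True then show ?thesis by (simp add: cutdens_def)
next
 case False
 then have r: "r > 0" using assms by simp
 have s: "sin (a * pi) > 0" by (rule sin_pi_pos[OF a])
 have m: "sin (a * pi) * r powr a <= cmod (of_real (r powr a) * cis (a * pi) + of_real l)"
  using cmod_cutpow_add_ge[of a l "- of_real r"] a l r cutpow_neg[of r a] by simp
 have p: "0 < sin (a * pi) * r powr a" using s r by simp
 have c: "0 < cmod (of_real (r powr a) * cis (a * pi) + of_real l)" using m p by linarith
 have "(sin (a * pi) * r powr a)\<^sup>2 <= (cmod (of_real (r powr a) * cis (a * pi) + of_real l))\<^sup>2"
  using m p by (intro power_mono) linarith+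
 then have "cutdens a l r <= r powr a * sin (a * pi) / (sin (a * pi) * r powr a)\<^sup>2"
  unfolding cutdens_def using s r c by (intro divide_left_mono mult_pos_pos zero_less_power) auto
 also have "... = r powr (-a) / sin (a*pi)" using s r by (simp add: power2_eq_square powr_minus field_simps)
 finally show ?thesis .
qed

lemma mlk_integrable:
 assumes "0 < x" "0 <= k"
 shows "set_lint {0..} (%r. exp (- r * x) * r powr k * cutdens a l r)"
proof -
 have s: "sin (a * pi) > 0" by (rule sin_pi_pos[OF a])
 have "set_lint {0..} (%r. (exp (- r * x) * r powr (k - a)) / sin (a * pi))"
  using exp_powr_integral(1)[of x "k-a"] assms a by (intro set_integrable_divide) auto
 then show ?thesis unfolding set_integrable_def
 proof (rule Bochner_Integration.integrable_bound)
  have "exp (- r * x) * r powr k * cutdens a l r <= exp (- r * x) * r powr k * (r powr (-a) / sin (a*pi))" if "0 <= r" for r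
   using cutdens_le[OF that] by (intro mult_left_mono) auto
  then have "norm (exp (- r * x) * r powr k * cutdens a l r) <= norm (exp (- r * x) * r powr (k - a) / sin (a*pi))" if "0 <= r" for r
   using that cutdens_nonneg[of r] s by (auto simp: powr_diff powr_minus field_simps abs_mult)
  then show "AE r in lborel. norm (indicator {0..} r *\<^sub>R (exp (- r * x) * r powr k * cutdens a l r)) <= norm (indicator {0..} r *\<^sub>R (exp (- r * x) * r powr (k - a) / sin (a*pi)))"
   by (auto simp: indicator_def)
 qed measurable
qed

lemma mlk_integrable0:
 assumes "0 < x"
 shows "set_lint {0..} (%r. exp (- r * x) * cutdens a l r)"
proof -
 \<comment> \<open>Since \<open>0 powr 0 = 0\<close>, the factor \<open>r powr 0\<close> is not 1 at
   r = 0; there \<open>cutdens\<close> vanishes as well.\<close>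
 have "indicator {0..} r *\<^sub>R (exp (- r * x) * cutdens a l r) = indicator {0..} r *\<^sub>R (exp (- r * x) * r powr 0 * cutdens a l r)" for r
  by (cases "r = 0") (auto simp: cutdens_def)
 then have "(%r. indicator {0..} r *\<^sub>R (exp (- r * x) * cutdens a l r)) = (%r. indicator {0..} r *\<^sub>R (exp (- r * x) * r powr 0 * cutdens a l r))"
  by (rule ext)
 then show ?thesis using mlk_integrable[OF assms order_refl] by (simp only: set_integrable_def)
qed

text \<open>Replacing the density by r^(-a) / sin(a pi) leaves a Gamma integral. The case k = 2
  yields the exponent a - 3 in \<open>mlk_interp_error\<close>.\<close>

lemma cutdens_moment_le:
 assumes "0 < x" "0 <= k"
 shows "(LBINT r:{0..}. exp (- r * x) * r powr k * cutdens a l r) <= Gamma (k + 1 - a) / sin (a * pi) * x powr (a - k - 1)"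
proof -
 have s: "sin (a * pi) > 0" by (rule sin_pi_pos[OF a])
 have "(LBINT r:{0..}. exp (- r * x) * r powr k * cutdens a l r) <= (LBINT r:{0..}. exp (- r * x) * r powr (k - a) / sin (a * pi))"
 proof (rule set_integral_mono)
  show "set_lint {0..} (%r. exp (- r * x) * r powr (k - a) / sin (a * pi))"
   using exp_powr_integral(1)[of x "k-a"] assms a by (intro set_integrable_divide) auto
  show "exp (- r * x) * r powr k * cutdens a l r <= exp (- r * x) * r powr (k - a) / sin (a * pi)" if "r \<in> {0..}" for r
   using mult_left_mono[OF cutdens_le[of r], of "exp (- r * x) * r powr k"] that by (auto simp: powr_diff powr_minus field_simps)
 qed (use assms mlk_integrable in auto)
 also have "... = Gamma (k + 1 - a) / sin (a * pi) * x powr (a - k - 1)"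
  using exp_powr_integral(2)[of x "k-a"] assms a by (simp add: algebra_simps)
 finally show ?thesis .
qed

lemma mlk_nonneg: "0 <= mlk a l x"
 unfolding mlk_def set_lebesgue_integral_def using cutdens_nonneg by (intro mult_nonneg_nonneg Bochner_Integration.integral_nonneg) auto

lemma mlk_le:
 assumes "0 < x" shows "mlk a l x <= Gamma (1 - a) / sin (a * pi) * x powr (a - 1)"
proof -
 have "(LBINT r:{0..}. exp (- r * x) * cutdens a l r) = (LBINT r:{0..}. exp (- r * x) * r powr 0 * cutdens a l r)"
  by (intro set_lebesgue_integral_cong) (auto simp: cutdens_def)
 also have "... <= Gamma (1 - a) / sin (a * pi) * x powr (a - 1)" using cutdens_moment_le[of x 0] assms by simp
 finally have 1: "(LBINT r:{0..}. exp (- r * x) * cutdens a l r) <= Gamma (1 - a) / sin (a * pi) * x powr (a - 1)" .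
 have 2: "0 <= (LBINT r:{0..}. exp (- r * x) * cutdens a l r)"
  unfolding set_lebesgue_integral_def using cutdens_nonneg by (intro Bochner_Integration.integral_nonneg) auto
 have "mlk a l x <= 1 * (LBINT r:{0..}. exp (- r * x) * cutdens a l r)"
  unfolding mlk_def using 2 pi_ge_two by (intro mult_right_mono) auto
 then show ?thesis using 1 by simp
qed

end

lemma mlk_measurable [measurable]: "mlk a l \<in> borel_measurable borel"
proof -
 have "(%x. LBINT r. indicator {0..} r *\<^sub>R (exp (- r * x) * cutdens a l r)) \<in> borel_measurable borel"
  unfolding cutdens_def by (rule lborel.borel_measurable_lebesgue_integral) measurable
 then show ?thesis unfolding mlk_def set_lebesgue_integral_def by measurable
qed

text \<open>The integrand takes conjugate values at conjugate points, so the symmetric integral is 2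
  i times the imaginary part of its upper half. On the closed upper half plane there is a primitive,
  so the path may be replaced by one that starts at \<sigma>, follows the real axis to -M, rises to
  height R and returns. The positive axis contributes a real number, the cut contributes
  \<open>cutdens\<close>, the side at -M disappears as M grows, and the side at height R is
  O(R^(-a)).\<close>

lemma bromwich_mlk:
 fixes a l t \<sigma> :: real
 assumes a: "0 < a" "a < 1" and l: "0 < l" and t: "0 < t" and \<sigma>: "0 < \<sigma>"
 shows "((%R. 1 / (2 * of_real pi * \<i>) * contour_integral (vline \<sigma> R)
     (%s. exp (s * of_real t) / (s powr of_real a + of_real l))) \<longlongrightarrow> of_real (mlk a l t)) at_top"
proof -
 define H where "H = {z::complex. 0 <= Im z}"
 define f where "f z = exp (z * of_real t) / (cutpow a z + of_real l)" for z
 define F where "F s = exp (s * of_real t) / (s powr of_real a + of_real l)" for s :: complex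
 define s where "s = sin (a * pi)"
 have s: "0 < s" unfolding s_def by (rule sin_pi_pos[OF a])
 have nz: "cutpow a z + of_real l ~= 0" if "z \<in> H" for z
  using cutpow_add_nonzero[OF a l] that by (simp add: H_def)
 have cvx: "convex H" unfolding H_def by (rule convex_halfspace_Im_ge)
 have intH: "interior H = {z. 0 < Im z}" 
  using interior_halfspace_ge[of "\<i>::complex" 0] by (simp add: H_def inner_complex_def)
 obtain G where G: "!!z. z \<in> H ==> (G has_field_derivative f z) (at z within H)"
 proof (rule holomorphic_convex_primitive[OF cvx, of "{}" f])
  show "continuous_on H f" unfolding f_def using nz continuous_on_cutpow[OF a(1)]
   by (intro continuous_intros) (auto simp: H_def)
  show "f field_differentiable at z" if "z \<in> interior H - {}" for z
   unfolding f_def using that nz[of z] cutpow_field_differentiable[of z a] interior_subset[of H]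
   by (intro field_differentiable_divide field_differentiable_add field_differentiable_const)
    (auto simp: intH field_differentiable_def intro!: derivative_eq_intros)
 qed auto
 have fF: "f z = F z" if "0 <= Im z" "0 < Re z" for z
  unfolding f_def F_def using that by (subst cutpow_eq_powr) (auto simp: complex_nonpos_Reals_iff)
 have Fcnj: "F (cnj z) = cnj (F z)" if "0 < Re z" for z
  unfolding F_def using that by (simp add: exp_cnj cnj_powr complex_nonpos_Reals_iff)
 have bnd: "cmod (f z) <= exp (Re z * t) / (s * cmod z powr a)" if "0 <= Im z" "z ~= 0" for z
 proof -
  have "s * cmod z powr a <= cmod (cutpow a z + of_real l)" "0 < s * cmod z powr a"
   using cmod_cutpow_add_ge[OF a, of l z] l that s by (auto simp: s_def)
  then show ?thesis unfolding f_def using that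
   by (auto simp: norm_divide intro!: divide_left_mono mult_pos_pos)
 qed
 \<comment> \<open>The integral of \<open>f\<close> over the upper half of the vertical segment,
   expressed by the primitive.\<close>
 define w where "w R = G (Complex \<sigma> R) - G (of_real \<sigma>)" for R
 have ci: "contour_integral (vline \<sigma> R) F = 2 * \<i> * Im (w R)" if R: "R > 0" for R
 proof -
  have c1: "contour_integral (linepath (of_real \<sigma>) (Complex \<sigma> R)) F = w R"
  proof -
   have "path_image (linepath (of_real \<sigma>) (Complex \<sigma> R)) \<subseteq> H" using R by (auto simp: H_def closed_segment_def)
   then have "(f has_contour_integral w R) (linepath (of_real \<sigma>) (Complex \<sigma> R))"
    using contour_integral_primitive[of H G f "linepath (of_real \<sigma>) (Complex \<sigma> R)", OF G] by (simp add: w_def)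
   then have "(F has_contour_integral w R) (linepath (of_real \<sigma>) (Complex \<sigma> R))"
    by (rule has_contour_integral_eq) (use R \<sigma> in \<open>auto simp: closed_segment_same_Re closed_segment_eq_real_ivl fF\<close>)
   then show ?thesis by (rule contour_integral_unique)
  qed
  have c2: "contour_integral (linepath (Complex \<sigma> (-R)) (of_real \<sigma>)) F = - cnj (w R)"
  proof -
   have "linepath (Complex \<sigma> (-R)) (of_real \<sigma>) = cnj \<circ> linepath (Complex \<sigma> R) (of_real \<sigma>)"
    by (auto simp: linepath_def fun_eq_iff complex_eq_iff)
   then have "contour_integral (linepath (Complex \<sigma> (-R)) (of_real \<sigma>)) F = cnj (contour_integral (linepath (Complex \<sigma> R) (of_real \<sigma>)) (cnj \<circ> F \<circ> cnj))"
    by (simp add: contour_integral_cnj)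
   also have "contour_integral (linepath (Complex \<sigma> R) (of_real \<sigma>)) (cnj \<circ> F \<circ> cnj) = contour_integral (linepath (Complex \<sigma> R) (of_real \<sigma>)) F"
    using Fcnj \<sigma> by (intro contour_integral_cong) (auto simp: closed_segment_same_Re)
   also have "... = - contour_integral (linepath (of_real \<sigma>) (Complex \<sigma> R)) F"
    using contour_integral_reversepath[of "linepath (of_real \<sigma>) (Complex \<sigma> R)" F] by simp
   finally show ?thesis using c1 by simp
  qed
  have hol: "continuous_on {z. 0 < Re z} F"
   unfolding F_def using fF nz
  proof (intro continuous_intros)
   show "\<forall>z\<in>{z. 0 < Re z}. z powr complex_of_real a + complex_of_real l ~= 0"
   proof (clarsimp)
    fix z assume z: "0 < Re z" "z powr complex_of_real a + complex_of_real l = 0"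
    have 1: "cutpow a z = z powr of_real a" if "Im z >= 0" using z that by (intro cutpow_eq_powr) (auto simp: complex_nonpos_Reals_iff)
    have 2: "cutpow a (cnj z) = cnj (z powr of_real a)" if "Im z < 0" using z that
     by (subst cutpow_eq_powr) (auto simp: complex_nonpos_Reals_iff cnj_powr)
    show False
    proof (cases "Im z >= 0")
     case True then show False using 1 z cutpow_add_nonzero[OF a l, of z] by simp
    next
     case False
     then have "cutpow a (cnj z) + of_real l = cnj (z powr of_real a + of_real l)" using 2 by simp
     then show False using z False cutpow_add_nonzero[OF a l, of "cnj z"] by simp
    qed
   qed
  qed (auto simp: complex_nonpos_Reals_iff)
  have "contour_integral (linepath (Complex \<sigma> (-R)) (of_real \<sigma>)) F + contour_integral (linepath (of_real \<sigma>) (Complex \<sigma> R)) F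
    = contour_integral (linepath (Complex \<sigma> (-R)) (Complex \<sigma> R)) F"
  proof (rule contour_integral_split_linepath[symmetric])
   show "continuous_on (closed_segment (Complex \<sigma> (-R)) (Complex \<sigma> R)) F"
    by (rule continuous_on_subset[OF hol]) (use \<sigma> in \<open>auto simp: closed_segment_same_Re\<close>)
   show "complex_of_real \<sigma> \<in> closed_segment (Complex \<sigma> (-R)) (Complex \<sigma> R)"
    by (auto simp: closed_segment_def complex_eq_iff intro!: exI[of _ "1/2"])
  qed
  then show ?thesis unfolding c1 c2 by (simp add: complex_eq_iff)
 qed
 have est: "\<bar>Im (w R) - pi * mlk a l t\<bar> <= exp (\<sigma> * t) / (s * t) * R powr (-a)" if R: "R > 0" for R
 proof -
  \<comment> \<open>At fixed R the corner -M is finite. In the resulting estimate M tends to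
    infinity first, and R only afterwards.\<close>
  have "\<bar>Im (w R) - (LBINT r:{0..M}. exp (- r * t) * cutdens a l r)\<bar>
   <= exp (\<sigma> * t) / (s * t) * R powr (-a) + R * (exp (- M * t) / (s * M powr a))" if M: "M > 0" for M
  proof -
   have h1: "((%x. f (\<i> * of_real R + of_real x * 1) * 1) has_integral (G (\<i> * of_real R + of_real \<sigma> * 1) - G (\<i> * of_real R + of_real (-M) * 1))) {-M..\<sigma>}"
    by (rule line_integral_primitive[OF G]) (use R M \<sigma> in \<open>auto simp: H_def\<close>)
   have e1: "((%x. exp (x * t) / (s * R powr a)) has_integral (exp (\<sigma> * t) / (t * s * R powr a) - exp ((-M) * t) / (t * s * R powr a))) {-M..\<sigma>}"
    using M \<sigma> t s R by (intro fundamental_theorem_of_calculus)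
     (auto intro!: derivative_eq_intros simp: has_real_derivative_iff_has_vector_derivative[symmetric] field_simps)
   have "cmod (integral {-M..\<sigma>} (%x. f (\<i> * of_real R + of_real x * 1) * 1)) <= integral {-M..\<sigma>} (%x. exp (x * t) / (s * R powr a))"
   proof (rule integral_norm_bound_integral)
    fix x
    have "R <= cmod (\<i> * of_real R + of_real x)" using abs_Im_le_cmod[of "\<i> * of_real R + of_real x"] R by simp
    then have "R powr a <= cmod (\<i> * of_real R + of_real x) powr a" using R a by (intro powr_mono2) auto
    then have "exp (x * t) / (s * cmod (\<i> * of_real R + of_real x) powr a) <= exp (x * t) / (s * R powr a)"
     using s R by (intro divide_left_mono mult_left_mono mult_pos_pos) auto
    moreover have "cmod (f (\<i> * of_real R + of_real x)) <= exp (x * t) / (s * cmod (\<i> * of_real R + of_real x) powr a)"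
     using bnd[of "\<i> * of_real R + of_real x"] R by (auto simp: complex_eq_iff)
    ultimately show "cmod (f (\<i> * of_real R + of_real x * 1) * 1) <= exp (x * t) / (s * R powr a)" by simp
   qed (use h1 e1 in \<open>auto simp: has_integral_iff\<close>)
   also have "... <= exp (\<sigma> * t) / (t * s * R powr a)" unfolding integral_unique[OF e1] using s t R by simp
   finally have b0: "cmod (integral {-M..\<sigma>} (%x. f (\<i> * of_real R + of_real x * 1) * 1)) <= exp (\<sigma> * t) / (t * s * R powr a)" .
   have b1: "cmod (G (Complex \<sigma> R) - G (Complex (-M) R)) <= exp (\<sigma> * t) / (s * t) * R powr (-a)"
   proof -
    have "\<i> * of_real R + of_real \<sigma> * 1 = Complex \<sigma> R" "\<i> * of_real R + of_real (-M) * 1 = Complex (-M) R"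
     by (auto simp: complex_eq_iff)
    then show ?thesis using b0 unfolding integral_unique[OF h1] by (simp add: powr_minus divide_inverse mult_ac)
   qed
   have b2: "cmod (G (Complex (-M) R) - G (of_real (-M))) <= R * (exp (- M * t) / (s * M powr a))"
   proof -
    have "cmod (G (Complex (-M) R) - G (of_real (-M))) <= exp (- M * t) / (s * M powr a) * cmod (Complex (-M) R - of_real (-M))"
    proof (rule field_differentiable_bound[where S = "closed_segment (of_real (-M)) (Complex (-M) R)" and f' = f])
     fix z assume "z \<in> closed_segment (complex_of_real (-M)) (Complex (-M) R)"
     then have z: "Re z = - M" "0 <= Im z" using R by (auto simp: closed_segment_same_Re closed_segment_eq_real_ivl)
     have "closed_segment (complex_of_real (-M)) (Complex (-M) R) \<subseteq> H"
      using R by (auto simp: closed_segment_same_Re closed_segment_eq_real_ivl H_def)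
     moreover have "z \<in> H" using z by (simp add: H_def)
     ultimately show "(G has_field_derivative f z) (at z within closed_segment (complex_of_real (-M)) (Complex (-M) R))"
      using G DERIV_subset by blast
     have "M <= cmod z" using abs_Re_le_cmod[of z] z M by simp
     then have "M powr a <= cmod z powr a" using M a by (intro powr_mono2) auto
     then have "exp (Re z * t) / (s * cmod z powr a) <= exp (Re z * t) / (s * M powr a)"
      using s M by (intro divide_left_mono mult_left_mono mult_pos_pos) auto
     moreover have "z ~= 0" using z M by auto
     ultimately show "cmod (f z) <= exp (- M * t) / (s * M powr a)" using bnd[of z] z by simp
    qed auto
    moreover have "Complex (-M) R - of_real (-M) = \<i> * of_real R" by (simp add: complex_eq_iff)
    ultimately show ?thesis using R by (simp add: norm_mult mult.commute)
   qed
   have h3: "((%x. f (0 + of_real x * (-1)) * (-1)) has_integral (G (0 + of_real M * (-1)) - G (0 + of_real 0 * (-1)))) {0..M}"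
    by (rule line_integral_primitive[OF G]) (use M in \<open>auto simp: H_def\<close>)
   have b3: "Im (G (of_real (-M)) - G 0) = (LBINT r:{0..M}. exp (- r * t) * cutdens a l r)"
   proof -
    have 1: "((%x. Im (f (0 + of_real x * (-1)) * (-1))) has_integral Im (G (of_real (-M)) - G 0)) {0..M}"
     using has_integral_linear[OF h3 bounded_linear_Im] by (simp add: o_def)
    have 2: "Im (f (0 + of_real x * (-1)) * (-1)) = exp (- x * t) * cutdens a l x" if "x \<in> {0..M}" for x
    proof -
     have "f (0 + of_real x * (-1)) * (-1) = of_real (- exp (- x * t)) * (1 / (cutpow a (- of_real x) + of_real l))"
      by (simp add: f_def exp_of_real[symmetric])
     also have "Im ... = - exp (- x * t) * Im (1 / (cutpow a (- of_real x) + of_real l))"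
      by (simp only: Im_complex_of_real Re_complex_of_real times_complex.sel)
     also have "... = exp (- x * t) * cutdens a l x" using that by (subst Im_cutpow_neg_inverse) auto
     finally show ?thesis .
    qed
    have 3: "((%x. exp (- x * t) * cutdens a l x) has_integral Im (G (of_real (-M)) - G 0)) {0..M}"
     by (rule has_integral_eq[OF 2 1])
    show ?thesis using cutdens_nonneg[OF a l] cutdens_measurable[OF a l]
     by (intro set_integrable_lborelI_nonneg(2)[OF 3, symmetric]) auto
   qed
   have h4: "((%x. f (0 + of_real x * 1) * 1) has_integral (G (0 + of_real \<sigma> * 1) - G (0 + of_real 0 * 1))) {0..\<sigma>}"
    by (rule line_integral_primitive[OF G]) (use \<sigma> in \<open>auto simp: H_def\<close>)
   have b4: "Im (G (of_real \<sigma>) - G 0) = 0"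
   proof -
    have 1: "((%x. Im (f (0 + of_real x * 1) * 1)) has_integral Im (G (of_real \<sigma>) - G 0)) {0..\<sigma>}"
     using has_integral_linear[OF h4 bounded_linear_Im] by (simp add: o_def)
    have "((%x. 0) has_integral Im (G (of_real \<sigma>) - G 0)) {0..\<sigma>}"
    proof (rule has_integral_eq[OF _ 1])
     fix x assume "x \<in> {0..\<sigma>}"
     then have "f (of_real x) = of_real (exp (x * t) / (x powr a + l))"
      by (simp add: f_def cutpow_of_real exp_of_real[symmetric])
     then show "Im (f (0 + of_real x * 1) * 1) = 0" by simp
    qed
    then show ?thesis by (simp add: has_integral_iff)
   qed
   have "Im (w R) - (LBINT r:{0..M}. exp (- r * t) * cutdens a l r) =
    Im (G (Complex \<sigma> R) - G (Complex (-M) R)) + Im (G (Complex (-M) R) - G (of_real (-M)))"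
    using b3 b4 by (simp add: w_def)
   then show ?thesis using b1 b2 abs_Im_le_cmod[of "G (Complex \<sigma> R) - G (Complex (-M) R)"]
     abs_Im_le_cmod[of "G (Complex (-M) R) - G (of_real (-M))"] by linarith
  qed
  then have ev: "eventually (%M. \<bar>Im (w R) - (LBINT r:{0..M}. exp (- r * t) * cutdens a l r)\<bar>
   <= exp (\<sigma> * t) / (s * t) * R powr (-a) + R * (exp (- M * t) / (s * M powr a))) at_top"
   by (intro eventually_mono[OF eventually_gt_at_top[of 0]]) auto
  have l1: "((%M. \<bar>Im (w R) - (LBINT r:{0..M}. exp (- r * t) * cutdens a l r)\<bar>) \<longlongrightarrow> \<bar>Im (w R) - (LBINT r:{0..}. exp (- r * t) * cutdens a l r)\<bar>) at_top"
   by (intro tendsto_intros tendsto_set_lebesgue_integral_at_top mlk_integrable0[OF a l t]) auto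
  have "((%M. exp (- M * t) / (s * M powr a)) \<longlongrightarrow> 0) at_top" using t s a by real_asymp
  then have l2: "((%M. exp (\<sigma> * t) / (s * t) * R powr (-a) + R * (exp (- M * t) / (s * M powr a))) \<longlongrightarrow> exp (\<sigma> * t) / (s * t) * R powr (-a) + R * 0) at_top"
   by (intro tendsto_intros)
  have "pi * mlk a l t = (LBINT r:{0..}. exp (- r * t) * cutdens a l r)" by (simp add: mlk_def)
  then show ?thesis using tendsto_le[OF _ l2 l1 ev] by simp
 qed
 have "((%R. exp (\<sigma> * t) / (s * t) * R powr (-a)) \<longlongrightarrow> 0) at_top" using t s a by real_asymp
 then have "((%R. Im (w R) - pi * mlk a l t) \<longlongrightarrow> 0) at_top"
  by (rule Lim_null_comparison[rotated]) (use est in \<open>auto intro: eventually_mono[OF eventually_gt_at_top[of 0]]\<close>)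
 then have "((%R. Im (w R)) \<longlongrightarrow> pi * mlk a l t) at_top" by (simp add: LIM_zero_iff)
 then have "((%R. of_real (Im (w R) / pi)) \<longlongrightarrow> complex_of_real (pi * mlk a l t / pi)) at_top"
  by (intro tendsto_intros) auto
 then have lim: "((%R. of_real (Im (w R) / pi)) \<longlongrightarrow> complex_of_real (mlk a l t)) at_top" by simp
 show ?thesis
 proof (rule Lim_transform_eventually[OF lim])
  show "\<forall>\<^sub>F R in at_top. complex_of_real (Im (w R) / pi) = 1 / (2 * of_real pi * \<i>) * contour_integral (vline \<sigma> R)
     (%s. exp (s * of_real t) / (s powr of_real a + of_real l))"
   using ci by (intro eventually_mono[OF eventually_gt_at_top[of 0]]) (auto simp: F_def[abs_def])
 qed
qed

section \<open>The generating function of the scheme\<close>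

text \<open>Symbol of the left-hand side of the scheme with step 1, the operator being replaced by
  its eigenvalue \<open>l\<close>.\<close>

definition cn_fps :: "real => real => real fps" where
 "cn_fps a l = Abs_fps (cn_weight a) + fps_const l * (fps_const (1 - a/2) + fps_const (a/2) * fps_X)"

text \<open>The BDF2 symbol is (1 - z)(3 - z) / 2 and occurs twice, on the data and on the solution.
  Of its square the factor (1 - z)^2 is left with the double primitive as a second difference, and
  (3 - z)^2 / 4 remains here; the extra factor z centres that difference.\<close>

definition mlk_fps :: "real => real => real fps" where
 "mlk_fps a l = fps_const (1/4) * fps_X * (3 - fps_X)^2 * (fps_const (1 - a/2) + fps_const (a/2) * fps_X) * inverse (cn_fps a l)"

definition mlk_gf :: "real => real => complex => complex" where
 "mlk_gf a l w = 1/4 * w * (3 - w)^2 * (1 - of_real a/2 + of_real a/2 * w) / ((1 - w) powr of_real a + of_real l * (1 - of_real a/2 + of_real a/2 * w))"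

lemma of_real_gbinomial: "of_real (a gchoose n) = (of_real a gchoose n :: complex)"
 by (simp add: gbinomial_prod_rev)

lemma cn_weight_gbinomial: "cn_weight a j = (-1) ^ j * (a gchoose j)"
proof (induction j)
 case 0 then show ?case by simp
next
 case (Suc j)
 have "a gchoose Suc j = (a - real j) / real (Suc j) * (a gchoose j)"
  using gbinomial_absorption'[of "Suc j" a] gbinomial_absorb_comp[of a j] gbinomial_absorption[of j a]
  by (simp add: field_simps)
 have "cn_weight a (Suc j) = (1 - (a + 1) / real (Suc j)) * ((-1) ^ j * (a gchoose j))"
  using Suc by simp
 also have "... = (-1) ^ Suc j * ((a - real j) / real (Suc j) * (a gchoose j))"
  by (simp add: divide_simps) (simp add: algebra_simps)
 finally show ?case using \<open>a gchoose Suc j = _\<close> by simp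
qed

context
 fixes a l :: real
 assumes a: "0 < a" "a < 1" and l: "0 < l"
begin

lemma cn_fps_nth_0: "fps_nth (cn_fps a l) 0 ~= 0"
proof -
 have "0 < l * (1 - a/2)" using a l by simp
 then have "fps_nth (cn_fps a l) 0 > 0" by (simp add: cn_fps_def)
 then show ?thesis by simp
qed

text \<open>Stability of the scheme, with p = 1 - w. If p has argument \<phi> in (0, pi], then p^a
  times the conjugate of 1 - (a/2) p has imaginary part |p|^a (sin(a \<phi>) + (a |p| / 2) sin((1 -
  a) \<phi>)) > 0; for real p in (0, 2 / a) the quotient of the two is positive. As the quotient
  avoids the nonpositive reals, no l > 0 can produce a zero.\<close>

lemma cutpow_add_linear_nonzero:
 assumes p: "0 <= Im p" "Im p = 0 ==> Re p < 2 / a"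
 shows "cutpow a p + of_real l * (1 - of_real a/2 * p) ~= 0"
  and "1 - of_real a/2 * p ~= 0" and "p ~= 0 ==> cutpow a p / (1 - of_real a/2 * p) \<notin> \<real>\<^sub>\<le>\<^sub>0"
proof -
 show C: "1 - of_real a/2 * p ~= 0"
 proof
  assume "1 - of_real a/2 * p = 0"
  then have "p = of_real (2 / a)" using a by (simp add: field_simps)
  then show False using p(2) by simp
 qed
 obtain \<phi> where \<phi>: "0 <= \<phi>" "\<phi> <= pi" "p = of_real (cmod p) * cis \<phi>" using upper_polar p by blast
 define R where "R = cmod p"
 have pR: "p = of_real R * cis \<phi>" "0 <= R" using \<phi> R_def by auto
 have cp: "cutpow a p = of_real (R powr a) * cis (a * \<phi>)" using cutpow_polar[of R \<phi> a] \<phi> pR by simp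
 show nr: "cutpow a p / (1 - of_real a/2 * p) \<notin> \<real>\<^sub>\<le>\<^sub>0" if "p ~= 0"
 proof (cases "\<phi> = 0")
  case True
  then have "p = of_real R" using pR by simp
  moreover have "R > 0" using that R_def by simp
  moreover have "R < 2 / a" using p(2) \<open>p = of_real R\<close> by simp
  ultimately have "cutpow a p / (1 - of_real a/2 * p) = of_real (R powr a / (1 - a/2 * R))" "0 < R powr a / (1 - a/2 * R)"
   using cp True a by (auto simp: field_simps)
  then show ?thesis by (simp only: complex_nonpos_Reals_iff Re_complex_of_real) simp
 next
  case False
  have R: "R > 0" using that R_def by simp
  have "Im (cutpow a p * cnj (1 - of_real a/2 * p)) = R powr a * (sin (a * \<phi>) + a * R / 2 * (sin \<phi> * cos (a * \<phi>) - cos \<phi> * sin (a*\<phi>)))"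
   unfolding cp by (subst pR(1)) (simp add: field_simps)
  also have "sin \<phi> * cos (a * \<phi>) - cos \<phi> * sin (a*\<phi>) = sin (\<phi> - a * \<phi>)" by (simp add: sin_diff)
  finally have e: "Im (cutpow a p * cnj (1 - of_real a/2 * p)) = R powr a * (sin (a * \<phi>) + a * R / 2 * sin (\<phi> - a * \<phi>))" .
  have \<phi>0: "\<phi> > 0" using False \<phi> by simp
  have "a * \<phi> < 1 * \<phi>" using a \<phi>0 by (intro mult_strict_right_mono) auto
  then have "a * \<phi> < pi" "0 < \<phi> - a * \<phi>" using \<phi> by auto
  moreover have "0 < a * \<phi>" using a \<phi>0 by simp
  ultimately have "0 < sin (a * \<phi>)" "0 < sin (\<phi> - a * \<phi>)" using \<phi> by (auto intro!: sin_gt_zero)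
  then have pos: "0 < Im (cutpow a p * cnj (1 - of_real a/2 * p))" unfolding e using R a
   by (intro mult_pos_pos add_pos_pos) auto
  have "Im (cutpow a p / (1 - of_real a/2 * p)) = Im (cutpow a p * cnj (1 - of_real a/2 * p)) / (cmod (1 - of_real a/2 * p))\<^sup>2"
   by (subst complex_div_cnj) simp
  then have "Im (cutpow a p / (1 - of_real a/2 * p)) > 0" using pos C by simp
  then show ?thesis by (auto simp: complex_nonpos_Reals_iff)
 qed
 show "cutpow a p + of_real l * (1 - of_real a/2 * p) ~= 0"
 proof (cases "p = 0")
  case True then show ?thesis using l by simp
 next
  case False
  show ?thesis
  proof
   assume "cutpow a p + of_real l * (1 - of_real a/2 * p) = 0"
   then have "cutpow a p = of_real (-l) * (1 - of_real a/2 * p)" by (simp add: eq_neg_iff_add_eq_0)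
   then have "cutpow a p / (1 - of_real a/2 * p) = of_real (-l)" using C by simp
   then show False using nr[OF False] l by (simp add: complex_nonpos_Reals_iff)
  qed
 qed
qed

text \<open>Points w of the lower half disc give p = 1 - w in the upper half plane with Re p < 2 < 2
  / a; the upper half disc follows by conjugation.\<close>

lemma mlk_gf_denominator_nonzero:
 assumes "cmod w < 1"
 shows "(1 - w) powr of_real a + of_real l * (1 - of_real a/2 + of_real a/2 * w) ~= 0"
proof -
 have key: "(1 - w) powr of_real a + of_real l * (1 - of_real a/2 + of_real a/2 * w) ~= 0" if w: "cmod w < 1" "Im w <= 0" for w
 proof -
  have R: "Re w < 1" "- 1 < Re w" using w abs_Re_le_cmod[of w] by auto
  have "cutpow a (1 - w) = (1 - w) powr of_real a"
   using w R by (intro cutpow_eq_powr) (auto simp: complex_nonpos_Reals_iff)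
  moreover have "2 / a > 2" using a by (simp add: field_simps)
  ultimately show ?thesis using cutpow_add_linear_nonzero(1)[of "1 - w"] w R by (simp add: algebra_simps)
 qed
 show ?thesis
 proof (cases "Im w <= 0")
  case True then show ?thesis using key assms by blast
 next
  case False
  have "Re w < 1" using assms abs_Re_le_cmod[of w] by auto
  then have "cnj ((1 - w) powr of_real a) = (1 - cnj w) powr of_real a"
   by (subst cnj_powr) (auto simp: complex_nonpos_Reals_iff)
  then have "cnj ((1 - w) powr of_real a + of_real l * (1 - of_real a/2 + of_real a/2 * w)) ~= 0"
   using key[of "cnj w"] assms False by simp
  then show ?thesis by (metis complex_cnj_zero)
 qed
qed

lemma mlk_gf_holomorphic: "mlk_gf a l holomorphic_on ball 0 1"
 unfolding mlk_gf_def
proof (intro holomorphic_intros)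
 fix w :: complex assume "w \<in> ball 0 1"
 then show "(1 - w) powr complex_of_real a + complex_of_real l * (1 - complex_of_real a / 2 + complex_of_real a / 2 * w) ~= 0"
  using mlk_gf_denominator_nonzero by simp
next
 fix w :: complex assume "w \<in> ball 0 1"
 then show "1 - w \<notin> \<real>\<^sub>\<le>\<^sub>0" using abs_Re_le_cmod[of w] by (auto simp: complex_nonpos_Reals_iff)
qed

text \<open>The formal inverse in \<open>mlk_fps\<close> says nothing about convergence. Holomorphy
  gives an expansion of \<open>mlk_gf\<close> that converges in the whole disc, and multiplication
  by the denominator near 0 identifies its coefficients.\<close>

lemma mlk_gf_sums:
 assumes "cmod w < 1"
 shows "(%m. of_real (fps_nth (mlk_fps a l) m) * w ^ m) sums mlk_gf a l w"
proof -
 define cf :: "real fps => complex fps" where "cf F = Abs_fps (%n. of_real (fps_nth F n))" for F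
 have cf_mult: "cf (F * G) = cf F * cf G" for F G
  by (rule fps_ext) (simp add: cf_def fps_mult_nth)
 have cf_simps: "cf (F + G) = cf F + cf G" "cf (F - G) = cf F - cf G" "cf (fps_const c) = fps_const (of_real c)" "cf fps_X = fps_X" for F G c
  by (rule fps_ext; simp add: cf_def fps_X_def)+
 have cf_num: "cf 3 = 3" by (rule fps_ext) (simp add: cf_def fps_numeral_nth)
 define Cc :: "complex fps" where "Cc = fps_const (1 - of_real a/2) + fps_const (of_real a/2) * fps_X"
 define Bc :: "complex fps" where "Bc = fps_const (1/4) * fps_X * (3 - fps_X)^2 * Cc"
 define Ac where "Ac = cf (cn_fps a l)"
 have "mlk_fps a l * cn_fps a l = fps_const (1/4) * fps_X * (3 - fps_X)^2 * (fps_const (1 - a/2) + fps_const (a/2) * fps_X)"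
  using inverse_mult_eq_1[OF cn_fps_nth_0] by (simp add: mlk_fps_def mult.assoc)
 then have "cf (mlk_fps a l) * Ac = Bc"
  unfolding Ac_def cf_mult[symmetric] by (simp add: cf_mult cf_simps cf_num power2_eq_square Bc_def Cc_def)
 have s1: "(%n. of_real (cn_weight a n) * u ^ n) sums ((1 - u) powr of_real a)" if "cmod u < 1" for u
 proof -
  have "(of_real a gchoose n) * (-u) ^ n = of_real (cn_weight a n) * u ^ n" for n
   unfolding cn_weight_gbinomial power_minus[of u n] by (simp add: of_real_gbinomial)
  then show ?thesis using gen_binomial_complex[of "-u" "of_real a"] that by simp
 qed
 have "(%u. (1 - u) powr of_real a) has_fps_expansion cf (Abs_fps (cn_weight a))"
 proof (rule has_fps_expansionI)
  show "\<forall>\<^sub>F u in nhds 0. (%n. fps_nth (cf (Abs_fps (cn_weight a))) n * u ^ n) sums ((1 - u) powr complex_of_real a)"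
   using eventually_nhds_in_open[of "ball 0 1" "0::complex"]
   by (rule eventually_mono) (auto simp: cf_def s1)
 qed
 then have eA: "(%u. (1 - u) powr of_real a + of_real l * (1 - of_real a/2 + of_real a/2 * u)) has_fps_expansion Ac"
  unfolding Ac_def cn_fps_def cf_simps cf_mult
  by (intro fps_expansion_intros) (auto intro!: fps_expansion_intros)
 have eB: "(%u. 1/4 * u * (3 - u)^2 * (1 - of_real a/2 + of_real a/2 * u)) has_fps_expansion Bc"
  unfolding Bc_def Cc_def by (intro fps_expansion_intros)
 have eQ: "mlk_gf a l has_fps_expansion fps_expansion (mlk_gf a l) 0"
  by (rule has_fps_expansion_fps_expansion[of "ball 0 1"]) (auto intro: mlk_gf_holomorphic)
 have "(%u. mlk_gf a l u * ((1 - u) powr of_real a + of_real l * (1 - of_real a/2 + of_real a/2 * u))) has_fps_expansion fps_expansion (mlk_gf a l) 0 * Ac"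
  by (intro fps_expansion_intros eQ eA)
 moreover have "\<forall>\<^sub>F u in nhds 0. mlk_gf a l u * ((1 - u) powr of_real a + of_real l * (1 - of_real a/2 + of_real a/2 * u)) = 1/4 * u * (3 - u)^2 * (1 - of_real a/2 + of_real a/2 * u)"
  using eventually_nhds_in_open[of "ball 0 1" "0::complex"]
 proof (rule eventually_mono)
  have c: "x / D * D = x" if "D ~= 0" for x D :: complex using that by simp
  show "mlk_gf a l u * ((1 - u) powr of_real a + of_real l * (1 - of_real a/2 + of_real a/2 * u)) = 1/4 * u * (3 - u)^2 * (1 - of_real a/2 + of_real a/2 * u)"
   if "u \<in> ball 0 1" for u
   unfolding mlk_gf_def by (rule c, rule mlk_gf_denominator_nonzero) (use that in simp)
 qed auto
 ultimately have "(%u. 1/4 * u * (3 - u)^2 * (1 - of_real a/2 + of_real a/2 * u)) has_fps_expansion fps_expansion (mlk_gf a l) 0 * Ac"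
  by (subst (asm) has_fps_expansion_cong[OF _ refl])
 then have "fps_expansion (mlk_gf a l) 0 * Ac = Bc" using eB fps_expansion_unique_complex by blast
 moreover have "fps_nth Ac 0 ~= 0" using cn_fps_nth_0 by (simp add: Ac_def cf_def)
 then have "Ac ~= 0" by auto
 ultimately have eq: "fps_expansion (mlk_gf a l) 0 = cf (mlk_fps a l)"
  using \<open>cf (mlk_fps a l) * Ac = Bc\<close> by (metis mult_right_cancel)
 have "(%n. fps_nth (fps_expansion (mlk_gf a l) 0) n * w ^ n) sums mlk_gf a l w"
  using holomorphic_power_series[OF mlk_gf_holomorphic, of w] assms by (simp add: fps_expansion_def)
 then show ?thesis unfolding eq by (simp add: cf_def)
qed

end

text \<open>Cauchy's coefficient formula on the circle w = exp(-1 - i y); since the coefficients are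
  real, half the circle and the real part suffice. In the variable z = 1 + i y the coefficient
  becomes an integral against e^(m z), comparable with the Bromwich integral for \<open>mlk\<close>
  at m.\<close>

lemma mlk_fps_integral:
 assumes a: "0 < a" "a < 1" and l: "0 < l"
 shows "((%y. Re (exp (of_nat m * Complex 1 y) * mlk_gf a l (exp (- Complex 1 y)))) has_integral pi * fps_nth (mlk_fps a l) m) {0..pi}"
proof -
 define s where "s = fps_nth (mlk_fps a l)"
 define f where "f i y = s i * exp (real m - real i) * cos ((real m - real i) * y)" for i y
 \<comment> \<open>Convergence at the larger radius e^(-1/2) gives absolute convergence on the
   circle of radius e^(-1).\<close>
 have sm: "summable (%n. \<bar>s n\<bar> * exp (real m - real n))"
 proof -
  have "summable (%n. complex_of_real (s n) * of_real (exp (-1/2)) ^ n)"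
   using mlk_gf_sums[OF a l, of "of_real (exp (-1/2))"] by (auto simp: s_def sums_iff)
  then have "summable (%n. norm (complex_of_real (s n) * of_real (exp (-1)) ^ n))"
   by (rule powser_insidea) simp
  then have "summable (%n. exp (real m) * norm (complex_of_real (s n) * of_real (exp (-1)) ^ n))"
   by (rule summable_mult)
  moreover have "exp (real m) * norm (complex_of_real (s n) * of_real (exp (-1)) ^ n) = \<bar>s n\<bar> * exp (real m - real n)" for n
  proof -
   have "norm (complex_of_real (exp (-1)) ^ n) = exp (real n * (-1))"
    unfolding norm_power exp_of_nat_mult by simp
   then show ?thesis unfolding norm_mult by (simp only:) (simp add: exp_diff exp_minus divide_inverse)
  qed
  ultimately show ?thesis by simp
 qed
 have sums: "(%i. f i y) sums Re (exp (of_nat m * Complex 1 y) * mlk_gf a l (exp (- Complex 1 y)))" for y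
 proof -
  have "cmod (exp (- Complex 1 y)) < 1" by simp
  then have "(%i. exp (of_nat m * Complex 1 y) * (of_real (s i) * exp (- Complex 1 y) ^ i)) sums (exp (of_nat m * Complex 1 y) * mlk_gf a l (exp (- Complex 1 y)))"
   unfolding s_def by (intro sums_mult mlk_gf_sums[OF a l])
  then have "(%i. Re (exp (of_nat m * Complex 1 y) * (of_real (s i) * exp (- Complex 1 y) ^ i))) sums Re (exp (of_nat m * Complex 1 y) * mlk_gf a l (exp (- Complex 1 y)))"
   by (rule sums_Re)
  moreover have "Re (exp (of_nat m * Complex 1 y) * (of_real (s i) * exp (- Complex 1 y) ^ i)) = f i y" for i
  proof -
   have "exp (- Complex 1 y) ^ i = exp (of_nat i * (- Complex 1 y))" by (simp only: exp_of_nat_mult)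
   then have "exp (of_nat m * Complex 1 y) * (of_real (s i) * exp (- Complex 1 y) ^ i) = of_real (s i) * exp (of_nat m * Complex 1 y + of_nat i * (- Complex 1 y))"
    by (simp only: exp_add mult_ac)
   also have "of_nat m * Complex 1 y + of_nat i * (- Complex 1 y) = Complex (real m - real i) ((real m - real i) * y)"
    by (simp add: complex_eq_iff algebra_simps)
   finally have e: "exp (of_nat m * Complex 1 y) * (of_real (s i) * exp (- Complex 1 y) ^ i) = of_real (s i) * exp (Complex (real m - real i) ((real m - real i) * y))" .
   show ?thesis unfolding e f_def by (simp add: Re_exp)
  qed
  ultimately show ?thesis by simp
 qed
 have "uniform_limit {0..pi} (%n y. \<Sum>i<n. f i y) (%y. \<Sum>i. f i y) sequentially"
 proof (rule Weierstrass_m_test[OF _ sm])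
  show "norm (f n x) <= \<bar>s n\<bar> * exp (real m - real n)" for n x
   using mult_left_mono[OF abs_cos_le_one[of "(real m - real n) * x"], of "\<bar>s n\<bar> * exp (real m - real n)"]
   by (simp add: f_def abs_mult)
 qed
 then obtain I J where IJ: "!!n. ((%y. \<Sum>i<n. f i y) has_integral I n) {0..pi}" "((%y. \<Sum>i. f i y) has_integral J) {0..pi}" "(I \<longlongrightarrow> J) sequentially"
  by (rule uniform_limit_integral) (auto simp: f_def intro!: continuous_intros)
 have fi: "(f i has_integral (if i = m then pi * s m else 0)) {0..pi}" for i
 proof (cases "i = m")
  case True
  then show ?thesis using has_integral_const_real[of "s m" 0 pi] by (simp add: f_def[abs_def])
 next
  case False
  define k where "k = real m - real i"
  have k: "k ~= 0" using False by (simp add: k_def)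
  have "((%y. s i * exp k * cos (k * y)) has_integral (s i * exp k * (sin (k * pi) / k) - s i * exp k * (sin (k * 0) / k))) {0..pi}"
   using k by (intro fundamental_theorem_of_calculus)
    (auto intro!: derivative_eq_intros simp: has_real_derivative_iff_has_vector_derivative[symmetric])
  moreover have "sin (k * pi) = 0" using sin_npi_int[of "int m - int i"] by (simp add: k_def mult.commute)
  ultimately show ?thesis using False by (simp add: f_def[abs_def] k_def)
 qed
 have I: "I n = (if m < n then pi * s m else 0)" for n
 proof -
  have "((%y. \<Sum>i<n. f i y) has_integral (\<Sum>i<n. if i = m then pi * s m else 0)) {0..pi}"
   by (intro has_integral_sum fi) auto
  then have "I n = (\<Sum>i<n. if i = m then pi * s m else 0)" using IJ(1)[of n] has_integral_unique by blast
  then show ?thesis by (simp add: sum.delta)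
 qed
 have "eventually (%n. pi * s m = I n) sequentially"
  using eventually_gt_at_top[of m] by eventually_elim (simp add: I)
 then have "(I \<longlongrightarrow> pi * s m) sequentially" by (rule Lim_transform_eventually[OF tendsto_const])
 then have "J = pi * s m" using IJ(3) LIMSEQ_unique by blast
 moreover have "(\<Sum>i. f i y) = Re (exp (of_nat m * Complex 1 y) * mlk_gf a l (exp (- Complex 1 y)))" for y
  using sums[of y] by (simp add: sums_iff)
 ultimately show ?thesis using IJ(2) by (simp add: s_def)
qed

text \<open>On the cut z = -r, so e^(-z) = e^r. In the second quotient ((e^r - 1) / r)^a = 1 + a r /
  2 + O(r^2) is matched to first order by the Crank-Nicolson factor in the denominator. The
  condition \<open>1 + exp r0 < 2 / a\<close> keeps p = 1 - e^(-z) in the range of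
  \<open>cutpow_add_linear_nonzero\<close> for all z in the strip with Re z >= -r0.\<close>

lemma cut_radius_exists:
 fixes a :: real
 assumes a: "0 < a" "a < 1"
 obtains r0 K where "0 < r0" "1 + exp r0 < 2 / a" "0 < K"
  "!!r. 0 < r ==> r <= r0 ==> \<bar>exp r * (3 - exp r)\<^sup>2 / 4 - 1\<bar> <= K * r\<^sup>2"
  "!!r. 0 < r ==> r <= r0 ==> \<bar>((exp r - 1) / r) powr a / (1 + a * (exp r - 1) / 2) - 1\<bar> <= K * r\<^sup>2"
  "!!r. 0 < r ==> r <= r0 ==> 1/2 <= ((exp r - 1) / r) powr a / (1 + a * (exp r - 1) / 2)"
proof -
 have o1: "(%r::real. exp r * (3 - exp r)^2 / 4 - 1) \<in> O[at_right 0](%r. r^2)" by real_asymp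
 have o2: "(%r::real. ((exp r - 1)/r) powr a / (1 + a*(exp r - 1)/2) - 1) \<in> O[at_right 0](%r. r^2)"
  using a by real_asymp
 obtain c1 where c1: "c1 > 0" "eventually (%r::real. norm (exp r * (3 - exp r)^2 / 4 - 1) <= c1 * norm (r^2)) (at_right 0)"
  by (rule landau_o.bigE[OF o1])
 obtain c2 where c2: "c2 > 0" "eventually (%r::real. norm (((exp r - 1)/r) powr a / (1 + a*(exp r - 1)/2) - 1) <= c2 * norm (r^2)) (at_right 0)"
  by (rule landau_o.bigE[OF o2])
 have l3: "((%r::real. ((exp r - 1)/r) powr a / (1 + a*(exp r - 1)/2)) \<longlongrightarrow> 1) (at_right 0)"
  using a by real_asymp
 have c3: "eventually (%r. 1/2 < ((exp r - 1)/r) powr a / (1 + a*(exp r - 1)/2)) (at_right 0)"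
  by (rule order_tendstoD(1)[OF l3]) simp
 have "((%r::real. 1 + exp r) \<longlongrightarrow> 1 + exp 0) (at_right 0)" by (intro tendsto_intros)
 moreover have "1 + exp 0 < 2 / a" using a by (simp add: field_simps)
 ultimately have c4: "eventually (%r::real. 1 + exp r < 2 / a) (at_right 0)" by (rule order_tendstoD(2))
 obtain b where b: "b > 0" "!!r::real. 0 < r ==> r < b ==> norm (exp r * (3 - exp r)^2 / 4 - 1) <= c1 * norm (r^2) \<and>
  norm (((exp r - 1)/r) powr a / (1 + a*(exp r - 1)/2) - 1) <= c2 * norm (r^2) \<and>
  1/2 < ((exp r - 1)/r) powr a / (1 + a*(exp r - 1)/2) \<and> 1 + exp r < 2 / a"
  using eventually_conj[OF c1(2) eventually_conj[OF c2(2) eventually_conj[OF c3 c4]]]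
  unfolding eventually_at_right_field by blast
 have m: "c1 * r^2 <= max c1 c2 * r^2" "c2 * r^2 <= max c1 c2 * r^2" for r :: real
  by (intro mult_right_mono; simp)+
 show ?thesis
 proof (rule that[of "b/2" "max c1 c2"])
  show "1 + exp (b / 2) < 2 / a" using b(2)[of "b/2"] b(1) by simp
 next
  fix r :: real assume r: "0 < r" "r <= b/2"
  then have "r < b" using b(1) by simp
  note B = b(2)[OF r(1) this]
  show "\<bar>exp r * (3 - exp r)\<^sup>2 / 4 - 1\<bar> <= max c1 c2 * r\<^sup>2" using B m(1)[of r] by simp
  show "\<bar>((exp r - 1) / r) powr a / (1 + a * (exp r - 1) / 2) - 1\<bar> <= max c1 c2 * r\<^sup>2" using B m(2)[of r] by simp
  show "1/2 <= ((exp r - 1) / r) powr a / (1 + a * (exp r - 1) / 2)" using B by simp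
 qed (use b c1 in auto)
qed

text \<open>In the strip 0 <= Im z <= pi the line Re z = 1 of the coefficient formula is moved to
  the line Re z = -r0 and the segment [-r0, 0] of the cut. The edges Im z = pi and [0, 1] carry real
  integrands and drop out of the imaginary part. On the cut the integrand differs from that of
  \<open>mlk\<close> by e^(-m r) O(r^(2-a)), uniformly in \<open>l\<close>, and the integral of this
  is of order m^(a-3). The left edge is exponentially small in m.\<close>

lemma mlk_grid_error:
 assumes a: "0 < a" "a < 1"
 obtains K where "0 < K" "!!l m. 0 < l ==> 1 <= m ==> \<bar>mlk a l (real m) - fps_nth (mlk_fps a l) m\<bar> <= K * real m powr (a - 3)"
proof -
 obtain r0 K where r0: "0 < r0" "1 + exp r0 < 2 / a" and K: "0 < K"
  and q: "!!r. 0 < r ==> r <= r0 ==> \<bar>exp r * (3 - exp r)\<^sup>2 / 4 - 1\<bar> <= K * r\<^sup>2"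
  and v: "!!r. 0 < r ==> r <= r0 ==> \<bar>((exp r - 1) / r) powr a / (1 + a * (exp r - 1) / 2) - 1\<bar> <= K * r\<^sup>2"
  and v2: "!!r. 0 < r ==> r <= r0 ==> 1/2 <= ((exp r - 1) / r) powr a / (1 + a * (exp r - 1) / 2)"
  using cut_radius_exists[OF a] by metis
 define s where "s = sin (a * pi)"
 have s: "0 < s" unfolding s_def by (rule sin_pi_pos[OF a])
 define p where "p z = 1 - exp (- z)" for z :: complex
 define C where "C z = 1 - of_real a/2 * p z" for z
 define Q where "Q z = 1/4 * exp (- z) * (3 - exp (- z))\<^sup>2" for z :: complex
 define S where "S = {z. - r0 <= Re z \<and> 0 <= Im z \<and> Im z <= pi}"
 have pS: "0 <= Im (p z)" "Im (p z) = 0 ==> Re (p z) < 2 / a" if "z \<in> S" for z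
 proof -
  have z: "- r0 <= Re z" "0 <= Im z" "Im z <= pi" using that by (auto simp: S_def)
  have e: "Im (p z) = exp (- Re z) * sin (Im z)" "Re (p z) = 1 - exp (- Re z) * cos (Im z)"
   by (auto simp: p_def Im_exp Re_exp)
  show "0 <= Im (p z)" unfolding e using z by (intro mult_nonneg_nonneg sin_ge_zero) auto
  have "Re (p z) <= 1 + exp (- Re z)" unfolding e
   using mult_left_mono[OF cos_ge_minus_one[of "Im z"], of "exp (- Re z)"] by simp
  also have "... <= 1 + exp r0" using z by simp
  finally show "Re (p z) < 2 / a" using r0 by simp
 qed
 have cvx: "convex S"
 proof -
  have "S = {z. - r0 <= Re z} \<inter> {z. 0 <= Im z} \<inter> {z. Im z <= pi}" by (auto simp: S_def)
  moreover have "convex ..." by (intro convex_Int convex_halfspace_Re_ge convex_halfspace_Im_ge convex_halfspace_Im_le)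
  ultimately show ?thesis by simp
 qed
 have intS: "0 < Im z" "Im z < pi" if "z \<in> interior S" for z
 proof -
  have "interior S \<subseteq> interior {z. 0 <= Im z}" "interior S \<subseteq> interior {z. Im z <= pi}"
   by (intro interior_mono; auto simp: S_def)+
  then show "0 < Im z" "Im z < pi"
   using interior_halfspace_ge[of "\<i>::complex" 0] interior_halfspace_le[of "\<i>::complex" pi] that
   by (auto simp: inner_complex_def)
 qed
 have contS: "continuous_on S (%z. cutpow a (p z))"
 proof (rule continuous_on_compose2[OF continuous_on_cutpow[OF a(1)]])
  show "continuous_on S p" unfolding p_def by (intro continuous_intros)
 qed (use pS in auto)
 \<comment> \<open>After division by \<open>C\<close> the denominator on the left edge is b(y) + l.
   The compact curve \<open>b\<close> misses the nonpositive reals, so its distance \<open>d\<close>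
   from them bounds the denominator from below for all l at once.\<close>
 define b where "b y = cutpow a (p (Complex (- r0) y)) / C (Complex (- r0) y)" for y
 have inS: "Complex (- r0) y \<in> S" if "y \<in> {0..pi}" for y using that by (auto simp: S_def)
 have Cnz: "C z ~= 0" if "z \<in> S" for z
  using cutpow_add_linear_nonzero(2)[of a 1 "p z"] a pS[OF that] by (simp add: C_def)
 have ccont: "continuous_on {0..pi} (%y. Complex (- r0) y)"
  by (intro continuous_on_Complex continuous_intros)
 have "continuous_on {0..pi} b" unfolding b_def C_def
  by (intro continuous_intros continuous_on_compose2[OF contS ccont])
   (use Cnz inS in \<open>auto simp: C_def p_def intro!: continuous_intros ccont\<close>)
 then have "compact (b ` {0..pi})" by (intro compact_continuous_image) auto
 moreover have "b ` {0..pi} \<inter> \<real>\<^sub>\<le>\<^sub>0 = {}"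
 proof -
  have "b y \<notin> \<real>\<^sub>\<le>\<^sub>0" if y: "y \<in> {0..pi}" for y
  proof -
   have "cmod (exp (- Complex (- r0) y)) = exp r0" by simp
   then have "exp (- Complex (- r0) y) ~= 1" using r0(1) by (metis norm_one exp_eq_one_iff less_irrefl)
   then have "p (Complex (- r0) y) ~= 0" by (simp add: p_def)
   then show ?thesis unfolding b_def C_def
    using cutpow_add_linear_nonzero(3)[of a 1 "p (Complex (- r0) y)"] a pS[OF inS[OF y]] by simp
  qed
  then show ?thesis by auto
 qed
 ultimately obtain d where d: "d > 0" "!!x y. x \<in> b ` {0..pi} ==> y \<in> \<real>\<^sub>\<le>\<^sub>0 ==> d <= dist x y"
  using separate_compact_closed[OF _ closed_nonpos_Reals_complex] by metis
 define KL where "KL = exp r0 * (3 + exp r0)\<^sup>2 / (4 * d)"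
 have "3 + exp r0 > 0" by (intro add_pos_pos) auto
 then have KL: "KL > 0" using d by (auto simp: KL_def intro!: divide_pos_pos mult_pos_pos)
 \<comment> \<open>The exponential is eventually below the power; the finitely many remaining m are
   absorbed into the constant.\<close>
 obtain KM where KM: "!!m::nat. 1 <= m ==> exp (- r0 * real m) <= KM * real m powr (a - 3)" "KM > 0"
 proof -
  have o: "(%m::nat. exp (- r0 * real m)) \<in> O(%m. real m powr (a - 3))" using r0(1) by real_asymp
  obtain c where c: "c > 0" "eventually (%m::nat. norm (exp (- r0 * real m)) <= c * norm (real m powr (a - 3))) sequentially"
   by (rule landau_o.bigE[OF o])
  then obtain N where N: "!!m. m >= N ==> exp (- r0 * real m) <= c * real m powr (a - 3)"
   by (auto simp: eventually_sequentially)
  define c' where "c' = max c (real (Suc N) powr (3 - a))"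
  show ?thesis
  proof (rule that[of c'])
   fix m :: nat assume m: "1 <= m"
   show "exp (- r0 * real m) <= c' * real m powr (a - 3)"
   proof (cases "m >= N")
    case True
    have "c * real m powr (a - 3) <= c' * real m powr (a - 3)" by (intro mult_right_mono) (auto simp: c'_def)
    then show ?thesis using N[OF True] by linarith
   next
    case False
    have "exp (- r0 * real m) <= 1" using r0(1) by simp
    also have "1 = real (Suc N) powr (3 - a) * real (Suc N) powr (a - 3)" by (simp add: powr_add[symmetric])
    also have "... <= c' * real m powr (a - 3)" using False m a
     by (intro mult_mono) (auto simp: c'_def le_max_iff_disj intro!: powr_mono2')
    finally show ?thesis .
   qed
  qed (use c in \<open>auto simp: c'_def\<close>)
 qed
 \<comment> \<open>The three summands come from the numerator on [0, r0], from the denominator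
   there, and from the part r > r0 of the density, where r^(-a) <= r0^(-2) r^(2-a).\<close>
 define K1 where "K1 = 2 * K / s + 2 * K / s\<^sup>2 + r0 powr (-2) / s"
 have K1: "K1 > 0" unfolding K1_def using K s r0(1) by (intro add_pos_pos) auto
 define K2 where "K2 = (K1 * Gamma (3 - a) + pi * KL * KM) / pi"
 have K2: "K2 > 0" unfolding K2_def using K1 KL KM a by (intro divide_pos_pos add_pos_pos mult_pos_pos Gamma_real_pos) auto
 show ?thesis
 proof (rule that[OF K2])
  fix l :: real and m :: nat assume l: "0 < l" and m: "1 <= m"
  define X where "X z = Q z * C z / (cutpow a (p z) + of_real l * C z)" for z
  define F where "F z = exp (of_nat m * z) * X z" for z
  have D: "cutpow a (p z) + of_real l * C z ~= 0" if "z \<in> S" for z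
   using cutpow_add_linear_nonzero(1)[OF a l, of "p z"] pS[OF that] by (simp add: C_def)
  have contF: "continuous_on S F" unfolding F_def X_def Q_def C_def
   by (intro continuous_intros contS) (use D in \<open>auto simp: C_def p_def intro!: continuous_intros\<close>)
  obtain G where G: "!!z. z \<in> S ==> (G has_field_derivative F z) (at z within S)"
  proof (rule holomorphic_convex_primitive[OF cvx, of "{}" F])
   show "F field_differentiable at z" if "z \<in> interior S - {}" for z
   proof -
    have z: "0 < Im z" "Im z < pi" "z \<in> S" using intS that interior_subset by auto
    have "0 < Im (p z)" using z by (auto simp: p_def Im_exp intro!: mult_pos_pos sin_gt_zero)
    then have "cutpow a field_differentiable at (p z)" by (rule cutpow_field_differentiable)
    moreover have p: "p field_differentiable at z" unfolding p_def field_differentiable_def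
     by (auto intro!: derivative_eq_intros)
    ultimately have "(cutpow a \<circ> p) field_differentiable at z" by (intro field_differentiable_compose)
    then have "(%z. cutpow a (p z)) field_differentiable at z" by (simp add: o_def)
    moreover have "Q field_differentiable at z" unfolding Q_def field_differentiable_def
     by (rule exI, (rule derivative_eq_intros refl | simp)+)
    moreover have "(%z. exp (of_nat m * z)) field_differentiable at z" unfolding field_differentiable_def
     by (rule exI, (rule derivative_eq_intros refl | simp)+)
    ultimately show ?thesis unfolding F_def X_def C_def
     by (intro field_differentiable_mult field_differentiable_divide field_differentiable_add field_differentiable_diff field_differentiable_const p)
      (use D[OF z(3)] in \<open>auto simp: C_def\<close>)
   qed
  qed (use contF in auto)
  have right: "pi * fps_nth (mlk_fps a l) m = Im (G (Complex 1 pi) - G 1)"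
  proof -
   have h: "((%x. F (1 + of_real x * \<i>) * \<i>) has_integral (G (1 + of_real pi * \<i>) - G (1 + of_real 0 * \<i>))) {0..pi}"
    by (rule line_integral_primitive[OF G]) (use r0 in \<open>auto simp: S_def\<close>)
   have 1: "((%x. Im (F (1 + of_real x * \<i>) * \<i>)) has_integral Im (G (1 + of_real pi * \<i>) - G (1 + of_real 0 * \<i>))) {0..pi}"
    using has_integral_linear[OF h bounded_linear_Im] by (simp add: o_def)
   have 2: "Im (F (1 + of_real y * \<i>) * \<i>) = Re (exp (of_nat m * Complex 1 y) * mlk_gf a l (exp (- Complex 1 y)))" if y: "y \<in> {0..pi}" for y
   proof -
    have c: "1 + of_real y * \<i> = Complex 1 y" by (simp add: complex_eq_iff)
    have "0 < Re (p (Complex 1 y))"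
    proof -
     have "exp (-1) * cos y <= exp (-1) * 1" by (intro mult_left_mono) auto
     also have "... < (1::real)" by simp
     finally show ?thesis by (simp add: p_def Re_exp)
    qed
    then have "cutpow a (p (Complex 1 y)) = p (Complex 1 y) powr of_real a"
     using pS(1)[of "Complex 1 y"] y r0 by (intro cutpow_eq_powr) (auto simp: S_def complex_nonpos_Reals_iff)
    then have "X (Complex 1 y) = mlk_gf a l (exp (- Complex 1 y))"
     unfolding X_def mlk_gf_def Q_def C_def p_def by (simp add: algebra_simps)
    then show ?thesis unfolding c F_def by simp
   qed
   have "((%y. Re (exp (of_nat m * Complex 1 y) * mlk_gf a l (exp (- Complex 1 y)))) has_integral Im (G (1 + of_real pi * \<i>) - G (1 + of_real 0 * \<i>))) {0..pi}"
    by (rule has_integral_eq[OF 2 1])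
   then have "Im (G (1 + of_real pi * \<i>) - G (1 + of_real 0 * \<i>)) = pi * fps_nth (mlk_fps a l) m"
    using mlk_fps_integral[OF a l] has_integral_unique by blast
   moreover have "1 + of_real pi * \<i> = Complex 1 pi" by (simp add: complex_eq_iff)
   ultimately show ?thesis by simp
  qed
  have realline: "Im (G (z0 + of_real x2) - G (z0 + of_real x1)) = 0"
   if le: "x1 <= x2" and sub: "!!x. x1 <= x ==> x <= x2 ==> z0 + of_real x \<in> S \<and> Im (F (z0 + of_real x)) = 0" for z0 x1 x2
  proof -
   have h: "((%x. F (z0 + of_real x * 1) * 1) has_integral (G (z0 + of_real x2 * 1) - G (z0 + of_real x1 * 1))) {x1..x2}"
    by (rule line_integral_primitive[OF G]) (use sub le in auto)
   have 1: "((%x. Im (F (z0 + of_real x * 1) * 1)) has_integral Im (G (z0 + of_real x2) - G (z0 + of_real x1))) {x1..x2}"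
    using has_integral_linear[OF h bounded_linear_Im] by (simp add: o_def)
   have "((%x. 0) has_integral Im (G (z0 + of_real x2) - G (z0 + of_real x1))) {x1..x2}"
    by (rule has_integral_eq[OF _ 1]) (use sub in auto)
   then show ?thesis by (simp add: has_integral_iff)
  qed
  have realF: "Im (F z) = 0" if w: "exp (- z) = of_real w" "w <= 1" and E: "Im (exp (of_nat m * z)) = 0" for z w
  proof -
   have pz: "p z = of_real (1 - w)" using w by (simp add: p_def)
   have "cutpow a (p z) = of_real ((1 - w) powr a)" unfolding pz using w by (intro cutpow_of_real) simp
   then have "X z = of_real (1/4 * w * (3 - w)\<^sup>2 * (1 - a/2 * (1 - w)) / ((1 - w) powr a + l * (1 - a/2 * (1 - w))))"
    unfolding X_def Q_def C_def w(1) pz by (simp add: pz)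
   then have "Im (X z) = 0" by (simp only: Im_complex_of_real)
   then show ?thesis using E by (simp add: F_def)
  qed
  have bottom2: "Im (G 1 - G 0) = 0"
  proof -
   have "Im (G (0 + of_real 1) - G (0 + of_real 0)) = 0"
   proof (rule realline)
    fix x :: real assume x: "0 <= x" "x <= 1"
    have "Im (F (of_real x)) = 0"
    proof (rule realF)
     show "exp (- of_real x) = complex_of_real (exp (- x))" by (simp add: complex_eq_iff Re_exp Im_exp)
    qed (use x in \<open>auto simp: Im_exp\<close>)
    then show "0 + of_real x \<in> S \<and> Im (F (0 + of_real x)) = 0" using x r0 by (simp add: S_def)
   qed simp
   then show ?thesis by simp
  qed
  have top: "Im (G (Complex 1 pi) - G (Complex (- r0) pi)) = 0"
  proof -
   have "Im (G (Complex 0 pi + of_real 1) - G (Complex 0 pi + of_real (- r0))) = 0"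
   proof (rule realline)
    fix x :: real assume x: "- r0 <= x" "x <= 1"
    have c: "Complex 0 pi + of_real x = Complex x pi" by (simp add: complex_eq_iff)
    have "Im (F (Complex x pi)) = 0"
    proof (rule realF)
     show "exp (- Complex x pi) = complex_of_real (- exp (- x))" by (simp add: complex_eq_iff Re_exp Im_exp)
     show "- exp (- x) <= 1" by (rule order_trans[of _ 0]) auto
     show "Im (exp (of_nat m * Complex x pi)) = 0" by (simp add: Im_exp sin_npi)
    qed
    then show "Complex 0 pi + of_real x \<in> S \<and> Im (F (Complex 0 pi + of_real x)) = 0"
     unfolding c using x by (simp add: S_def)
   qed (use r0 in auto)
   moreover have "Complex 0 pi + of_real 1 = Complex 1 pi" "Complex 0 pi + of_real (- r0) = Complex (- r0) pi" by (auto simp: complex_eq_iff)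
   ultimately show ?thesis by simp
  qed
  have left: "cmod (G (Complex (- r0) pi) - G (of_real (- r0))) <= exp (- r0 * real m) * KL * pi"
  proof -
   have "cmod (G (Complex (- r0) pi) - G (of_real (- r0))) <= exp (- r0 * real m) * KL * cmod (Complex (- r0) pi - of_real (- r0))"
   proof (rule field_differentiable_bound[where S = "closed_segment (of_real (- r0)) (Complex (- r0) pi)" and f' = F])
    fix z assume "z \<in> closed_segment (complex_of_real (- r0)) (Complex (- r0) pi)"
    then have z: "Re z = - r0" "0 <= Im z" "Im z <= pi" by (auto simp: closed_segment_same_Re closed_segment_eq_real_ivl)
    have "closed_segment (complex_of_real (- r0)) (Complex (- r0) pi) \<subseteq> S"
     by (auto simp: closed_segment_same_Re closed_segment_eq_real_ivl S_def)
    moreover have zS: "z \<in> S" using z by (simp add: S_def)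
    ultimately show "(G has_field_derivative F z) (at z within closed_segment (complex_of_real (- r0)) (Complex (- r0) pi))"
     using G DERIV_subset by blast
    have zc: "z = Complex (- r0) (Im z)" using z by (simp add: complex_eq_iff)
    have bz: "cutpow a (p z) / C z \<in> b ` {0..pi}" using z by (subst zc, subst (2) zc) (auto simp: b_def)
    have "d <= cmod (cutpow a (p z) / C z + of_real l)"
     using d(2)[OF bz, of "- of_real l"] l by (simp add: dist_norm complex_nonpos_Reals_iff)
    moreover have "X z = Q z / (cutpow a (p z) / C z + of_real l)"
     unfolding X_def using Cnz[OF zS] by (simp add: field_simps)
    ultimately have "cmod (X z) <= cmod (Q z) / d"
     using d(1) by (auto simp: norm_divide intro!: divide_left_mono mult_pos_pos)
    also have "cmod (Q z) <= exp r0 * (3 + exp r0)\<^sup>2 / 4"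
    proof -
     have e: "cmod (exp (- z)) = exp r0" using z by simp
     have "cmod (3 - exp (- z)) <= 3 + exp r0" using norm_triangle_ineq4[of 3 "exp (- z)"] e by simp
     then have "cmod (3 - exp (- z))^2 <= (3 + exp r0)^2" by (intro power_mono) auto
     then show ?thesis using e by (simp add: Q_def norm_mult norm_power)
    qed
    finally have "cmod (X z) <= KL" using d(1) by (simp add: KL_def divide_right_mono)
    then have "cmod (F z) <= exp (real m * Re z) * KL" unfolding F_def norm_mult by (simp add: mult_left_mono)
    then show "cmod (F z) <= exp (- r0 * real m) * KL" using z by (simp add: mult.commute)
   qed auto
   moreover have "Complex (- r0) pi - of_real (- r0) = \<i> * of_real pi" by (simp add: complex_eq_iff)
   ultimately show ?thesis by (simp add: norm_mult)
  qed
  have contF0: "continuous_on {0..r0} (%r. Im (F (- of_real r)))"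
   by (intro continuous_intros continuous_on_compose2[OF contF]) (auto simp: S_def)
  have bottom: "Im (G (of_real (- r0)) - G 0) = - (LBINT r:{0..r0}. Im (F (- of_real r)))"
  proof -
   have h: "((%x. F (0 + of_real x * (-1)) * (-1)) has_integral (G (0 + of_real r0 * (-1)) - G (0 + of_real 0 * (-1)))) {0..r0}"
    by (rule line_integral_primitive[OF G]) (use r0 in \<open>auto simp: S_def\<close>)
   have 1: "((%x. - Im (F (- of_real x))) has_integral Im (G (of_real (- r0)) - G 0)) {0..r0}"
    using has_integral_linear[OF h bounded_linear_Im] by (simp add: o_def)
   have 2: "set_lint {0..r0} (%r. Im (F (- of_real r)))"
    by (rule borel_integrable_atLeastAtMost'[OF contF0])
   show ?thesis using set_borel_integral_eq_integral(2)[OF 2] integral_unique[OF has_integral_neg[OF 1]] by simp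
  qed
  \<comment> \<open>The difference of the two integrands along the cut. \<open>Im F\<close> enters
    with a plus sign because \<open>cutdens\<close> is minus an imaginary part.\<close>
  define W where "W r = exp (- r * real m) * cutdens a l r + indicator {0..r0} r * Im (F (- of_real r))" for r
  have intF: "set_lint {0..r0} (%r. Im (F (- of_real r)))"
   by (rule borel_integrable_atLeastAtMost'[OF contF0])
  have e1: "indicator {0..r0} r *\<^sub>R Im (F (- of_real r)) = indicator {0..} r *\<^sub>R (indicator {0..r0} r * Im (F (- of_real r)))" for r
   by (auto simp: indicator_def)
  have intF': "set_lint {0..} (%r. indicator {0..r0} r * Im (F (- of_real r)))"
   using intF unfolding set_integrable_def e1 .
  have m0: "0 < real m" using m by simp
  have intW: "set_lint {0..} W" unfolding W_def
   by (intro set_integral_add(1) mlk_integrable0[OF a l m0] intF')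
  have "(LBINT r:{0..}. W r) = (LBINT r:{0..}. exp (- r * real m) * cutdens a l r) + (LBINT r:{0..}. indicator {0..r0} r * Im (F (- of_real r)))"
   unfolding W_def by (intro set_integral_add(2) mlk_integrable0[OF a l m0] intF')
  also have "(LBINT r:{0..}. indicator {0..r0} r * Im (F (- of_real r))) = (LBINT r:{0..r0}. Im (F (- of_real r)))"
   unfolding set_lebesgue_integral_def e1 ..
  finally have Wint: "(LBINT r:{0..}. W r) = pi * mlk a l (real m) + (LBINT r:{0..r0}. Im (F (- of_real r)))"
   by (simp add: mlk_def)
  have eq: "pi * (mlk a l (real m) - fps_nth (mlk_fps a l) m) = (LBINT r:{0..}. W r) - Im (G (Complex (- r0) pi) - G (of_real (- r0)))"
   using right bottom bottom2 top Wint by (simp add: algebra_simps)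
  have Wle: "\<bar>W r\<bar> <= K1 * (exp (- r * real m) * r powr (2 - a))" if r: "0 <= r" for r
  proof -
   consider "r = 0" | "0 < r" "r <= r0" | "r0 < r" using r by linarith
   then show ?thesis
   proof cases
    case 1
    have "Im (F (0::complex)) = 0" using realF[of 0 1] by simp
    then show ?thesis using 1 by (simp add: W_def cutdens_def)
   next
    case 2
    define P where "P = exp r - 1"
    have P: "P > 0" using 2 by (simp add: P_def)
    \<comment> \<open>By this choice P^a = r^a v' (1 + a P / 2). Cancelling the last factor against
      \<open>C\<close> leaves the denominator dd v' + l, to be compared with dd + l.\<close>
    define v' where "v' = ((exp r - 1) / r) powr a / (1 + a * (exp r - 1) / 2)"
    define q' where "q' = exp r * (3 - exp r)\<^sup>2 / 4"
    define dd where "dd = of_real (r powr a) * cis (a * pi)"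
    have vv: "\<bar>v' - 1\<bar> <= K * r\<^sup>2" "1/2 <= v'" "\<bar>q' - 1\<bar> <= K * r\<^sup>2"
     using v[OF 2] v2[OF 2] q[OF 2] by (auto simp: v'_def q'_def)
    have e: "exp (- (- of_real r)) = complex_of_real (exp r)" by (simp add: exp_of_real)
    have pP: "p (- of_real r) = - of_real P" using e by (simp add: p_def P_def)
    have CP: "C (- of_real r) = of_real (1 + a * P / 2)" unfolding C_def pP by simp
    have aP: "1 + a * P / 2 > 0" using a P by (simp add: add_pos_pos)
    have "P powr a = r powr a * v' * (1 + a * P / 2)"
     using 2 P aP by (simp add: v'_def P_def[symmetric] powr_divide)
    then have "cutpow a (p (- of_real r)) = dd * of_real v' * of_real (1 + a * P / 2)"
     unfolding pP using P by (simp add: cutpow_neg dd_def mult_ac)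
    then have "cutpow a (p (- of_real r)) + of_real l * C (- of_real r) = (dd * of_real v' + of_real l) * of_real (1 + a * P / 2)"
     unfolding CP by (simp add: algebra_simps)
    moreover have "Q (- of_real r) = of_real q'" unfolding Q_def e q'_def by simp
    moreover have "complex_of_real (1 + a * P / 2) ~= 0" using aP by (simp only: of_real_eq_0_iff)
    ultimately have X: "X (- of_real r) = of_real q' / (dd * of_real v' + of_real l)"
     unfolding X_def by (simp only: CP nonzero_mult_divide_mult_cancel_right not_False_eq_True)
    have sb: "s * r powr a <= cmod (dd + of_real l)"
     using cmod_cutpow_add_ge[OF a, of l "- of_real r"] 2 l by (simp add: cutpow_neg dd_def s_def)
    have dv: "cmod (dd * of_real v' + of_real l) >= s * r powr a / 2"
    proof -
     have "s * r powr a / 2 <= r powr a * s * v'" using vv(2) s 2 mult_left_mono[OF vv(2), of "r powr a * s"] by simp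
     also have "... = Im (dd * of_real v' + of_real l)" by (simp add: dd_def s_def)
     also have "... <= cmod (dd * of_real v' + of_real l)" by (metis abs_Im_le_cmod abs_le_D1)
     finally show ?thesis .
    qed
    have sp: "0 < s * r powr a" using s 2 by simp
    have n1: "dd + of_real l ~= 0" "dd * of_real v' + of_real l ~= 0" using sb dv sp by auto
    have diff: "of_real q' / (dd * of_real v' + of_real l) - 1 / (dd + of_real l) =
     of_real (q' - 1) / (dd * of_real v' + of_real l) + dd * of_real (1 - v') / ((dd * of_real v' + of_real l) * (dd + of_real l))"
     using n1 by (simp add: divide_simps) (simp add: algebra_simps)
    have t1: "cmod (of_real (q' - 1) / (dd * of_real v' + of_real l)) <= K * r\<^sup>2 / (s * r powr a / 2)"
     unfolding norm_divide using vv(3) dv sp K by (intro frac_le) (auto simp del: of_real_diff)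
    have t2: "cmod (dd * of_real (1 - v') / ((dd * of_real v' + of_real l) * (dd + of_real l))) <= r powr a * (K * r\<^sup>2) / ((s * r powr a / 2) * (s * r powr a))"
     unfolding norm_divide norm_mult
    proof (intro frac_le mult_mono)
     show "cmod dd <= r powr a" by (simp add: dd_def norm_mult)
     show "cmod (complex_of_real (1 - v')) <= K * r\<^sup>2" using vv(1) by (simp add: abs_minus_commute del: of_real_diff)
    qed (use dv sb sp K 2 in \<open>auto simp del: of_real_diff\<close>)
    have p2: "r powr (2 - a) = r\<^sup>2 / r powr a" using 2 by (simp add: powr_diff)
    have "cmod (X (- of_real r) - 1 / (dd + of_real l)) <= K * r\<^sup>2 / (s * r powr a / 2) + r powr a * (K * r\<^sup>2) / ((s * r powr a / 2) * (s * r powr a))"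
     unfolding X diff by (rule order_trans[OF norm_triangle_ineq]) (use t1 t2 in linarith)
    also have "... = (2 * K / s + 2 * K / s\<^sup>2) * r powr (2 - a)"
     unfolding p2 using s sp 2 by (simp add: field_simps power2_eq_square)
    also have "... <= K1 * r powr (2 - a)" using s by (intro mult_right_mono) (auto simp: K1_def)
    finally have XX: "cmod (X (- of_real r) - 1 / (dd + of_real l)) <= K1 * r powr (2 - a)" .
    have cd: "cutdens a l r = - Im (1 / (dd + of_real l))"
     using Im_cutpow_neg_inverse[of r a l] 2 by (simp add: cutpow_neg dd_def)
    have "F (- of_real r) = of_real (exp (- r * real m)) * X (- of_real r)"
     by (simp add: F_def exp_of_real[symmetric] mult.commute)
    then have "W r = exp (- r * real m) * Im (X (- of_real r) - 1 / (dd + of_real l))"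
     unfolding W_def cd using 2 by (simp add: algebra_simps)
    then have "\<bar>W r\<bar> = exp (- r * real m) * \<bar>Im (X (- of_real r) - 1 / (dd + of_real l))\<bar>" by (simp add: abs_mult)
    also have "... <= exp (- r * real m) * (K1 * r powr (2 - a))"
     using abs_Im_le_cmod[of "X (- of_real r) - 1 / (dd + of_real l)"] XX by (intro mult_left_mono) (linarith, simp)
    finally show ?thesis by (simp add: mult_ac)
   next
    case 3
    have c: "0 <= cutdens a l r" "cutdens a l r <= r powr (-a) / s"
     using cutdens_nonneg[OF a l] cutdens_le[OF a l r] by (auto simp: s_def)
    have "1 = r0 powr (-2 + 2)" using r0 by simp
    also have "... = r0 powr (-2) * r0 powr 2" by (rule powr_add)
    also have "... <= r0 powr (-2) * r powr 2" using 3 r0 by (intro mult_left_mono powr_mono2) auto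
    finally have "r powr (-a) * 1 <= r powr (-a) * (r0 powr (-2) * r powr 2)" by (intro mult_left_mono) auto
    also have "... = r0 powr (-2) * r powr (2 - a)" by (simp add: powr_add[symmetric] mult_ac)
    finally have "r powr (-a) / s <= r0 powr (-2) * r powr (2 - a) / s" using s by (intro divide_right_mono) auto
    also have "... = r0 powr (-2) / s * r powr (2 - a)" by simp
    also have "... <= K1 * r powr (2 - a)" using s K by (intro mult_right_mono) (auto simp: K1_def)
    finally have "cutdens a l r <= K1 * r powr (2 - a)" using c by linarith
    then have "exp (- r * real m) * cutdens a l r <= exp (- r * real m) * (K1 * r powr (2 - a))" by (intro mult_left_mono) auto
    moreover have "\<bar>W r\<bar> = exp (- r * real m) * cutdens a l r" unfolding W_def using 3 c by (simp add: abs_mult)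
    ultimately show ?thesis by (simp add: mult_ac)
   qed
  qed
  have bndW: "\<bar>LBINT r:{0..}. W r\<bar> <= K1 * Gamma (3 - a) * real m powr (a - 3)"
  proof -
   note gi = exp_powr_integral[of "real m" "2 - a"]
   have gi1: "set_lint {0..} (%r. K1 * (exp (- r * real m) * r powr (2 - a)))"
    using gi(1) m0 a by (intro set_integrable_mult_right) auto
   have "\<bar>LBINT r:{0..}. W r\<bar> <= (LBINT r:{0..}. \<bar>W r\<bar>)"
    using set_integral_norm_bound[OF intW] by simp
   also have "... <= (LBINT r:{0..}. K1 * (exp (- r * real m) * r powr (2 - a)))"
    by (intro set_integral_mono set_integrable_abs intW gi1) (use Wle in auto)
   also have "... = K1 * (Gamma (2 - a + 1) * real m powr (- (2 - a) - 1))"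
    using gi(2) m0 a by simp
   also have "... = K1 * Gamma (3 - a) * real m powr (a - 3)" by (simp add: algebra_simps)
   finally show ?thesis .
  qed
  have "\<bar>pi * (mlk a l (real m) - fps_nth (mlk_fps a l) m)\<bar> <= K1 * Gamma (3 - a) * real m powr (a - 3) + exp (- r0 * real m) * KL * pi"
   using eq bndW left abs_Im_le_cmod[of "G (Complex (- r0) pi) - G (of_real (- r0))"] by linarith
  then have "pi * \<bar>mlk a l (real m) - fps_nth (mlk_fps a l) m\<bar> <= K1 * Gamma (3 - a) * real m powr (a - 3) + pi * KL * exp (- r0 * real m)"
   by (simp add: abs_mult mult_ac)
  also have "... <= K1 * Gamma (3 - a) * real m powr (a - 3) + pi * KL * (KM * real m powr (a - 3))"
   using KM(1)[OF m] KL by (intro add_left_mono mult_left_mono) auto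
  finally show "\<bar>mlk a l (real m) - fps_nth (mlk_fps a l) m\<bar> <= K2 * real m powr (a - 3)"
   by (simp add: K2_def field_simps)
 qed
qed

section \<open>The kernel error\<close>

definition pl_interp :: "(nat => real) => real => real" where
 "pl_interp c x = (let m = nat \<lfloor>x\<rfloor> in (1 - (x - real m)) * c m + (x - real m) * c (Suc m))"

definition kernel1 :: "real => real => real => real" where
 "kernel1 a l x = mlk a l x - pl_interp (fps_nth (mlk_fps a l)) x"

lemma pl_interp_cell:
 assumes "real m <= x" "x <= real m + 1"
 shows "pl_interp c x = (1 - (x - real m)) * c m + (x - real m) * c (Suc m)"
proof (cases "x = real m + 1")
 case True
 then have "nat \<lfloor>x\<rfloor> = Suc m" by (simp add: nat_add_distrib)
 then show ?thesis using True by (simp add: pl_interp_def)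
next
 case False
 then have "\<lfloor>x\<rfloor> = int m" using assms by (intro floor_unique) auto
 then show ?thesis by (simp add: pl_interp_def)
qed

lemma pl_interp_measurable [measurable]: "pl_interp c \<in> borel_measurable borel"
 unfolding pl_interp_def Let_def by measurable

lemma kernel1_measurable [measurable]: "kernel1 a l \<in> borel_measurable borel"
 unfolding kernel1_def by measurable

lemma abs_pl_interp_le:
 assumes "0 <= x" "!!m. \<bar>c m\<bar> <= B"
 shows "\<bar>pl_interp c x\<bar> <= B"
proof -
 define m where "m = nat \<lfloor>x\<rfloor>"
 define t where "t = x - real m"
 have t: "0 <= t" "t <= 1" using assms(1) by (auto simp: t_def m_def of_nat_nat) linarith+
 have "\<bar>pl_interp c x\<bar> = \<bar>(1 - t) * c m + t * c (Suc m)\<bar>" by (simp add: pl_interp_def Let_def m_def t_def)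
 also have "... <= (1 - t) * \<bar>c m\<bar> + t * \<bar>c (Suc m)\<bar>" using t abs_triangle_ineq[of "(1-t) * c m" "t * c (Suc m)"] by (simp add: abs_mult)
 also have "... <= (1 - t) * B + t * B" using t assms(2) by (intro add_mono mult_left_mono) auto
 finally show ?thesis by (simp add: algebra_simps)
qed

lemma exp_neg_taylor:
 fixes y :: real assumes "0 <= y"
 shows "1 - y <= exp (- y)" "exp (- y) <= 1 - y + y\<^sup>2 / 2"
proof -
 show "1 - y <= exp (- y)" using exp_ge_add_one_self[of "-y"] by simp
 have "(%y. 1 - y + y\<^sup>2 / 2 - exp (- y)) 0 <= (%y::real. 1 - y + y\<^sup>2 / 2 - exp (- y)) y"
 proof (rule DERIV_nonneg_imp_nondecreasing[OF assms])
  fix x :: real assume "0 <= x"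
  have "((%y. 1 - y + y\<^sup>2 / 2 - exp (- y)) has_real_derivative (-1 + x + exp (- x))) (at x)"
   by (auto intro!: derivative_eq_intros)
  moreover have "0 <= -1 + x + exp (- x)" using exp_ge_add_one_self[of "-x"] by simp
  ultimately show "\<exists>z. ((%y. 1 - y + y\<^sup>2 / 2 - exp (- y)) has_real_derivative z) (at x) \<and> 0 <= z" by blast
 qed
 then show "exp (- y) <= 1 - y + y\<^sup>2 / 2" by simp
qed

text \<open>Both e^(-r t) and its linear interpolant equal 1 - r t up to terms between 0 and r^2 /
  2.\<close>

lemma exp_interp_error:
 fixes r t :: real assumes "0 <= r" "0 <= t" "t <= 1"
 shows "\<bar>exp (- r * t) - ((1 - t) + t * exp (- r))\<bar> <= r\<^sup>2"
proof -
 have e1: "1 - r * t <= exp (- (r * t))" "exp (- (r * t)) <= 1 - r * t + (r * t)\<^sup>2 / 2"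
  using exp_neg_taylor[of "r * t"] assms by auto
 have "t * (1 - r) <= t * exp (- r)" "t * exp (- r) <= t * (1 - r + r\<^sup>2 / 2)"
  using exp_neg_taylor[of r] assms by (auto intro: mult_left_mono)
 moreover have "t * (r\<^sup>2 / 2) <= 1 * (r\<^sup>2/2)" using assms by (intro mult_right_mono) auto
 moreover have "(r * t)\<^sup>2 <= r\<^sup>2 * 1" unfolding power_mult_distrib using assms by (intro mult_left_mono power_le_one) auto
 ultimately show ?thesis using e1 zero_le_power2[of r] by (simp add: abs_le_iff algebra_simps)
qed

text \<open>The interpolation error of x -> e^(-r x) on [m, m + 1] is at most r^2 e^(-r m);
  integrated against the density this is the second moment of \<open>cutdens\<close>.\<close>

lemma mlk_interp_error:
 assumes a: "0 < a" "a < 1" and l: "0 < l" and m: "0 < m" and t: "0 <= t" "t <= 1"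
 shows "\<bar>mlk a l (m + t) - ((1 - t) * mlk a l m + t * mlk a l (m + 1))\<bar> <= Gamma (3 - a) / sin (a * pi) * m powr (a - 3)"
proof -
 define I where "I x = (LBINT r:{0..}. exp (- r * x) * cutdens a l r)" for x
 have si: "set_lint {0..} (%r. exp (- r * x) * cutdens a l r)" if "0 < x" for x
  using mlk_integrable0[OF a l that] .
 have pos: "0 < m + t" "0 < m + 1" using m t by auto
 define D where "D r = exp (- r * (m + t)) * cutdens a l r - ((1 - t) * (exp (- r * m) * cutdens a l r) + t * (exp (- r * (m + 1)) * cutdens a l r))" for r
 have intD: "set_lint {0..} D" unfolding D_def
  by (intro set_integral_diff(1) set_integral_add(1) set_integrable_mult_right si pos m)
 have "(LBINT r:{0..}. D r) = I (m + t) - ((1 - t) * I m + t * I (m + 1))"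
  unfolding D_def I_def
  by (subst set_integral_diff(2); (subst set_integral_add(2))?; (intro set_integral_diff(1) set_integral_add(1) set_integrable_mult_right si pos m)?) simp
 then have e: "pi * (mlk a l (m + t) - ((1 - t) * mlk a l m + t * mlk a l (m + 1))) = (LBINT r:{0..}. D r)"
 proof -
  assume e: "(LBINT r:{0..}. D r) = I (m + t) - ((1 - t) * I m + t * I (m + 1))"
  have mI: "mlk a l y = I y / pi" for y by (simp add: mlk_def I_def)
  show ?thesis unfolding e mI by (simp add: field_simps)
 qed
 have "\<bar>D r\<bar> <= exp (- r * m) * r powr 2 * cutdens a l r" if r: "0 <= r" for r
 proof -
  have "D r = exp (- r * m) * cutdens a l r * (exp (- r * t) - ((1 - t) + t * exp (- r)))"
   by (simp add: D_def exp_add[symmetric] algebra_simps)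
  then have "\<bar>D r\<bar> = exp (- r * m) * cutdens a l r * \<bar>exp (- r * t) - ((1 - t) + t * exp (- r))\<bar>"
   using cutdens_nonneg[OF a l, of r] by (simp add: abs_mult)
  also have "... <= exp (- r * m) * cutdens a l r * r\<^sup>2"
   using cutdens_nonneg[OF a l, of r] exp_interp_error[OF r t] by (intro mult_left_mono mult_nonneg_nonneg) auto
  finally show ?thesis using r by (simp add: mult_ac)
 qed
 then have "(LBINT r:{0..}. \<bar>D r\<bar>) <= (LBINT r:{0..}. exp (- r * m) * r powr 2 * cutdens a l r)"
  by (intro set_integral_mono set_integrable_abs intD mlk_integrable[OF a l m]) auto
 also have "... <= Gamma (3 - a) / sin (a * pi) * m powr (a - 3)"
  using cutdens_moment_le[OF a l m, of 2] by (simp add: algebra_simps)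
 finally have "\<bar>LBINT r:{0..}. D r\<bar> <= Gamma (3 - a) / sin (a * pi) * m powr (a - 3)"
  using set_integral_norm_bound[OF intD] by simp
 then have "pi * \<bar>mlk a l (m + t) - ((1 - t) * mlk a l m + t * mlk a l (m + 1))\<bar> <= Gamma (3 - a) / sin (a * pi) * m powr (a - 3)"
  (is "_ <= ?R") unfolding e[symmetric] by (simp add: abs_mult)
 moreover have "1 * \<bar>mlk a l (m + t) - ((1 - t) * mlk a l m + t * mlk a l (m + 1))\<bar> <= pi * \<bar>mlk a l (m + t) - ((1 - t) * mlk a l m + t * mlk a l (m + 1))\<bar>"
  using pi_ge_two by (intro mult_right_mono) auto
 ultimately show ?thesis unfolding mult_1 by (rule order_trans[rotated])
qed

lemma mlk_fps_nth_0 [simp]: "fps_nth (mlk_fps a l) 0 = 0"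
 by (simp add: mlk_fps_def fps_mult_nth_0)

text \<open>Below x = 1 the interpolant is bounded and \<open>mlk\<close> contributes x^(a-1); from
  1 on, grid error and interpolation error both give x^(a-3). Since x^(a-1) <= x^(a-3) on (0, 1] and
  conversely on [1, infinity), each bound extends to all x > 0.\<close>

lemma kernel1_bounds:
 assumes a: "0 < a" "a < 1"
 obtains C where "0 < C" "!!l x. 0 < l ==> 0 < x ==> \<bar>kernel1 a l x\<bar> <= C * x powr (a - 1)"
  "!!l x. 0 < l ==> 0 < x ==> \<bar>kernel1 a l x\<bar> <= C * x powr (a - 3)"
  "!!l m. 0 < l ==> \<bar>fps_nth (mlk_fps a l) m\<bar> <= C"
proof -
 obtain K where K: "0 < K" "!!l m. 0 < l ==> 1 <= m ==> \<bar>mlk a l (real m) - fps_nth (mlk_fps a l) m\<bar> <= K * real m powr (a - 3)"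
  using mlk_grid_error[OF a] by metis
 have s: "0 < sin (a * pi)" by (rule sin_pi_pos[OF a])
 define G1 where "G1 = Gamma (1 - a) / sin (a * pi)"
 define G3 where "G3 = Gamma (3 - a) / sin (a * pi)"
 have G: "0 < G1" "0 < G3" unfolding G1_def G3_def using a s by (auto intro!: divide_pos_pos Gamma_real_pos)
 have grid: "\<bar>fps_nth (mlk_fps a l) m\<bar> <= G1 + K" if l: "0 < l" for l m
 proof (cases "m = 0")
  case True then show ?thesis using G K by simp
 next
  case False
  then have m: "1 <= m" by simp
  have "real m powr (a - 1) <= real m powr 0" "real m powr (a - 3) <= real m powr 0" using m a by (intro powr_mono; simp)+
  then have p: "real m powr (a - 1) <= 1" "real m powr (a - 3) <= 1" using m by auto
  have "0 <= mlk a l (real m)" "mlk a l (real m) <= G1 * real m powr (a - 1)"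
   using mlk_nonneg[OF a l] mlk_le[OF a l, of "real m"] m by (auto simp: G1_def)
  moreover have "G1 * real m powr (a - 1) <= G1 * 1" "K * real m powr (a - 3) <= K * 1" using p G K by (intro mult_left_mono; simp)+
  ultimately show ?thesis using K(2)[OF l m] by linarith
 qed
 \<comment> \<open>The factor 2^(3-a) pays for bounding the floor of x from below by x / 2.\<close>
 define C where "C = max (G1 + (G1 + K)) (2 powr (3 - a) * (G3 + K))"
 have C: "C > 0" using G K by (auto simp: C_def)
 have small: "\<bar>kernel1 a l x\<bar> <= C * x powr (a - 1)" if l: "0 < l" and x: "0 < x" "x < 1" for l x
 proof -
  have "\<bar>pl_interp (fps_nth (mlk_fps a l)) x\<bar> <= G1 + K" using grid[OF l] x by (intro abs_pl_interp_le) auto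
  moreover have "\<bar>mlk a l x\<bar> <= G1 * x powr (a - 1)" using mlk_nonneg[OF a l] mlk_le[OF a l x(1)] by (simp add: G1_def)
  moreover have "(G1 + K) * 1 <= (G1 + K) * x powr (a - 1)"
   using powr_mono'[of "a - 1" 0 x] x a G K by (intro mult_left_mono) auto
  moreover have "(G1 + (G1 + K)) * x powr (a - 1) <= C * x powr (a - 1)" by (intro mult_right_mono) (auto simp: C_def)
  ultimately show ?thesis unfolding kernel1_def by (simp add: algebra_simps)
 qed
 have large: "\<bar>kernel1 a l x\<bar> <= C * x powr (a - 3)" if l: "0 < l" and x: "1 <= x" for l x
 proof -
  define m where "m = nat \<lfloor>x\<rfloor>"
  define t where "t = x - real m"
  have mx: "real m = of_int \<lfloor>x\<rfloor>" using x by (simp add: m_def)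
  have t: "0 <= t" "t <= 1" unfolding t_def mx by linarith+
  have m1: "1 <= m" unfolding m_def using x by linarith
  have m: "0 < real m" using m1 by simp
  have xe: "x = real m + t" by (simp add: t_def)
  have pl: "pl_interp (fps_nth (mlk_fps a l)) x = (1 - t) * fps_nth (mlk_fps a l) m + t * fps_nth (mlk_fps a l) (Suc m)"
   by (simp add: pl_interp_def Let_def m_def t_def)
  define e0 where "e0 = mlk a l (real m) - fps_nth (mlk_fps a l) m"
  define e1 where "e1 = mlk a l (real m + 1) - fps_nth (mlk_fps a l) (Suc m)"
  have e: "\<bar>e0\<bar> <= K * real m powr (a - 3)" "\<bar>e1\<bar> <= K * real m powr (a - 3)"
  proof -
   show "\<bar>e0\<bar> <= K * real m powr (a - 3)" unfolding e0_def using K(2)[OF l m1] .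
   have "\<bar>e1\<bar> <= K * real (Suc m) powr (a - 3)" unfolding e1_def using K(2)[OF l, of "Suc m"] by (simp add: add.commute)
   also have "... <= K * real m powr (a - 3)" using K m a by (intro mult_left_mono powr_mono2') auto
   finally show "\<bar>e1\<bar> <= K * real m powr (a - 3)" .
  qed
  have "\<bar>(1 - t) * e0 + t * e1\<bar> <= (1 - t) * \<bar>e0\<bar> + t * \<bar>e1\<bar>" using t abs_triangle_ineq[of "(1-t) * e0" "t * e1"] by (simp add: abs_mult)
  also have "... <= (1 - t) * (K * real m powr (a - 3)) + t * (K * real m powr (a - 3))" using t e by (intro add_mono mult_left_mono) auto
  finally have "\<bar>(1 - t) * e0 + t * e1\<bar> <= K * real m powr (a - 3)" by (simp add: algebra_simps)
  moreover have "kernel1 a l x = (mlk a l (real m + t) - ((1 - t) * mlk a l (real m) + t * mlk a l (real m + 1))) + ((1 - t) * e0 + t * e1)"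
   unfolding kernel1_def pl by (simp add: xe e0_def e1_def algebra_simps)
  ultimately have "\<bar>kernel1 a l x\<bar> <= (G3 + K) * real m powr (a - 3)"
   using mlk_interp_error[OF a l m t] unfolding G3_def[symmetric] by (simp add: algebra_simps)
  also have "real m powr (a - 3) <= (x / 2) powr (a - 3)" using xe t m m1 a by (intro powr_mono2') auto
  also have "(x / 2) powr (a - 3) = 2 powr (3 - a) * x powr (a - 3)" using x by (simp add: powr_divide powr_diff field_simps)
  finally have "\<bar>kernel1 a l x\<bar> <= (2 powr (3 - a) * (G3 + K)) * x powr (a - 3)" using G K by (simp add: mult_ac)
  also have "... <= C * x powr (a - 3)" by (intro mult_right_mono) (auto simp: C_def)
  finally show ?thesis .
 qed
 show ?thesis
 proof (rule that[OF C])
  fix l x :: real assume l: "0 < l" and x: "0 < x"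
  show "\<bar>kernel1 a l x\<bar> <= C * x powr (a - 1)"
  proof (cases "x < 1")
   case False
   then have "C * x powr (a - 3) <= C * x powr (a - 1)" using C by (intro mult_left_mono powr_mono) auto
   then show ?thesis using large[OF l, of x] False by linarith
  qed (use small l x in auto)
  show "\<bar>kernel1 a l x\<bar> <= C * x powr (a - 3)"
  proof (cases "x < 1")
   case True
   then have "C * x powr (a - 1) <= C * x powr (a - 3)" using C x by (intro mult_left_mono powr_mono') auto
   then show ?thesis using small[OF l x True] by linarith
  qed (use large l x in auto)
 next
  fix l :: real and m assume "0 < l"
  then show "\<bar>fps_nth (mlk_fps a l) m\<bar> <= C" using grid[of l m] G by (auto simp: C_def)
 qed
qed

section \<open>Scaling, and integrable majorants for the kernel error\<close>

lemma cutdens_scale: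
 assumes "0 < \<tau>" "0 <= u"
 shows "cutdens a l (u / \<tau>) = \<tau> powr a * cutdens a (l * \<tau> powr a) u"
proof -
 have "of_real ((u / \<tau>) powr a) * cis (a * pi) + of_real l = (of_real (u powr a) * cis (a * pi) + of_real (l * \<tau> powr a)) / of_real (\<tau> powr a)"
  using assms by (simp add: powr_divide field_simps)
 then have "(cmod (of_real ((u / \<tau>) powr a) * cis (a * pi) + of_real l))\<^sup>2 = (cmod (of_real (u powr a) * cis (a * pi) + of_real (l * \<tau> powr a)))\<^sup>2 / (\<tau> powr a)\<^sup>2"
  using assms by (simp only: norm_divide power_divide) simp
 then show ?thesis unfolding cutdens_def using assms
  by (simp add: powr_divide power2_eq_square)
qed

text \<open>Substitution r = u / \<tau>. This self-similarity reduces every step size to step 1 at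
  the price of the eigenvalue l \<tau>^a, so that uniformity in \<open>l\<close> becomes uniformity
  in \<tau>.\<close>

lemma mlk_scale:
 assumes "0 < \<tau>"
 shows "mlk a l x = \<tau> powr (a - 1) * mlk a (l * \<tau> powr a) (x / \<tau>)"
proof -
 have "(LBINT r:{0..}. exp (- r * x) * cutdens a l r) = \<bar>1/\<tau>\<bar> *\<^sub>R (LBINT u. indicator {0..} (0 + 1/\<tau> * u) *\<^sub>R (exp (- (0 + 1/\<tau> * u) * x) * cutdens a l (0 + 1/\<tau> * u)))"
  unfolding set_lebesgue_integral_def using assms by (intro lborel_integral_real_affine) auto
 also have "(LBINT u. indicator {0..} (0 + 1/\<tau> * u) *\<^sub>R (exp (- (0 + 1/\<tau> * u) * x) * cutdens a l (0 + 1/\<tau> * u)))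
   = (LBINT u. \<tau> powr a * (indicator {0..} u *\<^sub>R (exp (- u * (x / \<tau>)) * cutdens a (l * \<tau> powr a) u)))"
  using assms by (intro Bochner_Integration.integral_cong refl) (auto simp: indicator_def cutdens_scale zero_le_divide_iff)
 also have "... = \<tau> powr a * (LBINT u:{0..}. exp (- u * (x / \<tau>)) * cutdens a (l * \<tau> powr a) u)"
  by (simp add: set_lebesgue_integral_def)
 finally show ?thesis unfolding mlk_def using assms by (simp add: powr_diff field_simps)
qed

lemma set_integrable_powr_0_1:
 assumes "-1 < (s::real)"
 shows "set_lint {0<..1} (%x. x powr s)"
proof -
 have "set_lint {0..1} (%x. x powr s)"
  using assms by (intro set_integrable_lborelI_nonneg(1)[OF has_integral_powr_from_0]) auto
 then show ?thesis by (rule set_integrable_subset) auto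
qed

lemma set_integrable_powr_1_inf:
 assumes "(s::real) < -1"
 shows "set_lint {1..} (%x. x powr s)"
 using assms by (intro set_integrable_lborelI_nonneg(1)[OF has_integral_powr_to_inf]) auto

text \<open>The smaller of the two powers. It is integrable at 0 because a > 0 and has a finite
  first moment at infinity because a < 1.\<close>

definition kernel_bound :: "real => real => real" where
 "kernel_bound a x = (if x <= 1 then x powr (a - 1) else x powr (a - 3))"

lemma kernel_bound_integrable:
 assumes a: "0 < a" "a < 1"
 shows "set_lint {0<..} (kernel_bound a)" "set_lint {0<..} (%x. x * kernel_bound a x)"
proof -
 have split: "set_lint {0<..} f" if "set_lint {0<..1} f" "set_lint {1<..} f" for f :: "real => real"
 proof -
  have u: "{0<..} = {0<..1} \<union> {1::real<..}" by auto
  show ?thesis unfolding u by (intro set_integrable_Un that) auto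
 qed
 have c: "set_lint S f" if "set_lint S g" "!!x. x \<in> S ==> f x = g x" for S and f g :: "real => real"
  using that(1) by (subst set_integrable_cong[OF refl refl that(2)])
 show "set_lint {0<..} (kernel_bound a)"
 proof (rule split)
  show "set_lint {0<..1} (kernel_bound a)"
   by (rule c[OF set_integrable_powr_0_1[of "a - 1"]]) (use a in \<open>auto simp: kernel_bound_def\<close>)
  have "set_lint {1<..} (%x. x powr (a - 3))"
   by (rule set_integrable_subset[OF set_integrable_powr_1_inf]) (use a in auto)
  then show "set_lint {1<..} (kernel_bound a)"
   by (rule c) (auto simp: kernel_bound_def)
 qed
 show "set_lint {0<..} (%x. x * kernel_bound a x)"
 proof (rule split)
  have p: "x * x powr s = x powr (s + 1)" if "0 < x" for x s :: real using that by (simp add: powr_add)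
  show "set_lint {0<..1} (%x. x * kernel_bound a x)"
   by (rule c[OF set_integrable_powr_0_1[of a]]) (use a p in \<open>auto simp: kernel_bound_def\<close>)
  have "set_lint {1<..} (%x. x powr (a - 2))"
   by (rule set_integrable_subset[OF set_integrable_powr_1_inf]) (use a in auto)
  then show "set_lint {1<..} (%x. x * kernel_bound a x)"
   by (rule c) (auto simp: kernel_bound_def p)
 qed
qed

text \<open>The interpolant is a sum of multiples c_m of the hat function centred at m, whose
  transform is e^(-m z) (e^z - 2 + e^(-z)) / z^2. The condition \<open>c 0 = 0\<close> removes the
  half hat at the origin.\<close>

lemma pl_interp_laplace:
 assumes z: "0 < z" and c: "!!m. \<bar>c m\<bar> <= B" "c 0 = 0" and s: "(%m. c m * exp (- z) ^ m) sums S"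
 shows "set_lint {0..} (%x. exp (- z * x) * pl_interp c x)"
  and "(LBINT x:{0..}. exp (- z * x) * pl_interp c x) = (exp z - 2 + exp (- z)) / z\<^sup>2 * S"
proof -
 let ?f = "%x. exp (- z * x) * pl_interp c x"
 have ei: "set_lint {0..} (%x. B * exp (- z * x))"
 proof -
  have "set_lint {0..} (%x. exp (- x * z) * x powr 0)" using exp_powr_integral(1)[OF z, of 0] by simp
  then have "set_lint {0<..} (%x. exp (- x * z) * x powr 0)" by (rule set_integrable_subset) auto
  then have 1: "set_lint {0<..} (%x. exp (- z * x))"
   by (subst (asm) set_integrable_cong[OF refl refl, of _ _ "%x. exp (- z * x)"]) (auto simp: mult.commute)
  have "{0::real..} = {0<..} \<union> {0}" by auto
  then have "set_lint {0..} (%x. exp (- z * x))"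
   using set_integrable_Un[OF 1 set_borel_integrable_singleton[of 0]] by simp
  then show ?thesis by (intro set_integrable_mult_right) auto
 qed
 show int: "set_lint {0..} ?f"
  using ei unfolding set_integrable_def
 proof (rule Bochner_Integration.integrable_bound)
  have "\<bar>?f x\<bar> <= \<bar>B * exp (- z * x)\<bar>" if "0 <= x" for x
   using abs_pl_interp_le[where B = B and c = c, OF that c(1)] by (intro order_trans[OF _ abs_ge_self]) (simp add: abs_mult mult.commute mult_left_mono)
  then show "AE x in lborel. norm (indicator {0..} x *\<^sub>R ?f x) <= norm (indicator {0..} x *\<^sub>R (B * exp (- z * x)))"
   by (auto simp: indicator_def)
 qed measurable
 \<comment> \<open>Contributions of the left and the right node of a cell: \<open>P\<close> and
   \<open>R\<close> are the integrals over [0, 1] of e^(-z x) (1 - x) and of e^(-z x) x.\<close>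
 define P where "P = (1 - exp (- z)) / z - (1 - exp (- z) * (1 + z)) / z\<^sup>2"
 define R where "R = (1 - exp (- z) * (1 + z)) / z\<^sup>2"
 have cell: "(?f has_integral exp (- z) ^ m * (c m * P + c (Suc m) * R)) {real m..real m + 1}" for m
 proof -
  let ?g = "%x. exp (- z * x) * ((1 - (x - real m)) * c m + (x - real m) * c (Suc m))"
  let ?G = "%x. exp (- z * x) * (- c m / z - (x - real m) * (c (Suc m) - c m) / z - (c (Suc m) - c m) / z\<^sup>2)"
  have "(?g has_integral ?G (real m + 1) - ?G (real m)) {real m..real m + 1}"
  proof (rule fundamental_theorem_of_calculus)
   fix x
   have "(?G has_real_derivative ?g x) (at x)"
    using z by (auto intro!: derivative_eq_intros simp: field_simps power2_eq_square)
   then show "(?G has_vector_derivative ?g x) (at x within {real m..real m + 1})"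
    by (simp add: has_real_derivative_iff_has_vector_derivative has_vector_derivative_at_within)
  qed simp
  moreover have "?G (real m + 1) - ?G (real m) = exp (- z) ^ m * (c m * P + c (Suc m) * R)"
  proof -
   have "exp (- z * real m) = exp (- z) ^ m" by (simp add: exp_of_nat_mult[symmetric] mult.commute)
   moreover have "exp (- z * (real m + 1)) = exp (- z) ^ m * exp (- z)"
    by (simp add: exp_of_nat_mult[symmetric] exp_add[symmetric] algebra_simps)
   ultimately show ?thesis using z unfolding P_def R_def by (simp add: divide_simps power2_eq_square) (simp add: algebra_simps)
  qed
  ultimately have "(?g has_integral exp (- z) ^ m * (c m * P + c (Suc m) * R)) {real m..real m + 1}" by simp
  then show ?thesis by (rule has_integral_eq[rotated]) (use pl_interp_cell[of m _ c] in auto)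
 qed
 have part: "(?f has_integral (\<Sum>m<n. exp (- z) ^ m * (c m * P + c (Suc m) * R))) {0..real n}" for n
 proof (induction n)
  case 0 then show ?case by (simp add: has_integral_refl)
 next
  case (Suc n)
  have "(?f has_integral (\<Sum>m<n. exp (- z) ^ m * (c m * P + c (Suc m) * R)) + exp (- z) ^ n * (c n * P + c (Suc n) * R)) {0..real n + 1}"
   by (rule has_integral_combine[OF _ _ Suc cell]) auto
  then show ?case by (simp add: add.commute)
 qed
 have s2: "(%m. exp (- z) ^ m * (c m * P + c (Suc m) * R)) sums (P * S + R * exp z * S)"
 proof -
  have "(%m. c (Suc m) * exp (- z) ^ Suc m) sums S" using s c(2) by (subst sums_Suc_iff) simp
  then have "(%m. P * (c m * exp (- z) ^ m) + R * exp z * (c (Suc m) * exp (- z) ^ Suc m)) sums (P * S + R * exp z * S)"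
   by (intro sums_add sums_mult s)
  moreover have "P * (c m * exp (- z) ^ m) + R * exp z * (c (Suc m) * exp (- z) ^ Suc m) = exp (- z) ^ m * (c m * P + c (Suc m) * R)" for m
  proof -
   have "exp z * exp (- z) = 1" by (simp add: exp_minus)
   then have "R * exp z * (c (Suc m) * exp (- z) ^ Suc m) = R * (c (Suc m) * exp (- z) ^ m)"
    by (metis (no_types, lifting) mult.assoc mult.left_commute mult.right_neutral power_Suc)
   then show ?thesis by (simp add: algebra_simps)
  qed
  ultimately show ?thesis by simp
 qed
 have lim1: "(%n. LBINT x:{0..real n}. ?f x) \<longlonglongrightarrow> (LBINT x:{0..}. ?f x)"
  using filterlim_compose[OF tendsto_set_lebesgue_integral_at_top[OF _ int] filterlim_real_sequentially] by simp
 have "(LBINT x:{0..real n}. ?f x) = (\<Sum>m<n. exp (- z) ^ m * (c m * P + c (Suc m) * R))" for n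
 proof -
  have "set_lint {0..real n} ?f" by (rule set_integrable_subset[OF int]) auto
  then show ?thesis using set_borel_integral_eq_integral(2) integral_unique[OF part[of n]] by metis
 qed
 then have "(LBINT x:{0..}. ?f x) = P * S + R * exp z * S"
  using lim1 s2 LIMSEQ_unique unfolding sums_def by auto
 also have "... = (exp z - 2 + exp (- z)) / z\<^sup>2 * S"
  using z unfolding P_def R_def by (simp add: exp_minus divide_simps power2_eq_square) (simp add: algebra_simps)
 finally show "(LBINT x:{0..}. ?f x) = (exp z - 2 + exp (- z)) / z\<^sup>2 * S" .
qed

lemma set_integral_Ici_eq_Ioi:
 fixes f :: "real => 'a::{banach, second_countable_topology}"
 assumes "f \<in> borel_measurable borel"
 shows "(LBINT x:{c..}. f x) = (LBINT x:{c<..}. f x)"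
 unfolding set_lebesgue_integral_def using assms AE_lborel_singleton[of c]
 by (intro integral_cong_AE) (auto simp: indicator_def)

section \<open>Laplace transform and moments of the kernel error\<close>

context
 fixes a :: real
 assumes a: "0 < a" "a < 1"
begin

definition mlk_gf_real :: "real => real => real" where
 "mlk_gf_real l w = 1/4 * w * (3 - w)^2 * (1 - a/2 + a/2 * w) / ((1 - w) powr a + l * (1 - a/2 + a/2 * w))"

lemma mlk_gf_real_sums:
 assumes l: "0 < l" and w: "0 <= w" "w < 1"
 shows "(%m. fps_nth (mlk_fps a l) m * w ^ m) sums mlk_gf_real l w"
proof -
 have "(1 - complex_of_real w) powr of_real a = of_real ((1 - w) powr a)"
  using powr_of_real[of "1 - w" a] w by simp
 then have "mlk_gf a l (of_real w) = of_real (mlk_gf_real l w)"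
  by (simp add: mlk_gf_def mlk_gf_real_def)
 then have "(%m. complex_of_real (fps_nth (mlk_fps a l) m * w ^ m)) sums of_real (mlk_gf_real l w)"
  using mlk_gf_sums[OF a l, of "of_real w"] w by simp
 then show ?thesis by (simp only: sums_of_real_iff)
qed

lemma kernel1_bound:
 obtains C where "0 < C" "!!l x. 0 < l ==> 0 < x ==> \<bar>kernel1 a l x\<bar> <= C * kernel_bound a x"
  "!!l x. 0 < l ==> 0 < x ==> \<bar>kernel1 a l x\<bar> <= C * x powr (a - 1)"
  "!!l x. 0 < l ==> 0 < x ==> \<bar>kernel1 a l x\<bar> <= C * x powr (a - 3)"
 using kernel1_bounds[OF a] unfolding kernel_bound_def by (smt (verit, best))

lemma kernel1_integrable:
 assumes l: "0 < l" and g: "g \<in> borel_measurable borel" "!!x. 0 < x ==> \<bar>g x\<bar> <= B"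
 shows "set_lint {0<..} (%x. g x * kernel1 a l x)" "set_lint {0<..} (%x. g x * (x * kernel1 a l x))"
proof -
 obtain C where C: "0 < C" "!!l x. 0 < l ==> 0 < x ==> \<bar>kernel1 a l x\<bar> <= C * kernel_bound a x"
  using kernel1_bound by metis
 have kb: "0 <= kernel_bound a x" for x by (simp add: kernel_bound_def)
 have B: "0 <= B" using g(2)[of 1] by simp
 note [measurable] = g(1)
 have b: "\<bar>g x * kernel1 a l x\<bar> <= \<bar>B * C * kernel_bound a x\<bar>" "\<bar>g x * (x * kernel1 a l x)\<bar> <= \<bar>B * C * (x * kernel_bound a x)\<bar>" if "0 < x" for x
 proof -
  have 1: "\<bar>g x\<bar> * \<bar>kernel1 a l x\<bar> <= B * (C * kernel_bound a x)"
   using g(2)[OF that] C(2)[OF l that] B by (intro mult_mono) auto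
  then show "\<bar>g x * kernel1 a l x\<bar> <= \<bar>B * C * kernel_bound a x\<bar>" using B C kb[of x] by (simp add: abs_mult mult_ac)
  show "\<bar>g x * (x * kernel1 a l x)\<bar> <= \<bar>B * C * (x * kernel_bound a x)\<bar>"
   using mult_left_mono[OF 1, of x] B C kb[of x] that by (simp add: abs_mult mult_ac)
 qed
 show "set_lint {0<..} (%x. g x * kernel1 a l x)"
  using set_integrable_mult_right[OF kernel_bound_integrable(1)[OF a], of "B * C"] unfolding set_integrable_def
  by (rule Bochner_Integration.integrable_bound) (use b(1) in \<open>auto simp: indicator_def\<close>)
 show "set_lint {0<..} (%x. g x * (x * kernel1 a l x))"
  using set_integrable_mult_right[OF kernel_bound_integrable(2)[OF a], of "B * C"] unfolding set_integrable_def
  by (rule Bochner_Integration.integrable_bound) (use b(2) in \<open>auto simp: indicator_def\<close>)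
qed

lemma mlk_laplace_integrable:
 assumes l: "0 < l" and z: "0 < z"
 shows "set_lint {0<..} (%x. exp (- z * x) * mlk a l x)"
proof -
 have s: "0 < sin (a * pi)" by (rule sin_pi_pos[OF a])
 define G1 where "G1 = Gamma (1 - a) / sin (a * pi)"
 have "set_lint {0<..} (%x. exp (- x * z) * x powr (a - 1))"
  by (rule set_integrable_subset[OF exp_powr_integral(1)]) (use z a in auto)
 then have "set_lint {0<..} (%x. G1 * (exp (- x * z) * x powr (a - 1)))"
  by (intro set_integrable_mult_right)
 then show ?thesis unfolding set_integrable_def
 proof (rule Bochner_Integration.integrable_bound)
  have "\<bar>exp (- z * x) * mlk a l x\<bar> <= \<bar>G1 * (exp (- x * z) * x powr (a - 1))\<bar>" if "0 < x" for x
  proof -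
   have 1: "exp (- z * x) * mlk a l x <= exp (- z * x) * (G1 * x powr (a - 1))"
    using mlk_le[OF a l that] by (intro mult_left_mono) (auto simp: G1_def)
   have 2: "0 <= exp (- z * x) * mlk a l x" using mlk_nonneg[OF a l, of x] by simp
   have 3: "exp (- z * x) * (G1 * x powr (a - 1)) = G1 * (exp (- x * z) * x powr (a - 1))" by (simp add: mult_ac)
   show ?thesis unfolding abs_of_nonneg[OF 2] using 1 3 abs_ge_self[of "G1 * (exp (- x * z) * x powr (a - 1))"] by linarith
  qed
  then show "AE x in lborel. norm (indicator {0<..} x *\<^sub>R (exp (- z * x) * mlk a l x)) <= norm (indicator {0<..} x *\<^sub>R (G1 * (exp (- x * z) * x powr (a - 1))))"
   by (auto simp: indicator_def)
 qed measurable
qed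

lemma kernel1_laplace:
 assumes l: "0 < l" and z: "0 < z"
 shows "(LBINT x:{0<..}. exp (- z * x) * kernel1 a l x) =
  (LBINT x:{0<..}. exp (- z * x) * mlk a l x) - (exp z - 2 + exp (- z)) / z\<^sup>2 * mlk_gf_real l (exp (- z))"
proof -
 obtain B where B: "!!m. \<bar>fps_nth (mlk_fps a l) m\<bar> <= B" using kernel1_bounds[OF a] l by metis
 have "(%m. fps_nth (mlk_fps a l) m * exp (- z) ^ m) sums mlk_gf_real l (exp (- z))"
  using z by (intro mlk_gf_real_sums l) auto
 note L = pl_interp_laplace[OF z B mlk_fps_nth_0 this]
 have i: "set_lint {0<..} (%x. exp (- z * x) * pl_interp (fps_nth (mlk_fps a l)) x)"
  by (rule set_integrable_subset[OF L(1)]) auto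
 have "(LBINT x:{0<..}. exp (- z * x) * kernel1 a l x) = (LBINT x:{0<..}. exp (- z * x) * mlk a l x - exp (- z * x) * pl_interp (fps_nth (mlk_fps a l)) x)"
  by (simp add: kernel1_def right_diff_distrib)
 also have "... = (LBINT x:{0<..}. exp (- z * x) * mlk a l x) - (LBINT x:{0<..}. exp (- z * x) * pl_interp (fps_nth (mlk_fps a l)) x)"
  by (intro set_integral_diff(2) mlk_laplace_integrable[OF l z] i)
 finally show ?thesis using L(2) by (subst (asm) set_integral_Ici_eq_Ioi) auto
qed

text \<open>Obtained from the scheme itself. The kernel error has an L1 norm bounded independently
  of \<open>l\<close>, so by scaling the transforms of \<open>mlk\<close> and of the interpolated
  kernel of step \<tau> differ by at most C0 \<tau>^a. The latter transform is explicit, and \<tau>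
  tends to 0.\<close>

lemma mlk_laplace:
 assumes l: "0 < l" and z: "0 < z"
 shows "(LBINT x:{0<..}. exp (- z * x) * mlk a l x) = 1 / (z powr a + l)"
proof -
 obtain C where C: "0 < C" "!!l x. 0 < l ==> 0 < x ==> \<bar>kernel1 a l x\<bar> <= C * kernel_bound a x"
  using kernel1_bound by metis
 define I where "I l z = (LBINT x:{0<..}. exp (- z * x) * mlk a l x)" for l z
 define H where "H z = (exp z - 2 + exp (- z)) / z\<^sup>2" for z :: real
 define C0 where "C0 = C * (LBINT x:{0<..}. kernel_bound a x)"
 have near: "\<bar>I l z - H z * mlk_gf_real l (exp (- z))\<bar> <= C0" if l: "0 < l" and z: "0 < z" for l z
 proof -
  have i: "set_lint {0<..} (%x. exp (- z * x) * kernel1 a l x)"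
   using z by (intro kernel1_integrable(1)[OF l, of _ 1]) auto
  have "\<bar>LBINT x:{0<..}. exp (- z * x) * kernel1 a l x\<bar> <= (LBINT x:{0<..}. \<bar>exp (- z * x) * kernel1 a l x\<bar>)"
   using set_integral_norm_bound[OF i] by simp
  also have "... <= (LBINT x:{0<..}. C * kernel_bound a x)"
  proof (intro set_integral_mono set_integrable_abs i set_integrable_mult_right kernel_bound_integrable(1)[OF a])
   fix x :: real assume x: "x \<in> {0<..}"
   have "exp (- z * x) * \<bar>kernel1 a l x\<bar> <= 1 * \<bar>kernel1 a l x\<bar>" using x z by (intro mult_right_mono) auto
   then show "\<bar>exp (- z * x) * kernel1 a l x\<bar> <= C * kernel_bound a x" using C(2)[OF l, of x] x by (simp add: abs_mult)
  qed
  finally show ?thesis unfolding kernel1_laplace[OF l z] by (simp add: I_def H_def C0_def)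
 qed
 have scale: "I l z = \<tau> powr a * I (l * \<tau> powr a) (z * \<tau>)" if \<tau>: "0 < \<tau>" for \<tau>
 proof -
  have "I l z = \<bar>\<tau>\<bar> *\<^sub>R (LBINT x. indicator {0<..} (0 + \<tau> * x) *\<^sub>R (exp (- z * (0 + \<tau> * x)) * mlk a l (0 + \<tau> * x)))"
   unfolding I_def set_lebesgue_integral_def using \<tau> by (intro lborel_integral_real_affine) auto
  also have "(LBINT x. indicator {0<..} (0 + \<tau> * x) *\<^sub>R (exp (- z * (0 + \<tau> * x)) * mlk a l (0 + \<tau> * x))) =
   (LBINT x. \<tau> powr (a - 1) * (indicator {0<..} x *\<^sub>R (exp (- (z * \<tau>) * x) * mlk a (l * \<tau> powr a) x)))"
  proof (intro Bochner_Integration.integral_cong refl)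
   fix x
   show "indicator {0<..} (0 + \<tau> * x) *\<^sub>R (exp (- z * (0 + \<tau> * x)) * mlk a l (0 + \<tau> * x)) = \<tau> powr (a - 1) * (indicator {0<..} x *\<^sub>R (exp (- (z * \<tau>) * x) * mlk a (l * \<tau> powr a) x))"
    using \<tau> mlk_scale[OF \<tau>, of a l "\<tau> * x"] by (auto simp: indicator_def zero_less_mult_iff mult_ac)
  qed
  also have "... = \<tau> powr (a - 1) * I (l * \<tau> powr a) (z * \<tau>)" by (simp add: I_def set_lebesgue_integral_def)
  finally show ?thesis using \<tau> by (simp add: powr_diff)
 qed
 \<comment> \<open>The transform at z of the interpolated scheme kernel with step \<tau>.\<close>
 define F where "F \<tau> = \<tau> powr a * (H (z * \<tau>) * mlk_gf_real (l * \<tau> powr a) (exp (- (z * \<tau>))))" for \<tau>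
 have est: "\<bar>I l z - F \<tau>\<bar> <= C0 * \<tau> powr a" if \<tau>: "0 < \<tau>" for \<tau>
 proof -
  have "\<bar>I (l * \<tau> powr a) (z * \<tau>) - H (z * \<tau>) * mlk_gf_real (l * \<tau> powr a) (exp (- (z * \<tau>)))\<bar> <= C0"
   using near[of "l * \<tau> powr a" "z * \<tau>"] l z \<tau> by simp
  then have "\<tau> powr a * \<bar>I (l * \<tau> powr a) (z * \<tau>) - H (z * \<tau>) * mlk_gf_real (l * \<tau> powr a) (exp (- (z * \<tau>)))\<bar> <= \<tau> powr a * C0"
   by (intro mult_left_mono) auto
  then show ?thesis unfolding scale[OF \<tau>] F_def right_diff_distrib[symmetric] by (simp add: abs_mult mult.commute)
 qed
 have limF: "(F \<longlongrightarrow> 1 / (z powr a + l)) (at_right 0)"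
 proof -
  define w where "w \<tau> = exp (- (z * \<tau>))" for \<tau>
  define Cw where "Cw \<tau> = 1 - a/2 + a/2 * w \<tau>" for \<tau>
  have wl: "(w \<longlongrightarrow> 1) (at_right 0)" unfolding w_def by real_asymp
  have Cl: "(Cw \<longlongrightarrow> 1 - a/2 + a/2 * 1) (at_right 0)" unfolding Cw_def by (intro tendsto_intros wl)
  have Hl: "((%\<tau>. H (z * \<tau>)) \<longlongrightarrow> 1) (at_right 0)" unfolding H_def using z by real_asymp (simp add: power2_eq_square field_simps)
  have dl: "((%\<tau>. (1 - w \<tau>) / \<tau>) \<longlongrightarrow> z) (at_right 0)" unfolding w_def using z by real_asymp
  have "((%\<tau>. H (z * \<tau>) * (1/4 * w \<tau> * (3 - w \<tau>)^2 * Cw \<tau> / (((1 - w \<tau>) / \<tau>) powr a + l * Cw \<tau>))) \<longlongrightarrow> 1 * (1/4 * 1 * (3 - 1)^2 * (1 - a/2 + a/2 * 1) / (z powr a + l * (1 - a/2 + a/2 * 1)))) (at_right 0)"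
   by (intro tendsto_intros Hl wl Cl dl) (use z l in \<open>auto intro: add_pos_pos simp: add_nonneg_eq_0_iff\<close>)
  moreover have "\<forall>\<^sub>F \<tau> in at_right 0. H (z * \<tau>) * (1/4 * w \<tau> * (3 - w \<tau>)^2 * Cw \<tau> / (((1 - w \<tau>) / \<tau>) powr a + l * Cw \<tau>)) = F \<tau>"
   unfolding eventually_at_right_field
  proof (intro exI[of _ 1] conjI allI impI)
   fix \<tau> :: real assume \<tau>: "0 < \<tau>"
   have w1: "0 <= 1 - w \<tau>" using \<tau> z by (simp add: w_def)
   have "((1 - w \<tau>) / \<tau>) powr a + l * Cw \<tau> = ((1 - w \<tau>) powr a + l * \<tau> powr a * Cw \<tau>) / \<tau> powr a"
    using \<tau> w1 by (simp add: powr_divide field_simps)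
   then show "H (z * \<tau>) * (1/4 * w \<tau> * (3 - w \<tau>)^2 * Cw \<tau> / (((1 - w \<tau>) / \<tau>) powr a + l * Cw \<tau>)) = F \<tau>"
    unfolding F_def mlk_gf_real_def w_def[symmetric] Cw_def[symmetric] by simp
  qed simp
  ultimately show ?thesis using Lim_transform_eventually by fastforce
 qed
 have "((%\<tau>. C0 * \<tau> powr a) \<longlongrightarrow> 0) (at_right 0)" using a by real_asymp
 then have "((%\<tau>. I l z - F \<tau>) \<longlongrightarrow> 0) (at_right 0)"
  by (rule Lim_null_comparison[rotated]) (use est in \<open>auto simp: eventually_at_right_field intro!: exI[of _ 1]\<close>)
 moreover have "((%\<tau>. I l z - F \<tau>) \<longlongrightarrow> I l z - 1 / (z powr a + l)) (at_right 0)"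
  by (intro tendsto_intros limF)
 ultimately have "I l z - 1 / (z powr a + l) = 0"
  using tendsto_unique trivial_limit_at_right_real by blast
 then show ?thesis by (simp add: I_def)
qed

text \<open>Second-order consistency in the transform domain: N(z) = 1 + o(z) and b(z) = z^a (1 +
  o(z)), hence k(z) = o(z). The limit of k at 0 is the moment of order 0. Once this is known to
  vanish, -k(z) / z is the integral of (1 - e^(-z x)) / z against the kernel and tends to the moment
  of order 1.\<close>

lemma kernel1_moments:
 assumes l: "0 < l"
 shows "(LBINT x:{0<..}. kernel1 a l x) = 0" "(LBINT x:{0<..}. x * kernel1 a l x) = 0"
proof -
 define k where "k z = (LBINT x:{0<..}. exp (- z * x) * kernel1 a l x)" for z
 define N where "N z = (exp z - 2 + exp (- z)) / z\<^sup>2 * (1/4 * exp (- z) * (3 - exp (- z))^2)" for z :: real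
 define b where "b z = (1 - exp (- z)) powr a / (1 - a/2 + a/2 * exp (- z))" for z :: real
 define g where "g z = ((1 - exp (-z))/z) powr a/(1 - a/2 + a*exp(-z)/2)" for z :: real
 have keq: "k z = 1 / (z powr a + l) - N z / (b z + l)" if z: "0 < z" for z
 proof -
  have p: "0 < 1 - a/2 + a/2 * exp (- z)" using a by (simp add: add_pos_pos)
  have "mlk_gf_real l (exp (- z)) = 1/4 * exp (- z) * (3 - exp (- z))^2 / (b z + l)"
  proof -
   have "b z + l = ((1 - exp (- z)) powr a + l * (1 - a/2 + a/2 * exp (- z))) / (1 - a/2 + a/2 * exp (- z))"
    unfolding b_def using p by (simp add: add_divide_distrib)
   then show ?thesis unfolding mlk_gf_real_def using p by simp
  qed
  then show ?thesis unfolding k_def kernel1_laplace[OF l z] mlk_laplace[OF l z] N_def by simp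
 qed
 have bg: "b z = z powr a * g z" if "0 < z" for z
  unfolding b_def g_def using that by (simp add: powr_divide)
 have N1: "((%z. (1 - N z) / z) \<longlongrightarrow> 0) (at_right 0)" unfolding N_def by real_asymp
 have g1: "((%z. (g z - 1) / z) \<longlongrightarrow> 0) (at_right 0)" unfolding g_def using a by real_asymp
 have g0: "(g \<longlongrightarrow> 1) (at_right 0)" unfolding g_def using a by real_asymp
 have za: "((%z. z powr a) \<longlongrightarrow> 0) (at_right 0)" using a by real_asymp
 have "((%z. (1 - N z) / z / (z powr a * g z + l) + z powr a * ((g z - 1) / z) / ((z powr a * g z + l) * (z powr a + l)))
   \<longlongrightarrow> 0 / (0 * 1 + l) + 0 * 0 / ((0 * 1 + l) * (0 + l))) (at_right 0)"
  by (intro tendsto_intros N1 g1 g0 za) (use l in auto)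
 moreover have "\<forall>\<^sub>F z in at_right 0. (1 - N z) / z / (z powr a * g z + l) + z powr a * ((g z - 1) / z) / ((z powr a * g z + l) * (z powr a + l)) = k z / z"
  unfolding eventually_at_right_field
 proof (intro exI[of _ 1] conjI allI impI)
  fix z :: real assume z: "0 < z" "z < 1"
  have "0 <= g z" unfolding g_def using a by (simp add: add_nonneg_nonneg)
  then have "0 < z powr a * g z + l" "0 < z powr a + l" using l by (auto intro: add_nonneg_pos)
  then show "(1 - N z) / z / (z powr a * g z + l) + z powr a * ((g z - 1) / z) / ((z powr a * g z + l) * (z powr a + l)) = k z / z"
   unfolding keq[OF z(1)] bg[OF z(1)] using z by (simp add: divide_simps) (simp add: algebra_simps)
 qed simp
 ultimately have kz: "((%z. k z / z) \<longlongrightarrow> 0) (at_right 0)"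
  using Lim_transform_eventually by fastforce
 have "((%z. k z / z * z) \<longlongrightarrow> 0 * 0) (at_right 0)" by (intro tendsto_intros kz)
 moreover have "\<forall>\<^sub>F z in at_right 0. k z / z * z = k z" by (auto simp: eventually_at_right_field intro!: exI[of _ 1])
 ultimately have "(k \<longlongrightarrow> 0 * 0) (at_right 0)" by (rule Lim_transform_eventually)
 then have k0: "(k \<longlongrightarrow> 0) (at_right 0)" by simp
 have I0: "set_lint {0<..} (kernel1 a l)" "set_lint {0<..} (%x. x * kernel1 a l x)"
  using kernel1_integrable[OF l, of "%_. 1" 1] by auto
 have zn: "(%n. 1 / real (Suc n)) \<longlonglongrightarrow> 0" by real_asymp
 have fz: "filterlim (%n. 1 / real (Suc n)) (at_right 0) sequentially"
  unfolding filterlim_at using zn by (auto simp: eventually_at_filter)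
 have lim0: "(%n. k (1 / real (Suc n))) \<longlonglongrightarrow> (LBINT x:{0<..}. kernel1 a l x)"
  unfolding k_def set_lebesgue_integral_def
 proof (rule integral_dominated_convergence)
  show "integrable lborel (%x. \<bar>indicator {0<..} x *\<^sub>R kernel1 a l x\<bar>)"
   using I0(1) by (simp add: set_integrable_def)
  show "AE x in lborel. (%n. indicator {0<..} x *\<^sub>R (exp (- (1 / real (Suc n)) * x) * kernel1 a l x)) \<longlonglongrightarrow> indicator {0<..} x *\<^sub>R kernel1 a l x"
  proof (intro AE_I2)
   fix x
   have "(%n. indicator {0<..} x *\<^sub>R (exp (- (1 / real (Suc n)) * x) * kernel1 a l x)) \<longlonglongrightarrow> indicator {0<..} x *\<^sub>R (exp (- 0 * x) * kernel1 a l x)"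
    by (intro tendsto_intros zn)
   then show "(%n. indicator {0<..} x *\<^sub>R (exp (- (1 / real (Suc n)) * x) * kernel1 a l x)) \<longlonglongrightarrow> indicator {0<..} x *\<^sub>R kernel1 a l x" by simp
  qed
  show "AE x in lborel. norm (indicator {0<..} x *\<^sub>R (exp (- (1 / real (Suc n)) * x) * kernel1 a l x)) <= \<bar>indicator {0<..} x *\<^sub>R kernel1 a l x\<bar>" for n
   by (auto simp: indicator_def abs_mult intro!: mult_left_le_one_le)
 qed measurable
 show m0: "(LBINT x:{0<..}. kernel1 a l x) = 0"
  using LIMSEQ_unique[OF lim0 filterlim_compose[OF k0 fz]] .
 \<comment> \<open>Dominated convergence with the majorant x |kernel|, because 0 <= (1 - e^(-z x)) /
   z <= x.\<close>
 have "(%n. LBINT x:{0<..}. (1 - exp (- (1 / real (Suc n)) * x)) / (1 / real (Suc n)) * kernel1 a l x) \<longlonglongrightarrow> (LBINT x:{0<..}. x * kernel1 a l x)"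
  unfolding set_lebesgue_integral_def
 proof (rule integral_dominated_convergence)
  show "integrable lborel (%x. \<bar>indicator {0<..} x *\<^sub>R (x * kernel1 a l x)\<bar>)"
   using I0(2) by (simp add: set_integrable_def)
  show "AE x in lborel. (%n. indicator {0<..} x *\<^sub>R ((1 - exp (- (1 / real (Suc n)) * x)) / (1 / real (Suc n)) * kernel1 a l x)) \<longlonglongrightarrow> indicator {0<..} x *\<^sub>R (x * kernel1 a l x)"
  proof (intro AE_I2)
   fix x :: real
   have "(%n. (1 - exp (- (1 / real (Suc n)) * x)) / (1 / real (Suc n))) \<longlonglongrightarrow> x" by real_asymp
   then show "(%n. indicator {0<..} x *\<^sub>R ((1 - exp (- (1 / real (Suc n)) * x)) / (1 / real (Suc n)) * kernel1 a l x)) \<longlonglongrightarrow> indicator {0<..} x *\<^sub>R (x * kernel1 a l x)"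
    by (intro tendsto_intros)
  qed
  show "AE x in lborel. norm (indicator {0<..} x *\<^sub>R ((1 - exp (- (1 / real (Suc n)) * x)) / (1 / real (Suc n)) * kernel1 a l x)) <= \<bar>indicator {0<..} x *\<^sub>R (x * kernel1 a l x)\<bar>" for n
  proof (intro AE_I2)
   fix x :: real
   have "\<bar>(1 - exp (- (1 / real (Suc n)) * x)) / (1 / real (Suc n))\<bar> <= x" if "0 < x"
   proof -
    have "1 - exp (- (1 / real (Suc n)) * x) <= 1 / real (Suc n) * x" using exp_neg_taylor(1)[of "1 / real (Suc n) * x"] that by simp
    then have "(1 - exp (- (1 / real (Suc n)) * x)) / (1 / real (Suc n)) <= x" by (subst pos_divide_le_eq) (auto simp: mult.commute)
    moreover have "0 <= (1 - exp (- (1 / real (Suc n)) * x)) / (1 / real (Suc n))" using that by (intro divide_nonneg_nonneg) auto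
    ultimately show ?thesis by (simp only: abs_of_nonneg)
   qed
   then show "norm (indicator {0<..} x *\<^sub>R ((1 - exp (- (1 / real (Suc n)) * x)) / (1 / real (Suc n)) * kernel1 a l x)) <= \<bar>indicator {0<..} x *\<^sub>R (x * kernel1 a l x)\<bar>"
    by (auto simp: indicator_def abs_mult intro!: mult_right_mono simp del: of_nat_Suc)
  qed
 qed measurable
 moreover have "(LBINT x:{0<..}. (1 - exp (- (1 / real (Suc n)) * x)) / (1 / real (Suc n)) * kernel1 a l x) = - (k (1 / real (Suc n)) / (1 / real (Suc n)))" for n
 proof -
 have gen: "(LBINT x:{0<..}. (1 - exp (- z * x)) / z * kernel1 a l x) = - (k z / z)" if z: "0 < z" for z
 proof -
  have i: "set_lint {0<..} (%x. exp (- z * x) * kernel1 a l x)"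
   using z by (intro kernel1_integrable(1)[OF l, of _ 1]) auto
  have "(LBINT x:{0<..}. (1 - exp (- z * x)) / z * kernel1 a l x) = (LBINT x:{0<..}. (kernel1 a l x - exp (- z * x) * kernel1 a l x) / z)"
   by (intro set_lebesgue_integral_cong) (auto simp: field_simps)
  also have "... = (LBINT x:{0<..}. (kernel1 a l x - exp (- z * x) * kernel1 a l x)) / z" by simp
  also have "(LBINT x:{0<..}. (kernel1 a l x - exp (- z * x) * kernel1 a l x)) = (LBINT x:{0<..}. kernel1 a l x) - k z"
   unfolding k_def by (intro set_integral_diff(2) I0 i)
  finally show ?thesis using m0 by simp
 qed
 show ?thesis by (rule gen) simp
 qed
 ultimately have "(%n. - (k (1 / real (Suc n)) / (1 / real (Suc n)))) \<longlonglongrightarrow> (LBINT x:{0<..}. x * kernel1 a l x)"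
  by (simp only:)
 moreover have "(%n. - (k (1 / real (Suc n)) / (1 / real (Suc n)))) \<longlonglongrightarrow> - 0"
  by (intro tendsto_minus filterlim_compose[OF kz fz])
 ultimately show "(LBINT x:{0<..}. x * kernel1 a l x) = 0" using LIMSEQ_unique by fastforce
qed

end

definition cn_kernel :: "real => real => real => real => real" where
 "cn_kernel a \<tau> l x = mlk a l x - \<tau> powr (a - 1) * pl_interp (fps_nth (mlk_fps a (l * \<tau> powr a))) (x / \<tau>)"

lemma cn_kernel_scale: "0 < \<tau> ==> cn_kernel a \<tau> l x = \<tau> powr (a - 1) * kernel1 a (l * \<tau> powr a) (x / \<tau>)"
 unfolding cn_kernel_def kernel1_def by (subst mlk_scale) (simp_all add: right_diff_distrib)

lemma cn_kernel_measurable [measurable]: "cn_kernel a \<tau> l \<in> borel_measurable borel"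
 unfolding cn_kernel_def by measurable

text \<open>Transport from step 1 by scaling: C x^(a-3) turns into C \<tau>^2 x^(a-3) because
  \<tau>^(a-1) \<tau>^(3-a) = \<tau>^2, whereas C x^(a-1) is scale invariant. Here the order of the
  scheme becomes a power of the step size.\<close>

theorem cn_kernel_properties:
 assumes a: "0 < a" "a < 1"
 obtains C where "0 < C"
  "!!l \<tau> x. 0 < l ==> 0 < \<tau> ==> 0 < x ==> \<bar>cn_kernel a \<tau> l x\<bar> <= C * x powr (a - 1)"
  "!!l \<tau> x. 0 < l ==> 0 < \<tau> ==> 0 < x ==> \<bar>cn_kernel a \<tau> l x\<bar> <= C * \<tau>\<^sup>2 * x powr (a - 3)"
  "!!l \<tau>. 0 < l ==> 0 < \<tau> ==> set_lint {0<..} (cn_kernel a \<tau> l)"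
  "!!l \<tau>. 0 < l ==> 0 < \<tau> ==> set_lint {0<..} (%x. x * cn_kernel a \<tau> l x)"
  "!!l \<tau>. 0 < l ==> 0 < \<tau> ==> (LBINT x:{0<..}. cn_kernel a \<tau> l x) = 0"
  "!!l \<tau>. 0 < l ==> 0 < \<tau> ==> (LBINT x:{0<..}. x * cn_kernel a \<tau> l x) = 0"
proof -
 obtain C where C: "0 < C" 
  "!!l x. 0 < l ==> 0 < x ==> \<bar>kernel1 a l x\<bar> <= C * x powr (a - 1)"
  "!!l x. 0 < l ==> 0 < x ==> \<bar>kernel1 a l x\<bar> <= C * x powr (a - 3)"
  using kernel1_bound[OF a] by metis
 have sc: "integrable lborel f \<longleftrightarrow> integrable lborel (%x. f (0 + \<tau> * x))" "(LBINT x. f x) = \<tau> * (LBINT x. f (0 + \<tau> * x))"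
  if "0 < \<tau>" for \<tau> and f :: "real => real"
  using that lborel_integrable_real_affine_iff[of \<tau> f 0] lborel_integral_real_affine[of \<tau> f 0] by auto
 have eq: "indicator {0<..} (0 + \<tau> * x) *\<^sub>R cn_kernel a \<tau> l (0 + \<tau> * x) = \<tau> powr (a - 1) * (indicator {0<..} x *\<^sub>R kernel1 a (l * \<tau> powr a) x)"
  "indicator {0<..} (0 + \<tau> * x) *\<^sub>R ((0 + \<tau> * x) * cn_kernel a \<tau> l (0 + \<tau> * x)) = \<tau> * \<tau> powr (a - 1) * (indicator {0<..} x *\<^sub>R (x * kernel1 a (l * \<tau> powr a) x))"
  if "0 < \<tau>" for \<tau> x l
  using that by (auto simp: cn_kernel_scale indicator_def zero_less_mult_iff)
 show ?thesis
 proof (rule that[OF C(1)])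
  fix l \<tau> :: real assume l: "0 < l" and \<tau>: "0 < \<tau>"
  then have lt: "0 < l * \<tau> powr a" by simp
  have i: "set_lint {0<..} (kernel1 a (l * \<tau> powr a))" "set_lint {0<..} (%x. x * kernel1 a (l * \<tau> powr a) x)"
   using kernel1_integrable[OF a lt, of "%_. 1" 1] by auto
  let ?f0 = "%x. indicator {0<..} x *\<^sub>R cn_kernel a \<tau> l x" and ?f1 = "%x. indicator {0<..} x *\<^sub>R (x * cn_kernel a \<tau> l x)"
  show "set_lint {0<..} (cn_kernel a \<tau> l)" "(LBINT x:{0<..}. cn_kernel a \<tau> l x) = 0"
   unfolding set_integrable_def set_lebesgue_integral_def sc[OF \<tau>, of ?f0] eq[OF \<tau>]
   using i kernel1_moments[OF a lt] by (auto simp: set_integrable_def set_lebesgue_integral_def)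
  show "set_lint {0<..} (%x. x * cn_kernel a \<tau> l x)" "(LBINT x:{0<..}. x * cn_kernel a \<tau> l x) = 0"
   unfolding set_integrable_def set_lebesgue_integral_def sc[OF \<tau>, of ?f1] eq[OF \<tau>]
   using i kernel1_moments[OF a lt] by (auto simp: set_integrable_def set_lebesgue_integral_def)
  fix x :: real assume x: "0 < x"
  have "\<tau> powr (a - 1) * \<bar>kernel1 a (l * \<tau> powr a) (x / \<tau>)\<bar> <= \<tau> powr (a - 1) * (C * (x / \<tau>) powr (a - 1))"
   "\<tau> powr (a - 1) * \<bar>kernel1 a (l * \<tau> powr a) (x / \<tau>)\<bar> <= \<tau> powr (a - 1) * (C * (x / \<tau>) powr (a - 3))"
   using C(2,3)[OF lt, of "x / \<tau>"] x \<tau> by (auto intro: mult_left_mono)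
  moreover have "\<tau> powr (a - 1) * (C * (x / \<tau>) powr (a - 1)) = C * x powr (a - 1)"
   using x \<tau> by (simp add: powr_divide)
  moreover have "\<tau> powr (a - 1) * (C * (x / \<tau>) powr (a - 3)) = C * \<tau>\<^sup>2 * x powr (a - 3)"
  proof -
   have "\<tau> powr (a - 1) = \<tau> powr 2 * \<tau> powr (a - 3)" by (simp add: powr_add[symmetric])
   then show ?thesis using x \<tau> by (simp add: powr_divide)
  qed
  ultimately show "\<bar>cn_kernel a \<tau> l x\<bar> <= C * x powr (a - 1)" "\<bar>cn_kernel a \<tau> l x\<bar> <= C * \<tau>\<^sup>2 * x powr (a - 3)"
   unfolding cn_kernel_scale[OF \<tau>] by (auto simp: abs_mult)
 qed
qed

section \<open>Convolution of the kernel error with exponentials\<close>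

lemma set_integral_norm_le:
 fixes f :: "'a => 'b::{banach, second_countable_topology}"
 assumes "set_integrable M S f" "set_integrable M S g" "!!x. x \<in> S ==> norm (f x) <= g x"
 shows "norm (LINT x:S|M. f x) <= (LINT x:S|M. g x)"
proof -
 have "norm (LINT x:S|M. f x) <= (LINT x:S|M. norm (f x))" by (rule set_integral_norm_bound[OF assms(1)])
 also have "... <= (LINT x:S|M. g x)" by (intro set_integral_mono set_integrable_norm assms)
 finally show ?thesis .
qed

lemma set_integrable_cofr:
 "set_integrable M S f ==> set_integrable M S (%x. complex_of_real (f x))"
 unfolding set_integrable_def by (drule integrable_of_real[where 'a = complex]) (simp add: scaleR_conv_of_real)

lemma set_integral_powr_0:
 fixes s X :: real assumes "-1 < s" "0 <= X"
 shows "set_lint {0<..X} (%x. x powr s)" "(LBINT x:{0<..X}. x powr s) = X powr (s + 1) / (s + 1)"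
proof -
 have h: "((%x. x powr s) has_integral X powr (s + 1) / (s + 1)) {0..X}" using assms by (intro has_integral_powr_from_0) auto
 then have h': "((%x. x powr s) has_integral X powr (s + 1) / (s + 1)) {0<..X}"
  by (rule has_integral_spike_set_eq[THEN iffD1, rotated 2]) (auto intro: negligible_subset[of "{0}"])
 show "set_lint {0<..X} (%x. x powr s)" "(LBINT x:{0<..X}. x powr s) = X powr (s + 1) / (s + 1)"
  by (intro set_integrable_lborelI_nonneg[OF h']; auto)+
qed

lemma set_integral_powr_inf:
 fixes s X :: real assumes "s < -1" "0 < X"
 shows "set_lint {X<..} (%x. x powr s)" "(LBINT x:{X<..}. x powr s) = X powr (s + 1) / (- s - 1)"
proof -
 have h: "((%x. x powr s) has_integral - (X powr (s + 1)) / (s + 1)) {X..}" using assms by (intro has_integral_powr_to_inf) auto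
 then have h': "((%x. x powr s) has_integral - (X powr (s + 1)) / (s + 1)) {X<..}"
  by (rule has_integral_spike_set_eq[THEN iffD1, rotated 2]) (auto intro: negligible_subset[of "{X}"])
 show "set_lint {X<..} (%x. x powr s)" "(LBINT x:{X<..}. x powr s) = X powr (s + 1) / (- s - 1)"
 proof -
  have e: "- (X powr (s + 1)) / (s + 1) = X powr (s + 1) / (- s - 1)" by (metis minus_add_distrib minus_divide_divide minus_minus uminus_add_conv_diff add.commute)
  show "set_lint {X<..} (%x. x powr s)" "(LBINT x:{X<..}. x powr s) = X powr (s + 1) / (- s - 1)"
   using set_integrable_lborelI_nonneg[OF h'] e by auto
 qed
qed

text \<open>The integral is at most t, and c times the integral is at most 1. Together these give
  the factor 1 / (1 + c t), one power of decay along the contour.\<close>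

lemma set_integral_exp_decay:
 fixes c X t :: real assumes "0 <= c" "0 <= X" "X <= t"
 shows "set_lint {X<..t} (%x. exp (- c * (t - x)))" 
  "(1 + c * t) * (LBINT x:{X<..t}. exp (- c * (t - x))) <= 2 * t"
proof -
 show i: "set_lint {X<..t} (%x. exp (- c * (t - x)))"
  by (rule set_integrable_subset[OF borel_integrable_atLeastAtMost'[of X t]]) (auto intro!: continuous_intros)
 define J where "J = (LBINT x:{X<..t}. exp (- c * (t - x)))"
 have "J <= (LBINT x:{X<..t}. 1)" unfolding J_def
  using assms by (intro set_integral_mono i) (auto simp: set_integrable_def)
 also have "... = t - X" using assms by (simp add: set_lebesgue_integral_def)
 finally have 1: "J <= t" using assms by simp
 have 2: "c * J <= 1"
 proof -
  have "((%x. c * exp (- c * (t - x))) has_integral exp (- c * (t - t)) - exp (- c * (t - X))) {X..t}"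
   using assms by (intro fundamental_theorem_of_calculus)
    (auto intro!: derivative_eq_intros simp: has_real_derivative_iff_has_vector_derivative[symmetric])
  then have h: "((%x. c * exp (- c * (t - x))) has_integral exp (- c * (t - t)) - exp (- c * (t - X))) {X<..t}"
   by (rule has_integral_spike_set_eq[THEN iffD1, rotated 2]) (auto intro: negligible_subset[of "{X}"])
  have "(LBINT x:{X<..t}. c * exp (- c * (t - x))) = exp (- c * (t - t)) - exp (- c * (t - X))"
   using assms by (intro set_integrable_lborelI_nonneg(2)[OF h]) auto
  then show ?thesis by (simp add: J_def)
 qed
 have "c * t * J <= t * 1" using mult_left_mono[OF 2, of t] assms by (simp add: mult_ac)
 then show "(1 + c * t) * (LBINT x:{X<..t}. exp (- c * (t - x))) <= 2 * t"
  using 1 unfolding J_def[symmetric] by (simp add: distrib_right)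
qed

text \<open>From 1 + x <= e^x at x = (1 + v) c / 3, cubed.\<close>

lemma poly_exp_le:
 fixes c v :: real assumes "0 < c" "0 <= v"
 shows "(1 + v) ^ 3 * exp (- c * v) <= (3 / c) ^ 3 * exp c"
proof -
 have "(1 + v) * (c / 3) <= exp ((1 + v) * (c / 3))" using exp_ge_add_one_self[of "(1 + v) * (c / 3)"] by linarith
 then have "1 + v <= 3 / c * exp ((1 + v) * (c / 3))" using assms by (simp add: field_simps)
 then have "(1 + v) ^ 3 <= (3 / c * exp ((1 + v) * (c / 3))) ^ 3" using assms by (intro power_mono) auto
 also have "... = (3 / c) ^ 3 * exp ((1 + v) * c)"
  unfolding power_mult_distrib exp_of_nat_mult[symmetric] by simp
 finally have "(1 + v) ^ 3 * exp (- c * v) <= (3 / c) ^ 3 * exp ((1 + v) * c) * exp (- c * v)" by (intro mult_right_mono) auto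
 also have "... = (3 / c) ^ 3 * exp c" by (simp add: exp_add[symmetric] mult.assoc) (simp add: algebra_simps)
 finally show ?thesis .
qed

text \<open>Two rays from the vertex v, parametrised by the imaginary part and running into the left
  half plane for m > 0. For m = 0 it is the vertical line through v.\<close>

definition vcontour :: "real => real => real => complex" where
 "vcontour v m y = Complex (v - m * \<bar>y\<bar>) y"

text \<open>On (0, t/2] the exponential e^(s (t - x)) is replaced by e^(s t) (1 - s x) with an error
  O(|s|^2 x^2), which makes x^(a-3) integrable at 0. The two subtracted terms are truncated moments
  of \<kappa>; as the full moments vanish, they equal minus the tails over (t/2, infinity), where
  the bound on \<kappa> is integrable even after multiplication by x. On (t/2, t] the kernel is of
  order t^(a-3) and the integral of the exponential yields 1 / (1 + |y| t).\<close>

lemma kernel_exp_bound: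
 assumes a: "0 < a" "a < 1" and A: "0 <= A" and m: "0 < m"
 obtains K where "0 < K"
  "!!\<kappa> B t y. [|!!x. 0 < x ==> \<bar>\<kappa> x\<bar> <= B * x powr (a - 3); 0 <= B;
    set_lint {0<..} \<kappa>; set_lint {0<..} (%x. x * \<kappa> x);
    (LBINT x:{0<..}. \<kappa> x) = 0; (LBINT x:{0<..}. x * \<kappa> x) = 0; \<kappa> \<in> borel_measurable borel; 0 < t|] ==>
   cmod (LBINT x:{0<..t}. of_real (\<kappa> x) * exp (vcontour (A / t) m y * of_real (t - x)))
    <= K * B * t powr (a - 2) / (1 + \<bar>y\<bar> * t)"
proof -
 define P where "P = (3 / (m/2)) ^ 3 * exp (m/2)"
 define Q where "Q = (A + 1 + m)"
 have P: "0 < P" using m by (simp add: P_def)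
 have Q: "1 <= Q" using A m by (simp add: Q_def)
 \<comment> \<open>One summand for each of the pieces \<open>T1\<close> to \<open>T4\<close>
   below.\<close>
 define K where "K = Q\<^sup>2 * exp (3 * A / 2) * P / a + exp A * P * 4 + Q * exp A * P * (2 / (1 - a)) + 16 * exp A * (1 + 1 / m)"
 have K: "0 < K" unfolding K_def using P Q a m by (intro add_nonneg_pos add_pos_pos mult_pos_pos divide_pos_pos) (auto intro!: add_pos_pos)
 show ?thesis
 proof (rule that[OF K])
  fix \<kappa> :: "real => real" and B t y :: real
  assume b: "!!x. 0 < x ==> \<bar>\<kappa> x\<bar> <= B * x powr (a - 3)" and B: "0 <= B"
   and i0: "set_lint {0<..} \<kappa>" and i1: "set_lint {0<..} (%x. x * \<kappa> x)"
   and z0: "(LBINT x:{0<..}. \<kappa> x) = 0" and z1: "(LBINT x:{0<..}. x * \<kappa> x) = 0"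
   and meas [measurable]: "\<kappa> \<in> borel_measurable borel" and t: "0 < t"
  define s where "s = vcontour (A / t) m y"
  define v where "v = \<bar>y\<bar> * t"
  define X where "X = t / 2"
  have X: "0 < X" "X < t" using t by (auto simp: X_def)
  have v: "0 <= v" using t by (simp add: v_def)
  have Re_s: "Re s = A / t - m * \<bar>y\<bar>" by (simp add: s_def vcontour_def)
  have Rst: "Re s * t = A - m * v" using t by (simp add: Re_s v_def field_simps)
  have ns: "cmod s * t <= Q * (1 + v)"
  proof -
   have "cmod s <= \<bar>Re s\<bar> + \<bar>Im s\<bar>" by (rule cmod_le)
   also have "... <= (A / t + m * \<bar>y\<bar>) + \<bar>y\<bar>" using A m t by (auto simp: s_def vcontour_def abs_if)
   finally have "cmod s * t <= ((A / t + m * \<bar>y\<bar>) + \<bar>y\<bar>) * t" using t by (intro mult_right_mono) auto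
   also have "... = A + m * v + v" using t by (simp add: v_def field_simps)
   also have "... <= Q * (1 + v)" using A m v by (simp add: Q_def algebra_simps)
   finally show ?thesis .
  qed
  have pe: "(1 + v) ^ 3 * exp (- (m/2) * v) <= P" unfolding P_def using m v by (intro poly_exp_le) auto
  \<comment> \<open>The powers k = 2, 0, 1 serve \<open>T1\<close>, \<open>T2\<close>,
    \<open>T3\<close>, according to the number of factors s; the additional factor 1 + v becomes the
    denominator 1 + |y| t.\<close>
  have dec: "(1 + v) * (1 + v) ^ k * exp (- (m/2) * v) <= P" if "k <= 2" for k
  proof -
   have "(1 + v) * (1 + v) ^ k <= (1 + v) ^ 3" using power_increasing[of "Suc k" 3 "1 + v"] that v by simp
   then have "(1 + v) * (1 + v) ^ k * exp (- (m/2) * v) <= (1 + v) ^ 3 * exp (- (m/2) * v)" by (intro mult_right_mono) auto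
   then show ?thesis using pe by linarith
  qed
  have exp_le: "exp (A - m * v) <= exp A * exp (- (m/2) * v)" using m v by (simp add: exp_add[symmetric])
  have sub: "set_lint S f" if "set_lint {0<..} f" "S \<in> sets borel" "S \<subseteq> {0<..}" for S and f :: "real => real"
   by (rule set_integrable_subset[OF that(1)]) (use that in auto)
  have eint: "set_lint S (%x. of_real (\<kappa> x) * exp (s * of_real (t - x)))" if "S \<in> sets borel" "S \<subseteq> {0<..t}" for S
  proof -
   have "set_lint S (%x. exp (\<bar>Re s\<bar> * t) * \<kappa> x)" using that by (intro set_integrable_mult_right sub[OF i0]) auto
   then show ?thesis unfolding set_integrable_def
   proof (rule Bochner_Integration.integrable_bound)
    have "cmod (of_real (\<kappa> x) * exp (s * of_real (t - x))) <= \<bar>exp (\<bar>Re s\<bar> * t) * \<kappa> x\<bar>" if x: "x \<in> {0<..t}" for x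
    proof -
     have "Re s * (t - x) <= \<bar>Re s\<bar> * t" using x by (intro mult_mono) auto
     then have "\<bar>\<kappa> x\<bar> * exp (Re s * (t - x)) <= \<bar>\<kappa> x\<bar> * exp (\<bar>Re s\<bar> * t)" by (intro mult_left_mono) auto
     moreover have "cmod (of_real (\<kappa> x) * exp (s * of_real (t - x))) = \<bar>\<kappa> x\<bar> * exp (Re s * (t - x))"
      unfolding norm_mult norm_exp_eq_Re by simp
     moreover have "\<bar>exp (\<bar>Re s\<bar> * t) * \<kappa> x\<bar> = \<bar>\<kappa> x\<bar> * exp (\<bar>Re s\<bar> * t)"
      unfolding abs_mult by simp
     ultimately show ?thesis by linarith
    qed
    then have "norm (indicator S x *\<^sub>R (complex_of_real (\<kappa> x) * exp (s * of_real (t - x)))) <= norm (indicator S x *\<^sub>R (exp (\<bar>Re s\<bar> * t) * \<kappa> x))" for x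
     using subsetD[OF that(2), of x] by (cases "x \<in> S") simp_all
    then show "AE x in lborel. norm (indicator S x *\<^sub>R (complex_of_real (\<kappa> x) * exp (s * of_real (t - x)))) <= norm (indicator S x *\<^sub>R (exp (\<bar>Re s\<bar> * t) * \<kappa> x))"
     by blast
   qed (use that in measurable)
  qed
  define M0 where "M0 = (LBINT x:{0<..X}. \<kappa> x)"
  define M1 where "M1 = (LBINT x:{0<..X}. x * \<kappa> x)"
  have un: "{0<..} = {0<..X} \<union> {X<..}" using X by auto
  have split: "(LBINT x:{0<..X}. f x) = - (LBINT x:{X<..}. f x)" if "set_lint {0<..} f" "(LBINT x:{0<..}. f x) = 0" for f :: "real => real"
  proof -
   have "(LBINT x:{0<..}. f x) = (LBINT x:{0<..X}. f x) + (LBINT x:{X<..}. f x)"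
    unfolding un using X by (intro set_integral_Un sub[OF that(1)]) auto
   then show ?thesis using that by simp
  qed
  have M0: "\<bar>M0\<bar> <= B * (4 * t powr (a - 2))"
  proof -
   have "\<bar>M0\<bar> = norm (LBINT x:{X<..}. \<kappa> x)" unfolding M0_def split[OF i0 z0] by simp
   also have "... <= (LBINT x:{X<..}. B * x powr (a - 3))"
    using X a b by (intro set_integral_norm_le sub[OF i0] set_integrable_mult_right set_integral_powr_inf(1)) auto
   also have "... = B * (X powr (a - 2) / (2 - a))" using set_integral_powr_inf(2)[of "a - 3" X] a X by simp
   also have "X powr (a - 2) / (2 - a) <= X powr (a - 2) / 1" using a by (intro divide_left_mono) auto
   also have "X powr (a - 2) = 2 powr (2 - a) * t powr (a - 2)" using t by (simp add: X_def powr_divide powr_diff field_simps)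
   also have "2 powr (2 - a) <= (2::real) powr 2" using a by (intro powr_mono) auto
   finally show ?thesis using B by (simp add: mult_left_mono mult_right_mono)
  qed
  have M1: "\<bar>M1\<bar> <= B * (2 / (1 - a) * t powr (a - 1))"
  proof -
   have "\<bar>M1\<bar> = norm (LBINT x:{X<..}. x * \<kappa> x)" unfolding M1_def split[OF i1 z1] by simp
   also have "... <= (LBINT x:{X<..}. B * x powr (a - 2))"
   proof (intro set_integral_norm_le sub[OF i1] set_integrable_mult_right set_integral_powr_inf(1))
    fix x assume x: "x \<in> {X<..}"
    then have x0: "0 < x" using X by simp
    have "x * \<bar>\<kappa> x\<bar> <= x * (B * x powr (a - 3))" using b[OF x0] x0 by (intro mult_left_mono) auto
    also have "... = B * (x powr 1 * x powr (a - 3))" using x0 by simp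
    also have "x powr 1 * x powr (a - 3) = x powr (a - 2)" by (simp only: powr_add[symmetric]) simp
    finally show "norm (x * \<kappa> x) <= B * x powr (a - 2)" using x0 by (simp add: abs_mult)
   qed (use X a in auto)
   also have "... = B * (X powr (a - 1) / (1 - a))" using set_integral_powr_inf(2)[of "a - 2" X] a X by simp
   also have "X powr (a - 1) = 2 powr (1 - a) * t powr (a - 1)" using t by (simp add: X_def powr_divide powr_diff field_simps)
   also have "2 powr (1 - a) <= (2::real) powr 1" using a by (intro powr_mono) auto
   finally show ?thesis using B a by (simp add: mult_left_mono mult_right_mono divide_right_mono)
  qed
  define E where "E x = exp (s * of_real (t - x)) - (1 - s * of_real x) * exp (s * of_real t)" for x
  have E: "cmod (E x) <= cmod s ^ 2 * x\<^sup>2 * (exp (3 * A / 2) * exp (- (m/2) * v))" if x: "0 < x" "x <= X" for x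
  proof -
   have "E x = exp (s * of_real t) * (exp (- s * of_real x) - (1 + (- s * of_real x)))"
    by (simp add: E_def exp_diff exp_minus right_diff_distrib divide_inverse algebra_simps)
   moreover have "cmod (exp (- s * of_real x) - (1 + (- s * of_real x))) <= exp \<bar>Re (- s * of_real x)\<bar> * cmod (- s * of_real x) ^ 2"
    using Taylor_exp[of "- s * of_real x" 1] by (simp add: numeral_2_eq_2)
   ultimately have "cmod (E x) <= exp (Re s * t) * (exp \<bar>Re (- s * of_real x)\<bar> * cmod (- s * of_real x) ^ 2)"
    by (simp add: norm_mult mult_left_mono)
   also have "... = cmod s ^ 2 * x\<^sup>2 * exp (Re s * t + \<bar>Re s\<bar> * x)"
    using x by (simp add: norm_mult power_mult_distrib abs_mult exp_add)
   \<comment> \<open>Half of the decay is spent here: for x <= t/2 the factor e^(|Re s| x) costs up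
     to e^(A/2 + m v / 2). This is why m / 2 replaces m in the decay factors.\<close>
   also have "exp (Re s * t + \<bar>Re s\<bar> * x) <= exp (3 * A / 2 + (- (m/2) * v))"
   proof -
    have "\<bar>Re s\<bar> * x <= (A / t + m * \<bar>y\<bar>) * X" using A m t x by (intro mult_mono) (auto simp: Re_s abs_if)
    also have "... = A / 2 + m * v / 2" using t by (simp add: X_def v_def field_simps)
    finally show ?thesis using Rst by simp
   qed
   finally have "cmod (E x) <= cmod s ^ 2 * x\<^sup>2 * exp (3 * A / 2 + (- (m/2) * v))" by (simp add: mult_left_mono)
   then show ?thesis unfolding exp_add .
  qed
  have decomp: "(LBINT x:{0<..t}. of_real (\<kappa> x) * exp (s * of_real (t - x))) =
    (LBINT x:{0<..X}. of_real (\<kappa> x) * E x) + exp (s * of_real t) * of_real M0 - s * exp (s * of_real t) * of_real M1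
    + (LBINT x:{X<..t}. of_real (\<kappa> x) * exp (s * of_real (t - x)))"
   and Eint: "set_lint {0<..X} (%x. of_real (\<kappa> x) * E x)"
  proof -
   have un: "{0<..t} = {0<..X} \<union> {X<..t}" using X by auto
   have 1: "(LBINT x:{0<..t}. of_real (\<kappa> x) * exp (s * of_real (t - x))) =
    (LBINT x:{0<..X}. of_real (\<kappa> x) * exp (s * of_real (t - x))) + (LBINT x:{X<..t}. of_real (\<kappa> x) * exp (s * of_real (t - x)))"
    unfolding un using X by (intro set_integral_Un eint) auto
   have j0: "set_lint {0<..X} (%x. exp (s * of_real t) * complex_of_real (\<kappa> x))"
    by (intro set_integrable_mult_right set_integrable_cofr sub[OF i0]) auto
   have j1: "set_lint {0<..X} (%x. s * exp (s * of_real t) * complex_of_real (x * \<kappa> x))"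
    by (intro set_integrable_mult_right set_integrable_cofr sub[OF i1]) auto
   have e: "of_real (\<kappa> x) * E x = of_real (\<kappa> x) * exp (s * of_real (t - x)) - (exp (s * of_real t) * complex_of_real (\<kappa> x) - s * exp (s * of_real t) * complex_of_real (x * \<kappa> x))" for x
    by (simp add: E_def algebra_simps)
   show "set_lint {0<..X} (%x. of_real (\<kappa> x) * E x)" unfolding e using X by (intro set_integral_diff(1) j0 j1 eint) auto
   have "(LBINT x:{0<..X}. of_real (\<kappa> x) * E x) = (LBINT x:{0<..X}. of_real (\<kappa> x) * exp (s * of_real (t - x))) - (exp (s * of_real t) * of_real M0 - s * exp (s * of_real t) * of_real M1)"
   proof -
    have "(LBINT x:{0<..X}. of_real (\<kappa> x) * E x) = (LBINT x:{0<..X}. of_real (\<kappa> x) * exp (s * of_real (t - x))) - (LBINT x:{0<..X}. exp (s * of_real t) * complex_of_real (\<kappa> x) - s * exp (s * of_real t) * complex_of_real (x * \<kappa> x))"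
     unfolding e using X by (intro set_integral_diff(2) set_integral_diff(1)[OF j0 j1] eint) auto
    also have "(LBINT x:{0<..X}. exp (s * of_real t) * complex_of_real (\<kappa> x) - s * exp (s * of_real t) * complex_of_real (x * \<kappa> x)) = (LBINT x:{0<..X}. exp (s * of_real t) * complex_of_real (\<kappa> x)) - (LBINT x:{0<..X}. s * exp (s * of_real t) * complex_of_real (x * \<kappa> x))"
     by (rule set_integral_diff(2)[OF j0 j1])
    also have "(LBINT x:{0<..X}. exp (s * of_real t) * complex_of_real (\<kappa> x)) = exp (s * of_real t) * of_real M0"
     by (simp add: M0_def set_integral_complex_of_real)
    also have "(LBINT x:{0<..X}. s * exp (s * of_real t) * complex_of_real (x * \<kappa> x)) = s * exp (s * of_real t) * of_real M1"
     unfolding M1_def set_integral_complex_of_real[symmetric] by (rule set_integral_mult_right)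
    finally show ?thesis .
   qed
   then show "(LBINT x:{0<..t}. of_real (\<kappa> x) * exp (s * of_real (t - x))) =
    (LBINT x:{0<..X}. of_real (\<kappa> x) * E x) + exp (s * of_real t) * of_real M0 - s * exp (s * of_real t) * of_real M1
    + (LBINT x:{X<..t}. of_real (\<kappa> x) * exp (s * of_real (t - x)))" using 1 by simp
  qed
  define Z where "Z = B * t powr (a - 2)"
  have Z: "0 <= Z" using B by (simp add: Z_def)
  have n_est: "cmod (exp (s * of_real t)) <= exp A * exp (- (m/2) * v)" using exp_le Rst by simp
  have T1: "(1 + v) * cmod (LBINT x:{0<..X}. of_real (\<kappa> x) * E x) <= Q\<^sup>2 * exp (3 * A / 2) * P / a * Z"
  proof -
   define c where "c = cmod s ^ 2 * (exp (3 * A / 2) * exp (- (m/2) * v))"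
   have c: "0 <= c" by (simp add: c_def)
   have "cmod (LBINT x:{0<..X}. of_real (\<kappa> x) * E x) <= (LBINT x:{0<..X}. c * B * x powr (a - 1))"
   proof (rule set_integral_norm_le[OF Eint])
    show "set_lint {0<..X} (%x. c * B * x powr (a - 1))"
     using a X by (intro set_integrable_mult_right set_integral_powr_0(1)) auto
    fix x assume x: "x \<in> {0<..X}"
    have "cmod (of_real (\<kappa> x) * E x) <= (B * x powr (a - 3)) * (c * x\<^sup>2)"
     unfolding norm_mult using b[of x] E[of x] x B by (intro mult_mono) (auto simp: c_def mult_ac)
    also have "... = c * B * (x powr 2 * x powr (a - 3))" using x by simp
    also have "x powr 2 * x powr (a - 3) = x powr (a - 1)" by (simp only: powr_add[symmetric]) simp
    finally show "norm (of_real (\<kappa> x) * E x) <= c * B * x powr (a - 1)" .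
   qed
   also have "... = c * B * (X powr a / a)" using set_integral_powr_0(2)[of "a - 1" X] a X by simp
   also have "... <= c * B * (t powr a / a)" using X a c B by (intro mult_left_mono divide_right_mono powr_mono2) auto
   finally have 1: "cmod (LBINT x:{0<..X}. of_real (\<kappa> x) * E x) <= c * B * (t powr a / a)" .
   have 2: "c * t\<^sup>2 <= (Q * (1 + v))\<^sup>2 * (exp (3 * A / 2) * exp (- (m/2) * v))"
   proof -
    have "(cmod s * t)\<^sup>2 <= (Q * (1 + v))\<^sup>2" using ns t by (intro power_mono) auto
    then have "(cmod s * t)\<^sup>2 * (exp (3 * A / 2) * exp (- (m/2) * v)) <= (Q * (1 + v))\<^sup>2 * (exp (3 * A / 2) * exp (- (m/2) * v))" by (intro mult_right_mono) auto
    then show ?thesis by (simp add: c_def power_mult_distrib mult_ac)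
   qed
   have ta: "t powr a = t\<^sup>2 * t powr (a - 2)" using t by (simp add: powr_diff)
   have "(1 + v) * cmod (LBINT x:{0<..X}. of_real (\<kappa> x) * E x) <= (1 + v) * (c * B * (t powr a / a))"
    using 1 v by (intro mult_left_mono) auto
   also have "... = (1 + v) * (c * t\<^sup>2) * (Z / a)" unfolding ta Z_def by simp
   also have "... <= (1 + v) * ((Q * (1 + v))\<^sup>2 * (exp (3 * A / 2) * exp (- (m/2) * v))) * (Z / a)"
    using 2 v Z a by (intro mult_right_mono mult_left_mono) auto
   also have "... = Q\<^sup>2 * exp (3 * A / 2) * ((1 + v) * (1 + v)^2 * exp (- (m/2) * v)) * (Z / a)" by (simp add: power_mult_distrib mult_ac)
   also have "... <= Q\<^sup>2 * exp (3 * A / 2) * P * (Z / a)" using dec[of 2] Z a by (intro mult_right_mono mult_left_mono) auto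
   finally show ?thesis by simp
  qed
  have T2: "(1 + v) * cmod (exp (s * of_real t) * of_real M0) <= exp A * P * 4 * Z"
  proof -
   have "cmod (exp (s * of_real t) * of_real M0) <= (exp A * exp (- (m/2) * v)) * (4 * Z)"
    unfolding norm_mult using n_est M0 by (intro mult_mono) (auto simp: Z_def mult_ac)
   then have "(1 + v) * cmod (exp (s * of_real t) * of_real M0) <= (1 + v) * ((exp A * exp (- (m/2) * v)) * (4 * Z))"
    using v by (intro mult_left_mono) auto
   also have "... = exp A * 4 * Z * ((1 + v) * (1 + v) ^ 0 * exp (- (m/2) * v))" by (simp add: mult_ac)
   also have "... <= exp A * 4 * Z * P" using dec[of 0] Z by (intro mult_left_mono) auto
   finally show ?thesis by (simp add: mult_ac)
  qed
  have T3: "(1 + v) * cmod (s * exp (s * of_real t) * of_real M1) <= Q * exp A * P * (2 / (1 - a)) * Z"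
  proof -
   have "cmod (s * exp (s * of_real t) * of_real M1) <= cmod s * (exp A * exp (- (m/2) * v)) * (B * (2 / (1 - a) * t powr (a - 1)))"
    unfolding norm_mult using n_est M1 by (intro mult_mono mult_left_mono) auto
   also have "t powr (a - 1) = t * t powr (a - 2)" using t by (simp add: powr_diff power2_eq_square)
   finally have "cmod (s * exp (s * of_real t) * of_real M1) <= cmod s * t * (exp A * exp (- (m/2) * v) * (2 / (1 - a) * Z))" by (simp add: Z_def mult_ac)
   also have "... <= Q * (1 + v) * (exp A * exp (- (m/2) * v) * (2 / (1 - a) * Z))" using ns Z a by (intro mult_right_mono) auto
   finally have "(1 + v) * cmod (s * exp (s * of_real t) * of_real M1) <= (1 + v) * (Q * (1 + v) * (exp A * exp (- (m/2) * v) * (2 / (1 - a) * Z)))"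
    using v by (intro mult_left_mono) auto
   also have "... = Q * exp A * (2 / (1 - a)) * Z * ((1 + v) * (1 + v) ^ 1 * exp (- (m/2) * v))" by (simp add: mult_ac)
   also have "... <= Q * exp A * (2 / (1 - a)) * Z * P" using dec[of 1] Z Q a by (intro mult_left_mono) auto
   finally show ?thesis by (simp add: mult_ac)
  qed
  have T4: "(1 + v) * cmod (LBINT x:{X<..t}. of_real (\<kappa> x) * exp (s * of_real (t - x))) <= 16 * exp A * (1 + 1 / m) * Z"
  proof -
   define c where "c = B * X powr (a - 3) * exp A"
   have c: "0 <= c" using B by (simp add: c_def)
   note ed = set_integral_exp_decay[of "m * \<bar>y\<bar>" X t]
   define J where "J = (LBINT x:{X<..t}. damp m y (t - x))"
   have Jn: "0 <= J" unfolding J_def set_lebesgue_integral_def by (intro Bochner_Integration.integral_nonneg) auto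
   have "cmod (LBINT x:{X<..t}. of_real (\<kappa> x) * exp (s * of_real (t - x))) <= (LBINT x:{X<..t}. c * damp m y (t - x))"
   proof (rule set_integral_norm_le)
    show "set_lint {X<..t} (%x. of_real (\<kappa> x) * exp (s * of_real (t - x)))" using X by (intro eint) auto
    show "set_lint {X<..t} (%x. c * damp m y (t - x))" using ed(1) m X by (intro set_integrable_mult_right) auto
    fix x assume x: "x \<in> {X<..t}"
    then have x0: "0 < x" using X by simp
    have "B * x powr (a - 3) <= B * X powr (a - 3)" using B a x X by (intro mult_left_mono powr_mono2') auto
    then have 1: "\<bar>\<kappa> x\<bar> <= B * X powr (a - 3)" using b[OF x0] by linarith
    have "A / t * (t - x) <= A / t * t" using A t x0 by (intro mult_left_mono) auto
    then have "Re s * (t - x) <= A + (- (m * \<bar>y\<bar>) * (t - x))" using t by (simp add: Re_s left_diff_distrib)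
    then have 2: "cmod (exp (s * of_real (t - x))) <= exp A * damp m y (t - x)" by (simp add: exp_add[symmetric])
    show "norm (of_real (\<kappa> x) * exp (s * of_real (t - x))) <= c * damp m y (t - x)"
     using mult_mono[OF 1 2] B by (simp add: norm_mult c_def mult_ac)
   qed
   also have "... = c * J" by (simp add: J_def)
   finally have 1: "cmod (LBINT x:{X<..t}. of_real (\<kappa> x) * exp (s * of_real (t - x))) <= c * J" .
   have "(1 + v) * J <= (1 + 1 / m) * ((1 + m * v) * J)"
   proof -
    have "(1 + 1 / m) * (1 + m * v) = 1 + m * v + 1 / m + v" using m by (simp add: algebra_simps)
    moreover have "0 <= m * v" "0 <= 1 / m" using m v by auto
    ultimately have "1 + v <= (1 + 1 / m) * (1 + m * v)" by linarith
    then show ?thesis using Jn mult_right_mono[of "1 + v" "(1 + 1 / m) * (1 + m * v)" J] by (simp add: mult_ac)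
   qed
   also have "(1 + m * v) * J <= 2 * t" using ed(2) m X t by (simp add: J_def v_def mult_ac)
   finally have 2: "(1 + v) * J <= (1 + 1 / m) * (2 * t)" using m by (simp add: mult_left_mono)
   have "X powr (a - 3) = 2 powr (3 - a) * t powr (a - 3)" using t by (simp add: X_def powr_divide powr_diff field_simps)
   also have "2 powr (3 - a) <= (2::real) powr 3" using a by (intro powr_mono) auto
   finally have "X powr (a - 3) <= 8 * t powr (a - 3)" by (simp add: mult_right_mono)
   then have 3: "c <= B * (8 * t powr (a - 3)) * exp A" unfolding c_def using B by (intro mult_right_mono mult_left_mono) auto
   have "(1 + v) * cmod (LBINT x:{X<..t}. of_real (\<kappa> x) * exp (s * of_real (t - x))) <= (1 + v) * (c * J)" using 1 v by (intro mult_left_mono) auto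
   also have "... = c * ((1 + v) * J)" by (rule mult.left_commute)
   also have "... <= (B * (8 * t powr (a - 3)) * exp A) * ((1 + 1 / m) * (2 * t))"
   proof (rule mult_mono[OF 3 2])
    show "0 <= B * (8 * t powr (a - 3)) * exp A" using B by simp
    show "0 <= (1 + v) * J" using v Jn by simp
   qed
   also have "... = 16 * exp A * (1 + 1 / m) * (B * (t * t powr (a - 3)))"
   proof -
    have gen: "(B * (8 * p) * e) * (q * (2 * t)) = 16 * e * q * (B * (t * p))" for p e q :: real by algebra
    show ?thesis by (rule gen)
   qed
   also have "t * t powr (a - 3) = t powr (a - 2)" using t powr_add[of t 1 "a - 3"] by simp
   finally show ?thesis by (simp add: Z_def)
  qed
  have "(1 + v) * cmod (LBINT x:{0<..t}. of_real (\<kappa> x) * exp (s * of_real (t - x))) <= K * Z"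
  proof -
   define H1 where "H1 = (LBINT x:{0<..X}. of_real (\<kappa> x) * E x)"
   define H2 where "H2 = exp (s * of_real t) * complex_of_real M0"
   define H3 where "H3 = s * exp (s * of_real t) * complex_of_real M1"
   define H4 where "H4 = (LBINT x:{X<..t}. of_real (\<kappa> x) * exp (s * of_real (t - x)))"
   have "cmod (H1 + H2 - H3 + H4) <= cmod H1 + cmod H2 + cmod H3 + cmod H4"
    using norm_triangle_ineq[of "H1 + H2 - H3" H4] norm_triangle_ineq4[of "H1 + H2" H3] norm_triangle_ineq[of H1 H2] by linarith
   then have "(1 + v) * cmod (H1 + H2 - H3 + H4) <= (1 + v) * (cmod H1 + cmod H2 + cmod H3 + cmod H4)" using v by (intro mult_left_mono) auto
   also have "... <= K * Z"
    using T1 T2 T3 T4 unfolding H1_def[symmetric] H2_def[symmetric] H3_def[symmetric] H4_def[symmetric] K_def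
     distrib_left distrib_right by linarith
   finally show ?thesis unfolding decomp H1_def H2_def H3_def H4_def .
  qed
  then have "cmod (LBINT x:{0<..t}. of_real (\<kappa> x) * exp (s * of_real (t - x))) * (1 + v) <= K * B * t powr (a - 2)"
   unfolding Z_def by (simp only: mult_ac)
  then show "cmod (LBINT x:{0<..t}. of_real (\<kappa> x) * exp (vcontour (A / t) m y * of_real (t - x))) <= K * B * t powr (a - 2) / (1 + \<bar>y\<bar> * t)"
   using v unfolding s_def[symmetric] v_def[symmetric] by (subst pos_le_divide_eq) auto
 qed
qed

section \<open>Laplace inversion\<close>

text \<open>Joint integrability is obtained from a majorant \<open>G\<close> of the inner L1 norms,
  which for contour integrals is a power of 1 + |y|.\<close>

lemma fubini_swap:
 fixes F :: "real => real => complex"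
 assumes meas [measurable]: "(%(x, y). F x y) \<in> borel_measurable (borel \<Otimes>\<^sub>M borel)"
  and int: "!!y. integrable lborel (%x. F x y)"
  and bnd: "integrable lborel G" "!!y. (LBINT x. cmod (F x y)) <= G y"
 shows "integrable lborel (%x. LBINT y. F x y)"
  and "(LBINT x. LBINT y. F x y) = (LBINT y. LBINT x. F x y)"
  and "integrable lborel (%y. LBINT x. F x y)"
proof -
 have m: "(%z. F (snd z) (fst z)) \<in> borel_measurable (lborel \<Otimes>\<^sub>M lborel)" by measurable
 have i: "integrable (lborel \<Otimes>\<^sub>M lborel) (%z. F (snd z) (fst z))"
 proof (rule lborel_pair.Fubini_integrable[OF m])
  have "integrable lborel (%y. LBINT x. cmod (F x y))"
  proof (rule Bochner_Integration.integrable_bound[OF bnd(1)])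
   show "(%y. LBINT x. cmod (F x y)) \<in> borel_measurable lborel" by measurable
   have "\<bar>LBINT x. cmod (F x y)\<bar> <= \<bar>G y\<bar>" for y
   proof -
    have "0 <= (LBINT x. cmod (F x y))" by (intro Bochner_Integration.integral_nonneg) auto
    then show ?thesis using bnd(2)[of y] by linarith
   qed
   then show "AE y in lborel. norm (LBINT x. cmod (F x y)) <= norm (G y)" by simp
  qed
  then show "integrable lborel (%x. LBINT y. norm (F (snd (x, y)) (fst (x, y))))" by simp
 qed (use int in auto)
 have i2: "integrable (lborel \<Otimes>\<^sub>M lborel) (%(x, y). F y x)" using i by (simp add: case_prod_beta')
 show "integrable lborel (%y. LBINT x. F x y)" using lborel_pair.integrable_fst'[OF i2] by simp
 show "integrable lborel (%x. LBINT y. F x y)" using lborel_pair.integrable_snd[OF i2] by simp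
 show "(LBINT x. LBINT y. F x y) = (LBINT y. LBINT x. F x y)"
  using lborel_pair.Fubini_integral[OF i2] by simp
qed

lemma integrable_one_plus_abs_powr:
 fixes p :: real assumes p: "1 < p"
 shows "integrable lborel (%y::real. (1 + \<bar>y\<bar>) powr (- p))"
proof -
 have h: "integrable lborel (%x. indicator {1..} x *\<^sub>R x powr (- p))"
  using set_integrable_powr_1_inf[of "-p"] p by (simp add: set_integrable_def)
 have 1: "integrable lborel (%x. indicator {1..} (1 + 1 * x) *\<^sub>R (1 + 1 * x) powr (- p))"
  by (rule lborel_integrable_real_affine[OF h]) simp
 have 2: "integrable lborel (%x. indicator {1..} (1 + (-1) * x) *\<^sub>R (1 + (-1) * x) powr (- p))"
  by (rule lborel_integrable_real_affine[OF h]) simp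
 show ?thesis
  by (rule Bochner_Integration.integrable_bound[OF Bochner_Integration.integrable_add[OF 1 2]])
   (auto simp: indicator_def abs_if)
qed

lemma vcontour_0 [simp]: "vcontour b 0 y = Complex b y"
 by (simp add: vcontour_def)

text \<open>For |y| < \<delta> = v / (2 (1 + m)) the real part is still at least \<delta>; otherwise
  |y| itself is a lower bound. Hence the contour keeps a distance from 0 and grows linearly.\<close>

lemma vcontour_norm_ge:
 assumes "0 < v" "0 <= m"
 obtains c where "0 < c" "!!y. c * (1 + \<bar>y\<bar>) <= cmod (vcontour v m y)"
proof -
 define \<delta> where "\<delta> = v / (2 * (1 + m))"
 have \<delta>: "0 < \<delta>" using assms by (simp add: \<delta>_def)
 have "max \<bar>y\<bar> \<delta> <= cmod (vcontour v m y)" for y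
 proof -
  have 1: "\<bar>y\<bar> <= cmod (vcontour v m y)" using abs_Im_le_cmod[of "vcontour v m y"] by (simp add: vcontour_def)
  have "\<delta> <= cmod (vcontour v m y)" if "\<bar>y\<bar> < \<delta>"
  proof -
   have "m * \<bar>y\<bar> <= m * \<delta>" using that assms by (intro mult_left_mono) auto
   also have "m * \<delta> <= v - \<delta>" using assms by (simp add: \<delta>_def field_simps)
   finally have "\<delta> <= Re (vcontour v m y)" by (simp add: vcontour_def)
   then show ?thesis using complex_Re_le_cmod[of "vcontour v m y"] by linarith
  qed
  then show ?thesis using 1 by (cases "\<bar>y\<bar> < \<delta>") auto
 qed note M = this
 have "\<delta> / (1 + \<delta>) * (1 + \<bar>y\<bar>) <= cmod (vcontour v m y)" for y
 proof -
  have "\<delta> * (1 + \<bar>y\<bar>) <= max \<bar>y\<bar> \<delta> + \<delta> * max \<bar>y\<bar> \<delta>" using \<delta> by (simp add: distrib_left add_mono mult_left_mono)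
  also have "... = (1 + \<delta>) * max \<bar>y\<bar> \<delta>" by (simp add: algebra_simps)
  finally have "\<delta> / (1 + \<delta>) * (1 + \<bar>y\<bar>) <= max \<bar>y\<bar> \<delta>" using \<delta> by (simp add: pos_divide_le_eq mult.commute)
  then show ?thesis using M[of y] by linarith
 qed
 then show ?thesis using that[of "\<delta> / (1 + \<delta>)"] \<delta> by simp
qed

lemma vcontour_powr_le:
 assumes "0 < v" "0 <= m" "0 <= p"
 obtains C where "0 < C" "!!y. cmod (vcontour v m y) powr (- p) <= C * (1 + \<bar>y\<bar>) powr (- p)"
proof -
 obtain c where c: "0 < c" "!!y. c * (1 + \<bar>y\<bar>) <= cmod (vcontour v m y)" using vcontour_norm_ge[OF assms(1,2)] by metis
 have "cmod (vcontour v m y) powr (- p) <= c powr (- p) * (1 + \<bar>y\<bar>) powr (- p)" for y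
 proof -
  have "cmod (vcontour v m y) powr (- p) <= (c * (1 + \<bar>y\<bar>)) powr (- p)" using c assms by (intro powr_mono2') auto
  then show ?thesis using c by (simp add: powr_mult)
 qed
 then show ?thesis using that[of "c powr (- p)"] c by simp
qed

lemma vcontour_measurable [measurable]: "vcontour v m \<in> borel_measurable borel"
 unfolding vcontour_def by (intro borel_measurable_continuous_onI continuous_on_Complex continuous_intros)

lemma lborel_integral_symmetric_limit:
 fixes F :: "real => complex"
 assumes "integrable lborel F"
 shows "(%n. LBINT y:{- real n..real n}. F y) \<longlonglongrightarrow> (LBINT y. F y)"
 unfolding set_lebesgue_integral_def
proof (rule integral_dominated_convergence)
 show "integrable lborel (%y. norm (F y))" using assms by simp
 show "AE y in lborel. (%n. indicator {- real n..real n} y *\<^sub>R F y) \<longlonglongrightarrow> F y"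
 proof (intro AE_I2)
  fix y
  obtain N where N: "\<bar>y\<bar> <= real N" using real_arch_simple by blast
  have "\<forall>\<^sub>F n in sequentially. indicator {- real n..real n} y *\<^sub>R F y = F y"
   using eventually_ge_at_top[of N] by eventually_elim (use N in \<open>auto simp: indicator_def\<close>)
  then show "(%n. indicator {- real n..real n} y *\<^sub>R F y) \<longlonglongrightarrow> F y" by (rule tendsto_eventually)
 qed
qed (use assms in \<open>auto simp: indicator_def\<close>)

text \<open>Half-open intervals generate the Borel sets and are stable under intersection, so the
  integral vanishes over every Borel set.\<close>

lemma AE_zero_of_Ioc_integrals:
 fixes h :: "real => complex"
 assumes h: "integrable lborel h" and z: "!!u w. (LBINT r:{u<..w}. h r) = 0"
 shows "AE r in lborel. h r = 0"
proof (rule sigma_finite_measure.density_zero[OF sigma_finite_lborel h])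
 have si: "set_lint S h" if "S \<in> sets borel" for S
  using h that by (simp add: set_integrable_def integrable_mult_indicator)
 have U: "(LBINT r:UNIV. h r) = 0"
 proof -
  have "(%n. LBINT r:{- real n..real n}. h r) \<longlonglongrightarrow> (LBINT r. h r)" by (rule lborel_integral_symmetric_limit[OF h])
  moreover have "(LBINT r:{- real n..real n}. h r) = 0" for n
  proof -
   have "(LBINT r:{- real n..real n}. h r) = (LBINT r:{- real n<..real n}. h r)"
    unfolding set_lebesgue_integral_def using borel_measurable_integrable[OF h] AE_lborel_singleton[of "- real n"]
    by (intro integral_cong_AE) (auto simp: indicator_def)
   then show ?thesis using z by simp
  qed
  ultimately have "(LBINT r. h r) = 0" by (simp add: LIMSEQ_const_iff)
  then show ?thesis by (simp add: set_lebesgue_integral_def)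
 qed
 define G where "G = range (%(a, b). {a<..b::real})"
 have SB: "sets borel = sigma_sets UNIV G"
  unfolding G_def by (subst borel_sigma_sets_Ioc) (simp add: sets_measure_of)
 fix A assume "A \<in> sets (lborel :: real measure)"
 then have A: "A \<in> sigma_sets UNIV G" by (simp add: SB)
 show "(LBINT r:A. h r) = 0"
 proof (rule sigma_sets_induct_disjoint[of G UNIV A "%A. (LBINT r:A. h r) = 0"])
  show "Int_stable G" by (auto simp: Int_stable_def G_def)
  show "(LBINT r:A. h r) = 0" if "A \<in> G" for A using that z by (auto simp: G_def)
  fix A assume AS: "A \<in> sigma_sets UNIV G" and A0: "(LBINT r:A. h r) = 0"
  have "(LBINT r:A \<union> (UNIV - A). h r) = (LBINT r:A. h r) + (LBINT r:UNIV - A. h r)"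
   using AS by (intro set_integral_Un si) (auto simp: SB[symmetric])
  then show "(LBINT r:UNIV - A. h r) = 0" using U A0 by simp
 next
  fix A :: "nat => real set" assume d: "disjoint_family A" and r: "range A \<subseteq> sigma_sets UNIV G" and A0: "!!i. (LBINT r:A i. h r) = 0"
  have "A i \<in> sets borel" for i using r by (auto simp: SB)
  then have "(LBINT r:(\<Union>i. A i). h r) = (\<Sum>i. (LBINT r:A i. h r))"
   using d by (intro lebesgue_integral_countable_add si) (auto simp: disjoint_family_on_def)
  then show "(LBINT r:(\<Union>i. A i). h r) = 0" using A0 by simp
 next
  show "(LBINT r:{}. h r) = 0" by (simp add: set_lebesgue_integral_def)
 qed (use A in simp_all)
qed

text \<open>Inversion of 1 / s^2. For x >= 0 the vertical segment is closed by a box on the left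
  that contains the pole; for x < 0 it is closed on the right, where the integrand is holomorphic.
  The other sides contribute O(1 / R).\<close>

lemma inverse_square_integral:
 fixes b x :: real assumes b: "0 < b"
 shows "integrable lborel (%y. exp (Complex b y * of_real x) / (Complex b y)\<^sup>2)"
  and "(LBINT y. exp (Complex b y * of_real x) / (Complex b y)\<^sup>2) = 2 * pi * of_real (max x 0)"
proof -
 let ?F = "%y. exp (Complex b y * of_real x) / (Complex b y)\<^sup>2"
 obtain C where C: "0 < C" "!!y. cmod (vcontour b 0 y) powr (- 2) <= C * (1 + \<bar>y\<bar>) powr (- 2)"
  using vcontour_powr_le[OF b, of 0 2] by auto
 have [measurable]: "(%y. Complex b y) \<in> borel_measurable borel" using vcontour_measurable[of b 0] by (simp add: vcontour_def[abs_def])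
 have nz: "Complex b y ~= 0" for y using b by (simp add: complex_eq_iff)
 have i: "integrable lborel (%y. exp (b * x) * C * (1 + \<bar>y\<bar>) powr (- 2))"
  by (intro integrable_mult_right integrable_one_plus_abs_powr) simp
 show int: "integrable lborel ?F"
 proof (rule Bochner_Integration.integrable_bound[OF i])
  have "cmod (?F y) <= exp (b * x) * C * (1 + \<bar>y\<bar>) powr (- 2)" for y
  proof -
   have "cmod (?F y) = exp (b * x) * cmod (Complex b y) powr (-2)"
    using nz[of y] by (simp add: norm_divide norm_power powr_minus_divide)
   also have "... <= exp (b * x) * (C * (1 + \<bar>y\<bar>) powr (- 2))" using C(2)[of y] by (intro mult_left_mono) auto
   finally show ?thesis by (simp add: mult_ac)
  qed
  then show "AE y in lborel. norm (?F y) <= norm (exp (b * x) * C * (1 + \<bar>y\<bar>) powr (- 2))"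
   by (intro AE_I2) (metis abs_ge_self order_trans real_norm_def)
 qed measurable
 have part: "(LBINT y:{- real n..real n}. ?F y) = integral {- real n..real n} ?F" for n
  using int by (intro set_borel_integral_eq_integral(2)) (simp add: set_integrable_def integrable_mult_indicator)
 have "(%n. integral {- real n..real n} ?F) \<longlonglongrightarrow> 2 * pi * of_real (max x 0)"
 proof (cases "0 <= x")
  case True
  \<comment> \<open>The holomorphic extension of (e^(z x) - 1) / z, with value x at 0. Subtracting 1
    leaves a simple pole for Cauchy's formula; the subtracted 1 / w^2 has an explicit primitive and
    costs at most 2 / R.\<close>
  define f where "f z = (if z = 0 then deriv (%z. exp (z * of_real x)) 0 else exp (z * of_real x) / z - exp (0 * of_real x) / (z - 0))" for z :: complex
  have f: "f holomorphic_on UNIV" unfolding f_def[abs_def]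
   by (rule pole_theorem[of "%z. exp (z * of_real x)" UNIV 0]) (auto intro!: holomorphic_intros)
  have f0: "f 0 = of_real x"
  proof -
   have "((%z. exp (z * of_real x)) has_field_derivative exp (0 * of_real x) * of_real x) (at (0::complex))"
    by (auto intro!: derivative_eq_intros)
   then show ?thesis by (simp add: f_def DERIV_imp_deriv)
  qed
  define k where "k w = f w / (w - 0)" for w
  have k: "k w = (exp (w * of_real x) - 1) / w\<^sup>2" if "w ~= 0" for w
   using that by (simp add: k_def f_def power2_eq_square field_simps)
  have est: "cmod (integral {- R..R} ?F - 2 * pi * of_real x) <= (exp (b * x) + 1) / R\<^sup>2 * (2 * (b + R) + 2 * R) + 2 / R" if R: "R > 0" for R
  proof -
   define a1 a2 a3 a4 where "a1 = Complex (- R) (- R)" and "a2 = Complex b (- R)" and "a3 = Complex b R" and "a4 = Complex (- R) R"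
   have box: "0 \<in> box a1 a3" using R b by (simp add: a1_def a3_def in_box_complex_iff)
   have wn: "winding_number (rectpath a1 a3) 0 = 1" by (rule winding_number_rectpath[OF box])
   have pi: "path_image (rectpath a1 a3) \<subseteq> UNIV - {0}" using path_image_rectpath_inter_box[of a1 a3] box R b by (auto simp: a1_def a3_def)
   have "(k has_contour_integral 2 * pi * \<i> * winding_number (rectpath a1 a3) 0 * f 0) (rectpath a1 a3)"
    unfolding k_def by (rule Cauchy_integral_formula_convex_simple[OF _ f _ _ pi]) auto
   then have tot: "contour_integral (rectpath a1 a3) k = 2 * pi * \<i> * of_real x"
    by (simp add: wn f0 contour_integral_unique)
   have kc: "continuous_on (- {0}) k" unfolding k_def
    by (intro continuous_intros holomorphic_on_imp_continuous_on[OF holomorphic_on_subset[OF f]]) auto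
   have side: "closed_segment p q \<subseteq> - {0}" if "closed_segment p q \<subseteq> {z. R <= cmod z} \<or> closed_segment p q \<subseteq> {z. 0 < Re z}" for p q :: complex
    using that R by auto
   have s: "closed_segment a1 a2 \<subseteq> {z. R <= cmod z \<and> Re z <= b}" "closed_segment a3 a4 \<subseteq> {z. R <= cmod z \<and> Re z <= b}" "closed_segment a4 a1 \<subseteq> {z. R <= cmod z \<and> Re z <= b}"
   proof -
    have Imb: "R <= cmod z" if "\<bar>Im z\<bar> = R" for z using abs_Im_le_cmod[of z] that by simp
    have Reb: "R <= cmod z" if "Re z = - R" for z using abs_Re_le_cmod[of z] that R by simp
    show "closed_segment a1 a2 \<subseteq> {z. R <= cmod z \<and> Re z <= b}"
    proof
     fix z assume "z \<in> closed_segment a1 a2"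
     then have "\<bar>Im z\<bar> = R" "Re z <= b" using R b by (auto simp: a1_def a2_def closed_segment_same_Im closed_segment_eq_real_ivl split: if_splits)
     then show "z \<in> {z. R <= cmod z \<and> Re z <= b}" using Imb[of z] by simp
    qed
    show "closed_segment a3 a4 \<subseteq> {z. R <= cmod z \<and> Re z <= b}"
    proof
     fix z assume "z \<in> closed_segment a3 a4"
     then have "\<bar>Im z\<bar> = R" "Re z <= b" using R b by (auto simp: a3_def a4_def closed_segment_same_Im closed_segment_eq_real_ivl split: if_splits)
     then show "z \<in> {z. R <= cmod z \<and> Re z <= b}" using Imb[of z] by simp
    qed
    show "closed_segment a4 a1 \<subseteq> {z. R <= cmod z \<and> Re z <= b}"
    proof
     fix z assume "z \<in> closed_segment a4 a1"
     then have "Re z = - R" "Re z <= b" using R b by (auto simp: a1_def a4_def closed_segment_same_Re closed_segment_eq_real_ivl split: if_splits)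
     then show "z \<in> {z. R <= cmod z \<and> Re z <= b}" using Reb[of z] by simp
    qed
   qed
   have sr: "closed_segment a2 a3 \<subseteq> {z. 0 < Re z}" using b by (auto simp: a2_def a3_def closed_segment_same_Re)
   have ci: "k contour_integrable_on linepath a1 a2" "k contour_integrable_on linepath a2 a3" "k contour_integrable_on linepath a3 a4" "k contour_integrable_on linepath a4 a1"
    using s sr by (intro contour_integrable_continuous_linepath continuous_on_subset[OF kc] side; blast)+
   have a24: "Complex (Re a3) (Im a1) = a2" "Complex (Re a1) (Im a3) = a4" by (auto simp: a1_def a2_def a3_def a4_def)
   have "contour_integral (rectpath a1 a3) k = contour_integral (linepath a1 a2) k + contour_integral (linepath a2 a3) k + contour_integral (linepath a3 a4) k + contour_integral (linepath a4 a1) k"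
    unfolding rectpath_def Let_def a24 using ci by (simp add: valid_path_join)
   then have r: "contour_integral (linepath a2 a3) k - 2 * pi * \<i> * of_real x = - (contour_integral (linepath a1 a2) k + contour_integral (linepath a3 a4) k + contour_integral (linepath a4 a1) k)"
    using tot by (simp add: algebra_simps)
   have kb: "cmod (k w) <= (exp (b * x) + 1) / R\<^sup>2" if "R <= cmod w \<and> Re w <= b" for w
   proof -
    have w0: "w ~= 0" using that R by auto
    have "Re w * x <= b * x" using that True by (intro mult_right_mono) auto
    then have "exp (Re w * x) <= exp (b * x)" by (simp only: exp_le_cancel_iff)
    moreover have "cmod (exp (w * of_real x) - 1) <= exp (Re w * x) + 1" using norm_triangle_ineq4[of "exp (w * of_real x)" 1] by simp
    ultimately have "cmod (exp (w * of_real x) - 1) <= exp (b * x) + 1" by linarith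
    moreover have "R\<^sup>2 <= (cmod w)\<^sup>2" using that R by (intro power_mono) auto
    ultimately show ?thesis unfolding k[OF w0] norm_divide norm_power using R by (intro frac_le) auto
   qed
   define B where "B = (exp (b * x) + 1) / R\<^sup>2"
   have B: "0 <= B" by (simp add: B_def add_nonneg_nonneg)
   have "cmod (contour_integral (linepath a1 a2) k) <= B * cmod (a2 - a1)" "cmod (contour_integral (linepath a3 a4) k) <= B * cmod (a4 - a3)" "cmod (contour_integral (linepath a4 a1) k) <= B * cmod (a1 - a4)"
    using ci kb s B unfolding B_def[symmetric]
    by (intro contour_integral_bound_linepath; blast)+
   moreover have "a2 - a1 = of_real (b + R)" "a4 - a3 = - of_real (b + R)" "a1 - a4 = - (\<i> * of_real (2 * R))"
    by (auto simp: a1_def a2_def a3_def a4_def complex_eq_iff)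
   ultimately have c: "cmod (contour_integral (linepath a1 a2) k) <= B * (b + R)" "cmod (contour_integral (linepath a3 a4) k) <= B * (b + R)" "cmod (contour_integral (linepath a4 a1) k) <= B * (2 * R)"
    using R b by (auto simp: norm_mult simp del: of_real_add)
   have "cmod (contour_integral (linepath a2 a3) k - 2 * pi * \<i> * of_real x) <= B * (b + R) + B * (b + R) + B * (2 * R)"
    unfolding r norm_minus_cancel using c norm_triangle_ineq[of "contour_integral (linepath a1 a2) k + contour_integral (linepath a3 a4) k" "contour_integral (linepath a4 a1) k"]
     norm_triangle_ineq[of "contour_integral (linepath a1 a2) k" "contour_integral (linepath a3 a4) k"] by linarith
   then have e1: "cmod (contour_integral (linepath a2 a3) k - 2 * pi * \<i> * of_real x) <= B * (2 * (b + R) + 2 * R)" by (simp add: algebra_simps)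
   have "((%w. 1 / w\<^sup>2) has_contour_integral (- 1 / a3) - (- 1 / a2)) (linepath a2 a3)"
   proof -
    have "((%w. - 1 / w) has_field_derivative 1 / w\<^sup>2) (at w within {z. 0 < Re z})" if "w \<in> {z. 0 < Re z}" for w
    proof -
     have "w ~= 0" using that by auto
     then show ?thesis by (auto intro!: derivative_eq_intros simp: power2_eq_square)
    qed
    then show ?thesis using contour_integral_primitive[of "{z. 0 < Re z}" "%w. - 1 / w" "%w. 1 / w\<^sup>2" "linepath a2 a3"] sr by simp
   qed
   moreover have "(k has_contour_integral contour_integral (linepath a2 a3) k) (linepath a2 a3)" using ci by (simp add: has_contour_integral_integral)
   ultimately have "((%w. k w + 1 / w\<^sup>2) has_contour_integral (contour_integral (linepath a2 a3) k + ((- 1 / a3) - (- 1 / a2)))) (linepath a2 a3)"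
    by (intro has_contour_integral_add)
   then have "((%w. exp (w * of_real x) / w\<^sup>2) has_contour_integral (contour_integral (linepath a2 a3) k + ((- 1 / a3) - (- 1 / a2)))) (linepath a2 a3)"
   proof (rule has_contour_integral_eq)
    fix w assume "w \<in> path_image (linepath a2 a3)"
    then have "w ~= 0" using sr by auto
    then show "k w + 1 / w\<^sup>2 = exp (w * of_real x) / w\<^sup>2" unfolding k[OF \<open>w ~= 0\<close>] by (simp add: diff_divide_distrib)
   qed
   then have "contour_integral (linepath a2 a3) (%w. exp (w * of_real x) / w\<^sup>2) = contour_integral (linepath a2 a3) k + ((- 1 / a3) - (- 1 / a2))"
    by (rule contour_integral_unique)
   moreover have "contour_integral (linepath a2 a3) (%w. exp (w * of_real x) / w\<^sup>2) = \<i> * integral {-R..R} ?F"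
    using R by (subst contour_integral_linepath_same_Re[of _ b _ "-R" R]) (auto simp: a2_def a3_def)
   ultimately have e2: "\<i> * (integral {-R..R} ?F - 2 * pi * of_real x) = (contour_integral (linepath a2 a3) k - 2 * pi * \<i> * of_real x) + ((- 1 / a3) - (- 1 / a2))"
    by (simp add: algebra_simps)
   have "R <= cmod a3" "R <= cmod a2" using abs_Im_le_cmod[of a3] abs_Im_le_cmod[of a2] R by (auto simp: a2_def a3_def)
   then have "1 / cmod a3 <= 1 / R" "1 / cmod a2 <= 1 / R" using R by (auto intro!: divide_left_mono mult_pos_pos)
   then have "cmod ((- 1 / a3) - (- 1 / a2)) <= 2 / R"
    using norm_triangle_ineq4[of "- 1 / a3" "- 1 / a2"] by (simp add: norm_divide)
   then have "cmod (\<i> * (integral {-R..R} ?F - 2 * pi * of_real x)) <= B * (2 * (b + R) + 2 * R) + 2 / R"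
    unfolding e2 using e1 norm_triangle_ineq[of "contour_integral (linepath a2 a3) k - 2 * pi * \<i> * of_real x" "(- 1 / a3) - (- 1 / a2)"] by linarith
   then show ?thesis by (simp add: norm_mult B_def)
  qed
  have l: "(%n::nat. (exp (b * x) + 1) / (real n)\<^sup>2 * (2 * (b + real n) + 2 * real n) + 2 / real n) \<longlonglongrightarrow> 0" by real_asymp
  have "(%n. integral {- real n..real n} ?F - 2 * pi * of_real x) \<longlonglongrightarrow> 0"
   by (rule Lim_null_comparison[OF _ l]) (use est in \<open>auto intro!: eventually_mono[OF eventually_gt_at_top[of 0]]\<close>)
  then have "(%n. integral {- real n..real n} ?F) \<longlonglongrightarrow> 2 * pi * of_real x" by (simp add: LIM_zero_iff)
  then show ?thesis using True by (simp add: max_def)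
 next
  case False
  then have x: "x < 0" by simp
  have est: "cmod (integral {- R..R} ?F) <= 2 / R + exp (x * R) / R\<^sup>2 * (2 * R)" if R: "R > 0" for R
  proof -
   define h where "h w = exp (w * of_real x) / w\<^sup>2" for w :: complex
   have cv: "convex {z. 0 < Re z}" by (rule convex_halfspace_Re_gt)
   obtain H where H: "!!z. z \<in> {z. 0 < Re z} ==> (H has_field_derivative h z) (at z within {z. 0 < Re z})"
   proof (rule holomorphic_convex_primitive'[OF cv])
    show "h holomorphic_on {z. 0 < Re z}" unfolding h_def by (intro holomorphic_intros) auto
   qed (auto simp: open_halfspace_Re_gt)
   have seg: "cmod (H q - H p) <= M * cmod (q - p)" if "closed_segment p q \<subseteq> {z. 0 < Re z}" "!!z. z \<in> closed_segment p q ==> cmod (h z) <= M" for p q M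
   proof (rule field_differentiable_bound[of "closed_segment p q" H h])
    show "(H has_field_derivative h z) (at z within closed_segment p q)" if "z \<in> closed_segment p q" for z
     using H that \<open>closed_segment p q \<subseteq> _\<close> DERIV_subset by blast
   qed (use that in auto)
   have hb: "cmod (h w) <= 1 / R\<^sup>2 * exp (x * Re w)" if "R <= cmod w" for w
   proof -
    have "R\<^sup>2 <= (cmod w)\<^sup>2" using that R by (intro power_mono) auto
    then show ?thesis unfolding h_def norm_divide norm_power using R by (auto simp: mult.commute intro!: frac_le)
   qed
   have hor: "cmod (H (Complex (b + R) s) - H (Complex b s)) <= 1 / R\<^sup>2 * R" if "\<bar>s\<bar> = R" for s
   proof -
    have "cmod (H (Complex (b + R) s) - H (Complex b s)) <= 1 / R\<^sup>2 * cmod (Complex (b + R) s - Complex b s)"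
    proof (rule seg)
     show "closed_segment (Complex b s) (Complex (b + R) s) \<subseteq> {z. 0 < Re z}" using R b by (auto simp: closed_segment_same_Im closed_segment_eq_real_ivl)
     fix z assume "z \<in> closed_segment (Complex b s) (Complex (b + R) s)"
     then have z: "Im z = s" "b <= Re z" using R by (auto simp: closed_segment_same_Im closed_segment_eq_real_ivl)
     then have "R <= cmod z" using abs_Im_le_cmod[of z] \<open>\<bar>s\<bar> = R\<close> by simp
     moreover have "exp (x * Re z) <= 1" using z b x by (simp add: mult_nonpos_nonneg)
     ultimately show "cmod (h z) <= 1 / R\<^sup>2" using hb[of z] mult_left_mono[of "exp (x * Re z)" 1 "1 / R\<^sup>2"] by simp
    qed
    moreover have "Complex (b + R) s - Complex b s = of_real R" by (simp add: complex_eq_iff)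
    ultimately show ?thesis using R by simp
   qed
   have ver: "cmod (H (Complex (b + R) R) - H (Complex (b + R) (- R))) <= 1 / R\<^sup>2 * exp (x * R) * (2 * R)"
   proof -
    have "cmod (H (Complex (b + R) R) - H (Complex (b + R) (- R))) <= 1 / R\<^sup>2 * exp (x * R) * cmod (Complex (b + R) R - Complex (b + R) (- R))"
    proof (rule seg)
     show "closed_segment (Complex (b + R) (- R)) (Complex (b + R) R) \<subseteq> {z. 0 < Re z}" using R b by (auto simp: closed_segment_same_Re)
     fix z assume "z \<in> closed_segment (Complex (b + R) (- R)) (Complex (b + R) R)"
     then have z: "Re z = b + R" by (auto simp: closed_segment_same_Re)
     then have "R <= cmod z" using abs_Re_le_cmod[of z] b R by simp
     moreover have "exp (x * Re z) <= exp (x * R)" using z b x by (simp add: mult_left_mono_neg)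
     ultimately show "cmod (h z) <= 1 / R\<^sup>2 * exp (x * R)" using hb[of z] mult_left_mono[of "exp (x * Re z)" "exp (x * R)" "1 / R\<^sup>2"] by simp
    qed
    moreover have "Complex (b + R) R - Complex (b + R) (- R) = \<i> * of_real (2 * R)" by (simp add: complex_eq_iff)
    ultimately show ?thesis using R by (simp add: norm_mult)
   qed
   have "(h has_contour_integral H (Complex b R) - H (Complex b (- R))) (linepath (Complex b (- R)) (Complex b R))"
   proof -
    have "path_image (linepath (Complex b (- R)) (Complex b R)) \<subseteq> {z. 0 < Re z}" using b by (auto simp: closed_segment_same_Re)
    then show ?thesis using contour_integral_primitive[of "{z. 0 < Re z}" H h "linepath (Complex b (- R)) (Complex b R)", OF H] by simp
   qed
   then have "contour_integral (linepath (Complex b (- R)) (Complex b R)) h = H (Complex b R) - H (Complex b (- R))" by (rule contour_integral_unique)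
   moreover have "contour_integral (linepath (Complex b (- R)) (Complex b R)) h = \<i> * integral {-R..R} ?F"
    using R by (subst contour_integral_linepath_same_Re[of _ b _ "-R" R]) (auto simp: h_def)
   ultimately have e: "\<i> * integral {-R..R} ?F = (H (Complex (b + R) R) - H (Complex (b + R) (- R))) - (H (Complex (b + R) R) - H (Complex b R)) + (H (Complex (b + R) (- R)) - H (Complex b (- R)))"
    by simp
   have "cmod (\<i> * integral {-R..R} ?F) <= 1 / R\<^sup>2 * exp (x * R) * (2 * R) + 1 / R\<^sup>2 * R + 1 / R\<^sup>2 * R"
    unfolding e using ver hor[of R] hor[of "-R"] R
     norm_triangle_ineq[of "(H (Complex (b + R) R) - H (Complex (b + R) (- R))) - (H (Complex (b + R) R) - H (Complex b R))" "(H (Complex (b + R) (- R)) - H (Complex b (- R)))"]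
     norm_triangle_ineq4[of "(H (Complex (b + R) R) - H (Complex (b + R) (- R)))" "(H (Complex (b + R) R) - H (Complex b R))"] by simp
   then show ?thesis using R by (simp add: norm_mult power2_eq_square field_simps)
  qed
  have l: "(%n::nat. 2 / real n + exp (x * real n) / (real n)\<^sup>2 * (2 * real n)) \<longlonglongrightarrow> 0" using x by real_asymp
  have "(%n. integral {- real n..real n} ?F) \<longlonglongrightarrow> 0"
   by (rule Lim_null_comparison[OF _ l]) (use est in \<open>auto intro!: eventually_mono[OF eventually_gt_at_top[of 0]]\<close>)
  then show ?thesis using x by (simp add: max_def)
 qed
 then have "(%n. LBINT y:{- real n..real n}. ?F y) \<longlonglongrightarrow> 2 * pi * of_real (max x 0)" unfolding part .
 then show "(LBINT y. ?F y) = 2 * pi * of_real (max x 0)"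
  using lborel_integral_symmetric_limit[OF int] LIMSEQ_unique by blast
qed

lemma set_integral_exp_decay':
 fixes c t :: real assumes "0 <= c" "0 <= t"
 shows "set_lint {0<..t} (%r. exp (- c * r))" "(1 + c * t) * (LBINT r:{0<..t}. exp (- c * r)) <= 2 * t"
proof -
 show i: "set_lint {0<..t} (%r. exp (- c * r))"
  by (rule set_integrable_subset[OF borel_integrable_atLeastAtMost'[of 0 t]]) (auto intro!: continuous_intros)
 define J where "J = (LBINT r:{0<..t}. exp (- c * r))"
 have "J <= (LBINT r:{0<..t}. 1)" unfolding J_def
  using assms by (intro set_integral_mono i) (auto simp: set_integrable_def)
 also have "... = t" using assms by (simp add: set_lebesgue_integral_def)
 finally have 1: "J <= t" .
 have 2: "c * J <= 1"
 proof -
  have "((%r. c * exp (- c * r)) has_integral - exp (- c * t) - (- exp (- c * 0))) {0..t}"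
   using assms by (intro fundamental_theorem_of_calculus)
    (auto intro!: derivative_eq_intros simp: has_real_derivative_iff_has_vector_derivative[symmetric])
  then have h: "((%r. c * exp (- c * r)) has_integral - exp (- c * t) - (- exp (- c * 0))) {0<..t}"
   by (rule has_integral_spike_set_eq[THEN iffD1, rotated 2]) (auto intro: negligible_subset[of "{0}"])
  have "(LBINT r:{0<..t}. c * exp (- c * r)) = - exp (- c * t) - (- exp (- c * 0))"
   using assms by (intro set_integrable_lborelI_nonneg(2)[OF h]) auto
  then show ?thesis by (simp add: J_def)
 qed
 have "c * t * J <= t * 1" using mult_left_mono[OF 2, of t] assms by (simp add: mult_ac)
 then show "(1 + c * t) * (LBINT r:{0<..t}. exp (- c * r)) <= 2 * t"
  using 1 unfolding J_def[symmetric] by (simp add: distrib_right)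
qed

text \<open>The derivative of the contour divided by i. At the corner y = 0, a null set,
  \<open>sgn 0 = 0\<close> gives the value 1.\<close>

definition vdir :: "real => real => complex" where
 "vdir m y = Complex 1 (m * sgn y)"

lemma vdir_measurable [measurable]: "vdir m \<in> borel_measurable borel"
proof -
 have "vdir m = (%y. 1 + \<i> * of_real (m * sgn y))" by (auto simp: vdir_def complex_eq_iff)
 then show ?thesis by simp
qed

lemma vdir_norm: "0 <= m ==> cmod (vdir m y) <= 1 + m"
 using cmod_le[of "vdir m y"] by (auto simp: vdir_def abs_mult sgn_if split: if_splits)

lemma vcontour_has_vector_derivative:
 assumes "y ~= 0"
 shows "(vcontour v m has_vector_derivative \<i> * vdir m y) (at y)"
proof -
 have "((%y. \<bar>y\<bar>) has_real_derivative sgn y) (at y)"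
 proof (cases "0 < y")
  case True
  have "((%y. \<bar>y\<bar>) has_real_derivative 1) (at y)"
   by (rule has_field_derivative_transform_within_open[of "%y. y" _ _ "{0<..}"]) (use True in \<open>auto intro!: derivative_eq_intros\<close>)
  then show ?thesis using True by simp
 next
  case False
  then have y: "y < 0" using assms by simp
  have "((%y. \<bar>y\<bar>) has_real_derivative - 1) (at y)"
   by (rule has_field_derivative_transform_within_open[of "%y. - y" _ _ "{..<0}"]) (use y in \<open>auto intro!: derivative_eq_intros\<close>)
  then show ?thesis using y by simp
 qed
 then have A: "((%y. complex_of_real \<bar>y\<bar>) has_vector_derivative of_real (sgn y)) (at y)"
  by (rule has_vector_derivative_of_real)
 then have "((%y. of_real v - of_real m * complex_of_real \<bar>y\<bar> + \<i> * of_real y) has_vector_derivative 0 - of_real m * of_real (sgn y) + \<i> * of_real 1) (at y)"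
  by (intro has_vector_derivative_add has_vector_derivative_diff has_vector_derivative_const has_vector_derivative_mult_right A has_vector_derivative_of_real DERIV_ident)
 moreover have "vcontour v m = (%y. of_real v - of_real m * complex_of_real \<bar>y\<bar> + \<i> * of_real y)"
  by (auto simp: vcontour_def complex_eq_iff)
 moreover have "0 - of_real m * of_real (sgn y) + \<i> * of_real 1 = \<i> * vdir m y" by (simp add: vdir_def complex_eq_iff)
 ultimately show ?thesis by simp
qed

text \<open>The combination of the values at w + \<delta>, w, u + \<delta>, u with signs +, -, -, +
  annihilates the affine right-hand side, while the same combination of ramps, divided by \<delta>,
  converges to the indicator of (u, w]. Hence \<open>d\<close> integrates to 0 over every such
  interval with u > 0.\<close>

lemma AE_zero_of_linear_convolution:
 fixes d :: "real => complex"
 assumes [measurable]: "d \<in> borel_measurable borel"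
  and int: "!!t. 0 < t ==> set_lint {0<..t} d"
  and lin: "!!t. 0 < t ==> (LBINT r:{0<..t}. of_real (t - r) * d r) = k0 + of_real t * k1"
 shows "AE r in lborel. 0 < r --> d r = 0"
proof -
 have zero: "(LBINT r:{u<..w}. d r) = 0" if uw: "0 < u" "u <= w" for u w
 proof -
  define T where "T = w + 1"
  have T: "0 < T" using uw by (simp add: T_def)
  note iT = int[OF T]
  define P where "P t r = max (t - r) 0" for t r :: real
  have Pint: "set_lint {0<..T} (%r. of_real (P t r) * d r)" if "0 < t" for t
   using set_integrable_mult_right[OF iT, of "complex_of_real t"] unfolding set_integrable_def
  proof (rule Bochner_Integration.integrable_bound)
   show "AE x in lborel. norm (indicator {0<..T} x *\<^sub>R (of_real (P t x) * d x)) <= norm (indicator {0<..T} x *\<^sub>R (complex_of_real t * d x))"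
    using that by (auto simp: indicator_def P_def norm_mult intro!: mult_right_mono)
  qed (simp add: P_def)
  have PI: "(LBINT r:{0<..T}. of_real (P t r) * d r) = k0 + of_real t * k1" if "0 < t" "t <= T" for t
  proof -
   have "(LBINT r:{0<..T}. of_real (P t r) * d r) = (LBINT r:{0<..t}. of_real (t - r) * d r)"
    unfolding set_lebesgue_integral_def using that
    by (intro Bochner_Integration.integral_cong refl) (auto simp: indicator_def P_def)
   then show ?thesis using lin that by simp
  qed
  define Kn where "Kn n r = (P (w + 1 / real (Suc n)) r - P w r - P (u + 1 / real (Suc n)) r + P u r) / (1 / real (Suc n))" for n r
  have Kn0: "(LBINT r:{0<..T}. of_real (Kn n r) * d r) = 0" for n
  proof -
   define \<delta> where "\<delta> = 1 / real (Suc n)"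
   have \<delta>: "0 < \<delta>" "\<delta> <= 1" by (auto simp: \<delta>_def)
   have t: "0 < w + \<delta>" "w + \<delta> <= T" "0 < w" "w <= T" "0 < u + \<delta>" "u + \<delta> <= T" "u <= T" using uw \<delta> by (auto simp: T_def)
   have e: "of_real (Kn n r) * d r = (of_real (P (w + \<delta>) r) * d r - of_real (P w r) * d r - of_real (P (u + \<delta>) r) * d r + of_real (P u r) * d r) / of_real \<delta>" for r
    unfolding Kn_def \<delta>_def[symmetric] by (simp add: algebra_simps add_divide_distrib diff_divide_distrib)
   have "(LBINT r:{0<..T}. of_real (Kn n r) * d r) = (LBINT r:{0<..T}. (of_real (P (w + \<delta>) r) * d r - of_real (P w r) * d r - of_real (P (u + \<delta>) r) * d r + of_real (P u r) * d r)) / of_real \<delta>"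
    unfolding e by (rule set_integral_divide_zero)
   also have "(LBINT r:{0<..T}. (of_real (P (w + \<delta>) r) * d r - of_real (P w r) * d r - of_real (P (u + \<delta>) r) * d r + of_real (P u r) * d r))
    = (k0 + of_real (w + \<delta>) * k1) - (k0 + of_real w * k1) - (k0 + of_real (u + \<delta>) * k1) + (k0 + of_real u * k1)"
    using t uw by (simp add: set_integral_add set_integral_diff Pint PI)
   finally show ?thesis by (simp add: algebra_simps)
  qed
  have "(%n. LBINT r:{0<..T}. of_real (Kn n r) * d r) \<longlonglongrightarrow> (LBINT r:{0<..T}. indicator {u<..w} r *\<^sub>R d r)"
   unfolding set_lebesgue_integral_def
  proof (rule integral_dominated_convergence)
   show "integrable lborel (%r. 2 * norm (indicator {0<..T} r *\<^sub>R d r))"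
    using iT by (intro integrable_mult_right integrable_norm) (simp add: set_integrable_def)
   have Pd: "(%n. (P (z + 1 / real (Suc n)) r - P z r) / (1 / real (Suc n))) \<longlonglongrightarrow> (if r <= z then 1 else 0)" for z r
   proof (cases "r <= z")
    case True
    have "P (z + 1 / real (Suc n)) r = z + 1 / real (Suc n) - r" for n
    proof -
     have "0 <= 1 / real (Suc n)" by simp
     then show ?thesis unfolding P_def using True by (intro max_absorb1) linarith
    qed
    moreover have "P z r = z - r" using True by (simp add: P_def)
    ultimately have "(P (z + 1 / real (Suc n)) r - P z r) / (1 / real (Suc n)) = 1" for n by simp
    then show ?thesis using True by simp
   next
    case False
    have "(%n. 1 / real (Suc n)) \<longlonglongrightarrow> 0" by real_asymp
    then have "\<forall>\<^sub>F n in sequentially. 1 / real (Suc n) < r - z" using False by (intro order_tendstoD(2)) auto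
    then have "\<forall>\<^sub>F n in sequentially. (P (z + 1 / real (Suc n)) r - P z r) / (1 / real (Suc n)) = 0"
     by eventually_elim (use False in \<open>simp add: P_def max_def\<close>)
    then show ?thesis using False by (simp add: tendsto_eventually)
   qed
   show "AE r in lborel. (%n. indicator {0<..T} r *\<^sub>R (of_real (Kn n r) * d r)) \<longlonglongrightarrow> indicator {0<..T} r *\<^sub>R (indicator {u<..w} r *\<^sub>R d r)"
   proof (intro AE_I2)
    fix r
    have "(%n. (P (w + 1 / real (Suc n)) r - P w r) / (1 / real (Suc n)) - (P (u + 1 / real (Suc n)) r - P u r) / (1 / real (Suc n))) \<longlonglongrightarrow> (if r <= w then 1 else 0) - (if r <= u then 1 else 0)"
     by (intro tendsto_diff Pd)
    moreover have "(if r <= w then 1 else 0) - (if r <= u then 1 else 0) = (indicator {u<..w} r :: real)" using uw by (auto simp: indicator_def)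
    moreover have "(P (w + 1 / real (Suc n)) r - P w r) / (1 / real (Suc n)) - (P (u + 1 / real (Suc n)) r - P u r) / (1 / real (Suc n)) = Kn n r" for n
     by (simp add: Kn_def diff_divide_distrib[symmetric] add_divide_distrib[symmetric] algebra_simps)
    ultimately have "(%n. Kn n r) \<longlonglongrightarrow> (indicator {u<..w} r :: real)" by simp
    then have "(%n. indicator {0<..T} r *\<^sub>R (complex_of_real (Kn n r) * d r)) \<longlonglongrightarrow> indicator {0<..T} r *\<^sub>R (complex_of_real (indicator {u<..w} r) * d r)"
     by (intro tendsto_intros)
    then show "(%n. indicator {0<..T} r *\<^sub>R (of_real (Kn n r) * d r)) \<longlonglongrightarrow> indicator {0<..T} r *\<^sub>R (indicator {u<..w} r *\<^sub>R d r)"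
     by (simp add: scaleR_conv_of_real)
   qed
   show "AE r in lborel. norm (indicator {0<..T} r *\<^sub>R (of_real (Kn n r) * d r)) <= 2 * norm (indicator {0<..T} r *\<^sub>R d r)" for n
   proof (intro AE_I2)
    fix r
    define \<delta> where "\<delta> = 1 / real (Suc n)"
    have \<delta>: "0 < \<delta>" by (simp add: \<delta>_def)
    have "\<bar>P (z + \<delta>) r - P z r\<bar> <= \<delta>" for z using \<delta> by (auto simp: P_def max_def)
    from this[of w] this[of u] have "\<bar>P (w + \<delta>) r - P w r - P (u + \<delta>) r + P u r\<bar> <= 2 * \<delta>" by linarith
    then have "\<bar>Kn n r\<bar> <= 2" unfolding Kn_def \<delta>_def[symmetric] abs_divide using \<delta> by (simp add: pos_divide_le_eq)
    then show "norm (indicator {0<..T} r *\<^sub>R (of_real (Kn n r) * d r)) <= 2 * norm (indicator {0<..T} r *\<^sub>R d r)"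
     by (simp add: norm_mult mult_right_mono indicator_def)
   qed
  qed (auto simp: Kn_def P_def)
  then have "(LBINT r:{0<..T}. indicator {u<..w} r *\<^sub>R d r) = 0" unfolding Kn0 by (simp add: LIMSEQ_const_iff)
  moreover have "(LBINT r:{0<..T}. indicator {u<..w} r *\<^sub>R d r) = (LBINT r:{u<..w}. d r)"
   unfolding set_lebesgue_integral_def using uw by (intro Bochner_Integration.integral_cong refl) (auto simp: indicator_def T_def)
  ultimately show ?thesis by simp
 qed
 \<comment> \<open>Only intervals away from 0 are available; countably many of them exhaust the half
   line.\<close>
 have "AE r in lborel. indicator {1 / real (Suc n)<..real (Suc n)} r *\<^sub>R d r = 0" for n
 proof (rule AE_zero_of_Ioc_integrals)
  have "set_lint {1 / real (Suc n)<..real (Suc n)} d"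
  proof (rule set_integrable_subset[OF int[of "real (Suc n)"]])
   have p0: "0 < 1 / real (Suc n)" by simp
   show "{1 / real (Suc n)<..real (Suc n)} \<subseteq> {0<..real (Suc n)}"
    by (auto simp del: of_nat_Suc intro: less_trans[OF p0])
  qed auto
  then show "integrable lborel (%r. indicator {1 / real (Suc n)<..real (Suc n)} r *\<^sub>R d r)" by (simp add: set_integrable_def)
  fix u w
  define u' w' where "u' = max u (1 / real (Suc n))" and "w' = min w (real (Suc n))"
  have "(LBINT r:{u<..w}. indicator {1 / real (Suc n)<..real (Suc n)} r *\<^sub>R d r) = (LBINT r:{u'<..w'}. d r)"
   unfolding set_lebesgue_integral_def by (intro Bochner_Integration.integral_cong refl) (auto simp: indicator_def u'_def w'_def)
  also have "... = 0"
  proof (cases "u' <= w'")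
   case True
   have "0 < u'" by (simp add: u'_def less_max_iff_disj)
   then show ?thesis using zero True by blast
  next
   case False then show ?thesis by (simp add: set_lebesgue_integral_def)
  qed
  finally show "(LBINT r:{u<..w}. indicator {1 / real (Suc n)<..real (Suc n)} r *\<^sub>R d r) = 0" .
 qed
 then have "AE r in lborel. \<forall>n. indicator {1 / real (Suc n)<..real (Suc n)} r *\<^sub>R d r = 0" unfolding AE_all_countable by blast
 then show ?thesis
 proof eventually_elim
  case (elim r)
  show ?case
  proof
   assume r: "0 < r"
   obtain n1 where n1: "1 / real (Suc n1) < r" using r nat_approx_posE by metis
   obtain n2 where n2: "r <= real n2" using real_arch_simple by blast
   define n where "n = max n1 n2"
   have "1 / real (Suc n) <= 1 / real (Suc n1)" by (intro divide_left_mono) (auto simp: n_def)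
   then have "r \<in> {1 / real (Suc n)<..real (Suc n)}" using n1 n2 by (auto simp: n_def)
   then show "d r = 0" using elim[rule_format, of n] by simp
  qed
 qed
qed

text \<open>One scalar component: \<open>f\<close> is a coefficient of the data, \<open>g\<close>
  its transform continued to the cone a1 - m |Im s| < Re s. The two are tied together only on the
  line Re s = b, where the Laplace integral converges absolutely; to its left \<open>g\<close> is
  known by holomorphy and the bound.\<close>

locale laplace_data =
 fixes f :: "real => complex" and g :: "complex => complex" and b a1 m c \<mu> :: real
 assumes f_meas [measurable]: "f \<in> borel_measurable borel"
  and m: "0 < m" and a1: "0 < a1" "a1 < b" and mu: "-1 < \<mu>"
  and int: "set_lint {0<..} (%r. of_real (exp (- b * r)) * f r)"
  and hol: "g holomorphic_on {s. a1 - m * \<bar>Im s\<bar> < Re s}"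
  and bound: "!!s. a1 - m * \<bar>Im s\<bar> < Re s ==> cmod (g s) <= c * cmod s powr (- \<mu> - 1)"
  and lap: "!!y. g (Complex b y) = (LBINT r:{0<..}. exp (- Complex b y * of_real r) * f r)"
begin

definition "W = {s. a1 - m * \<bar>Im s\<bar> < Re s}"

lemma open_W: "open W"
proof -
 have "open {s. a1 - m * \<bar>Im s\<bar> < Re s}" by (intro open_Collect_less continuous_intros)
 then show ?thesis by (simp add: W_def)
qed

text \<open>The cone opens wider than a half plane and is not convex, but it is star-shaped about a1
  + 1. This is enough for a primitive of holomorphic functions.\<close>

lemma starlike_W: "starlike W"
 unfolding starlike_def
proof (intro bexI[of _ "of_real (a1 + 1)"] ballI)
 fix s assume s: "s \<in> W"
 show "closed_segment (of_real (a1 + 1)) s \<subseteq> W"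
 proof
  fix z assume "z \<in> closed_segment (complex_of_real (a1 + 1)) s"
  then obtain u where u: "0 <= u" "u <= 1" "z = (1 - u) *\<^sub>R complex_of_real (a1 + 1) + u *\<^sub>R s" by (auto simp: closed_segment_def)
  have Re: "Re z - a1 = (1 - u) + u * (Re s - a1)" and Im: "Im z = u * Im s" unfolding u(3) by (simp_all add: algebra_simps)
  have "- (m * \<bar>Im z\<bar>) < Re z - a1"
  proof (cases "u = 0")
   case True then show ?thesis using Re Im by simp
  next
   case False
   have "u * (- (m * \<bar>Im s\<bar>)) < u * (Re s - a1)" using s u False by (intro mult_strict_left_mono) (auto simp: W_def)
   then show ?thesis using u unfolding Re Im by (simp add: abs_mult mult_ac)
  qed
  then show "z \<in> W" by (simp add: W_def)
 qed
qed (use m in \<open>simp add: W_def\<close>)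

lemma zero_notin_W: "0 \<notin> W" using a1 by (simp add: W_def)

lemma vcontour_in_W: "a1 < v ==> m' <= m ==> vcontour v m' y \<in> W"
 using mult_right_mono[of m' m "\<bar>y\<bar>"] by (simp add: W_def vcontour_def)

lemma c_nonneg: "0 <= c"
proof -
 have "a1 - m * \<bar>Im (of_real b)\<bar> < Re (of_real b)" using a1 by simp
 then have "0 <= c * b powr (- \<mu> - 1)" 
 proof -
  have "cmod (g (of_real b)) <= c * b powr (- \<mu> - 1)" using bound[OF \<open>a1 - m * \<bar>Im (of_real b)\<bar> < Re (of_real b)\<close>] a1 by simp
  then show ?thesis using norm_ge_zero[of "g (of_real b)"] by linarith
 qed
 then show ?thesis using a1 by (simp add: zero_le_mult_iff)
qed

lemma g_vcontour_measurable:
 assumes "a1 < v" "m' <= m" shows "(%y. g (vcontour v m' y)) \<in> borel_measurable borel"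
proof (rule borel_measurable_continuous_onI)
 have "continuous_on UNIV (vcontour v m')" unfolding vcontour_def by (intro continuous_on_Complex continuous_intros)
 then show "continuous_on UNIV (%y. g (vcontour v m' y))"
  using continuous_on_compose2[OF holomorphic_on_imp_continuous_on[OF hol[folded W_def]], of UNIV "vcontour v m'"] vcontour_in_W[OF assms] by auto
qed

lemma g_vcontour_bound:
 assumes "a1 < v" "0 <= m'" "m' <= m"
 obtains C where "0 <= C" "!!y. cmod (g (vcontour v m' y) * vdir m' y) <= C * (1 + \<bar>y\<bar>) powr (- \<mu> - 1)"
proof -
 have v: "0 < v" using assms a1 by simp
 have pe: "- (\<mu> + 1) = - \<mu> - 1" by simp
 obtain C1 where C1: "0 < C1" "!!y. cmod (vcontour v m' y) powr (- \<mu> - 1) <= C1 * (1 + \<bar>y\<bar>) powr (- \<mu> - 1)"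
  using vcontour_powr_le[OF v assms(2), of "\<mu> + 1", unfolded pe] mu by auto
 have "cmod (g (vcontour v m' y) * vdir m' y) <= (c * C1 * (1 + m')) * (1 + \<bar>y\<bar>) powr (- \<mu> - 1)" for y
 proof -
  have "cmod (g (vcontour v m' y)) <= c * (C1 * (1 + \<bar>y\<bar>) powr (- \<mu> - 1))"
   by (rule order_trans[OF bound mult_left_mono[OF C1(2)[of y] c_nonneg]]) (use vcontour_in_W[OF assms(1,3), of y] in \<open>simp add: W_def\<close>)
  then have "cmod (g (vcontour v m' y) * vdir m' y) <= c * (C1 * (1 + \<bar>y\<bar>) powr (- \<mu> - 1)) * (1 + m')"
   unfolding norm_mult using vdir_norm[OF assms(2)] c_nonneg C1 by (intro mult_mono) auto
  then show ?thesis by (simp add: mult_ac)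
 qed
 then show ?thesis using that[of "c * C1 * (1 + m')"] c_nonneg C1 assms by simp
qed

text \<open>The bound on \<open>g\<close> decays like |y|^(-\<mu>-1), with an exponent merely known
  to be negative. One division by s brings it to -(\<mu>+2) < -1.\<close>

lemma contour_quotient_integrable:
 assumes v: "a1 < v" and m': "0 <= m'" "m' <= m" and t: "0 <= t" and k: "1 <= k"
 shows "integrable lborel (%y. exp (vcontour v m' y * of_real t) * (g (vcontour v m' y) * vdir m' y) / vcontour v m' y ^ k)"
proof -
 obtain C where C: "0 <= C" "!!y. cmod (g (vcontour v m' y) * vdir m' y) <= C * (1 + \<bar>y\<bar>) powr (- \<mu> - 1)"
  using g_vcontour_bound[OF v m'] by metis
 have v0: "0 < v" using v a1 by simp
 obtain c0 where c0: "0 < c0" "!!y. c0 * (1 + \<bar>y\<bar>) <= cmod (vcontour v m' y)" using vcontour_norm_ge[OF v0 m'(1)] by metis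
 have [measurable]: "(%y. g (vcontour v m' y)) \<in> borel_measurable borel" by (rule g_vcontour_measurable[OF v m'(2)])
 define K where "K = exp (v * t) * C / c0 ^ k"
 have i: "integrable lborel (%y. K * (1 + \<bar>y\<bar>) powr (- (\<mu> + 2)))"
  using mu by (intro integrable_mult_right integrable_one_plus_abs_powr) simp
 show ?thesis
 proof (rule Bochner_Integration.integrable_bound[OF i])
  have "cmod (exp (vcontour v m' y * of_real t) * (g (vcontour v m' y) * vdir m' y) / vcontour v m' y ^ k) <= \<bar>K * (1 + \<bar>y\<bar>) powr (- (\<mu> + 2))\<bar>" for y
  proof -
   have "Re (vcontour v m' y) * t <= v * t" using t m' by (intro mult_right_mono) (auto simp: vcontour_def)
   then have 1: "cmod (exp (vcontour v m' y * of_real t)) <= exp (v * t)" by simp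
   have 2: "(c0 * (1 + \<bar>y\<bar>)) ^ k <= cmod (vcontour v m' y) ^ k" using c0 by (intro power_mono) auto
   have "cmod (exp (vcontour v m' y * of_real t) * (g (vcontour v m' y) * vdir m' y) / vcontour v m' y ^ k) <= exp (v * t) * (C * (1 + \<bar>y\<bar>) powr (- \<mu> - 1)) / (c0 * (1 + \<bar>y\<bar>)) ^ k"
    unfolding norm_divide norm_power norm_mult[of "exp _"] using 1 2 C(2)[of y] c0 C(1) by (intro frac_le mult_mono) auto
   also have "... = K * ((1 + \<bar>y\<bar>) powr (- \<mu> - 1) / (1 + \<bar>y\<bar>) ^ k)" by (simp add: K_def power_mult_distrib)
   also have "... <= K * ((1 + \<bar>y\<bar>) powr (- \<mu> - 1) / (1 + \<bar>y\<bar>) ^ 1)"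
    using C c0 k by (intro mult_left_mono divide_left_mono power_increasing) (auto simp: K_def)
   also have "(1 + \<bar>y\<bar>) powr (- \<mu> - 1) / (1 + \<bar>y\<bar>) ^ 1 = (1 + \<bar>y\<bar>) powr (- (\<mu> + 2))"
   proof -
    have "(1 + \<bar>y\<bar>) powr (- \<mu> - 1) / (1 + \<bar>y\<bar>) ^ 1 = (1 + \<bar>y\<bar>) powr (- \<mu> - 1) * (1 + \<bar>y\<bar>) powr (-1)" by (simp add: powr_minus_divide)
    also have "... = (1 + \<bar>y\<bar>) powr (- (\<mu> + 2))" by (subst powr_add[symmetric]) (rule arg_cong2[where f = "(powr)"]; simp)
    finally show ?thesis .
   qed
   finally show ?thesis by (rule order_trans) (rule abs_ge_self)
  qed
  then show "AE y in lborel. norm (exp (vcontour v m' y * of_real t) * (g (vcontour v m' y) * vdir m' y) / vcontour v m' y ^ k) <= norm (K * (1 + \<bar>y\<bar>) powr (- (\<mu> + 2)))"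
   unfolding real_norm_def by blast
 qed measurable
qed

text \<open>Inserting the Laplace integral for \<open>g\<close> and exchanging the integrals leaves,
  for each r, the inverse transform of 1 / s^2 at t - r.\<close>

lemma bromwich_second_primitive:
 assumes t: "0 < t"
 shows "(LBINT y. exp (Complex b y * of_real t) * g (Complex b y) / Complex b y ^ 2) = 2 * pi * (LBINT r:{0<..t}. of_real (t - r) * f r)"
proof -
 define F where "F r y = exp (Complex b y * of_real (t - r)) / (Complex b y)\<^sup>2 * (indicator {0<..} r *\<^sub>R f r)" for r y
 have bpos: "0 < b" using a1 by simp
 define N where "N = (LBINT r:{0<..}. cmod (of_real (exp (- b * r)) * f r))"
 have [measurable]: "(%y. Complex b y) \<in> borel_measurable borel" using vcontour_measurable[of b 0] by (simp add: vcontour_def[abs_def])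
 have Fi: "F r y = exp (Complex b y * of_real t) / (Complex b y)\<^sup>2 * (indicator {0<..} r *\<^sub>R (exp (- Complex b y * of_real r) * f r))" for r y
  by (simp add: F_def exp_diff exp_minus right_diff_distrib divide_inverse mult_ac indicator_def)
 have ii: "set_lint {0<..} (%r. exp (- Complex b y * of_real r) * f r)" for y
  using int unfolding set_integrable_def
  by (rule Bochner_Integration.integrable_bound) (auto simp: indicator_def norm_mult)
 have Fint: "integrable lborel (%r. F r y)" for y
  unfolding Fi using ii[of y] by (intro integrable_mult_right) (simp add: set_integrable_def)
 have Fn: "cmod (F r y) = exp (b * t) * cmod (Complex b y) powr (-2) * (indicator {0<..} r *\<^sub>R cmod (of_real (exp (- b * r)) * f r))" for r y
 proof -
  have "Complex b y ~= 0" using bpos by (simp add: complex_eq_iff)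
  then show ?thesis unfolding Fi by (simp add: norm_mult norm_divide norm_power powr_minus_divide indicator_def)
 qed
 obtain C where C: "0 < C" "!!y. cmod (vcontour b 0 y) powr (- 2) <= C * (1 + \<bar>y\<bar>) powr (- 2)"
  using vcontour_powr_le[OF bpos, of 0 2] by auto
 have "0 <= N" unfolding N_def set_lebesgue_integral_def by (intro Bochner_Integration.integral_nonneg) auto
 have sw: "(LBINT r. LBINT y. F r y) = (LBINT y. LBINT r. F r y)"
 proof (rule fubini_swap(2)[OF _ Fint])
  show "(%(r, y). F r y) \<in> borel_measurable (borel \<Otimes>\<^sub>M borel)" unfolding F_def by measurable
  show "integrable lborel (%y::real. exp (b * t) * (C * N) * (1 + \<bar>y\<bar>) powr (- 2))"
   by (intro integrable_mult_right integrable_one_plus_abs_powr) simp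
  show "(LBINT r. cmod (F r y)) <= exp (b * t) * (C * N) * (1 + \<bar>y\<bar>) powr (- 2)" for y
  proof -
   have "(LBINT r. cmod (F r y)) = exp (b * t) * cmod (Complex b y) powr (-2) * N"
    unfolding Fn N_def set_lebesgue_integral_def by simp
   also have "... <= exp (b * t) * (C * (1 + \<bar>y\<bar>) powr (- 2)) * N"
    using C(2)[of y] \<open>0 <= N\<close> by (intro mult_right_mono mult_left_mono) auto
   finally show ?thesis by (simp add: mult_ac)
  qed
 qed
 have inner1: "(LBINT r. F r y) = exp (Complex b y * of_real t) * g (Complex b y) / Complex b y ^ 2" for y
  unfolding Fi integral_mult_right_zero lap set_lebesgue_integral_def by simp
 have inner2: "(LBINT y. F r y) = 2 * pi * (indicator {0<..t} r *\<^sub>R (of_real (t - r) * f r))" for r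
 proof -
  have "(LBINT y. F r y) = 2 * pi * of_real (max (t - r) 0) * (indicator {0<..} r *\<^sub>R f r)"
   by (simp only: F_def integral_mult_left_zero inverse_square_integral(2)[OF bpos])
  then show ?thesis by (auto simp: indicator_def max_def)
 qed
 show ?thesis using sw unfolding inner1 inner2 integral_mult_right_zero set_lebesgue_integral_def by (rule sym)
qed

text \<open>Both integrals are limits of differences of one primitive \<open>H\<close> at end points
  of height n and -n. At equal height these are joined by horizontal segments of length O(n), on
  which the integrand is O(n^(-\<mu>-3)).\<close>

lemma contour_shift:
 assumes t: "0 < t" and v: "a1 < v"
 shows "(LBINT y. exp (Complex b y * of_real t) * g (Complex b y) / Complex b y ^ 2) =
  (LBINT y. exp (vcontour v m y * of_real t) * (g (vcontour v m y) * vdir m y) / vcontour v m y ^ 2)"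
proof -
 define h where "h s = exp (s * of_real t) * g s / s ^ 2" for s
 have hh: "h holomorphic_on W" unfolding h_def using hol[folded W_def] zero_notin_W by (intro holomorphic_intros) auto
 obtain H where H: "!!z. z \<in> W ==> (H has_field_derivative h z) (at z)"
  using holomorphic_starlike_primitive[OF holomorphic_on_imp_continuous_on[OF hh] starlike_W open_W, of "{}"] 
   holomorphic_on_imp_differentiable_at[OF hh open_W] by auto
 have ftc: "(LBINT y:{- real n..real n}. h (vcontour v' m' y) * vdir m' y) = (H (vcontour v' m' (real n)) - H (vcontour v' m' (- real n))) / \<i>"
  if v': "a1 < v'" and m': "0 <= m'" "m' <= m" for v' m' n
 proof -
  have "((%y. h (vcontour v' m' y) * (\<i> * vdir m' y)) has_integral (H (vcontour v' m' (real n)) - H (vcontour v' m' (- real n)))) {- real n..real n}"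
  \<comment> \<open>The corner y = 0 is the single exceptional point.\<close>
  proof (rule fundamental_theorem_of_calculus_interior_strong[of "{0}"])
   fix y assume "y \<in> {- real n<..<real n} - {0}"
   then show "((%y. H (vcontour v' m' y)) has_vector_derivative h (vcontour v' m' y) * (\<i> * vdir m' y)) (at y)"
    using field_vector_diff_chain_at[OF vcontour_has_vector_derivative[of y v' m'] H[OF vcontour_in_W[OF v' m'(2), of y]]]
    by (simp add: o_def mult_ac)
  next
   have cV: "continuous_on UNIV (vcontour v' m')" unfolding vcontour_def by (intro continuous_on_Complex continuous_intros)
   have cW: "continuous_on W H" using H by (meson DERIV_isCont continuous_at_imp_continuous_on)
   have "continuous_on UNIV (%y. H (vcontour v' m' y))"
    by (rule continuous_on_compose2[OF cW cV]) (use vcontour_in_W[OF v' m'(2)] in blast)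
   then show "continuous_on {- real n..real n} (%y. H (vcontour v' m' y))" by (rule continuous_on_subset) simp
  qed auto
  then have "((%y. h (vcontour v' m' y) * vdir m' y) has_integral (H (vcontour v' m' (real n)) - H (vcontour v' m' (- real n))) / \<i>) {- real n..real n}"
  proof -
   assume hi: "((%y. h (vcontour v' m' y) * (\<i> * vdir m' y)) has_integral (H (vcontour v' m' (real n)) - H (vcontour v' m' (- real n)))) {- real n..real n}"
   have "x * (\<i> * z) / \<i> = x * z" for x z :: complex by (simp add: complex_eq_iff)
   then have eq: "h (vcontour v' m' y) * (\<i> * vdir m' y) / \<i> = h (vcontour v' m' y) * vdir m' y" for y .
   show ?thesis using has_integral_divide[OF hi, of \<i>] unfolding eq .
  qed
  moreover have "set_lint {- real n..real n} (%y. h (vcontour v' m' y) * vdir m' y)"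
  proof -
   have "h (vcontour v' m' y) * vdir m' y = exp (vcontour v' m' y * of_real t) * (g (vcontour v' m' y) * vdir m' y) / vcontour v' m' y ^ 2" for y
    by (simp add: h_def)
   then show ?thesis using contour_quotient_integrable[OF v' m', of t 2] t by (simp add: set_integrable_def integrable_mult_indicator)
  qed
  ultimately show ?thesis using set_borel_integral_eq_integral(2) integral_unique by metis
 qed
 have lim: "(%n. (H (vcontour v' m' (real n)) - H (vcontour v' m' (- real n))) / \<i>) \<longlonglongrightarrow> (LBINT y. exp (vcontour v' m' y * of_real t) * (g (vcontour v' m' y) * vdir m' y) / vcontour v' m' y ^ 2)"
  if v': "a1 < v'" and m': "0 <= m'" "m' <= m" for v' m'
 proof -
  have eqh: "h (vcontour v' m' y) * vdir m' y = exp (vcontour v' m' y * of_real t) * (g (vcontour v' m' y) * vdir m' y) / vcontour v' m' y ^ 2" for y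
   by (simp add: h_def)
  have "(%n. LBINT y:{- real n..real n}. h (vcontour v' m' y) * vdir m' y) \<longlonglongrightarrow> (LBINT y. exp (vcontour v' m' y * of_real t) * (g (vcontour v' m' y) * vdir m' y) / vcontour v' m' y ^ 2)"
   unfolding eqh by (rule lborel_integral_symmetric_limit[OF contour_quotient_integrable[OF v' m']]) (use t in auto)
  then show ?thesis unfolding ftc[OF v' m'] .
 qed
 define M where "M = max b v"
 have est: "cmod (H (Complex b s) - H (vcontour v m s)) <= exp (M * t) * c * n powr (- \<mu> - 3) * (\<bar>b - v\<bar> + m * n)" if s: "\<bar>s\<bar> = n" "0 < n" for s n
 proof -
  have seg: "closed_segment (vcontour v m s) (Complex b s) \<subseteq> {z. Im z = s \<and> min b (v - m * n) <= Re z \<and> Re z <= max b (v - m * n)}"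
   using s by (auto simp: vcontour_def closed_segment_same_Im closed_segment_eq_real_ivl)
  have "cmod (H (Complex b s) - H (vcontour v m s)) <= exp (M * t) * c * n powr (- \<mu> - 3) * cmod (Complex b s - vcontour v m s)"
  proof (rule field_differentiable_bound[of "closed_segment (vcontour v m s) (Complex b s)" H h])
   fix z assume z: "z \<in> closed_segment (vcontour v m s) (Complex b s)"
   then have z': "Im z = s" "min b (v - m * n) <= Re z" "Re z <= max b (v - m * n)" using seg by auto
   have mn: "0 < m * n" using m s by simp
   have Imn: "\<bar>Im z\<bar> = n" using z' s by simp
   have mb: "a1 - m * n < min b (v - m * n)" using v a1 mn by (simp add: min_def)
   have zW: "z \<in> W" unfolding W_def mem_Collect_eq Imn using mb z'(2) by linarith
   then show "(H has_field_derivative h z) (at z within closed_segment (vcontour v m s) (Complex b s))" using H has_field_derivative_at_within by blast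
   have n: "n <= cmod z" using abs_Im_le_cmod[of z] z' s by simp
   then have z0: "0 < cmod z" using s by linarith
   have "max b (v - m * n) <= M" unfolding M_def using mn by (intro max.mono) auto
   then have "Re z <= M" using z' by linarith
   then have e: "cmod (exp (z * of_real t)) <= exp (M * t)" using t by simp
   have gb: "cmod (g z) <= c * cmod z powr (- \<mu> - 1)" using bound zW by (simp add: W_def)
   have "cmod (h z) = cmod (exp (z * of_real t)) * cmod (g z) * cmod z powr (-2)"
    unfolding h_def norm_divide norm_mult norm_power using z0 by (simp add: powr_minus_divide)
   also have "... <= exp (M * t) * (c * cmod z powr (- \<mu> - 1)) * cmod z powr (-2)"
    using e gb by (intro mult_right_mono mult_mono) auto
   also have "... = exp (M * t) * c * (cmod z powr (- \<mu> - 1) * cmod z powr (-2))" by simp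
   also have "cmod z powr (- \<mu> - 1) * cmod z powr (-2) = cmod z powr (- \<mu> - 3)" by (subst powr_add[symmetric]) (rule arg_cong2[where f = "(powr)"]; simp)
   also have "exp (M * t) * c * cmod z powr (- \<mu> - 3) <= exp (M * t) * c * n powr (- \<mu> - 3)"
    using n s mu c_nonneg by (intro mult_left_mono powr_mono2') auto
   finally show "cmod (h z) <= exp (M * t) * c * n powr (- \<mu> - 3)" .
  qed auto
  also have "cmod (Complex b s - vcontour v m s) <= \<bar>b - v\<bar> + m * n"
  proof -
   have "Complex b s - vcontour v m s = of_real (b - v + m * n)" using s by (simp add: vcontour_def complex_eq_iff)
   then have "cmod (Complex b s - vcontour v m s) = \<bar>b - v + m * n\<bar>" by (simp only: norm_of_real)
   then show ?thesis using m s by (simp add: abs_triangle_ineq[of "b - v" "m * n", simplified] order_trans[OF abs_triangle_ineq])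
  qed
  finally show ?thesis using c_nonneg by (simp add: mult_left_mono)
 qed
 have z: "(%n::nat. exp (M * t) * c * real n powr (- \<mu> - 3) * (\<bar>b - v\<bar> + m * real n)) \<longlonglongrightarrow> 0"
  using mu by real_asymp
 have l1: "(%n. H (Complex b (real n)) - H (vcontour v m (real n))) \<longlonglongrightarrow> 0"
  by (rule Lim_null_comparison[OF _ z], rule eventually_mono[OF eventually_gt_at_top[of 0]], rule est) auto
 have l2: "(%n. H (Complex b (- real n)) - H (vcontour v m (- real n))) \<longlonglongrightarrow> 0"
  by (rule Lim_null_comparison[OF _ z], rule eventually_mono[OF eventually_gt_at_top[of 0]], rule est) auto
 have L1: "(%n. (H (vcontour b 0 (real n)) - H (vcontour b 0 (- real n))) / \<i>) \<longlonglongrightarrow> (LBINT y. exp (vcontour b 0 y * of_real t) * (g (vcontour b 0 y) * vdir 0 y) / vcontour b 0 y ^ 2)"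
  using m a1 by (intro lim) auto
 have L2: "(%n. (H (vcontour v m (real n)) - H (vcontour v m (- real n))) / \<i>) \<longlonglongrightarrow> (LBINT y. exp (vcontour v m y * of_real t) * (g (vcontour v m y) * vdir m y) / vcontour v m y ^ 2)"
  using m v by (intro lim) auto
 have eqn: "(A - B) / \<i> - ((A - A') - (B - B')) / \<i> = (A' - B') / \<i>" for A B A' B' :: complex
  by (simp add: complex_eq_iff)
 have L1': "(%n. (H (Complex b (real n)) - H (Complex b (- real n))) / \<i>) \<longlonglongrightarrow> (LBINT y. exp (vcontour b 0 y * of_real t) * (g (vcontour b 0 y) * vdir 0 y) / vcontour b 0 y ^ 2)"
  using L1 by (simp only: vcontour_0)
 have "(%n. (H (Complex b (real n)) - H (Complex b (- real n))) / \<i> - ((H (Complex b (real n)) - H (vcontour v m (real n))) - (H (Complex b (- real n)) - H (vcontour v m (- real n)))) / \<i>) \<longlonglongrightarrow>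
  (LBINT y. exp (vcontour b 0 y * of_real t) * (g (vcontour b 0 y) * vdir 0 y) / vcontour b 0 y ^ 2) - (0 - 0) / \<i>"
  by (rule tendsto_diff[OF L1' tendsto_divide[OF tendsto_diff[OF l1 l2] tendsto_const complex_i_not_zero]])
 then have "(%n. (H (vcontour v m (real n)) - H (vcontour v m (- real n))) / \<i>) \<longlonglongrightarrow> (LBINT y. exp (vcontour b 0 y * of_real t) * (g (vcontour b 0 y) * vdir 0 y) / vcontour b 0 y ^ 2)"
  unfolding eqn by simp
 then have "(LBINT y. exp (vcontour b 0 y * of_real t) * (g (vcontour b 0 y) * vdir 0 y) / vcontour b 0 y ^ 2) = (LBINT y. exp (vcontour v m y * of_real t) * (g (vcontour v m y) * vdir m y) / vcontour v m y ^ 2)"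
  using LIMSEQ_unique L2 by blast
 moreover have "vdir 0 y = 1" for y by (simp add: vdir_def complex_eq_iff)
 ultimately show ?thesis by simp
qed

text \<open>The inversion integral along the bent contour. For r > 0 the factor e^(-m |y| r) makes
  it converge absolutely, which it need not do on the vertical line.\<close>

definition phi :: "real => real => complex" where
 "phi v r = 1 / (2 * of_real pi) * (LBINT y. exp (vcontour v m y * of_real r) * (g (vcontour v m y) * vdir m y))"

lemma exp_contour_bound:
 assumes v: "0 <= v" and t: "0 < t" and r: "0 < r" "r <= t"
 shows "cmod (exp (vcontour v m y * of_real r)) <= exp (v * t) * damp m y r"
proof -
 have "v * r <= v * t" using v r by (intro mult_left_mono) auto
 then have "Re (vcontour v m y * of_real r) <= v * t + (- (m * \<bar>y\<bar>) * r)" by (simp add: vcontour_def left_diff_distrib)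
 then show ?thesis by (simp add: exp_add[symmetric])
qed

text \<open>The hypothesis on \<open>p\<close> supplies the power (1 + |y|)^(-1) that is missing
  from the bound on \<open>g\<close>: together with (1 + |y|)^(-\<mu>-1) it is integrable because
  \<mu> > -1.\<close>

lemma phi_fubini_weighted:
 assumes v: "a1 < v" and t: "0 < t" and p [measurable]: "p \<in> borel_measurable borel" and pint: "set_lint {0<..t} p"
  and pb: "!!y. (LBINT r:{0<..t}. \<bar>p r\<bar> * damp m y r) <= B * (1 + \<bar>y\<bar>) powr (-1)"
 shows "set_lint {0<..t} (%r. of_real (p r) * phi v r)"
  and "2 * of_real pi * (LBINT r:{0<..t}. of_real (p r) * phi v r) = (LBINT y. (LBINT r:{0<..t}. of_real (p r) * exp (vcontour v m y * of_real r)) * (g (vcontour v m y) * vdir m y))"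
  and "integrable lborel (%y. (LBINT r:{0<..t}. of_real (p r) * exp (vcontour v m y * of_real r)) * (g (vcontour v m y) * vdir m y))"
proof -
 have v0: "0 <= v" using v a1 by simp
 obtain C where C: "0 <= C" "!!y. cmod (g (vcontour v m y) * vdir m y) <= C * (1 + \<bar>y\<bar>) powr (- \<mu> - 1)"
  using g_vcontour_bound[OF v, of m] m by auto
 have [measurable]: "(%y. g (vcontour v m y)) \<in> borel_measurable borel" by (rule g_vcontour_measurable[OF v order_refl])
 define F where "F r y = (indicator {0<..t} r *\<^sub>R (of_real (p r) * exp (vcontour v m y * of_real r))) * (g (vcontour v m y) * vdir m y)" for r y
 define D where "D y r = exp (v * t) * (\<bar>p r\<bar> * damp m y r)" for y r
 have Db: "cmod (of_real (p r) * exp (vcontour v m y * of_real r)) <= D y r" if "r \<in> {0<..t}" for r y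
  using mult_left_mono[OF exp_contour_bound[OF v0 t, of r y], of "\<bar>p r\<bar>"] that by (simp add: norm_mult D_def mult_ac)
 have Di: "set_lint {0<..t} (D y)" for y
 proof -
  have "set_lint {0<..t} (%r. \<bar>p r\<bar> * damp m y r)"
   using pint unfolding set_integrable_def
  proof (rule Bochner_Integration.integrable_bound)
   have "norm (indicator {0<..t} r *\<^sub>R (\<bar>p r\<bar> * damp m y r)) <= norm (indicator {0<..t} r *\<^sub>R p r)" for r
   proof (cases "r \<in> {0<..t}")
    case True
    then have "0 <= m * \<bar>y\<bar> * r" using m by simp
    then have "damp m y r <= 1" by simp
    then have "\<bar>p r\<bar> * damp m y r <= \<bar>p r\<bar> * 1" by (intro mult_left_mono) auto
    then show ?thesis using True by (simp add: abs_mult)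
   qed simp
   then show "AE r in lborel. norm (indicator {0<..t} r *\<^sub>R (\<bar>p r\<bar> * damp m y r)) <= norm (indicator {0<..t} r *\<^sub>R p r)" by blast
  qed measurable
  then show ?thesis unfolding D_def by (rule set_integrable_mult_right)
 qed
 have ei: "set_lint {0<..t} (%r. of_real (p r) * exp (vcontour v m y * of_real r))" for y
  using Di[of y] unfolding set_integrable_def
 proof (rule Bochner_Integration.integrable_bound)
  have "norm (indicator {0<..t} r *\<^sub>R (of_real (p r) * exp (vcontour v m y * of_real r))) <= norm (indicator {0<..t} r *\<^sub>R D y r)" for r
   using Db[of r y] by (cases "r \<in> {0<..t}") auto
  then show "AE r in lborel. norm (indicator {0<..t} r *\<^sub>R (of_real (p r) * exp (vcontour v m y * of_real r))) <= norm (indicator {0<..t} r *\<^sub>R D y r)" by blast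
 qed measurable
 have Fint: "integrable lborel (%r. F r y)" for y
  unfolding F_def using ei[of y] by (intro integrable_mult_left) (simp add: set_integrable_def)
 have Dle: "(LBINT r:{0<..t}. D y r) <= exp (v * t) * (B * (1 + \<bar>y\<bar>) powr (-1))" for y
  unfolding D_def by (subst set_integral_mult_right) (rule mult_left_mono[OF pb], simp)
 have B: "0 <= B"
 proof -
  have "0 <= (LBINT r:{0<..t}. \<bar>p r\<bar> * exp (- (m * \<bar>0\<bar>) * r))" unfolding set_lebesgue_integral_def by (intro Bochner_Integration.integral_nonneg) auto
  then show ?thesis using pb[of 0] by simp
 qed
 define K where "K = exp (v * t) * B * C"
 have Ki: "integrable lborel (%y. K * (1 + \<bar>y\<bar>) powr (- (\<mu> + 2)))"
  using mu by (intro integrable_mult_right integrable_one_plus_abs_powr) simp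
 have bnd: "(LBINT r. cmod (F r y)) <= K * (1 + \<bar>y\<bar>) powr (- (\<mu> + 2))" for y
 proof -
  have "(LBINT r. cmod (F r y)) = (LBINT r:{0<..t}. cmod (of_real (p r) * exp (vcontour v m y * of_real r))) * cmod (g (vcontour v m y) * vdir m y)"
   unfolding F_def set_lebesgue_integral_def norm_mult[of _ "g _ * _"] norm_scaleR by simp
  also have "... <= (exp (v * t) * (B * (1 + \<bar>y\<bar>) powr (-1))) * (C * (1 + \<bar>y\<bar>) powr (- \<mu> - 1))"
  proof (rule mult_mono)
   have "(LBINT r:{0<..t}. cmod (of_real (p r) * exp (vcontour v m y * of_real r))) <= (LBINT r:{0<..t}. D y r)"
    by (intro set_integral_mono set_integrable_norm ei Di Db)
   then show "(LBINT r:{0<..t}. cmod (of_real (p r) * exp (vcontour v m y * of_real r))) <= exp (v * t) * (B * (1 + \<bar>y\<bar>) powr (-1))"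
    using Dle[of y] by linarith
  qed (use C B in auto)
  also have "... = K * ((1 + \<bar>y\<bar>) powr (-1) * (1 + \<bar>y\<bar>) powr (- \<mu> - 1))" by (simp add: K_def)
  also have "(1 + \<bar>y\<bar>) powr (-1) * (1 + \<bar>y\<bar>) powr (- \<mu> - 1) = (1 + \<bar>y\<bar>) powr (- (\<mu> + 2))" by (subst powr_add[symmetric]) (rule arg_cong2[where f = "(powr)"]; simp)
  finally show ?thesis .
 qed
 have meas: "(%(r, y). F r y) \<in> borel_measurable (borel \<Otimes>\<^sub>M borel)" unfolding F_def by measurable
 note fs = fubini_swap[OF meas Fint Ki bnd]
 have Fy: "(LBINT y. F r y) = 2 * of_real pi * (indicator {0<..t} r *\<^sub>R (of_real (p r) * phi v r))" for r
 proof -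
  have "F r y = indicator {0<..t} r *\<^sub>R of_real (p r) * (exp (vcontour v m y * of_real r) * (g (vcontour v m y) * vdir m y))" for y by (simp add: F_def)
  then have "(LBINT y. F r y) = indicator {0<..t} r *\<^sub>R of_real (p r) * (LBINT y. exp (vcontour v m y * of_real r) * (g (vcontour v m y) * vdir m y))" by simp
  then show ?thesis by (simp add: phi_def)
 qed
 have "integrable lborel (%r. 1 / (2 * of_real pi) * (2 * of_real pi * (indicator {0<..t} r *\<^sub>R (of_real (p r) * phi v r))))"
  using fs(1) unfolding Fy by (rule integrable_mult_right)
 then show "set_lint {0<..t} (%r. of_real (p r) * phi v r)" by (simp add: set_integrable_def)
 have "2 * of_real pi * (LBINT r:{0<..t}. of_real (p r) * phi v r) = (LBINT r. 2 * of_real pi * (indicator {0<..t} r *\<^sub>R (of_real (p r) * phi v r)))"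
  unfolding set_lebesgue_integral_def integral_mult_right_zero ..
 also have "... = (LBINT y. LBINT r. F r y)" using fs(2) unfolding Fy .
 finally show "2 * of_real pi * (LBINT r:{0<..t}. of_real (p r) * phi v r) = (LBINT y. (LBINT r:{0<..t}. of_real (p r) * exp (vcontour v m y * of_real r)) * (g (vcontour v m y) * vdir m y))"
  unfolding F_def integral_mult_left_zero set_lebesgue_integral_def .
 show "integrable lborel (%y. (LBINT r:{0<..t}. of_real (p r) * exp (vcontour v m y * of_real r)) * (g (vcontour v m y) * vdir m y))"
  using fs(3) unfolding F_def integral_mult_left_zero set_lebesgue_integral_def .
qed

text \<open>A bounded weight qualifies, since the integral of e^(-m |y| r) over (0, t] is bounded by
  multiples of t and of 1 / (m |y|).\<close>

lemma phi_fubini: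
 assumes v: "a1 < v" and t: "0 < t" and p [measurable]: "p \<in> borel_measurable borel" and pb: "!!r. 0 < r ==> r <= t ==> \<bar>p r\<bar> <= B"
 shows "set_lint {0<..t} (%r. of_real (p r) * phi v r)"
  and "2 * of_real pi * (LBINT r:{0<..t}. of_real (p r) * phi v r) = (LBINT y. (LBINT r:{0<..t}. of_real (p r) * exp (vcontour v m y * of_real r)) * (g (vcontour v m y) * vdir m y))"
proof -
 have B: "0 <= B" using pb[of t] t by simp
 have ic: "set_lint {0<..t} (%r. B)" by (rule set_integrable_subset[OF borel_integrable_atLeastAtMost'[of 0 t]]) (auto intro!: continuous_intros)
 have pint: "set_lint {0<..t} p"
  using ic unfolding set_integrable_def
  by (rule Bochner_Integration.integrable_bound) (use pb B in \<open>auto simp: indicator_def\<close>)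
 have Dle: "(LBINT r:{0<..t}. \<bar>p r\<bar> * damp m y r) <= B * (2 * (t + 1 / m)) * (1 + \<bar>y\<bar>) powr (-1)" for y
 proof -
  define J where "J = (LBINT r:{0<..t}. damp m y r)"
  have J0: "0 <= J" unfolding J_def set_lebesgue_integral_def by (intro Bochner_Integration.integral_nonneg) auto
  have ex: "set_lint {0<..t} (%r. damp m y r)" using m t by (intro set_integral_exp_decay'(1)) auto
  have i: "set_lint {0<..t} (%r. B * damp m y r)" by (rule set_integrable_mult_right[OF ex])
  have li: "set_lint {0<..t} (%r. \<bar>p r\<bar> * damp m y r)"
   using i unfolding set_integrable_def
   by (rule Bochner_Integration.integrable_bound) (use pb B in \<open>auto simp: indicator_def abs_mult intro!: mult_right_mono\<close>)
  have "(LBINT r:{0<..t}. \<bar>p r\<bar> * damp m y r) <= (LBINT r:{0<..t}. B * damp m y r)"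
   using pb by (intro set_integral_mono li i mult_right_mono) auto
  also have "... = B * J" by (simp add: J_def)
  finally have 0: "(LBINT r:{0<..t}. \<bar>p r\<bar> * damp m y r) <= B * J" .
  have 1: "(1 + m * \<bar>y\<bar> * t) * J <= 2 * t" using set_integral_exp_decay'(2)[of "m * \<bar>y\<bar>" t] m t by (simp add: J_def)
  have mt: "0 <= m * \<bar>y\<bar> * t * J" using m t J0 by simp
  have "J <= 2 * t" "m * \<bar>y\<bar> * t * J <= 2 * t" using 1 mt J0 by (auto simp: distrib_right)
  then have "J <= 2 * t" "\<bar>y\<bar> * J <= 2 / m" using m t by (auto simp: field_simps)
  then have "(1 + \<bar>y\<bar>) * J <= 2 * (t + 1 / m)" by (simp add: distrib_right distrib_left)
  then have "J <= 2 * (t + 1 / m) / (1 + \<bar>y\<bar>)" by (simp add: pos_le_divide_eq mult.commute)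
  then have "B * J <= B * (2 * (t + 1 / m) / (1 + \<bar>y\<bar>))" using B by (intro mult_left_mono) auto
  then show ?thesis using 0 by (simp add: powr_minus_divide)
 qed
 show "set_lint {0<..t} (%r. of_real (p r) * phi v r)"
  and "2 * of_real pi * (LBINT r:{0<..t}. of_real (p r) * phi v r) = (LBINT y. (LBINT r:{0<..t}. of_real (p r) * exp (vcontour v m y * of_real r)) * (g (vcontour v m y) * vdir m y))"
  by (rule phi_fubini_weighted[OF v t p pint Dle])+
qed

lemma phi_measurable [measurable]: assumes "a1 < v" shows "phi v \<in> borel_measurable borel"
proof -
 have [measurable]: "(%y. g (vcontour v m y)) \<in> borel_measurable borel" by (rule g_vcontour_measurable[OF assms order_refl])
 have "(%r. LBINT y. exp (vcontour v m y * of_real r) * (g (vcontour v m y) * vdir m y)) \<in> borel_measurable borel"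
  by (rule lborel.borel_measurable_lebesgue_integral) measurable
 then show ?thesis unfolding phi_def by measurable
qed

lemma locally_integrable:
 assumes t: "0 < t" shows "set_lint {0<..t} f"
proof -
 have "set_lint {0<..t} (%r. of_real (exp (b * t)) * (of_real (exp (- b * r)) * f r))"
  by (intro set_integrable_mult_right set_integrable_subset[OF int]) auto
 then show ?thesis unfolding set_integrable_def
 proof (rule Bochner_Integration.integrable_bound)
  have "cmod (f r) <= cmod (of_real (exp (b * t)) * (of_real (exp (- b * r)) * f r))" if "r \<in> {0<..t}" for r
  proof -
   have "1 <= exp (b * t - b * r)" using that a1 by simp
   then have "1 * cmod (f r) <= exp (b * t - b * r) * cmod (f r)" by (rule mult_right_mono) simp
   moreover have "exp (b * t - b * r) = exp (b * t) * exp (- b * r)" by (simp add: exp_add[symmetric])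
   moreover have "cmod (of_real (exp (b * t)) * (of_real (exp (- b * r)) * f r)) = exp (b * t) * exp (- b * r) * cmod (f r)"
    unfolding norm_mult norm_of_real by simp
   ultimately show ?thesis by simp
  qed
  then show "AE r in lborel. norm (indicator {0<..t} r *\<^sub>R f r) <= norm (indicator {0<..t} r *\<^sub>R (of_real (exp (b * t)) * (of_real (exp (- b * r)) * f r)))"
   by (auto simp: indicator_def)
 qed measurable
qed

text \<open>For \<open>phi\<close> the second primitive is computed by exchanging integrals: the
  inner integral (e^(s t) - 1 - s t) / s^2 yields the shifted integral of
  \<open>bromwich_second_primitive\<close> minus an affine function of t. Thus f - phi has an affine
  second primitive and vanishes almost everywhere on the half line.\<close>

theorem laplace_inversion:
 assumes v: "a1 < v"
 shows "AE r in lborel. 0 < r --> f r = phi v r"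
proof -
 \<comment> \<open>Intercept and slope of the affine function: the contour integrals of g / s^2 and
   of g / s.\<close>
 define k0 where "k0 = 1 / (2 * of_real pi) * (LBINT y. exp (vcontour v m y * of_real 0) * (g (vcontour v m y) * vdir m y) / vcontour v m y ^ 2)"
 define k1 where "k1 = 1 / (2 * of_real pi) * (LBINT y. exp (vcontour v m y * of_real 0) * (g (vcontour v m y) * vdir m y) / vcontour v m y ^ 1)"
 note fint = locally_integrable
 have pint: "set_lint {0<..t} (phi v)" if t: "0 < t" for t
  using phi_fubini(1)[OF v t, of "%_. 1" 1] by simp
 have nz: "vcontour v m y ~= 0" for y using vcontour_in_W[OF v order_refl, of y] zero_notin_W by metis
 have "AE r in lborel. 0 < r --> f r - phi v r = 0"
 proof (rule AE_zero_of_linear_convolution[where ?k0.0 = k0 and ?k1.0 = k1])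
  show "(%r. f r - phi v r) \<in> borel_measurable borel" using phi_measurable[OF v] by measurable
  fix t :: real assume t: "0 < t"
  show "set_lint {0<..t} (%r. f r - phi v r)" by (intro set_integral_diff(1) fint pint t)
  have tb: "\<bar>t - r\<bar> <= t" if "0 < r" "r <= t" for r using that by simp
  have tm: "(%r. t - r) \<in> borel_measurable borel" by measurable
  note pf = phi_fubini[OF v t tm tb]
  have fi: "set_lint {0<..t} (%r. of_real (t - r) * f r)"
   using set_integrable_mult_right[OF fint[OF t], of "complex_of_real t"] unfolding set_integrable_def
  proof (rule Bochner_Integration.integrable_bound)
   show "AE r in lborel. norm (indicator {0<..t} r *\<^sub>R (of_real (t - r) * f r)) <= norm (indicator {0<..t} r *\<^sub>R (complex_of_real t * f r))"
    using t by (auto simp: indicator_def norm_mult simp del: of_real_diff intro!: mult_right_mono)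
  qed measurable
  have inner: "(LBINT r:{0<..t}. of_real (t - r) * exp (s * of_real r)) = (exp (s * of_real t) - 1 - s * of_real t) / s ^ 2" if s: "s ~= 0" for s :: complex
  proof -
   have h: "((%r. of_real (t - r) * exp (s * of_real r)) has_integral
    (of_real (t - t) * exp (s * of_real t) / s + exp (s * of_real t) / s ^ 2) - (of_real (t - 0) * exp (s * of_real 0) / s + exp (s * of_real 0) / s ^ 2)) {0..t}"
   proof (rule fundamental_theorem_of_calculus)
    fix r assume "r \<in> {0..t}"
    have "((%z. (of_real t - z) * exp (s * z) / s + exp (s * z) / s ^ 2) has_field_derivative (of_real t - of_real r) * exp (s * of_real r)) (at (of_real r))"
     using s by (auto intro!: derivative_eq_intros simp: field_simps power2_eq_square)
    then have "((%r. (of_real t - of_real r) * exp (s * of_real r) / s + exp (s * of_real r) / s ^ 2) has_vector_derivative (of_real t - of_real r) * exp (s * of_real r)) (at r within {0..t})"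
     by (rule has_vector_derivative_real_field)
    then show "((%r. of_real (t - r) * exp (s * of_real r) / s + exp (s * of_real r) / s ^ 2) has_vector_derivative of_real (t - r) * exp (s * of_real r)) (at r within {0..t})" by simp
   qed (use t in simp)
   have i: "set_lint {0..t} (%r. of_real (t - r) * exp (s * of_real r))"
    by (intro borel_integrable_atLeastAtMost' continuous_intros)
   have "(LBINT r:{0<..t}. of_real (t - r) * exp (s * of_real r)) = (LBINT r:{0..t}. of_real (t - r) * exp (s * of_real r))"
    unfolding set_lebesgue_integral_def using AE_lborel_singleton[of 0] by (intro integral_cong_AE) (auto simp: indicator_def)
   then show ?thesis unfolding set_borel_integral_eq_integral(2)[OF i] integral_unique[OF h] using s
    by (simp add: diff_divide_distrib power2_eq_square)
  qed
  define A2 where "A2 y = exp (vcontour v m y * of_real t) * (g (vcontour v m y) * vdir m y) / vcontour v m y ^ 2" for y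
  define B2 where "B2 y = exp (vcontour v m y * of_real 0) * (g (vcontour v m y) * vdir m y) / vcontour v m y ^ 2" for y
  define B1 where "B1 y = exp (vcontour v m y * of_real 0) * (g (vcontour v m y) * vdir m y) / vcontour v m y ^ 1" for y
  have iAB: "integrable lborel A2" "integrable lborel B2" "integrable lborel B1"
   unfolding A2_def B2_def B1_def by (rule contour_quotient_integrable[OF v]; use m t in simp)+
  have "2 * of_real pi * (LBINT r:{0<..t}. of_real (t - r) * phi v r) = (LBINT y. (LBINT r:{0<..t}. of_real (t - r) * exp (vcontour v m y * of_real r)) * (g (vcontour v m y) * vdir m y))"
   by (rule pf(2))
  also have "... = (LBINT y. A2 y - B2 y - of_real t * B1 y)"
  proof (intro Bochner_Integration.integral_cong refl)
   fix y
   have gen: "(E - 1 - z * \<tau>) / z ^ 2 * G = E * G / z ^ 2 - 1 * G / z ^ 2 - \<tau> * (1 * G / z ^ 1)" if "z ~= 0" for E z \<tau> G :: complex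
    using that by (simp add: diff_divide_distrib left_diff_distrib power2_eq_square)
   show "(LBINT r:{0<..t}. of_real (t - r) * exp (vcontour v m y * of_real r)) * (g (vcontour v m y) * vdir m y) = A2 y - B2 y - of_real t * B1 y"
    unfolding inner[OF nz] gen[OF nz] by (simp add: A2_def B2_def B1_def)
  qed
  also have "... = (LBINT y. A2 y) - (LBINT y. B2 y) - of_real t * (LBINT y. B1 y)"
   using iAB by simp
  also have "... = (LBINT y. A2 y) - 2 * of_real pi * k0 - of_real t * (2 * of_real pi * k1)"
   by (simp add: k0_def k1_def B2_def[abs_def] B1_def[abs_def])
  also have "... = 2 * of_real pi * (LBINT r:{0<..t}. of_real (t - r) * f r) - 2 * of_real pi * k0 - of_real t * (2 * of_real pi * k1)"
   using bromwich_second_primitive[OF t] contour_shift[OF t v] by (simp add: A2_def[abs_def])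
  also have "... = 2 * of_real pi * ((LBINT r:{0<..t}. of_real (t - r) * f r) - (k0 + of_real t * k1))" by (simp add: algebra_simps)
  finally have "(LBINT r:{0<..t}. of_real (t - r) * phi v r) = (LBINT r:{0<..t}. of_real (t - r) * f r) - (k0 + of_real t * k1)" by simp
  moreover have "(LBINT r:{0<..t}. of_real (t - r) * (f r - phi v r)) = (LBINT r:{0<..t}. of_real (t - r) * f r) - (LBINT r:{0<..t}. of_real (t - r) * phi v r)"
   unfolding right_diff_distrib[of "of_real (t - _)"] by (rule set_integral_diff(2)[OF fi pf(1)])
  ultimately show "(LBINT r:{0<..t}. of_real (t - r) * (f r - phi v r)) = k0 + of_real t * k1" by simp
 qed
 then show ?thesis by eventually_elim simp
qed

end

section \<open>Convolutions expressed along the contour\<close>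

lemma set_integral_reflect:
 fixes F :: "real => 'b::{banach, second_countable_topology}"
 assumes F [measurable]: "F \<in> borel_measurable borel"
 shows "set_lint {0<..t} (%r. F (t - r)) \<longleftrightarrow> set_lint {0<..t} F"
  and "(LBINT r:{0<..t}. F (t - r)) = (LBINT x:{0<..t}. F x)"
proof -
 have ae: "AE r in lborel. indicator {0<..t} r *\<^sub>R F (t - r) = indicator {0<..t} (t + (-1) * r) *\<^sub>R F (t + (-1) * r)"
  using AE_lborel_singleton[of 0] AE_lborel_singleton[of t]
  by eventually_elim (auto simp: indicator_def)
 have "set_lint {0<..t} (%r. F (t - r)) \<longleftrightarrow> integrable lborel (%r. indicator {0<..t} (t + (-1) * r) *\<^sub>R F (t + (-1) * r))"
  unfolding set_integrable_def by (rule integrable_cong_AE[OF _ _ ae]) measurable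
 also have "... \<longleftrightarrow> set_lint {0<..t} F"
  unfolding set_integrable_def by (rule lborel_integrable_real_affine_iff) simp
 finally show "set_lint {0<..t} (%r. F (t - r)) \<longleftrightarrow> set_lint {0<..t} F" .
 have "(LBINT r:{0<..t}. F (t - r)) = (LBINT r. indicator {0<..t} (t + (-1) * r) *\<^sub>R F (t + (-1) * r))"
  unfolding set_lebesgue_integral_def by (rule integral_cong_AE[OF _ _ ae]) measurable
 also have "... = (LBINT x:{0<..t}. F x)"
  unfolding set_lebesgue_integral_def by (subst (2) lborel_integral_real_affine[of "-1" _ t]) simp_all
 finally show "(LBINT r:{0<..t}. F (t - r)) = (LBINT x:{0<..t}. F x)" .
qed

text \<open>A weight singular like (t - r)^(a-1) also qualifies for
  \<open>phi_fubini_weighted\<close>. With x = t - r, the half x <= t/2 contains the singularity but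
  is damped by e^(-m |y| t / 2); on the other half \<open>k\<close> is bounded and the exponential
  is integrated.\<close>

lemma kernel_decay_integral:
 fixes k :: "real => real"
 assumes a: "0 < a" "a < 1" and m: "0 < m" and t: "0 < t" and k [measurable]: "k \<in> borel_measurable borel"
  and kb: "!!x. 0 < x ==> \<bar>k x\<bar> <= C * x powr (a - 1)"
 obtains B where "set_lint {0<..t} (%r. k (t - r))"
  "!!y. (LBINT r:{0<..t}. \<bar>k (t - r)\<bar> * damp m y r) <= B * (1 + \<bar>y\<bar>) powr (-1)"
proof -
 have C: "0 <= C" using kb[of 1] by simp
 have kint: "set_lint {0<..t} k"
 proof -
  have "set_lint {0<..t} (%x. C * x powr (a - 1))" using a t by (intro set_integrable_mult_right set_integral_powr_0(1)) auto
  then show ?thesis unfolding set_integrable_def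
   by (rule Bochner_Integration.integrable_bound) (use kb in \<open>auto simp: indicator_def intro: order_trans[OF _ abs_ge_self]\<close>)
 qed
 define X where "X = t / 2"
 have X: "0 < X" "X < t" using t by (auto simp: X_def)
 define B where "B = C * (X powr a / a) * (1 + 1 / (m * X)) + C * X powr (a - 1) * (2 * (t + 1 / m))"
 have est: "(LBINT x:{0<..t}. \<bar>k x\<bar> * damp m y (t - x)) <= B * (1 + \<bar>y\<bar>) powr (-1)" for y
 proof -
  have kei: "set_lint {0<..t} (%x. \<bar>k x\<bar> * damp m y (t - x))"
   using kint unfolding set_integrable_def
  proof (rule Bochner_Integration.integrable_bound)
   have "norm (indicator {0<..t} x *\<^sub>R (\<bar>k x\<bar> * damp m y (t - x))) <= norm (indicator {0<..t} x *\<^sub>R k x)" for x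
   proof (cases "x \<in> {0<..t}")
    case True
    then have "0 <= m * \<bar>y\<bar> * (t - x)" using m by simp
    then have "damp m y (t - x) <= 1" by simp
    then have "\<bar>k x\<bar> * damp m y (t - x) <= \<bar>k x\<bar> * 1" by (intro mult_left_mono) auto
    then show ?thesis using True by (simp add: abs_mult)
   qed simp
   then show "AE x in lborel. norm (indicator {0<..t} x *\<^sub>R (\<bar>k x\<bar> * damp m y (t - x))) <= norm (indicator {0<..t} x *\<^sub>R k x)" by blast
  qed measurable
  have un: "{0<..t} = {0<..X} \<union> {X<..t}" using X by auto
  have s1: "set_lint {0<..X} (%x. \<bar>k x\<bar> * damp m y (t - x))" "set_lint {X<..t} (%x. \<bar>k x\<bar> * damp m y (t - x))"
   by (rule set_integrable_subset[OF kei]; use X in auto)+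
  have split: "(LBINT x:{0<..t}. \<bar>k x\<bar> * damp m y (t - x)) = (LBINT x:{0<..X}. \<bar>k x\<bar> * damp m y (t - x)) + (LBINT x:{X<..t}. \<bar>k x\<bar> * damp m y (t - x))"
   unfolding un using X by (intro set_integral_Un s1) auto
  have p1: "(LBINT x:{0<..X}. \<bar>k x\<bar> * damp m y (t - x)) <= C * (X powr a / a) * (1 + 1 / (m * X)) * (1 + \<bar>y\<bar>) powr (-1)"
  proof -
   define e where "e = exp (- (m * \<bar>y\<bar> * X))"
   have "(LBINT x:{0<..X}. \<bar>k x\<bar> * damp m y (t - x)) <= (LBINT x:{0<..X}. C * e * x powr (a - 1))"
   proof (rule set_integral_mono[OF s1(1)])
    show "set_lint {0<..X} (%x. C * e * x powr (a - 1))" using a X by (intro set_integrable_mult_right set_integral_powr_0(1)) auto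
    fix x assume x: "x \<in> {0<..X}"
    have "m * \<bar>y\<bar> * X <= m * \<bar>y\<bar> * (t - x)" using x m by (intro mult_left_mono) (auto simp: X_def)
    then have "damp m y (t - x) <= e" by (simp add: e_def)
    then have "\<bar>k x\<bar> * damp m y (t - x) <= (C * x powr (a - 1)) * e" using kb[of x] x C by (intro mult_mono) auto
    then show "\<bar>k x\<bar> * damp m y (t - x) <= C * e * x powr (a - 1)" by (simp add: mult_ac)
   qed
   also have "... = (C * (X powr a / a)) * e" using set_integral_powr_0(2)[of "a - 1" X] a X by simp
   finally have 0: "(LBINT x:{0<..X}. \<bar>k x\<bar> * damp m y (t - x)) <= (C * (X powr a / a)) * e" .
   have 1: "e <= (1 + 1 / (m * X)) * (1 + \<bar>y\<bar>) powr (-1)"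
   proof -
    define w where "w = m * \<bar>y\<bar> * X"
    have w: "0 <= w" using m X by (simp add: w_def)
    have "1 + w <= exp w" by (rule exp_ge_add_one_self)
    then have ew: "e * (1 + w) <= 1" unfolding e_def w_def[symmetric] by (simp add: exp_minus field_simps)
    have e01: "0 <= e" "e <= 1" using w by (auto simp: e_def w_def)
    have "e * w <= 1" using ew e01 by (simp add: distrib_left)
    then have "(m * X) * (e * \<bar>y\<bar>) <= 1" by (simp add: w_def mult_ac)
    then have "e * \<bar>y\<bar> <= 1 / (m * X)" using m X by (simp add: pos_le_divide_eq mult.commute)
    then have "e * (1 + \<bar>y\<bar>) <= 1 + 1 / (m * X)" using e01 by (simp add: distrib_left)
    then show ?thesis by (simp add: powr_minus_divide pos_le_divide_eq)
   qed
   have "(C * (X powr a / a)) * e <= (C * (X powr a / a)) * ((1 + 1 / (m * X)) * (1 + \<bar>y\<bar>) powr (-1))"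
    using C a by (intro mult_left_mono[OF 1]) auto
   then show ?thesis using 0 unfolding mult.assoc by linarith
  qed
  have p2: "(LBINT x:{X<..t}. \<bar>k x\<bar> * damp m y (t - x)) <= C * X powr (a - 1) * (2 * (t + 1 / m)) * (1 + \<bar>y\<bar>) powr (-1)"
  proof -
   define J where "J = (LBINT x:{X<..t}. damp m y (t - x))"
   have J0: "0 <= J" unfolding J_def set_lebesgue_integral_def by (intro Bochner_Integration.integral_nonneg) auto
   note ed = set_integral_exp_decay[of "m * \<bar>y\<bar>" X t]
   have "(LBINT x:{X<..t}. \<bar>k x\<bar> * damp m y (t - x)) <= (LBINT x:{X<..t}. C * X powr (a - 1) * damp m y (t - x))"
   proof (rule set_integral_mono[OF s1(2)])
    show "set_lint {X<..t} (%x. C * X powr (a - 1) * damp m y (t - x))" using ed(1) m X by (intro set_integrable_mult_right) auto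
    fix x assume x: "x \<in> {X<..t}"
    have "C * x powr (a - 1) <= C * X powr (a - 1)" using x X a C by (intro mult_left_mono powr_mono2') auto
    then have "\<bar>k x\<bar> <= C * X powr (a - 1)" using kb[of x] x X by auto
    then show "\<bar>k x\<bar> * damp m y (t - x) <= C * X powr (a - 1) * damp m y (t - x)" by (intro mult_right_mono) auto
   qed
   also have "... = C * X powr (a - 1) * J" by (simp add: J_def)
   finally have 0: "(LBINT x:{X<..t}. \<bar>k x\<bar> * damp m y (t - x)) <= C * X powr (a - 1) * J" .
   have 1: "J <= 2 * (t + 1 / m) * (1 + \<bar>y\<bar>) powr (-1)"
   proof -
    have 1: "(1 + m * \<bar>y\<bar> * t) * J <= 2 * t" using ed(2) m X t by (simp add: J_def)
    have mt: "0 <= m * \<bar>y\<bar> * t * J" using m t J0 by simp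
    have "J <= 2 * t" "m * \<bar>y\<bar> * t * J <= 2 * t" using 1 mt J0 by (auto simp: distrib_right)
    then have "J <= 2 * t" "\<bar>y\<bar> * J <= 2 / m" using m t by (auto simp: field_simps)
    then have "(1 + \<bar>y\<bar>) * J <= 2 * (t + 1 / m)" by (simp add: distrib_right distrib_left)
    then show ?thesis by (simp add: powr_minus_divide pos_le_divide_eq mult.commute)
   qed
   have "C * X powr (a - 1) * J <= C * X powr (a - 1) * (2 * (t + 1 / m) * (1 + \<bar>y\<bar>) powr (-1))"
    using C by (intro mult_left_mono[OF 1]) auto
   then show ?thesis using 0 unfolding mult.assoc by linarith
  qed
  show ?thesis unfolding split B_def distrib_right using p1 p2 by linarith
 qed
 show ?thesis
 proof (rule that)
  show "set_lint {0<..t} (%r. k (t - r))" using set_integral_reflect(1)[OF k] kint by blast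
  fix y
  have "(LBINT r:{0<..t}. \<bar>k (t - r)\<bar> * damp m y r) = (LBINT x:{0<..t}. \<bar>k x\<bar> * damp m y (t - x))"
   using set_integral_reflect(2)[of "%x. \<bar>k x\<bar> * damp m y (t - x)" t] by simp
  then show "(LBINT r:{0<..t}. \<bar>k (t - r)\<bar> * damp m y r) <= B * (1 + \<bar>y\<bar>) powr (-1)" using est by simp
 qed
qed

text \<open>The substitution of \<open>phi\<close> for \<open>f\<close> under the integral. It is
  applied to \<open>cn_kernel\<close> for the error, and to \<open>mlk\<close> for the integrability
  of the semidiscrete convolution.\<close>

lemma (in laplace_data) convolution_representation:
 fixes k :: "real => real"
 assumes a: "0 < a" "a < 1" and t: "0 < t" and k [measurable]: "k \<in> borel_measurable borel"
  and kb: "!!x. 0 < x ==> \<bar>k x\<bar> <= C * x powr (a - 1)" and v: "a1 < v"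
 defines "h \<equiv> %y. (LBINT x:{0<..t}. of_real (k x) * exp (vcontour v m y * of_real (t - x)))"
 shows "set_lint {0<..t} (%r. of_real (k (t - r)) * f r)"
  and "(LBINT r:{0<..t}. of_real (k (t - r)) * f r) = (LBINT y. 1 / (2 * of_real pi) * (h y * (g (vcontour v m y) * vdir m y)))"
  and "integrable lborel (%y. 1 / (2 * of_real pi) * (h y * (g (vcontour v m y) * vdir m y)))"
proof -
 obtain B where B: "set_lint {0<..t} (%r. k (t - r))"
  "!!y. (LBINT r:{0<..t}. \<bar>k (t - r)\<bar> * damp m y r) <= B * (1 + \<bar>y\<bar>) powr (-1)"
  using kernel_decay_integral[OF a m t k kb] by metis
 have pm: "(%r. k (t - r)) \<in> borel_measurable borel" by measurable
 note pf = phi_fubini_weighted[OF v t pm B]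
 have hy: "(LBINT r:{0<..t}. of_real (k (t - r)) * exp (vcontour v m y * of_real r)) = h y" for y
  unfolding h_def using set_integral_reflect(2)[of "%x. complex_of_real (k x) * exp (vcontour v m y * of_real (t - x))" t] by simp
 have [measurable]: "phi v \<in> borel_measurable borel" by (rule phi_measurable[OF v])
 have ae: "AE r in lborel. indicator {0<..t} r *\<^sub>R (complex_of_real (k (t - r)) * f r) = indicator {0<..t} r *\<^sub>R (of_real (k (t - r)) * phi v r)"
  using laplace_inversion[OF v] by eventually_elim (auto simp: indicator_def)
 show "set_lint {0<..t} (%r. of_real (k (t - r)) * f r)"
  using pf(1) unfolding set_integrable_def by (subst integrable_cong_AE[OF _ _ ae]) auto
 have "(LBINT r:{0<..t}. of_real (k (t - r)) * f r) = (LBINT r:{0<..t}. of_real (k (t - r)) * phi v r)"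
  unfolding set_lebesgue_integral_def by (rule integral_cong_AE[OF _ _ ae]) measurable
 also have "... = 1 / (2 * of_real pi) * (LBINT y. h y * (g (vcontour v m y) * vdir m y))"
  using pf(2) unfolding hy by (simp add: field_simps)
 finally show "(LBINT r:{0<..t}. of_real (k (t - r)) * f r) = (LBINT y. 1 / (2 * of_real pi) * (h y * (g (vcontour v m y) * vdir m y)))"
  unfolding integral_mult_right_zero .
 show "integrable lborel (%y. 1 / (2 * of_real pi) * (h y * (g (vcontour v m y) * vdir m y)))"
  using pf(3) unfolding hy by (rule integrable_mult_right)
qed

text \<open>Minkowski's inequality for integrals, by duality: the square of the left-hand side is
  the integral of the pairing of G with the vector \<open>e\<close> of its integrals, and
  Cauchy-Schwarz under the integral leaves one factor N to cancel.\<close>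

lemma L2_set_integral_le:
 fixes G :: "'i => real => complex"
 assumes I: "finite I" and int: "!!k. k \<in> I ==> integrable lborel (G k)" and D: "integrable lborel D"
  and b: "!!y. L2_set (%k. cmod (G k y)) I <= D y"
 shows "L2_set (%k. cmod (LBINT y. G k y)) I <= (LBINT y. D y)"
proof -
 define e where "e k = (LBINT y. G k y)" for k
 define N where "N = L2_set (%k. cmod (e k)) I"
 have N0: "0 <= N" by (simp add: N_def)
 have D0: "0 <= (LBINT y. D y)" using b by (intro Bochner_Integration.integral_nonneg) (metis L2_set_nonneg order_trans)
 have int': "integrable lborel (%y. \<Sum>k\<in>I. cnj (e k) * G k y)" using int by (intro Bochner_Integration.integrable_sum integrable_mult_right) auto
 have "of_real (N\<^sup>2) = (\<Sum>k\<in>I. cnj (e k) * e k)"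
  by (simp add: N_def L2_set_def sum_nonneg complex_norm_square mult.commute del: of_real_power)
 also have "... = (LBINT y. (\<Sum>k\<in>I. cnj (e k) * G k y))"
  unfolding e_def using int by (subst Bochner_Integration.integral_sum) auto
 finally have "N\<^sup>2 = cmod (LBINT y. (\<Sum>k\<in>I. cnj (e k) * G k y))" by (metis norm_of_real abs_power2)
 also have "... <= (LBINT y. N * D y)"
 proof (rule Bochner_Integration.integral_norm_bound_integral[OF int'])
  show "integrable lborel (%y. N * D y)" using D by simp
  fix y
  have "cmod (\<Sum>k\<in>I. cnj (e k) * G k y) <= (\<Sum>k\<in>I. \<bar>cmod (e k)\<bar> * \<bar>cmod (G k y)\<bar>)"
   by (rule order_trans[OF norm_sum]) (simp add: norm_mult)
  also have "... <= N * L2_set (%k. cmod (G k y)) I" unfolding N_def by (rule L2_set_mult_ineq)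
  also have "... <= N * D y" using b N0 by (intro mult_left_mono) auto
  finally show "cmod (\<Sum>k\<in>I. cnj (e k) * G k y) <= N * D y" .
 qed
 also have "... = N * (LBINT y. D y)" by simp
 finally have "N * N <= N * (LBINT y. D y)" by (simp add: power2_eq_square)
 then have "N <= (LBINT y. D y)" using N0 D0 by (cases "N = 0") auto
 then show ?thesis by (simp add: N_def e_def)
qed

text \<open>All components are estimated at once in the Euclidean norm, \<open>c\<close> being a
  bound on the transform as a vector, so that their number does not enter. The power of t is
  composed of t^(a-2) from the kernel, t^(\<mu>+1) from \<open>g\<close> on the rescaled contour and
  t^(-1) from the integration in y.\<close>

theorem cn_convolution_error:
 assumes a: "0 < a" "a < 1" and mu: "-1 < \<mu>" and m: "0 < m" and A: "0 < A"
 obtains K where "0 < K"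
  "!!I l f g c c' b a1 t \<tau>. [|finite (I :: nat set); !!k. k \<in> I ==> 0 < l k; !!k. k \<in> I ==> laplace_data (f k) (g k) b a1 m c' \<mu>;
   !!s. a1 - m * \<bar>Im s\<bar> < Re s ==> L2_set (%k. cmod (g k s)) I <= c * cmod s powr (- \<mu> - 1); 0 <= c; 0 < t; 0 < \<tau>; a1 < A / t|] ==>
   L2_set (%k. cmod (LBINT r:{0<..t}. of_real (cn_kernel a \<tau> (l k) (t - r)) * f k r)) I <= K * c * t powr (a + \<mu> - 2) * \<tau>\<^sup>2"
proof -
 obtain C where C: "0 < C"
  "!!l \<tau> x. 0 < l ==> 0 < \<tau> ==> 0 < x ==> \<bar>cn_kernel a \<tau> l x\<bar> <= C * x powr (a - 1)"
  "!!l \<tau> x. 0 < l ==> 0 < \<tau> ==> 0 < x ==> \<bar>cn_kernel a \<tau> l x\<bar> <= C * \<tau>\<^sup>2 * x powr (a - 3)"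
  "!!l \<tau>. 0 < l ==> 0 < \<tau> ==> set_lint {0<..} (cn_kernel a \<tau> l)"
  "!!l \<tau>. 0 < l ==> 0 < \<tau> ==> set_lint {0<..} (%x. x * cn_kernel a \<tau> l x)"
  "!!l \<tau>. 0 < l ==> 0 < \<tau> ==> (LBINT x:{0<..}. cn_kernel a \<tau> l x) = 0"
  "!!l \<tau>. 0 < l ==> 0 < \<tau> ==> (LBINT x:{0<..}. x * cn_kernel a \<tau> l x) = 0"
  by (rule cn_kernel_properties[OF a]) (rule that)
 obtain K1 where K1: "0 < K1"
  "!!\<kappa> B t y. [|!!x. 0 < x ==> \<bar>\<kappa> x\<bar> <= B * x powr (a - 3); 0 <= B;
    set_lint {0<..} \<kappa>; set_lint {0<..} (%x. x * \<kappa> x);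
    (LBINT x:{0<..}. \<kappa> x) = 0; (LBINT x:{0<..}. x * \<kappa> x) = 0; \<kappa> \<in> borel_measurable borel; 0 < t|] ==>
   cmod (LBINT x:{0<..t}. of_real (\<kappa> x) * exp (vcontour (A / t) m y * of_real (t - x)))
    <= K1 * B * t powr (a - 2) / (1 + \<bar>y\<bar> * t)"
  by (fact kernel_exp_bound[OF a less_imp_le[OF A] m])
 have pe: "- (\<mu> + 1) = - \<mu> - 1" by simp
 obtain C2 where C2: "0 < C2" "!!y. cmod (vcontour A m y) powr (- \<mu> - 1) <= C2 * (1 + \<bar>y\<bar>) powr (- \<mu> - 1)"
  using vcontour_powr_le[OF A less_imp_le[OF m], of "\<mu> + 1", unfolded pe] mu by auto
 define P where "P = (LBINT u. (1 + \<bar>u\<bar>) powr (- (\<mu> + 2)))"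
 have P0: "0 <= P" unfolding P_def by (intro Bochner_Integration.integral_nonneg) auto
 define K where "K = K1 * C * (1 + m) * C2 * P + 1"
 have K: "0 < K" unfolding K_def using K1 C m C2 P0 by (intro add_nonneg_pos mult_nonneg_nonneg) auto
 show ?thesis
 proof (rule that[OF K])
  fix I :: "nat set" and l :: "nat => real" and f :: "nat => real => complex" and g :: "nat => complex => complex" and c c' b a1 t \<tau> :: real
  assume I: "finite I" and l: "!!k. k \<in> I ==> 0 < l k" and ld: "!!k. k \<in> I ==> laplace_data (f k) (g k) b a1 m c' \<mu>"
   and gb: "!!s. a1 - m * \<bar>Im s\<bar> < Re s ==> L2_set (%k. cmod (g k s)) I <= c * cmod s powr (- \<mu> - 1)"
   and c: "0 <= c" and t: "0 < t" and \<tau>: "0 < \<tau>" and v: "a1 < A / t"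
  define \<gamma> where "\<gamma> = vcontour (A / t) m"
  define h where "h k y = (LBINT x:{0<..t}. of_real (cn_kernel a \<tau> (l k) x) * exp (\<gamma> y * of_real (t - x)))" for k y
  define G where "G k y = 1 / (2 * of_real pi) * (h k y * (g k (\<gamma> y) * vdir m y))" for k y
  have rep: "(LBINT r:{0<..t}. of_real (cn_kernel a \<tau> (l k) (t - r)) * f k r) = (LBINT y. G k y)"
   and Gint: "integrable lborel (G k)" if k: "k \<in> I" for k
  proof -
   interpret laplace_data "f k" "g k" b a1 m c' \<mu> by (rule ld[OF k])
   show "(LBINT r:{0<..t}. of_real (cn_kernel a \<tau> (l k) (t - r)) * f k r) = (LBINT y. G k y)" "integrable lborel (G k)"
    unfolding G_def h_def \<gamma>_def
    by (rule convolution_representation[OF a t cn_kernel_measurable C(2)[OF l[OF k] \<tau>] v]; assumption)+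
  qed
  define Z where "Z = K1 * C * (1 + m) * C2 * c * \<tau>\<^sup>2 * t powr (a + \<mu> - 1)"
  define D where "D y = Z * (1 + \<bar>0 + t * y\<bar>) powr (- (\<mu> + 2))" for y
  have hb: "cmod (h k y) <= K1 * (C * \<tau>\<^sup>2) * t powr (a - 2) / (1 + \<bar>y\<bar> * t)" if k: "k \<in> I" for k y
   unfolding h_def \<gamma>_def using C l[OF k] \<tau> t by (intro K1(2)) auto
  have \<gamma>t: "cmod (\<gamma> y) powr (- \<mu> - 1) <= C2 * t powr (\<mu> + 1) * (1 + \<bar>y\<bar> * t) powr (- \<mu> - 1)" for y
  proof -
   \<comment> \<open>The contours for different t are dilates of a single one; hence one constant
     \<open>C2\<close> for all t.\<close>
   have "\<gamma> y = vcontour A m (y * t) / of_real t" using t by (simp add: \<gamma>_def vcontour_def complex_eq_iff abs_mult field_simps)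
   then have "cmod (\<gamma> y) = cmod (vcontour A m (y * t)) / t" using t by (simp add: norm_divide)
   then have "cmod (\<gamma> y) powr (- \<mu> - 1) = cmod (vcontour A m (y * t)) powr (- \<mu> - 1) / t powr (- \<mu> - 1)" using t by (simp add: powr_divide)
   also have "... = cmod (vcontour A m (y * t)) powr (- \<mu> - 1) * t powr (\<mu> + 1)"
    using powr_minus_divide[of t "- \<mu> - 1"] unfolding minus_diff_eq by (simp add: add.commute)
   also have "... <= (C2 * (1 + \<bar>y * t\<bar>) powr (- \<mu> - 1)) * t powr (\<mu> + 1)" using C2(2)[of "y * t"] by (intro mult_right_mono) auto
   finally show ?thesis using t by (simp add: abs_mult mult_ac)
  qed
  have Db: "L2_set (%k. cmod (G k y)) I <= D y" for y
  proof -
   define Hy where "Hy = K1 * (C * \<tau>\<^sup>2) * t powr (a - 2) / (1 + \<bar>y\<bar> * t)"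
   have Hy: "0 <= Hy" unfolding Hy_def using K1 C t by simp
   have "cmod (G k y) <= Hy * (1 + m) * cmod (g k (\<gamma> y))" if k: "k \<in> I" for k
   proof -
    have "cmod (G k y) = 1 / (2 * pi) * (cmod (h k y) * (cmod (g k (\<gamma> y)) * cmod (vdir m y)))"
     by (simp add: G_def norm_mult norm_divide)
    also have "... <= 1 * (Hy * (cmod (g k (\<gamma> y)) * (1 + m)))"
     using hb[OF k, of y] vdir_norm[of m y] m Hy pi_ge_two by (intro mult_mono) (auto simp: Hy_def)
    finally show ?thesis by (simp add: mult_ac)
   qed
   then have "L2_set (%k. cmod (G k y)) I <= L2_set (%k. Hy * (1 + m) * cmod (g k (\<gamma> y))) I" by (intro L2_set_mono) auto
   also have "... = Hy * (1 + m) * L2_set (%k. cmod (g k (\<gamma> y))) I" using Hy m by (simp add: L2_set_right_distrib)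
   also have "... <= Hy * (1 + m) * (c * (C2 * t powr (\<mu> + 1) * (1 + \<bar>y\<bar> * t) powr (- \<mu> - 1)))"
   proof (intro mult_left_mono)
    have "a1 - m * \<bar>Im (\<gamma> y)\<bar> < Re (\<gamma> y)" using v by (simp add: \<gamma>_def vcontour_def)
    then have "L2_set (%k. cmod (g k (\<gamma> y))) I <= c * cmod (\<gamma> y) powr (- \<mu> - 1)" by (rule gb)
    also have "... <= c * (C2 * t powr (\<mu> + 1) * (1 + \<bar>y\<bar> * t) powr (- \<mu> - 1))" using c \<gamma>t by (intro mult_left_mono) auto
    finally show "L2_set (%k. cmod (g k (\<gamma> y))) I <= c * (C2 * t powr (\<mu> + 1) * (1 + \<bar>y\<bar> * t) powr (- \<mu> - 1))" .
   qed (use Hy m in auto)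
   also have "... = K1 * C * (1 + m) * C2 * c * \<tau>\<^sup>2 * (t powr (a - 2) * t powr (\<mu> + 1)) * ((1 + \<bar>y\<bar> * t) powr (- \<mu> - 1) / (1 + \<bar>y\<bar> * t))"
    by (simp add: Hy_def)
   also have "t powr (a - 2) * t powr (\<mu> + 1) = t powr (a + \<mu> - 1)" by (subst powr_add[symmetric]) (rule arg_cong2[where f = "(powr)"]; simp)
   also have "(1 + \<bar>y\<bar> * t) powr (- \<mu> - 1) / (1 + \<bar>y\<bar> * t) = (1 + \<bar>y\<bar> * t) powr (- (\<mu> + 2))"
   proof -
    have p: "0 < 1 + \<bar>y\<bar> * t" using t by (simp add: add_pos_nonneg)
    have "(1 + \<bar>y\<bar> * t) powr (- \<mu> - 1) / (1 + \<bar>y\<bar> * t) = (1 + \<bar>y\<bar> * t) powr (- \<mu> - 1) * (1 + \<bar>y\<bar> * t) powr (-1)" using p by (simp add: powr_minus_divide)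
    also have "... = (1 + \<bar>y\<bar> * t) powr (- (\<mu> + 2))" by (subst powr_add[symmetric]) (rule arg_cong2[where f = "(powr)"]; simp)
    finally show ?thesis .
   qed
   finally show ?thesis using t by (simp add: D_def Z_def abs_mult mult.commute)
  qed
  have Dint: "integrable lborel D" unfolding D_def
   using mu t by (intro integrable_mult_right lborel_integrable_real_affine[of "%u. (1 + \<bar>u\<bar>) powr (- (\<mu> + 2))"] integrable_one_plus_abs_powr) auto
  have "L2_set (%k. cmod (LBINT r:{0<..t}. of_real (cn_kernel a \<tau> (l k) (t - r)) * f k r)) I = L2_set (%k. cmod (LBINT y. G k y)) I"
   using rep by (intro L2_set_cong) auto
  also have "... <= (LBINT y. D y)" by (rule L2_set_integral_le[OF I Gint Dint Db])
  also have "... = Z * (P / t)"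
  proof -
   have "P = \<bar>t\<bar> *\<^sub>R (LBINT y. (1 + \<bar>0 + t * y\<bar>) powr (- (\<mu> + 2)))"
    unfolding P_def using t by (intro lborel_integral_real_affine) auto
   then have "(LBINT y. (1 + \<bar>0 + t * y\<bar>) powr (- (\<mu> + 2))) = P / t" using t by simp
   then show ?thesis unfolding D_def by simp
  qed
  also have "... = (K1 * C * (1 + m) * C2 * P) * c * (t powr (a + \<mu> - 1) / t) * \<tau>\<^sup>2" by (simp add: Z_def)
  also have "t powr (a + \<mu> - 1) / t = t powr (a + \<mu> - 2)" using t powr_add[of t "a + \<mu> - 2" 1] by (simp add: field_simps)
  also have "(K1 * C * (1 + m) * C2 * P) * c * t powr (a + \<mu> - 2) * \<tau>\<^sup>2 <= K * c * t powr (a + \<mu> - 2) * \<tau>\<^sup>2"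
   using c by (intro mult_right_mono) (auto simp: K_def)
  finally show "L2_set (%k. cmod (LBINT r:{0<..t}. of_real (cn_kernel a \<tau> (l k) (t - r)) * f k r)) I <= K * c * t powr (a + \<mu> - 2) * \<tau>\<^sup>2" .
 qed
qed

section \<open>Spectral decomposition of a finite-dimensional form\<close>

text \<open>Gaussian elimination: some row j with a nonzero entry at p clears the point p from the
  other rows, and the induction hypothesis applies to these at the remaining points.\<close>

lemma nontrivial_relation:
 fixes w :: "'i => 'x => complex"
 assumes "finite P" "finite I" "card P < card I"
 obtains c where "\<exists>i\<in>I. c i ~= 0" "!!p. p \<in> P ==> (\<Sum>i\<in>I. c i * w i p) = 0"
proof -
 have "\<exists>c. (\<exists>i\<in>I. c i ~= 0) \<and> (\<forall>p\<in>P. (\<Sum>i\<in>I. c i * w i p) = 0)"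
  using assms
 proof (induction P arbitrary: I w rule: finite_induct)
  case empty
  then show ?case by (intro exI[of _ "%_. 1"]) (auto simp: card_gt_0_iff)
 next
  case (insert p P)
  show ?case
  proof (cases "\<forall>i\<in>I. w i p = 0")
   case True
   have "card P < card I" using insert by simp
   then obtain c where "(\<exists>i\<in>I. c i ~= 0) \<and> (\<forall>p\<in>P. (\<Sum>i\<in>I. c i * w i p) = 0)" using insert by metis
   then show ?thesis using True by (intro exI[of _ c]) auto
  next
   case False
   then obtain j where j: "j \<in> I" "w j p ~= 0" by auto
   define w' where "w' i x = w i x - (w i p / w j p) * w j x" for i x
   have "card P < card (I - {j})" using insert j by simp
   then obtain c where c: "\<exists>i\<in>I - {j}. c i ~= 0" "\<forall>p\<in>P. (\<Sum>i\<in>I - {j}. c i * w' i p) = 0"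
    using insert.IH[of "I - {j}" w'] insert.prems by auto
   define d where "d i = (if i = j then - (\<Sum>i\<in>I - {j}. c i * (w i p / w j p)) else c i)" for i
   have *: "(\<Sum>i\<in>I. d i * w i x) = (\<Sum>i\<in>I - {j}. c i * w' i x)" for x
   proof -
    have "(\<Sum>i\<in>I. d i * w i x) = d j * w j x + (\<Sum>i\<in>I - {j}. d i * w i x)" using insert.prems j by (simp add: sum.remove)
    also have "(\<Sum>i\<in>I - {j}. d i * w i x) = (\<Sum>i\<in>I - {j}. c i * w i x)" by (intro sum.cong) (auto simp: d_def)
    also have "d j * w j x = - (\<Sum>i\<in>I - {j}. c i * (w i p / w j p) * w j x)" by (simp add: d_def sum_distrib_right)
    finally show ?thesis by (simp add: w'_def algebra_simps sum_subtractf)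
   qed
   have "(\<Sum>i\<in>I - {j}. c i * w' i p) = 0" using j by (simp add: w'_def)
   then have "\<forall>x\<in>insert p P. (\<Sum>i\<in>I. d i * w i x) = 0" using c(2) unfolding * by blast
   moreover have "\<exists>i\<in>I. d i ~= 0" using c(1) by (auto simp: d_def)
   ultimately show ?thesis by blast
  qed
 qed
 then show ?thesis using that by blast
qed

text \<open>\<open>H\<close> stands for the square integrable functions, \<open>X\<close> for the
  discrete space. Finite dimension is expressed by a finite set \<open>P\<close> of points whose
  values determine the elements of \<open>X\<close>. Elements of \<open>H\<close> are functions
  rather than classes, so definiteness of \<open>ip\<close> is stated on \<open>X\<close>.\<close>

locale form_space =
 fixes H X :: "('x => complex) set" and ip a :: "('x => complex) => ('x => complex) => complex" and P :: "'x set"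
 assumes H_add: "u \<in> H ==> v \<in> H ==> (%x. u x + v x) \<in> H"
  and H_scale: "u \<in> H ==> (%x. c * u x) \<in> H"
  and X_H: "X \<subseteq> H"
  and X_zero: "(%_. 0) \<in> X"
  and X_add: "u \<in> X ==> v \<in> X ==> (%x. u x + v x) \<in> X"
  and X_scale: "u \<in> X ==> (%x. c * u x) \<in> X"
  and ip_add: "u \<in> H ==> v \<in> H ==> w \<in> H ==> ip (%x. u x + v x) w = ip u w + ip v w"
  and ip_scale: "u \<in> H ==> w \<in> H ==> ip (%x. c * u x) w = c * ip u w"
  and ip_cnj: "u \<in> H ==> w \<in> H ==> ip w u = cnj (ip u w)"
  and ip_pos: "u \<in> H ==> 0 <= Re (ip u u)"
  and ip_definite: "u \<in> X ==> ip u u = 0 ==> u = (%_. 0)"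
  and a_add: "u \<in> X ==> v \<in> X ==> w \<in> X ==> a (%x. u x + v x) w = a u w + a v w"
  and a_scale: "u \<in> X ==> w \<in> X ==> a (%x. c * u x) w = c * a u w"
  and a_cnj: "u \<in> X ==> w \<in> X ==> a w u = cnj (a u w)"
  and a_pos: "u \<in> X ==> u ~= (%_. 0) ==> 0 < Re (a u u)"
  and P_finite: "finite P"
  and P_separates: "u \<in> X ==> (!!p. p \<in> P ==> u p = 0) ==> u = (%_. 0)"
begin

lemma XH: "u \<in> X ==> u \<in> H" using X_H by blast

lemma X_sum: "(!!i. i \<in> I ==> f i \<in> X) ==> (%x. \<Sum>i\<in>I. c i * f i x) \<in> X"
proof (induction I rule: infinite_finite_induct)
 case (insert i I)
 have "(%x. c i * f i x + (\<Sum>i\<in>I. c i * f i x)) \<in> X" by (intro X_add X_scale insert) (use insert in auto)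
 then show ?case using insert by simp
qed (simp_all add: X_zero)

lemma ip_zero: "w \<in> H ==> ip (%_. 0) w = 0"
 using ip_scale[of "%_. 0" w 0] XH[OF X_zero] by simp

lemma a_zero: "w \<in> X ==> a (%_. 0) w = 0"
 using a_scale[of "%_. 0" w 0] X_zero by simp

lemma ip_sum: "w \<in> H ==> (!!i. i \<in> I ==> f i \<in> X) ==> ip (%x. \<Sum>i\<in>I. c i * f i x) w = (\<Sum>i\<in>I. c i * ip (f i) w)"
proof (induction I rule: infinite_finite_induct)
 case (insert i I)
 have "ip (%x. c i * f i x + (\<Sum>i\<in>I. c i * f i x)) w = c i * ip (f i) w + ip (%x. \<Sum>i\<in>I. c i * f i x) w"
  using insert by (subst ip_add) (simp_all add: H_scale XH X_sum ip_scale)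
 then show ?case using insert by simp
qed (simp_all add: ip_zero)

lemma a_sum: "w \<in> X ==> (!!i. i \<in> I ==> f i \<in> X) ==> a (%x. \<Sum>i\<in>I. c i * f i x) w = (\<Sum>i\<in>I. c i * a (f i) w)"
proof (induction I rule: infinite_finite_induct)
 case (insert i I)
 have "a (%x. c i * f i x + (\<Sum>i\<in>I. c i * f i x)) w = c i * a (f i) w + a (%x. \<Sum>i\<in>I. c i * f i x) w"
  using insert by (subst a_add) (simp_all add: X_scale X_sum a_scale)
 then show ?case using insert by simp
qed (simp_all add: a_zero)

lemma H_diff: "u \<in> H ==> v \<in> H ==> (%x. u x - v x) \<in> H" using H_add[of u "%x. (-1) * v x"] H_scale[of v "-1"] by simp
lemma X_diff: "u \<in> X ==> v \<in> X ==> (%x. u x - v x) \<in> X" using X_add[of u "%x. (-1) * v x"] X_scale[of v "-1"] by simp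
lemma ip_diff: "u \<in> H ==> v \<in> H ==> w \<in> H ==> ip (%x. u x - v x) w = ip u w - ip v w"
 using ip_add[of u "%x. (-1) * v x" w] ip_scale[of v w "-1"] H_scale[of v "-1"] by simp

lemma ip_self_real: "u \<in> H ==> ip u u = of_real (Re (ip u u))"
 using ip_cnj[of u u] by (simp add: complex_eq_iff)

lemma a_self_real: "u \<in> X ==> a u u = of_real (Re (a u u))"
 using a_cnj[of u u] by (simp add: complex_eq_iff)

definition orthonormal :: "nat => (nat => 'x => complex) => bool" where
 "orthonormal n e \<longleftrightarrow> (\<forall>i<n. e i \<in> X) \<and> (\<forall>i<n. \<forall>j<n. ip (e i) (e j) = (if i = j then 1 else 0))"

lemma ip_orthonormal_sum:
 assumes "orthonormal n e" "j < n"
 shows "ip (%x. \<Sum>i<n. c i * e i x) (e j) = c j"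
proof -
 have "ip (%x. \<Sum>i<n. c i * e i x) (e j) = (\<Sum>i<n. c i * ip (e i) (e j))"
  using assms by (intro ip_sum) (auto simp: orthonormal_def intro: XH)
 also have "... = (\<Sum>i<n. if i = j then c i else 0)" using assms by (intro sum.cong) (auto simp: orthonormal_def)
 finally show ?thesis using assms by simp
qed

text \<open>More than card P functions satisfy a nontrivial relation at the points of
  \<open>P\<close>, hence everywhere; pairing with the members of the family shows that all its
  coefficients vanish.\<close>

lemma orthonormal_card: assumes "orthonormal n e" shows "n <= card P"
proof (rule ccontr)
 assume "\<not> n <= card P"
 then have "card P < card {..<n}" by simp
 then obtain c where c: "\<exists>i\<in>{..<n}. c i ~= 0" "!!p. p \<in> P ==> (\<Sum>i<n. c i * e i p) = 0"
  using nontrivial_relation[OF P_finite, of "{..<n}" e] by auto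
 have X: "(%x. \<Sum>i<n. c i * e i x) \<in> X" using assms by (intro X_sum) (auto simp: orthonormal_def)
 have z: "(%x. \<Sum>i<n. c i * e i x) = (%_. 0)" by (rule P_separates[OF X c(2)])
 have "c j = 0" if "j < n" for j
  using ip_orthonormal_sum[OF assms that, of c] assms that unfolding z by (simp add: ip_zero XH orthonormal_def)
 then show False using c(1) by auto
qed

text \<open>A family of maximal length among those with property \<open>Q\<close>, the length being
  bounded by card P. If it did not span, v minus its expansion would feed \<open>ext\<close>, and
  the normalised result would lengthen the family. \<open>Q\<close> is trivial in
  \<open>form_operator_exists\<close> and means being an eigenvector in
  \<open>eigenbasis_exists\<close>.\<close>

lemma orthonormal_basis_exists:
 assumes ext: "!!n e v. orthonormal n e ==> (!!i. i < n ==> Q (e i)) ==> v \<in> X ==> v ~= (%_. 0) ==> (!!i. i < n ==> ip v (e i) = 0) ==>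
   \<exists>u\<in>X. u ~= (%_. 0) \<and> Q u \<and> (\<forall>i<n. ip u (e i) = 0)"
  and scale: "!!u c. u \<in> X ==> Q u ==> Q (%x. c * u x)"
 obtains n e where "orthonormal n e" "!!i. i < n ==> Q (e i)" "!!v. v \<in> X ==> v = (%x. \<Sum>i<n. ip v (e i) * e i x)"
proof -
 define R where "R n \<longleftrightarrow> (\<exists>e. orthonormal n e \<and> (\<forall>i<n. Q (e i)))" for n
 have R0: "R 0" by (auto simp: R_def orthonormal_def)
 have Rb: "\<forall>n. R n --> n <= card P" using orthonormal_card by (auto simp: R_def)
 define n where "n = (GREATEST n. R n)"
 have "R n" unfolding n_def using GreatestI_nat[of R, OF R0] Rb by blast
 then obtain e where e: "orthonormal n e" "!!i. i < n ==> Q (e i)" by (auto simp: R_def)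
 have eX: "e i \<in> X" if "i < n" for i using e(1) that by (simp add: orthonormal_def)
 have nR: "\<not> R (Suc n)" using Greatest_le_nat[of R "Suc n" "card P"] Rb by (auto simp: n_def)
 have "v = (%x. \<Sum>i<n. ip v (e i) * e i x)" if v: "v \<in> X" for v
 proof (rule ccontr)
  assume ne: "v ~= (%x. \<Sum>i<n. ip v (e i) * e i x)"
  define s where "s = (%x. \<Sum>i<n. ip v (e i) * e i x)"
  have s: "s \<in> X" unfolding s_def using eX by (intro X_sum) auto
  have d1: "(%x. v x - s x) \<in> X" by (intro X_diff v s)
  have d2: "(%x. v x - s x) ~= (%_. 0)" using ne by (auto simp: fun_eq_iff s_def)
  have d3: "ip (%x. v x - s x) (e i) = 0" if "i < n" for i
   using ip_diff[of v s "e i"] v s eX[OF that] ip_orthonormal_sum[OF e(1) that, of "%i. ip v (e i)"] by (simp add: XH s_def)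
  have "\<exists>u\<in>X. u ~= (%_. 0) \<and> Q u \<and> (\<forall>i<n. ip u (e i) = 0)"
   by (rule ext[OF e d1 d2 d3])
  then obtain u where u: "u \<in> X" "u ~= (%_. 0)" "Q u" "!!i. i < n ==> ip u (e i) = 0" by auto
  define r where "r = Re (ip u u)"
  have ur: "ip u u = of_real r" using ip_self_real[OF XH[OF u(1)]] by (simp add: r_def)
  have "r ~= 0" using ip_definite[OF u(1)] u(2) ur by auto
  then have r: "0 < r" using ip_pos[OF XH[OF u(1)]] by (simp add: r_def)
  define d where "d = complex_of_real (1 / sqrt r)"
  define w where "w = (%x. d * u x)"
  have wX: "w \<in> X" unfolding w_def by (intro X_scale u)
  have wH: "w \<in> H" "u \<in> H" using wX u XH by auto
  have we: "ip w (e i) = 0" "ip (e i) w = 0" if "i < n" for i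
  proof -
   show 1: "ip w (e i) = 0" unfolding w_def using u(4)[OF that] ip_scale[of u "e i" d] wH XH[OF eX[OF that]] by simp
   show "ip (e i) w = 0" using ip_cnj[of w "e i"] 1 wH XH[OF eX[OF that]] by simp
  qed
  have "ip w w = d * ip u w" using ip_scale[of u w d] wH by (simp add: w_def)
  also have "ip u w = cnj (ip w u)" using ip_cnj[of w u] wH by simp
  also have "ip w u = d * of_real r" using ip_scale[of u u d] wH ur by (simp add: w_def)
  also have "d * cnj (d * of_real r) = 1" using r by (simp add: d_def flip: of_real_mult)
  finally have ww: "ip w w = 1" .
  have "orthonormal (Suc n) (%i. if i = n then w else e i)"
   using e(1) wX we ww by (auto simp: orthonormal_def less_Suc_eq)
  moreover have "Q (if i = n then w else e i)" if "i < Suc n" for i using that e(2) scale[OF u(1,3)] by (auto simp: w_def less_Suc_eq)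
  ultimately show False using nR by (auto simp: R_def)
 qed
 then show ?thesis using that e by blast
qed

text \<open>The Riesz representative of the form, written out in an orthonormal basis.\<close>

lemma form_operator_exists:
 obtains T where "!!u. u \<in> X ==> T u \<in> X" "!!u v. u \<in> X ==> v \<in> X ==> ip (T u) v = a u v"
proof -
 obtain n b where b: "orthonormal n b" "!!v. v \<in> X ==> v = (%x. \<Sum>i<n. ip v (b i) * b i x)"
  by (rule orthonormal_basis_exists[of "%_. True"]) auto
 have bX: "b i \<in> X" if "i < n" for i using b(1) that by (simp add: orthonormal_def)
 define T where "T u = (%x. \<Sum>i<n. a u (b i) * b i x)" for u
 have TX: "T u \<in> X" for u unfolding T_def using bX by (intro X_sum) auto
 have "ip (T u) v = a u v" if u: "u \<in> X" and v: "v \<in> X" for u v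
 proof -
  have "ip (T u) v = (\<Sum>i<n. a u (b i) * ip (b i) v)" unfolding T_def using bX XH[OF v] by (intro ip_sum) auto
  also have "... = cnj (\<Sum>i<n. ip v (b i) * a (b i) u)"
   using u v bX by (auto simp: a_cnj[of u "b _"] ip_cnj[of "b _" v] XH intro!: sum.cong)
  also have "(\<Sum>i<n. ip v (b i) * a (b i) u) = a (%x. \<Sum>i<n. ip v (b i) * b i x) u" using bX u by (intro a_sum[symmetric]) auto
  also have "... = a v u" using b(2)[OF v] by simp
  finally show ?thesis using a_cnj[OF v u] by simp
 qed
 then show ?thesis using that TX by blast
qed

lemma ip_eqI: assumes "u \<in> X" "w \<in> X" "!!v. v \<in> X ==> ip u v = ip w v" shows "u = w"
proof -
 have "(%x. u x - w x) = (%_. 0)"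
  using assms by (intro ip_definite X_diff) (auto simp: ip_diff XH X_diff)
 then show ?thesis by (auto simp: fun_eq_iff)
qed

text \<open>A polynomial of least degree annihilating \<open>v\<close> under the operator of the form has a root by the
 fundamental theorem of algebra; the cofactor applied to \<open>v\<close> is then an eigenvector.\<close>

lemma eigenvector_exists:
 assumes e: "orthonormal n e" and ev: "!!i. i < n ==> \<exists>l. \<forall>\<psi>\<in>X. a (e i) \<psi> = l * ip (e i) \<psi>"
  and v: "v \<in> X" "v ~= (%_. 0)" "!!i. i < n ==> ip v (e i) = 0"
 shows "\<exists>u\<in>X. u ~= (%_. 0) \<and> (\<exists>l. \<forall>\<psi>\<in>X. a u \<psi> = l * ip u \<psi>) \<and> (\<forall>i<n. ip u (e i) = 0)"
proof -
 obtain T where T: "!!u. u \<in> X ==> T u \<in> X" "!!u v. u \<in> X ==> v \<in> X ==> ip (T u) v = a u v" using form_operator_exists by blast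
 have eX: "e i \<in> X" if "i < n" for i using e that by (simp add: orthonormal_def)
 \<comment> \<open>The orthogonal complement of the eigenvectors found so far. It is invariant under
   \<open>T\<close> because the form is Hermitian and every \<open>e i\<close> is an
   eigenvector.\<close>
 define Y where "Y = {u\<in>X. \<forall>i<n. ip u (e i) = 0}"
 have TY: "T u \<in> Y" if "u \<in> Y" for u
 proof -
  have u: "u \<in> X" "!!i. i < n ==> ip u (e i) = 0" using that by (auto simp: Y_def)
  have "ip (T u) (e i) = 0" if i: "i < n" for i
  proof -
   obtain l where l: "\<forall>\<psi>\<in>X. a (e i) \<psi> = l * ip (e i) \<psi>" using ev[OF i] by auto
   have "a (e i) u = l * cnj (ip u (e i))" using l u(1) ip_cnj[of u "e i"] XH[OF u(1)] XH[OF eX[OF i]] by simp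
   then have "a u (e i) = 0" using a_cnj[OF eX[OF i] u(1)] u(2)[OF i] by simp
   then show ?thesis using T(2)[OF u(1) eX[OF i]] by simp
  qed
  then show ?thesis using T(1)[OF u(1)] by (simp add: Y_def)
 qed
 have YX: "u \<in> X" if "u \<in> Y" for u using that by (simp add: Y_def)
 have Tl: "T (%x. c * u x + w x) = (%x. c * T u x + T w x)" if "u \<in> X" "w \<in> X" for c u w
  using that by (intro ip_eqI T X_add X_scale) (simp_all add: T ip_add ip_scale a_add a_scale X_scale X_add XH)
 \<comment> \<open>The polynomial p evaluated at \<open>T\<close> and applied to u, by Horner's
   rule.\<close>
 define pT where "pT p u = fold_coeffs (%c w x. c * u x + T w x) p (%_. 0)" for p u
 have T0: "T (%_. 0) = (%_. 0)" using Tl[OF X_zero X_zero, of 1] by (auto simp: fun_eq_iff)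
 have p0: "pT 0 u = (%_. 0)" for u by (simp add: pT_def)
 have pC: "pT (pCons c p) u = (%x. c * u x + T (pT p u) x)" for c p u
  by (cases "p = 0 \<and> c = 0") (auto simp: pT_def T0)
 have YI: "(%x. c * u x + w x) \<in> Y" if "u \<in> Y" "w \<in> Y" for c u w
  using that eX by (auto simp: Y_def X_add X_scale ip_add ip_scale XH X_scale)
 have Y0: "(%_. 0) \<in> Y" using eX by (simp add: Y_def X_zero ip_zero XH)
 have pY: "pT p u \<in> Y" if "u \<in> Y" for p u by (induction p) (auto simp: p0 pC Y0 YI TY that)
 have padd: "pT (p + q) u = (%x. pT p u x + pT q u x)" if "u \<in> Y" for p q u
 proof (induction p arbitrary: q)
  case (pCons c p)
  show ?case
  proof (cases q)
   case (pCons d q')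
   have "T (%x. pT p u x + pT q' u x) = (%x. T (pT p u) x + T (pT q' u) x)"
    using Tl[OF YX[OF pY[OF that, of p]] YX[OF pY[OF that, of q']], of 1] by simp
   then show ?thesis unfolding pCons add_pCons pC pCons.IH by (auto simp: algebra_simps)
  qed
 qed (simp add: p0)
 have psm: "pT (smult d p) u = (%x. d * pT p u x)" if "u \<in> Y" for d p u
 proof (induction p)
  case (pCons c p)
  have "T (%x. d * pT p u x) = (%x. d * T (pT p u) x)"
   using Tl[OF YX[OF pY[OF that, of p]] X_zero, of d] T0 by simp
  then show ?case unfolding smult_pCons pC pCons.IH by (auto simp: algebra_simps)
 qed (simp add: p0)
 have vY: "v \<in> Y" using v by (simp add: Y_def)
 \<comment> \<open>The card P + 1 vectors T^i v with i <= card P are linearly dependent, and the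
   relation is an annihilating polynomial.\<close>
 have ex: "\<exists>p. p ~= 0 \<and> pT p v = (%_. 0)"
 proof -
  obtain c where c: "\<exists>i\<in>{..card P}. c i ~= 0" "!!p. p \<in> P ==> (\<Sum>i\<in>{..card P}. c i * pT (monom 1 i) v p) = 0"
   using nontrivial_relation[OF P_finite, of "{..card P}" "%i. pT (monom 1 i) v"] by auto
  define p where "p = (\<Sum>i\<le>card P. smult (c i) (monom 1 i))"
  have "pT (\<Sum>i\<in>I. smult (c i) (monom 1 i)) v = (%x. \<Sum>i\<in>I. c i * pT (monom 1 i) v x)" if "finite I" for I
   using that by induction (simp_all add: p0 padd[OF vY] psm[OF vY])
  then have "pT p v = (%x. \<Sum>i\<le>card P. c i * pT (monom 1 i) v x)" by (simp add: p_def)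
  then have "pT p v = (%_. 0)" using P_separates[OF YX[OF pY[OF vY, of p]]] c(2) by simp
  moreover have "coeff p i = c i" if "i <= card P" for i
   using that by (simp add: p_def coeff_sum if_distrib[of "%x. _ * x"] cong: if_cong)
  then have "p ~= 0" using c(1) by auto
  ultimately show ?thesis by blast
 qed
 define d where "d = (LEAST d. \<exists>p. p ~= 0 \<and> pT p v = (%_. 0) \<and> degree p = d)"
 have "\<exists>p. p ~= 0 \<and> pT p v = (%_. 0) \<and> degree p = d" unfolding d_def by (rule LeastI_ex) (use ex in blast)
 then obtain p where p: "p ~= 0" "pT p v = (%_. 0)" "degree p = d" by blast
 have least: "d <= degree q" if "q ~= 0" "pT q v = (%_. 0)" for q unfolding d_def by (rule Least_le) (use that in blast)
 have "degree p ~= 0"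
 proof
  assume "degree p = 0"
  then obtain c where pc: "p = [:c:]" by (auto elim: degree_eq_zeroE)
  have "(%x. c * v x) = (%_. 0)" using p(2) by (simp add: pc pC p0 T0)
  then show False using p(1) v(2) pc by (auto simp: fun_eq_iff)
 qed
 then obtain z where z: "poly p z = 0"
  using alg_closed_imp_poly_has_root[of p] by auto
 then obtain q where q: "p = [:- z, 1:] * q" by (auto simp: poly_eq_0_iff_dvd)
 have q0: "q ~= 0" using p(1) q by auto
 then have "degree q < d" using p(3) q degree_mult_eq[of "[:- z, 1:]" q] by simp
 then have u0: "pT q v ~= (%_. 0)" using least[OF q0] by auto
 define u where "u = pT q v"
 have uY: "u \<in> Y" unfolding u_def by (rule pY[OF vY])
 have "p = smult (- z) q + pCons 0 q" using q by simp
 then have "pT (smult (- z) q + pCons 0 q) v = (%_. 0)" using p(2) by simp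
 then have "(%x. - z * u x + T u x) = (%_. 0)" unfolding padd[OF vY] psm[OF vY] pC by (simp add: u_def)
 then have "T u = (%x. z * u x)" by (auto simp: fun_eq_iff)
 then have "a u \<psi> = z * ip u \<psi>" if "\<psi> \<in> X" for \<psi> using T(2)[OF YX[OF uY] that] ip_scale[OF XH[OF YX[OF uY]] XH[OF that], of z] by simp
 then show ?thesis using uY u0 by (intro bexI[of _ u]) (auto simp: Y_def u_def)
qed

end

locale eigenbasis = form_space +
 fixes n :: nat and e :: "nat => 'a => complex" and l :: "nat => real"
 assumes e: "orthonormal n e" and l_pos: "i < n ==> 0 < l i"
  and expansion: "v \<in> X ==> v = (%x. \<Sum>i<n. ip v (e i) * e i x)"
  and eigen: "i < n ==> w \<in> X ==> a (e i) w = of_real (l i) * ip (e i) w"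

context form_space
begin

theorem eigenbasis_exists: obtains n e l where "eigenbasis H X ip a P n e l"
proof -
 obtain n e where e: "orthonormal n e" "!!i. i < n ==> \<exists>l. \<forall>\<psi>\<in>X. a (e i) \<psi> = l * ip (e i) \<psi>" "!!v. v \<in> X ==> v = (%x. \<Sum>i<n. ip v (e i) * e i x)"
 proof (rule orthonormal_basis_exists[of "%u. \<exists>l. \<forall>\<psi>\<in>X. a u \<psi> = l * ip u \<psi>"])
  fix u c assume u: "u \<in> X" "\<exists>l. \<forall>\<psi>\<in>X. a u \<psi> = l * ip u \<psi>"
  then obtain l where "\<forall>\<psi>\<in>X. a u \<psi> = l * ip u \<psi>" by blast
  then have "\<forall>\<psi>\<in>X. a (%x. c * u x) \<psi> = l * ip (%x. c * u x) \<psi>" using u(1) by (simp add: a_scale ip_scale XH)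
  then show "\<exists>l. \<forall>\<psi>\<in>X. a (%x. c * u x) \<psi> = l * ip (%x. c * u x) \<psi>" by blast
 next
  fix n e v assume "orthonormal n e" "!!i. i < n ==> \<exists>l. \<forall>\<psi>\<in>X. a (e i) \<psi> = l * ip (e i) \<psi>" "v \<in> X" "v ~= (%_. 0)" "!!i. i < n ==> ip v (e i) = 0"
  then show "\<exists>u\<in>X. u ~= (%_. 0) \<and> (\<exists>l. \<forall>\<psi>\<in>X. a u \<psi> = l * ip u \<psi>) \<and> (\<forall>i<n. ip u (e i) = 0)" by (rule eigenvector_exists)
 qed (rule that)
 have eX: "e i \<in> X" "ip (e i) (e i) = 1" if "i < n" for i using e(1) that by (auto simp: orthonormal_def)
 have "\<exists>l. 0 < l \<and> (\<forall>\<psi>\<in>X. a (e i) \<psi> = complex_of_real l * ip (e i) \<psi>)" if i: "i < n" for i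
 proof -
  obtain l where l: "\<forall>\<psi>\<in>X. a (e i) \<psi> = l * ip (e i) \<psi>" using e(2)[OF i] by blast
  then have "l = a (e i) (e i)" using eX[OF i] by simp
  then have lr: "l = of_real (Re (a (e i) (e i)))" using a_self_real[OF eX(1)[OF i]] by simp
  have "e i ~= (%_. 0)" using eX[OF i] ip_zero[of "%_. 0"] XH[OF X_zero] by auto
  then have "0 < Re (a (e i) (e i))" by (rule a_pos[OF eX(1)[OF i]])
  then show ?thesis using l lr by metis
 qed
 then obtain l where "!!i. i < n ==> 0 < l i \<and> (\<forall>\<psi>\<in>X. a (e i) \<psi> = complex_of_real (l i) * ip (e i) \<psi>)" by metis
 then have "eigenbasis H X ip a P n e l" using e(1,3) by unfold_locales auto
 then show ?thesis by (rule that)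
qed

end

section \<open>Projection, operator and resolvent in the eigenbasis\<close>

context eigenbasis
begin

lemma eX: "i < n ==> e i \<in> X" using e by (simp add: orthonormal_def)
lemma eH: "i < n ==> e i \<in> H" using eX XH by blast

lemma combination_in_X: "(%x. \<Sum>i<n. c i * e i x) \<in> X" using eX by (intro X_sum) auto

lemma ip_expand: assumes "v \<in> H" "w \<in> X" shows "ip v w = (\<Sum>i<n. ip v (e i) * cnj (ip w (e i)))"
proof -
 have "ip v w = cnj (ip (%x. \<Sum>i<n. ip w (e i) * e i x) v)" unfolding expansion[OF assms(2), symmetric] using ip_cnj[of w v] XH assms by simp
 also have "ip (%x. \<Sum>i<n. ip w (e i) * e i x) v = (\<Sum>i<n. ip w (e i) * ip (e i) v)" using eX assms by (intro ip_sum) auto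
 also have "cnj ... = (\<Sum>i<n. ip v (e i) * cnj (ip w (e i)))"
  using ip_cnj[of v "e _"] assms eH by (auto simp: mult.commute intro!: sum.cong)
 finally show ?thesis .
qed

lemma coefficient_unique: "(%x. \<Sum>i<n. c i * e i x) = (%x. \<Sum>i<n. d i * e i x) ==> j < n ==> c j = d j"
 using ip_orthonormal_sum[OF e, of j c] ip_orthonormal_sum[OF e, of j d] by simp

text \<open>This and the next two lemmas evaluate the definite descriptions in
  \<open>L2_proj\<close>, \<open>discrete_op\<close> and \<open>discrete_resolvent\<close>.
  Existence is the explicit sum; uniqueness comes from testing with all of \<open>X\<close> or from
  comparing coefficients.\<close>

lemma projection_eq:
 assumes v: "v \<in> H"
 shows "(THE w. w \<in> X \<and> (\<forall>\<psi>\<in>X. ip w \<psi> = ip v \<psi>)) = (%x. \<Sum>i<n. ip v (e i) * e i x)"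
proof (rule the_equality)
 have "ip (%x. \<Sum>i<n. ip v (e i) * e i x) \<psi> = ip v \<psi>" if "\<psi> \<in> X" for \<psi>
 proof -
  have "ip (%x. \<Sum>i<n. ip v (e i) * e i x) \<psi> = (\<Sum>i<n. ip (%x. \<Sum>i<n. ip v (e i) * e i x) (e i) * cnj (ip \<psi> (e i)))"
   by (rule ip_expand[OF XH[OF combination_in_X] that])
  also have "... = (\<Sum>i<n. ip v (e i) * cnj (ip \<psi> (e i)))" by (intro sum.cong refl arg_cong2[where f = "(*)"] ip_orthonormal_sum[OF e]) simp
  also have "... = ip v \<psi>" by (rule ip_expand[OF v that, symmetric])
  finally show ?thesis .
 qed
 note q = this
 show p: "(%x. \<Sum>i<n. ip v (e i) * e i x) \<in> X \<and> (\<forall>\<psi>\<in>X. ip (%x. \<Sum>i<n. ip v (e i) * e i x) \<psi> = ip v \<psi>)"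
  by (intro conjI ballI combination_in_X q)
 fix w assume "w \<in> X \<and> (\<forall>\<psi>\<in>X. ip w \<psi> = ip v \<psi>)"
 then show "w = (%x. \<Sum>i<n. ip v (e i) * e i x)" using p by (intro ip_eqI) simp_all
qed

lemma operator_eq:
 assumes \<phi>: "\<phi> \<in> X"
 shows "(THE w. w \<in> X \<and> (\<forall>\<psi>\<in>X. ip w \<psi> = a \<phi> \<psi>)) = (%x. \<Sum>i<n. (of_real (l i) * ip \<phi> (e i)) * e i x)"
proof (rule the_equality)
 have "ip (%x. \<Sum>i<n. (of_real (l i) * ip \<phi> (e i)) * e i x) \<psi> = a \<phi> \<psi>" if "\<psi> \<in> X" for \<psi>
 proof -
  have "ip (%x. \<Sum>i<n. (of_real (l i) * ip \<phi> (e i)) * e i x) \<psi> = (\<Sum>i<n. (of_real (l i) * ip \<phi> (e i)) * ip (e i) \<psi>)"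
   using that eX XH by (intro ip_sum) auto
  also have "... = (\<Sum>i<n. ip \<phi> (e i) * a (e i) \<psi>)" using that by (intro sum.cong) (auto simp: eigen)
  also have "... = a (%x. \<Sum>i<n. ip \<phi> (e i) * e i x) \<psi>" using that eX by (intro a_sum[symmetric]) auto
  also have "... = a \<phi> \<psi>" by (simp only: expansion[OF \<phi>, symmetric])
  finally show ?thesis .
 qed
 note q = this
 show p: "(%x. \<Sum>i<n. (of_real (l i) * ip \<phi> (e i)) * e i x) \<in> X \<and> (\<forall>\<psi>\<in>X. ip (%x. \<Sum>i<n. (of_real (l i) * ip \<phi> (e i)) * e i x) \<psi> = a \<phi> \<psi>)"
  by (intro conjI ballI combination_in_X q)
 fix w assume "w \<in> X \<and> (\<forall>\<psi>\<in>X. ip w \<psi> = a \<phi> \<psi>)"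
 then show "w = (%x. \<Sum>i<n. (of_real (l i) * ip \<phi> (e i)) * e i x)" using p by (intro ip_eqI) simp_all
qed

lemma resolvent_eq:
 assumes v: "v \<in> X" and z: "!!i. i < n ==> z + of_real (l i) ~= 0"
  and op: "!!\<phi>. \<phi> \<in> X ==> op \<phi> = (%x. \<Sum>i<n. (of_real (l i) * ip \<phi> (e i)) * e i x)"
 shows "(THE w. w \<in> X \<and> (\<forall>x. z * w x + op w x = v x)) = (%x. \<Sum>i<n. (ip v (e i) / (z + of_real (l i))) * e i x)"
proof (rule the_equality)
 define r where "r i = ip v (e i) / (z + of_real (l i))" for i
 have rX: "(%x. \<Sum>i<n. r i * e i x) \<in> X" by (rule combination_in_X)
 have "z * (\<Sum>i<n. r i * e i x) + (\<Sum>i<n. (of_real (l i) * r i) * e i x) = v x" for x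
 proof -
  have "z * (\<Sum>i<n. r i * e i x) + (\<Sum>i<n. (of_real (l i) * r i) * e i x) = (\<Sum>i<n. ((z + of_real (l i)) * r i) * e i x)"
   by (simp add: sum_distrib_left sum.distrib algebra_simps)
  also have "... = (\<Sum>i<n. ip v (e i) * e i x)" using z by (intro sum.cong) (auto simp: r_def)
  finally show ?thesis using fun_cong[OF expansion[OF v], of x] by simp
 qed
 then show "(%x. \<Sum>i<n. (ip v (e i) / (z + of_real (l i))) * e i x) \<in> X \<and> (\<forall>x. z * (\<Sum>i<n. (ip v (e i) / (z + of_real (l i))) * e i x) + op (%x. \<Sum>i<n. (ip v (e i) / (z + of_real (l i))) * e i x) x = v x)"
  using rX by (simp add: op ip_orthonormal_sum[OF e] flip: r_def)
 fix w assume w: "w \<in> X \<and> (\<forall>x. z * w x + op w x = v x)"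
 have "(\<Sum>i<n. ip v (e i) * e i x) = (\<Sum>i<n. (z * ip w (e i) + of_real (l i) * ip w (e i)) * e i x)" for x
 proof -
  have "(\<Sum>i<n. ip v (e i) * e i x) = z * w x + op w x" using w fun_cong[OF expansion[OF v], of x] by simp
  also have "... = z * (\<Sum>i<n. ip w (e i) * e i x) + (\<Sum>i<n. (of_real (l i) * ip w (e i)) * e i x)"
   using w fun_cong[OF expansion[of w], of x] by (simp add: op)
  finally show ?thesis by (simp add: sum_distrib_left sum.distrib algebra_simps)
 qed
 then have fe: "(%x. \<Sum>i<n. ip v (e i) * e i x) = (%x. \<Sum>i<n. (z * ip w (e i) + of_real (l i) * ip w (e i)) * e i x)" by (rule ext)
 have "ip v (e i) = z * ip w (e i) + of_real (l i) * ip w (e i)" if "i < n" for i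
  using coefficient_unique[OF fe that] .
 then have "ip w (e i) = r i" if "i < n" for i using z[OF that] that by (simp add: r_def field_simps)
 then have "(%x. \<Sum>i<n. ip w (e i) * e i x) = (%x. \<Sum>i<n. r i * e i x)" by simp
 moreover have "w = (%x. \<Sum>i<n. ip w (e i) * e i x)" using w by (intro expansion) simp
 ultimately show "w = (%x. \<Sum>i<n. (ip v (e i) / (z + of_real (l i))) * e i x)" unfolding r_def by (rule trans[rotated])
qed

lemma parseval: "ip (%x. \<Sum>i<n. c i * e i x) (%x. \<Sum>i<n. c i * e i x) = of_real (\<Sum>i<n. (cmod (c i))\<^sup>2)"
 using ip_expand[OF XH[OF combination_in_X] combination_in_X, of c c] ip_orthonormal_sum[OF e, of _ c]
 by (simp add: complex_norm_square del: of_real_power)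

text \<open>Stated for v in all of \<open>H\<close>: it is applied to values of the transform of the
  data, whose coefficients are thereby bounded independently of the discrete space.\<close>

lemma bessel: assumes v: "v \<in> H" shows "(\<Sum>i<n. (cmod (ip v (e i)))\<^sup>2) <= Re (ip v v)"
proof -
 define s where "s = (%x. \<Sum>i<n. ip v (e i) * e i x)"
 have sX: "s \<in> X" unfolding s_def by (rule combination_in_X)
 have sH: "s \<in> H" using sX XH by blast
 have ss: "ip s s = of_real (\<Sum>i<n. (cmod (ip v (e i)))\<^sup>2)" unfolding s_def by (rule parseval)
 have vs: "ip v s = ip s s"
  using ip_expand[OF v sX] ip_expand[OF sH sX] ip_orthonormal_sum[OF e, of _ "%i. ip v (e i)"] by (simp add: s_def)
 have sv: "ip s v = ip s s" using ip_cnj[OF v sH] vs ss by simp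
 have dH: "(%x. v x - s x) \<in> H" by (intro H_diff v sH)
 have "ip (%x. v x - s x) (%x. v x - s x) = ip v (%x. v x - s x) - ip s (%x. v x - s x)" by (rule ip_diff[OF v sH dH])
 also have "ip v (%x. v x - s x) = cnj (ip v v - ip s v)" using ip_cnj[OF dH v] ip_diff[OF v sH v] by simp
 also have "ip s (%x. v x - s x) = cnj (ip v s - ip s s)" using ip_cnj[OF dH sH] ip_diff[OF v sH sH] by simp
 finally have "ip (%x. v x - s x) (%x. v x - s x) = cnj (ip v v - ip s s)" using vs sv by simp
 then have "Re (ip v v) - Re (ip s s) >= 0" using ip_pos[OF dH] by simp
 then show ?thesis using ss by simp
qed

end

section \<open>Square integrable functions\<close>

text \<open>Completeness of Lebesgue measure: a change on a null set preserves
  measurability.\<close>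

lemma borel_measurable_lebesgue_AE_eq:
 fixes f g :: "'a::euclidean_space => 'b::topological_space"
 assumes g: "g \<in> borel_measurable lebesgue" and ae: "AE x in lebesgue. f x = g x"
 shows "f \<in> borel_measurable lebesgue"
proof (rule measurableI)
 fix A :: "'b set" assume "A \<in> sets borel"
 then have gA: "g -` A \<inter> space lebesgue \<in> sets lebesgue" by (rule measurable_sets[OF g])
 show "f -` A \<inter> space lebesgue \<in> sets lebesgue"
 proof (rule completion.in_sets_AE[OF _ gA])
  show "AE x in lebesgue. x \<in> g -` A \<inter> space lebesgue \<longleftrightarrow> x \<in> f -` A \<inter> space lebesgue"
   using ae by eventually_elim auto
 qed simp
qed simp

lemma borel_measurable_lebesgue_on_AE_eq:
 fixes f g :: "'a::euclidean_space => 'b::real_normed_vector"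
 assumes S: "S \<in> sets lebesgue" and g: "g \<in> borel_measurable (lebesgue_on S)" and ae: "AE x in lebesgue_on S. f x = g x"
 shows "f \<in> borel_measurable (lebesgue_on S)"
proof -
 have S': "S \<inter> space lebesgue \<in> sets lebesgue" using S by simp
 have g': "(%x. indicator S x *\<^sub>R g x) \<in> borel_measurable lebesgue" using g borel_measurable_restrict_space_iff[OF S', of g] by simp
 have ae': "AE x in lebesgue. x \<in> S --> f x = g x" using ae AE_restrict_space_iff[OF S'] by auto
 have "(%x. indicator S x *\<^sub>R f x) \<in> borel_measurable lebesgue"
  by (rule borel_measurable_lebesgue_AE_eq[OF g']) (use ae' in \<open>eventually_elim, auto simp: indicator_def\<close>)
 then show ?thesis using borel_measurable_restrict_space_iff[OF S', of f] by simp
qed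

lemma borel_measurable_lebesgue_on_AE_limit:
 fixes f :: "real => complex"
 assumes S: "S \<in> sets lebesgue" and u: "!!k. u k \<in> borel_measurable (lebesgue_on S)" and ae: "AE x in lebesgue_on S. (%k::nat. u k x) \<longlonglongrightarrow> f x"
 shows "f \<in> borel_measurable (lebesgue_on S)"
proof (rule borel_measurable_lebesgue_on_AE_eq[OF S])
 show "(%x. lim (%k. u k x)) \<in> borel_measurable (lebesgue_on S)" using u by (rule borel_measurable_lim_metric)
 show "AE x in lebesgue_on S. f x = lim (%k. u k x)" using ae by eventually_elim (simp add: limI)
qed

text \<open>Passes from Lebesgue integrals over [0, t] to Borel representatives on (0, t]. The
  hypothesis leaves out both end points; at r = t the solution operator would have to be evaluated
  at time 0.\<close>

lemma integral_lebesgue_on_eq_lborel: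
 fixes G H :: "real => complex"
 assumes H [measurable]: "H \<in> borel_measurable borel" and ae: "AE r in lborel. 0 < r --> r < t --> G r = H r"
 shows "(LINT r|lebesgue_on {0..t}. G r) = (LBINT r:{0<..t}. H r)"
proof -
 have ae1: "AE r in lborel. indicator {0..t} r *\<^sub>R G r = indicator {0<..t} r *\<^sub>R H r"
  using ae AE_lborel_singleton[of 0] AE_lborel_singleton[of t] by eventually_elim (auto simp: indicator_def)
 then have ae2: "AE r in lebesgue. indicator {0..t} r *\<^sub>R G r = indicator {0<..t} r *\<^sub>R H r" by (rule AE_completion)
 have Hm: "(%r. indicator {0<..t} r *\<^sub>R H r) \<in> borel_measurable lborel" by measurable
 have Hm': "(%r. indicator {0<..t} r *\<^sub>R H r) \<in> borel_measurable lebesgue" by (rule measurable_completion[OF Hm])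
 have "(LINT r|lebesgue_on {0..t}. G r) = (LINT r|lebesgue. indicator {0..t} r *\<^sub>R G r)" by (rule integral_restrict_space) simp
 also have "... = (LINT r|lebesgue. indicator {0<..t} r *\<^sub>R H r)"
  by (rule integral_cong_AE[OF borel_measurable_lebesgue_AE_eq[OF Hm' ae2] Hm' ae2])
 also have "... = (LBINT r. indicator {0<..t} r *\<^sub>R H r)" by (rule integral_completion[OF Hm])
 finally show ?thesis by (simp add: set_lebesgue_integral_def)
qed

lemma L2_square_integrable: "u \<in> L2 \<Omega> ==> integrable (lebesgue_on \<Omega>) (%x. (cmod (u x))\<^sup>2)" by (simp add: L2_def)

lemma L2_add: assumes "u \<in> L2 \<Omega>" "v \<in> L2 \<Omega>" shows "(%x. u x + v x) \<in> L2 \<Omega>"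
proof -
 have [measurable]: "u \<in> borel_measurable (lebesgue_on \<Omega>)" "v \<in> borel_measurable (lebesgue_on \<Omega>)" using assms by (simp_all add: L2_def)
 have "integrable (lebesgue_on \<Omega>) (%x. 2 * (cmod (u x))\<^sup>2 + 2 * (cmod (v x))\<^sup>2)" using assms by (simp add: L2_def)
 then have "integrable (lebesgue_on \<Omega>) (%x. (cmod (u x + v x))\<^sup>2)"
 proof (rule Bochner_Integration.integrable_bound)
  have "(cmod (u x + v x))\<^sup>2 <= 2 * (cmod (u x))\<^sup>2 + 2 * (cmod (v x))\<^sup>2" for x
  proof -
   have "(cmod (u x + v x))\<^sup>2 <= (cmod (u x) + cmod (v x))\<^sup>2" by (intro power_mono norm_triangle_ineq) simp
   also have "... <= 2 * (cmod (u x))\<^sup>2 + 2 * (cmod (v x))\<^sup>2" using zero_le_power2[of "cmod (u x) - cmod (v x)"] by (simp add: power2_sum power2_diff)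
   finally show ?thesis .
  qed
  then show "AE x in lebesgue_on \<Omega>. norm ((cmod (u x + v x))\<^sup>2) <= norm (2 * (cmod (u x))\<^sup>2 + 2 * (cmod (v x))\<^sup>2)" by simp
 qed measurable
 then show ?thesis by (simp add: L2_def)
qed

lemma L2_scale: "u \<in> L2 \<Omega> ==> (%x. c * u x) \<in> L2 \<Omega>" by (auto simp: L2_def norm_mult power_mult_distrib intro!: borel_measurable_times)
lemma L2_zero: "(%_. 0) \<in> L2 \<Omega>" by (simp add: L2_def)
lemma L2_diff: "u \<in> L2 \<Omega> ==> v \<in> L2 \<Omega> ==> (%x. u x - v x) \<in> L2 \<Omega>" using L2_add[of u \<Omega> "%x. (-1) * v x"] L2_scale[of v \<Omega> "-1"] by simp

lemma L2_product_integrable: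
 assumes "u \<in> L2 \<Omega>" "v \<in> L2 \<Omega>" shows "integrable (lebesgue_on \<Omega>) (%x. u x * cnj (v x))"
proof -
 have [measurable]: "u \<in> borel_measurable (lebesgue_on \<Omega>)" "v \<in> borel_measurable (lebesgue_on \<Omega>)" using assms by (simp_all add: L2_def)
 have [measurable]: "(%x. cnj (v x)) \<in> borel_measurable (lebesgue_on \<Omega>)"
  by (rule borel_measurable_continuous_on) (auto intro!: continuous_intros)
 have "integrable (lebesgue_on \<Omega>) (%x. (cmod (u x))\<^sup>2 + (cmod (v x))\<^sup>2)" using assms by (simp add: L2_def)
 then show ?thesis
 proof (rule Bochner_Integration.integrable_bound)
  have "cmod (u x * cnj (v x)) <= (cmod (u x))\<^sup>2 + (cmod (v x))\<^sup>2" for x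
  proof -
   have "2 * (cmod (u x) * cmod (v x)) <= (cmod (u x))\<^sup>2 + (cmod (v x))\<^sup>2" using sum_squares_bound[of "cmod (u x)" "cmod (v x)"] by (simp add: mult.assoc)
   moreover have "0 <= cmod (u x) * cmod (v x)" by simp
   ultimately show ?thesis unfolding norm_mult complex_mod_cnj by linarith
  qed
  then show "AE x in lebesgue_on \<Omega>. norm (u x * cnj (v x)) <= norm ((cmod (u x))\<^sup>2 + (cmod (v x))\<^sup>2)" by simp
 qed measurable
qed

lemma L2_inner_add: "u \<in> L2 \<Omega> ==> v \<in> L2 \<Omega> ==> w \<in> L2 \<Omega> ==> L2_inner \<Omega> (%x. u x + v x) w = L2_inner \<Omega> u w + L2_inner \<Omega> v w"
 by (simp add: L2_inner_def distrib_right L2_product_integrable)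

lemma L2_inner_scale: "L2_inner \<Omega> (%x. c * u x) w = c * L2_inner \<Omega> u w"
 by (simp add: L2_inner_def mult.assoc)

lemma L2_inner_diff: "u \<in> L2 \<Omega> ==> v \<in> L2 \<Omega> ==> w \<in> L2 \<Omega> ==> L2_inner \<Omega> (%x. u x - v x) w = L2_inner \<Omega> u w - L2_inner \<Omega> v w"
 by (simp add: L2_inner_def left_diff_distrib L2_product_integrable)

lemma L2_inner_cnj: "L2_inner \<Omega> w u = cnj (L2_inner \<Omega> u w)"
 unfolding L2_inner_def by (subst Bochner_Integration.integral_cnj[symmetric]) (simp add: mult.commute)

lemma L2_inner_self: "L2_inner \<Omega> u u = of_real ((L2_norm \<Omega> u)\<^sup>2)"
proof -
 have "L2_inner \<Omega> u u = (LINT x|lebesgue_on \<Omega>. complex_of_real ((cmod (u x))\<^sup>2))"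
  unfolding L2_inner_def by (intro Bochner_Integration.integral_cong refl) (simp add: complex_norm_square del: of_real_power)
 also have "... = of_real (LINT x|lebesgue_on \<Omega>. (cmod (u x))\<^sup>2)" by (rule integral_complex_of_real)
 finally show ?thesis by (simp add: L2_norm_def)
qed

lemma L2_norm_nonneg: "0 <= L2_norm \<Omega> u" by (simp add: L2_norm_def)

lemma L2_norm_scale: "L2_norm \<Omega> (%x. c * u x) = cmod c * L2_norm \<Omega> u"
 by (simp add: L2_norm_def norm_mult power_mult_distrib real_sqrt_mult)

text \<open>The squared norm of u - s p v is a quadratic in s, and the inequality is its
  nonnegativity at s = 1 / b. If b = 0, it degenerates to a linear function, which can only be
  nonnegative for all s if p = 0.\<close>

lemma L2_Cauchy_Schwarz:
 assumes u: "u \<in> L2 \<Omega>" and v: "v \<in> L2 \<Omega>"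
 shows "cmod (L2_inner \<Omega> u v) <= L2_norm \<Omega> u * L2_norm \<Omega> v"
proof -
 define p where "p = L2_inner \<Omega> u v"
 define a where "a = (L2_norm \<Omega> u)\<^sup>2"
 define b where "b = (L2_norm \<Omega> v)\<^sup>2"
 have key: "0 <= a - 2 * s * (cmod p)\<^sup>2 + s\<^sup>2 * (cmod p)\<^sup>2 * b" for s :: real
 proof -
  define c where "c = of_real s * p"
  have cv: "(%x. c * v x) \<in> L2 \<Omega>" by (rule L2_scale[OF v])
  have d: "(%x. u x - c * v x) \<in> L2 \<Omega>" by (rule L2_diff[OF u cv])
  have vu: "L2_inner \<Omega> v u = cnj p" using L2_inner_cnj[of \<Omega> v u] by (simp add: p_def)
  have "L2_inner \<Omega> (%x. u x - c * v x) (%x. u x - c * v x)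
    = cnj (L2_inner \<Omega> (%x. u x - c * v x) u) - c * cnj (L2_inner \<Omega> (%x. u x - c * v x) v)"
   using L2_inner_diff[OF u cv d] L2_inner_cnj[of \<Omega> u "%x. u x - c * v x"] L2_inner_cnj[of \<Omega> v "%x. u x - c * v x"] by (simp add: L2_inner_scale)
  also have "... = cnj (of_real a - c * cnj p) - c * cnj (p - c * of_real b)"
   using L2_inner_diff[OF u cv u] L2_inner_diff[OF u cv v] by (simp add: L2_inner_scale vu L2_inner_self a_def b_def p_def)
  also have "... = of_real (a - 2 * s * (cmod p)\<^sup>2 + s\<^sup>2 * (cmod p)\<^sup>2 * b)"
  proof -
   have pp: "p * cnj p = of_real ((cmod p)\<^sup>2)" using complex_norm_square[of p] by simp
   have "cnj (of_real a - c * cnj p) - c * cnj (p - c * of_real b) = of_real a - 2 * of_real s * (p * cnj p) + (of_real s)\<^sup>2 * (p * cnj p) * of_real b"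
    by (simp add: c_def algebra_simps power2_eq_square)
   then show ?thesis unfolding pp by simp
  qed
  finally have "complex_of_real ((L2_norm \<Omega> (%x. u x - c * v x))\<^sup>2) = of_real (a - 2 * s * (cmod p)\<^sup>2 + s\<^sup>2 * (cmod p)\<^sup>2 * b)"
   unfolding L2_inner_self .
  then have "(L2_norm \<Omega> (%x. u x - c * v x))\<^sup>2 = a - 2 * s * (cmod p)\<^sup>2 + s\<^sup>2 * (cmod p)\<^sup>2 * b" unfolding of_real_eq_iff .
  then show ?thesis using zero_le_power2[of "L2_norm \<Omega> (%x. u x - c * v x)"] by linarith
 qed
 have "(cmod p)\<^sup>2 <= a * b"
 proof (cases "b = 0")
  case True
  have "p = 0"
  proof (rule ccontr)
   assume "p ~= 0"
   \<comment> \<open>At this s the value is a - 2 (a + 1) = -a - 2 < 0.\<close>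
   then show False using key[of "(a + 1) / (cmod p)\<^sup>2"] True zero_le_power2[of "L2_norm \<Omega> u"] by (simp add: a_def)
  qed
  then show ?thesis using True by simp
 next
  case False
  then have b: "0 < b" by (simp add: b_def)
  have "s = 1 / b ==> s\<^sup>2 * (cmod p)\<^sup>2 * b = (cmod p)\<^sup>2 / b" for s using b by (simp add: power2_eq_square)
  from this[OF refl] have "(cmod p)\<^sup>2 / b <= a" using key[of "1 / b"] by simp
  then show ?thesis using b by (simp add: pos_divide_le_eq)
 qed
 then have "(cmod p)\<^sup>2 <= (L2_norm \<Omega> u * L2_norm \<Omega> v)\<^sup>2" by (simp add: a_def b_def power_mult_distrib)
 then show ?thesis unfolding p_def by (rule power2_le_imp_le) (simp add: L2_norm_nonneg)
qed

lemma L2_norm_triangle: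
 assumes u: "u \<in> L2 \<Omega>" and v: "v \<in> L2 \<Omega>"
 shows "L2_norm \<Omega> (%x. u x + v x) <= L2_norm \<Omega> u + L2_norm \<Omega> v"
proof -
 let ?s = "%x. u x + v x"
 have s: "?s \<in> L2 \<Omega>" by (rule L2_add[OF u v])
 have "complex_of_real ((L2_norm \<Omega> ?s)\<^sup>2) = L2_inner \<Omega> u ?s + L2_inner \<Omega> v ?s"
  unfolding L2_inner_self[symmetric] by (rule L2_inner_add[OF u v s])
 then have "cmod (complex_of_real ((L2_norm \<Omega> ?s)\<^sup>2)) <= L2_norm \<Omega> u * L2_norm \<Omega> ?s + L2_norm \<Omega> v * L2_norm \<Omega> ?s"
  using norm_triangle_ineq[of "L2_inner \<Omega> u ?s" "L2_inner \<Omega> v ?s"] L2_Cauchy_Schwarz[OF u s] L2_Cauchy_Schwarz[OF v s] by simp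
 then have "(L2_norm \<Omega> ?s)\<^sup>2 <= (L2_norm \<Omega> u + L2_norm \<Omega> v) * L2_norm \<Omega> ?s" by (simp add: norm_power distrib_right)
 then show ?thesis
  using L2_norm_nonneg[of \<Omega> ?s] L2_norm_nonneg[of \<Omega> u] L2_norm_nonneg[of \<Omega> v]
  by (cases "L2_norm \<Omega> ?s = 0") (auto simp: power2_eq_square)
qed

lemma L2_norm_tendsto_add:
 assumes "!!k. u k \<in> L2 \<Omega>" "!!k. v k \<in> L2 \<Omega>" "(%k. L2_norm \<Omega> (u k)) \<longlonglongrightarrow> 0" "(%k. L2_norm \<Omega> (v k)) \<longlonglongrightarrow> 0"
 shows "(%k::nat. L2_norm \<Omega> (%x. u k x + v k x)) \<longlonglongrightarrow> 0"
proof (rule tendsto_sandwich[OF _ _ tendsto_const])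
 show "(%k. L2_norm \<Omega> (u k) + L2_norm \<Omega> (v k)) \<longlonglongrightarrow> 0" using tendsto_add[OF assms(3,4)] by simp
qed (simp_all add: L2_norm_nonneg L2_norm_triangle assms)

lemma L2_inner_sum: "finite I ==> (!!i. i \<in> I ==> f i \<in> L2 \<Omega>) ==> w \<in> L2 \<Omega> ==>
  (%x. \<Sum>i\<in>I. c i * f i x) \<in> L2 \<Omega> \<and> L2_inner \<Omega> (%x. \<Sum>i\<in>I. c i * f i x) w = (\<Sum>i\<in>I. c i * L2_inner \<Omega> (f i) w)"
proof (induction I rule: finite_induct)
 case (insert i I)
 then show ?case
  using L2_add[of "%x. c i * f i x" \<Omega> "%x. \<Sum>i\<in>I. c i * f i x"] L2_inner_add[of "%x. c i * f i x" \<Omega> "%x. \<Sum>i\<in>I. c i * f i x" w]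
  by (simp add: L2_scale L2_inner_scale)
qed (simp_all add: L2_zero L2_inner_def)

section \<open>Scalar pairings of vector-valued integrals and holomorphic functions\<close>

lemma L2_simple_inner:
 assumes s: "L2_simple \<Omega> M s" and e: "e \<in> L2 \<Omega>"
 shows "integrable M (%t. L2_inner \<Omega> (s t) e)" and "(LINT t|M. L2_inner \<Omega> (s t) e) = L2_inner \<Omega> (L2_simple_integral M s) e"
  and "L2_simple_integral M s \<in> L2 \<Omega>"
proof -
 define V where "V = s ` space M"
 have sf: "simple_function M s" and sL: "!!t. t \<in> space M ==> s t \<in> L2 \<Omega>" and em: "emeasure M {t\<in>space M. s t ~= (%_. 0)} ~= \<infinity>"
  using s by (auto simp: L2_simple_def)
 have V: "finite V" using simple_functionD(1)[OF sf] by (simp add: V_def)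
 have VL: "v \<in> L2 \<Omega>" if "v \<in> V" for v using that sL by (auto simp: V_def)
 have sets: "{t\<in>space M. s t = v} \<in> sets M" for v
  using simple_functionD(2)[OF sf, of "{v}"] by (simp add: vimage_def Int_def conj_commute)
 have sets0: "{t\<in>space M. s t ~= (%_. 0)} \<in> sets M"
  using simple_functionD(2)[OF sf, of "- {%_. 0}"] by (simp add: vimage_def Int_def conj_commute)
 have expand: "L2_inner \<Omega> (s t) e = (\<Sum>v\<in>V. indicator {t\<in>space M. s t = v} t *\<^sub>R L2_inner \<Omega> v e)" if t: "t \<in> space M" for t
 proof -
  have "(\<Sum>v\<in>V. indicator {t\<in>space M. s t = v} t *\<^sub>R L2_inner \<Omega> v e) = (\<Sum>v\<in>V. if v = s t then L2_inner \<Omega> v e else 0)"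
   using t by (intro sum.cong) (auto simp: indicator_def)
  then show ?thesis using V t by (simp add: V_def)
 qed
 have tm: "has_bochner_integral M (%t. indicator {t\<in>space M. s t = v} t *\<^sub>R L2_inner \<Omega> v e) (measure M {t\<in>space M. s t = v} *\<^sub>R L2_inner \<Omega> v e)" if v: "v \<in> V" for v
 proof (cases "v = (%_. 0)")
  case True
  then have "L2_inner \<Omega> v e = 0" by (simp add: L2_inner_def)
  then show ?thesis by (simp add: has_bochner_integral_zero)
 next
  case False
  have "emeasure M {t\<in>space M. s t = v} <= emeasure M {t\<in>space M. s t ~= (%_. 0)}" using False by (intro emeasure_mono sets0) auto
  then have "emeasure M {t\<in>space M. s t = v} < \<infinity>" using em by (simp add: less_top order_le_less_trans)
  then have "has_bochner_integral M (indicator {t\<in>space M. s t = v} :: _ => real) (measure M {t\<in>space M. s t = v})"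
   using sets by (intro has_bochner_integral_real_indicator) auto
  then show ?thesis by (intro has_bochner_integral_scaleR_left)
 qed
 have "has_bochner_integral M (%t. \<Sum>v\<in>V. indicator {t\<in>space M. s t = v} t *\<^sub>R L2_inner \<Omega> v e) (\<Sum>v\<in>V. measure M {t\<in>space M. s t = v} *\<^sub>R L2_inner \<Omega> v e)"
  by (rule has_bochner_integral_sum) (rule tm)
 then have hb: "has_bochner_integral M (%t. L2_inner \<Omega> (s t) e) (\<Sum>v\<in>V. measure M {t\<in>space M. s t = v} *\<^sub>R L2_inner \<Omega> v e)"
  by (subst has_bochner_integral_cong[OF refl expand refl]) auto
 have eq: "L2_simple_integral M s = (%x. \<Sum>v\<in>V. of_real (measure M {t\<in>space M. s t = v}) * v x)"
  by (rule HOL.ext) (simp add: L2_simple_integral_def V_def scaleR_conv_of_real)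
 note ls = L2_inner_sum[of V "%v. v", OF V VL e, where c = "%v. of_real (measure M {t\<in>space M. s t = v})"]
 show "integrable M (%t. L2_inner \<Omega> (s t) e)" using hb by (rule integrable.intros)
 show "L2_simple_integral M s \<in> L2 \<Omega>" unfolding eq using ls by blast
 show "(LINT t|M. L2_inner \<Omega> (s t) e) = L2_inner \<Omega> (L2_simple_integral M s) e"
  unfolding eq has_bochner_integral_integral_eq[OF hb] using ls by (simp add: scaleR_conv_of_real)
qed

lemma L2_inner_tendsto:
 assumes "!!k. u k \<in> L2 \<Omega>" "v \<in> L2 \<Omega>" "e \<in> L2 \<Omega>" "((%k. L2_norm \<Omega> (%x. u k x - v x)) \<longlongrightarrow> 0) F"
 shows "((%k. L2_inner \<Omega> (u k) e) \<longlongrightarrow> L2_inner \<Omega> v e) F"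
proof (rule LIM_zero_cancel, rule Lim_null_comparison)
 show "((%k. L2_norm \<Omega> (%x. u k x - v x) * L2_norm \<Omega> e) \<longlongrightarrow> 0) F" using tendsto_mult_right[OF assms(4), of "L2_norm \<Omega> e"] by simp
 have "norm (L2_inner \<Omega> (u k) e - L2_inner \<Omega> v e) <= L2_norm \<Omega> (%x. u k x - v x) * L2_norm \<Omega> e" for k
  using L2_Cauchy_Schwarz[OF L2_diff[OF assms(1)[of k] assms(2)] assms(3)] L2_inner_diff[OF assms(1)[of k] assms(2,3)] by simp
 then show "\<forall>\<^sub>F k in F. norm (L2_inner \<Omega> (u k) e - L2_inner \<Omega> v e) <= L2_norm \<Omega> (%x. u k x - v x) * L2_norm \<Omega> e" by simp
qed

text \<open>Pairing with \<open>e\<close> commutes with the vector-valued integral, since it does so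
  on simple functions and is Lipschitz for the L2 norm by Cauchy-Schwarz. This turns the Laplace
  transform of the data into scalar Laplace integrals.\<close>

lemma has_L2_integral_inner:
 fixes F :: "real => real^'d::finite => complex"
 assumes S: "S \<in> sets lebesgue" and h: "has_L2_integral \<Omega> (lebesgue_on S) F I" and e: "e \<in> L2 \<Omega>"
 shows "integrable (lebesgue_on S) (%t. L2_inner \<Omega> (F t) e)" and "(LINT t|lebesgue_on S. L2_inner \<Omega> (F t) e) = L2_inner \<Omega> I e"
proof -
 let ?M = "lebesgue_on S"
 have FL: "F t \<in> L2 \<Omega>" if "t \<in> space ?M" for t using h that by (auto simp: has_L2_integral_def L2_integrable_def L2_strongly_measurable_def)
 have Fn: "integrable ?M (%t. L2_norm \<Omega> (F t))" and I: "I \<in> L2 \<Omega>" using h by (auto simp: has_L2_integral_def L2_integrable_def)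
 obtain s where s: "!!k::nat. L2_simple \<Omega> ?M (s k)" "AE t in ?M. (%k. L2_norm \<Omega> (%x. F t x - s k t x)) \<longlonglongrightarrow> 0"
  using h by (auto simp: has_L2_integral_def L2_integrable_def L2_strongly_measurable_def)
 obtain r where r: "!!k::nat. L2_simple \<Omega> ?M (r k)" "(%k. \<integral>\<^sup>+t. ennreal (L2_norm \<Omega> (%x. F t x - r k t x)) \<partial>?M) \<longlonglongrightarrow> 0"
  "(%k. L2_norm \<Omega> (%x. L2_simple_integral ?M (r k) x - I x)) \<longlonglongrightarrow> 0"
  using h by (auto simp: has_L2_integral_def)
 have flip: "L2_norm \<Omega> (%x. u x - v x) = L2_norm \<Omega> (%x. v x - u x)" for u v :: "real^'d => complex"
  by (simp add: L2_norm_def norm_minus_commute)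
 have m: "(%t. L2_inner \<Omega> (F t) e) \<in> borel_measurable ?M"
 proof (rule borel_measurable_lebesgue_on_AE_limit[OF S])
  show "(%t. L2_inner \<Omega> (s k t) e) \<in> borel_measurable ?M" for k using L2_simple_inner(1)[OF s(1) e] by (rule borel_measurable_integrable)
  show "AE t in ?M. (%k. L2_inner \<Omega> (s k t) e) \<longlonglongrightarrow> L2_inner \<Omega> (F t) e"
   using s(2) AE_space
  proof eventually_elim
   case (elim t)
   have "(%k. L2_norm \<Omega> (%x. s k t x - F t x)) \<longlonglongrightarrow> 0" using elim(1) by (subst flip)
   moreover have "s k t \<in> L2 \<Omega>" for k using s(1) elim(2) by (auto simp: L2_simple_def)
   ultimately show ?case using FL[OF elim(2)] e by (intro L2_inner_tendsto)
  qed
 qed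
 have "integrable ?M (%t. L2_norm \<Omega> (F t) * L2_norm \<Omega> e)" using Fn by simp
 then show int: "integrable ?M (%t. L2_inner \<Omega> (F t) e)"
 proof (rule Bochner_Integration.integrable_bound[OF _ m])
  show "AE t in ?M. norm (L2_inner \<Omega> (F t) e) <= norm (L2_norm \<Omega> (F t) * L2_norm \<Omega> e)"
   using AE_space by eventually_elim (use L2_Cauchy_Schwarz[OF FL e] in \<open>simp add: L2_norm_nonneg\<close>)
 qed
 have "(%k. LINT t|?M. L2_inner \<Omega> (r k t) e) \<longlonglongrightarrow> (LINT t|?M. L2_inner \<Omega> (F t) e)"
 proof (rule tendsto_L1_int[OF L2_simple_inner(1)[OF r(1) e] int])
  show "(%k. \<integral>\<^sup>+t. ennreal (norm (L2_inner \<Omega> (r k t) e - L2_inner \<Omega> (F t) e)) \<partial>?M) \<longlonglongrightarrow> 0"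
  proof (rule tendsto_sandwich[OF _ _ tendsto_const])
   have z: "ennreal (L2_norm \<Omega> e + 1) * 0 = 0" by simp
   show "(%k. ennreal (L2_norm \<Omega> e + 1) * (\<integral>\<^sup>+t. ennreal (L2_norm \<Omega> (%x. F t x - r k t x)) \<partial>?M)) \<longlonglongrightarrow> 0"
    using ennreal_tendsto_cmult[OF _ r(2), of "ennreal (L2_norm \<Omega> e + 1)"] by simp
   have "(\<integral>\<^sup>+t. ennreal (norm (L2_inner \<Omega> (r k t) e - L2_inner \<Omega> (F t) e)) \<partial>?M) <= ennreal (L2_norm \<Omega> e + 1) * (\<integral>\<^sup>+t. ennreal (L2_norm \<Omega> (%x. F t x - r k t x)) \<partial>?M)" for k
   proof -
    \<comment> \<open>The added 1 makes the factor positive, so that division by it is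
      possible.\<close>
    define c where "c = L2_norm \<Omega> e + 1"
    have c: "0 < c" using L2_norm_nonneg[of \<Omega> e] by (simp add: c_def)
    have "(\<integral>\<^sup>+t. ennreal (norm (L2_inner \<Omega> (r k t) e - L2_inner \<Omega> (F t) e)) \<partial>?M) = (\<integral>\<^sup>+t. ennreal c * ennreal (norm (L2_inner \<Omega> (r k t) e - L2_inner \<Omega> (F t) e) / c) \<partial>?M)"
     using c by (simp flip: ennreal_mult')
    also have "... = ennreal c * (\<integral>\<^sup>+t. ennreal (norm (L2_inner \<Omega> (r k t) e - L2_inner \<Omega> (F t) e) / c) \<partial>?M)"
     by (intro nn_integral_cmult measurable_compose[OF _ measurable_ennreal] borel_measurable_divide measurable_compose[OF _ borel_measurable_norm] borel_measurable_const borel_measurable_diff m borel_measurable_integrable[OF L2_simple_inner(1)[OF r(1)[of k] e]])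
    also have "... <= ennreal c * (\<integral>\<^sup>+t. ennreal (L2_norm \<Omega> (%x. F t x - r k t x)) \<partial>?M)"
    proof (intro mult_left_mono nn_integral_mono ennreal_leI)
     fix t assume t: "t \<in> space ?M"
     have rL: "r k t \<in> L2 \<Omega>" using r(1) t by (auto simp: L2_simple_def)
     have "norm (L2_inner \<Omega> (r k t) e - L2_inner \<Omega> (F t) e) <= L2_norm \<Omega> (%x. F t x - r k t x) * L2_norm \<Omega> e"
      using L2_Cauchy_Schwarz[OF L2_diff[OF rL FL[OF t]] e] L2_inner_diff[OF rL FL[OF t] e] flip[of "r k t" "F t"] by simp
     also have "... <= L2_norm \<Omega> (%x. F t x - r k t x) * c" by (intro mult_left_mono) (auto simp: c_def L2_norm_nonneg)
     finally show "norm (L2_inner \<Omega> (r k t) e - L2_inner \<Omega> (F t) e) / c <= L2_norm \<Omega> (%x. F t x - r k t x)" using c by (simp add: pos_divide_le_eq)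
    qed simp
    finally show ?thesis by (simp add: c_def)
   qed
   then show "\<forall>\<^sub>F k in sequentially. (\<integral>\<^sup>+t. ennreal (norm (L2_inner \<Omega> (r k t) e - L2_inner \<Omega> (F t) e)) \<partial>?M) <= ennreal (L2_norm \<Omega> e + 1) * (\<integral>\<^sup>+t. ennreal (L2_norm \<Omega> (%x. F t x - r k t x)) \<partial>?M)" by simp
  qed simp
 qed
 moreover have "(%k. LINT t|?M. L2_inner \<Omega> (r k t) e) \<longlonglongrightarrow> L2_inner \<Omega> I e"
  unfolding L2_simple_inner(2)[OF r(1) e] by (rule L2_inner_tendsto[OF L2_simple_inner(3)[OF r(1) e] I e r(3)])
 ultimately show "(LINT t|?M. L2_inner \<Omega> (F t) e) = L2_inner \<Omega> I e" by (rule LIMSEQ_unique)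
qed

text \<open>By Cauchy-Schwarz, convergence of the difference quotients in norm carries over to their
  pairings with \<open>e\<close>.\<close>

lemma L2_holomorphic_on_inner:
 assumes h: "L2_holomorphic_on \<Omega> F S" and e: "e \<in> L2 \<Omega>"
 shows "(%s. L2_inner \<Omega> (F s) e) holomorphic_on S"
 unfolding holomorphic_on_def
proof
 fix z assume z: "z \<in> S"
 obtain g where g: "g \<in> L2 \<Omega>" "((%w. L2_norm \<Omega> (%x. (F w x - F z x) / (w - z) - g x)) \<longlongrightarrow> 0) (at z within S)"
  using h z by (auto simp: L2_holomorphic_on_def)
 have FL: "F w \<in> L2 \<Omega>" if "w \<in> S" for w using h that by (auto simp: L2_holomorphic_on_def)
 have "((%w. (L2_inner \<Omega> (F w) e - L2_inner \<Omega> (F z) e) / (w - z)) \<longlongrightarrow> L2_inner \<Omega> g e) (at z within S)"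
 proof (rule LIM_zero_cancel, rule Lim_null_comparison)
  show "((%w. L2_norm \<Omega> (%x. (F w x - F z x) / (w - z) - g x) * L2_norm \<Omega> e) \<longlongrightarrow> 0) (at z within S)"
   using tendsto_mult_right[OF g(2), of "L2_norm \<Omega> e"] by simp
  have "norm ((L2_inner \<Omega> (F w) e - L2_inner \<Omega> (F z) e) / (w - z) - L2_inner \<Omega> g e) <= L2_norm \<Omega> (%x. (F w x - F z x) / (w - z) - g x) * L2_norm \<Omega> e" if w: "w \<in> S" for w
  proof -
   define q where "q = (%x. (1 / (w - z)) * (F w x - F z x))"
   have q: "q \<in> L2 \<Omega>" unfolding q_def by (intro L2_scale L2_diff FL w z)
   have "L2_inner \<Omega> q e = (1 / (w - z)) * (L2_inner \<Omega> (F w) e - L2_inner \<Omega> (F z) e)"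
    unfolding q_def L2_inner_scale using L2_inner_diff[OF FL[OF w] FL[OF z] e] by simp
   then have "(L2_inner \<Omega> (F w) e - L2_inner \<Omega> (F z) e) / (w - z) - L2_inner \<Omega> g e = L2_inner \<Omega> (%x. q x - g x) e"
    using L2_inner_diff[OF q g(1) e] by simp
   then show ?thesis using L2_Cauchy_Schwarz[OF L2_diff[OF q g(1)] e] by (simp add: q_def)
  qed
  then show "\<forall>\<^sub>F w in at z within S. norm ((L2_inner \<Omega> (F w) e - L2_inner \<Omega> (F z) e) / (w - z) - L2_inner \<Omega> g e) <= L2_norm \<Omega> (%x. (F w x - F z x) / (w - z) - g x) * L2_norm \<Omega> e"
   by (auto simp: eventually_at_filter)
 qed
 then have "((%s. L2_inner \<Omega> (F s) e) has_field_derivative L2_inner \<Omega> g e) (at z within S)" by (simp add: has_field_derivative_iff)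
 then show "(%s. L2_inner \<Omega> (F s) e) field_differentiable at z within S" by (auto simp: field_differentiable_def)
qed

section \<open>The finite element space\<close>

unbundle no fps_syntax

lemma continuous_bounded_L2:
 assumes \<Omega>: "open \<Omega>" "bounded \<Omega>" and v: "continuous_on UNIV v"
 shows "v \<in> L2 (\<Omega> :: (real^'d::finite) set)"
proof -
 have lm: "\<Omega> \<in> lmeasurable" using \<Omega> by (simp add: lmeasurable_open)
 have vb: "v \<in> borel_measurable borel" using v by (rule borel_measurable_continuous_onI)
 then have "v \<in> borel_measurable lborel" by simp
 then have vl: "v \<in> borel_measurable lebesgue" by (rule measurable_completion)
 have m: "v \<in> borel_measurable (lebesgue_on \<Omega>)" by (rule measurable_restrict_space1[OF vl])
 have "compact (v ` closure \<Omega>)" using \<Omega> v by (intro compact_continuous_image) (auto intro: continuous_on_subset)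
 then obtain B where B: "!!x. x \<in> closure \<Omega> ==> cmod (v x) <= B" using compact_imp_bounded bounded_iff by (metis imageI)
 have "integrable (lebesgue_on \<Omega>) (%x. (cmod (v x))\<^sup>2)"
 proof (rule finite_measure.integrable_const_bound[OF finite_measure_lebesgue_on[OF lm], of _ "B\<^sup>2"])
  show "AE x in lebesgue_on \<Omega>. norm ((cmod (v x))\<^sup>2) <= B\<^sup>2"
   using AE_space by eventually_elim (auto intro!: power_mono B simp: closure_subset[THEN subsetD])
 qed (use m in measurable)
 then show ?thesis using m by (simp add: L2_def)
qed

lemma C1_compact_support_L2:
 assumes "open \<Omega>" "bounded \<Omega>" "C1_compact_support \<Omega> \<eta>"
 shows "\<eta> \<in> L2 \<Omega>" "partial_deriv i \<eta> \<in> L2 \<Omega>"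
proof -
 have "continuous_on UNIV \<eta>" using assms(3)
  by (intro continuous_at_imp_continuous_on ballI differentiable_imp_continuous_within) (simp add: C1_compact_support_def)
 then show "\<eta> \<in> L2 \<Omega>" by (rule continuous_bounded_L2[OF assms(1,2)])
 show "partial_deriv i \<eta> \<in> L2 \<Omega>" using assms by (intro continuous_bounded_L2) (auto simp: C1_compact_support_def)
qed

lemma partial_deriv_add:
 assumes "u differentiable (at x)" "v differentiable (at x)"
 shows "partial_deriv i (%x. u x + v x) x = partial_deriv i u x + partial_deriv i v x"
proof -
 have "((%x. u x + v x) has_derivative (%h. frechet_derivative u (at x) h + frechet_derivative v (at x) h)) (at x)"
  using assms by (intro has_derivative_add) (simp_all add: frechet_derivative_works)
 then have "frechet_derivative (%x. u x + v x) (at x) = (%h. frechet_derivative u (at x) h + frechet_derivative v (at x) h)"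
  by (rule frechet_derivative_at[symmetric])
 then show ?thesis by (simp add: partial_deriv_def)
qed

lemma partial_deriv_scale:
 assumes "u differentiable (at x)" shows "partial_deriv i (%x. c * u x) x = c * partial_deriv i u x"
proof -
 have "((%x. c * u x) has_derivative (%h. c * frechet_derivative u (at x) h)) (at x)"
  using assms by (intro has_derivative_mult_right) (simp add: frechet_derivative_works)
 then have "frechet_derivative (%x. c * u x) (at x) = (%h. c * frechet_derivative u (at x) h)" by (rule frechet_derivative_at[symmetric])
 then show ?thesis by (simp add: partial_deriv_def)
qed

lemma C1_compact_support_add:
 assumes u: "C1_compact_support \<Omega> u" and v: "C1_compact_support \<Omega> v"
 shows "C1_compact_support \<Omega> (%x. u x + v x)"
proof -
 obtain K L where K: "compact K" "K \<subseteq> \<Omega>" "!!x. x \<notin> K ==> u x = 0" and L: "compact L" "L \<subseteq> \<Omega>" "!!x. x \<notin> L ==> v x = 0"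
  using u v by (auto simp: C1_compact_support_def)
 have "\<exists>K. compact K \<and> K \<subseteq> \<Omega> \<and> (\<forall>x. x \<notin> K --> u x + v x = 0)"
  using K L by (intro exI[of _ "K \<union> L"]) auto
 moreover have "partial_deriv i (%x. u x + v x) = (%x. partial_deriv i u x + partial_deriv i v x)" for i
  using u v by (intro HOL.ext partial_deriv_add) (auto simp: C1_compact_support_def)
 ultimately show ?thesis using u v by (auto simp: C1_compact_support_def intro!: continuous_intros)
qed

lemma C1_compact_support_scale:
 assumes u: "C1_compact_support \<Omega> u" shows "C1_compact_support \<Omega> (%x. c * u x)"
proof -
 have pd: "partial_deriv i (%x. c * u x) = (%x. c * partial_deriv i u x)" for i
  using u by (intro HOL.ext partial_deriv_scale) (auto simp: C1_compact_support_def)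
 have "\<exists>K. compact K \<and> K \<subseteq> \<Omega> \<and> (\<forall>x. x \<notin> K --> c * u x = 0)" using u by (auto simp: C1_compact_support_def)
 moreover have "(%x. c * u x) differentiable (at x)" for x
  using u by (intro differentiable_mult differentiable_const) (auto simp: C1_compact_support_def)
 moreover have "continuous_on UNIV (partial_deriv i (%x. c * u x))" for i
  unfolding pd using u by (intro continuous_intros) (auto simp: C1_compact_support_def)
 ultimately show ?thesis unfolding C1_compact_support_def by blast
qed

text \<open>Openness and boundedness put the approximating functions and their partial derivatives
  into \<open>L2\<close>, as the triangle inequality for the limits requires.\<close>

lemma has_H01_gradient_add:
 assumes \<Omega>: "open \<Omega>" "bounded \<Omega>" and u: "has_H01_gradient \<Omega> u p" and v: "has_H01_gradient \<Omega> v q"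
 shows "has_H01_gradient \<Omega> (%x. u x + v x) (%x. p x + q x)"
proof -
 obtain \<eta> where \<eta>: "!!k::nat. C1_compact_support \<Omega> (\<eta> k)" "(%k. L2_norm \<Omega> (%x. \<eta> k x - u x)) \<longlonglongrightarrow> 0"
  "!!i. (%k. L2_norm \<Omega> (%x. partial_deriv i (\<eta> k) x - p x $ i)) \<longlonglongrightarrow> 0" using u by (auto simp: has_H01_gradient_def)
 obtain \<zeta> where \<zeta>: "!!k::nat. C1_compact_support \<Omega> (\<zeta> k)" "(%k. L2_norm \<Omega> (%x. \<zeta> k x - v x)) \<longlonglongrightarrow> 0"
  "!!i. (%k. L2_norm \<Omega> (%x. partial_deriv i (\<zeta> k) x - q x $ i)) \<longlonglongrightarrow> 0" using v by (auto simp: has_H01_gradient_def)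
 have L: "u \<in> L2 \<Omega>" "v \<in> L2 \<Omega>" "!!i. (%x. p x $ i) \<in> L2 \<Omega>" "!!i. (%x. q x $ i) \<in> L2 \<Omega>" using u v by (auto simp: has_H01_gradient_def)
 note cL = C1_compact_support_L2[OF \<Omega> \<eta>(1)] C1_compact_support_L2[OF \<Omega> \<zeta>(1)]
 have pd: "partial_deriv i (%x. \<eta> k x + \<zeta> k x) x = partial_deriv i (\<eta> k) x + partial_deriv i (\<zeta> k) x" for i k x
  using \<eta>(1) \<zeta>(1) by (intro partial_deriv_add) (auto simp: C1_compact_support_def)
 have "(%k. L2_norm \<Omega> (%x. (\<eta> k x - u x) + (\<zeta> k x - v x))) \<longlonglongrightarrow> 0"
  by (rule L2_norm_tendsto_add[OF L2_diff[OF cL(1) L(1)] L2_diff[OF cL(3) L(2)] \<eta>(2) \<zeta>(2)])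
 moreover have "(%k. L2_norm \<Omega> (%x. (partial_deriv i (\<eta> k) x - p x $ i) + (partial_deriv i (\<zeta> k) x - q x $ i))) \<longlonglongrightarrow> 0" for i
  by (rule L2_norm_tendsto_add[OF L2_diff[OF cL(2) L(3)] L2_diff[OF cL(4) L(4)] \<eta>(3) \<zeta>(3)])
 ultimately show ?thesis
  unfolding has_H01_gradient_def using L
  by (intro conjI exI[of _ "%k x. \<eta> k x + \<zeta> k x"] allI C1_compact_support_add[OF \<eta>(1) \<zeta>(1)]) (simp_all add: L2_add pd algebra_simps)
qed

lemma has_H01_gradient_scale:
 assumes u: "has_H01_gradient \<Omega> u p"
 shows "has_H01_gradient \<Omega> (%x. c * u x) (%x. \<chi> i. c * p x $ i)"
proof -
 obtain \<eta> where \<eta>: "!!k::nat. C1_compact_support \<Omega> (\<eta> k)" "(%k. L2_norm \<Omega> (%x. \<eta> k x - u x)) \<longlonglongrightarrow> 0"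
  "!!i. (%k. L2_norm \<Omega> (%x. partial_deriv i (\<eta> k) x - p x $ i)) \<longlonglongrightarrow> 0" using u by (auto simp: has_H01_gradient_def)
 have pd: "partial_deriv i (%x. c * \<eta> k x) x = c * partial_deriv i (\<eta> k) x" for i k x
  using \<eta>(1) by (intro partial_deriv_scale) (auto simp: C1_compact_support_def)
 have "(%k. L2_norm \<Omega> (%x. c * (\<eta> k x - u x))) \<longlonglongrightarrow> 0" unfolding L2_norm_scale by (rule tendsto_mult_right_zero[OF \<eta>(2)])
 moreover have "(%k. L2_norm \<Omega> (%x. c * (partial_deriv i (\<eta> k) x - p x $ i))) \<longlonglongrightarrow> 0" for i unfolding L2_norm_scale by (rule tendsto_mult_right_zero[OF \<eta>(3)])
 ultimately show ?thesis
  unfolding has_H01_gradient_def using u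
  by (intro conjI exI[of _ "%k x. c * \<eta> k x"] allI C1_compact_support_scale[OF \<eta>(1)]) (simp_all add: L2_scale pd has_H01_gradient_def right_diff_distrib)
qed

lemma has_H01_gradient_zero: "has_H01_gradient \<Omega> (%_. 0) (%_. 0)"
proof -
 have pd: "partial_deriv i (%_. 0) = (%_. 0)" for i :: 'a by (auto simp: partial_deriv_def)
 have "C1_compact_support \<Omega> (%_. 0)" by (auto simp: C1_compact_support_def pd intro!: exI[of _ "{}"])
 then show ?thesis
  unfolding has_H01_gradient_def by (intro conjI exI[of _ "%_ _. 0"]) (simp_all add: L2_zero pd L2_norm_def)
qed

text \<open>The integral formula holds for every choice of gradients, so each identity may be
  checked on arbitrary witnesses. The bound on the coefficients gives the integrability behind
  additivity, and the symmetry of the matrix gives the Hermitian property.\<close>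

lemma elliptic_form_properties:
 fixes \<Omega> :: "(real^'d::finite) set"
 assumes \<Omega>: "open \<Omega>" "bounded \<Omega>" and A: "elliptic_form \<Omega> A"
 shows "u \<in> H01 \<Omega> ==> v \<in> H01 \<Omega> ==> w \<in> H01 \<Omega> ==> A (%x. u x + v x) w = A u w + A v w"
  and "u \<in> H01 \<Omega> ==> w \<in> H01 \<Omega> ==> A (%x. c * u x) w = c * A u w"
  and "u \<in> H01 \<Omega> ==> w \<in> H01 \<Omega> ==> A w u = cnj (A u w)"
  and "v \<in> H01 \<Omega> ==> L2_norm \<Omega> v ~= 0 ==> 0 < Re (A v v)"
proof -
 obtain a :: "real^'d => real^'d^'d" and b :: "real^'d => real" and \<kappa> B where E:
  "(\<forall>i j. (%x. a x $ i $ j) \<in> borel_measurable (lebesgue_on \<Omega>)) \<and>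
    b \<in> borel_measurable (lebesgue_on \<Omega>) \<and>
    (\<forall>x\<in>\<Omega>. (\<forall>i j. \<bar>a x $ i $ j\<bar> <= B) \<and> \<bar>b x\<bar> <= B) \<and>
    (\<forall>x\<in>\<Omega>. Finite_Cartesian_Product.transpose (a x) = a x) \<and>
    \<kappa> > 0 \<and> (\<forall>x\<in>\<Omega>. \<forall>\<xi>. \<xi> \<bullet> (a x *v \<xi>) >= \<kappa> * (norm \<xi>)\<^sup>2) \<and>
    (\<forall>\<phi> \<psi> p q. has_H01_gradient \<Omega> \<phi> p --> has_H01_gradient \<Omega> \<psi> q -->
     A \<phi> \<psi> = (LINT x|lebesgue_on \<Omega>.
       (\<Sum>i\<in>UNIV. \<Sum>j\<in>UNIV. of_real (a x $ i $ j) * p x $ j * cnj (q x $ i))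
       + of_real (b x) * \<phi> x * cnj (\<psi> x)))"
  using A[unfolded elliptic_form_def, THEN conjunct1] by (elim exE) (rule that)
 note E2 = E[THEN conjunct2]
 note E4 = E2[THEN conjunct2, THEN conjunct2]
 note am = E[THEN conjunct1, rule_format] and bm = E2[THEN conjunct1] and bd = E2[THEN conjunct2, THEN conjunct1, THEN bspec]
  and sym = E4[THEN conjunct1, THEN bspec] and form = E4[THEN conjunct2, THEN conjunct2, THEN conjunct2, rule_format]
 define I where "I \<phi> p \<psi> q x = (\<Sum>i\<in>UNIV. \<Sum>j\<in>UNIV. of_real (a x $ i $ j) * p x $ j * cnj (q x $ i)) + of_real (b x) * \<phi> x * cnj (\<psi> x)"
  for \<phi> \<psi> :: "real^'d => complex" and p q :: "real^'d => complex^'d" and x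
 have form': "A \<phi> \<psi> = (LINT x|lebesgue_on \<Omega>. I \<phi> p \<psi> q x)" if "has_H01_gradient \<Omega> \<phi> p" "has_H01_gradient \<Omega> \<psi> q" for \<phi> \<psi> p q
  unfolding I_def using form that by blast
 have sp: "space (lebesgue_on \<Omega>) = \<Omega>" by (simp add: space_restrict_space)
 have weighted: "integrable (lebesgue_on \<Omega>) (%x. of_real (h x) * y x * cnj (z x))"
  if h: "h \<in> borel_measurable (lebesgue_on \<Omega>)" "!!x. x \<in> \<Omega> ==> \<bar>h x\<bar> <= B" and y: "y \<in> L2 \<Omega>" and z: "z \<in> L2 \<Omega>" for h y z
 proof (rule Bochner_Integration.integrable_bound)
  show "integrable (lebesgue_on \<Omega>) (%x. of_real B * (y x * cnj (z x)))" by (intro integrable_mult_right L2_product_integrable y z)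
  have "(%x. of_real (h x) * (y x * cnj (z x))) \<in> borel_measurable (lebesgue_on \<Omega>)"
   by (intro borel_measurable_times[OF measurable_compose[OF h(1) borel_measurable_of_real]] borel_measurable_integrable[OF L2_product_integrable[OF y z]])
  then show "(%x. of_real (h x) * y x * cnj (z x)) \<in> borel_measurable (lebesgue_on \<Omega>)" by (simp add: mult.assoc)
  show "AE x in lebesgue_on \<Omega>. norm (of_real (h x) * y x * cnj (z x)) <= norm (of_real B * (y x * cnj (z x)))"
   using AE_space
  proof eventually_elim
   case (elim x)
   then have "\<bar>h x\<bar> <= \<bar>B\<bar>" using h(2)[of x] by (simp add: sp)
   then have "\<bar>h x\<bar> * (cmod (y x) * cmod (z x)) <= \<bar>B\<bar> * (cmod (y x) * cmod (z x))" by (rule mult_right_mono) simp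
   then show ?case by (simp add: norm_mult mult.assoc)
  qed
 qed
 have Ii: "integrable (lebesgue_on \<Omega>) (I \<phi> p \<psi> q)" if "has_H01_gradient \<Omega> \<phi> p" "has_H01_gradient \<Omega> \<psi> q" for \<phi> \<psi> p q
  unfolding I_def using that bd
  by (intro Bochner_Integration.integrable_add Bochner_Integration.integrable_sum weighted am bm) (auto simp: has_H01_gradient_def)
 show "A (%x. u x + v x) w = A u w + A v w" if uvw: "u \<in> H01 \<Omega>" "v \<in> H01 \<Omega>" "w \<in> H01 \<Omega>"
 proof -
  obtain p q r where g: "has_H01_gradient \<Omega> u p" "has_H01_gradient \<Omega> v q" "has_H01_gradient \<Omega> w r" using uvw by (auto simp: H01_def)
  have "A (%x. u x + v x) w = (LINT x|lebesgue_on \<Omega>. I u p w r x + I v q w r x)"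
   unfolding form'[OF has_H01_gradient_add[OF \<Omega> g(1,2)] g(3)]
   by (intro Bochner_Integration.integral_cong refl) (simp add: I_def algebra_simps sum.distrib)
  also have "... = A u w + A v w" unfolding form'[OF g(1,3)] form'[OF g(2,3)] by (rule Bochner_Integration.integral_add[OF Ii[OF g(1,3)] Ii[OF g(2,3)]])
  finally show ?thesis .
 qed
 show "A (%x. c * u x) w = c * A u w" if uw: "u \<in> H01 \<Omega>" "w \<in> H01 \<Omega>"
 proof -
  obtain p r where g: "has_H01_gradient \<Omega> u p" "has_H01_gradient \<Omega> w r" using uw by (auto simp: H01_def)
  have "A (%x. c * u x) w = (LINT x|lebesgue_on \<Omega>. c * I u p w r x)"
   unfolding form'[OF has_H01_gradient_scale[OF g(1)] g(2)]
   by (intro Bochner_Integration.integral_cong refl) (simp add: I_def distrib_left sum_distrib_left mult_ac)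
  also have "... = c * A u w" unfolding form'[OF g] by simp
  finally show ?thesis .
 qed
 show "A w u = cnj (A u w)" if uw: "u \<in> H01 \<Omega>" "w \<in> H01 \<Omega>"
 proof -
  obtain p r where g: "has_H01_gradient \<Omega> u p" "has_H01_gradient \<Omega> w r" using uw by (auto simp: H01_def)
  have "A w u = (LINT x|lebesgue_on \<Omega>. cnj (I u p w r x))"
   unfolding form'[OF g(2,1)]
  proof (rule Bochner_Integration.integral_cong[OF refl])
   fix x assume "x \<in> space (lebesgue_on \<Omega>)"
   then have "transpose (a x) = a x" using sym[of x] by (simp add: sp)
   then have s: "a x $ j $ i = a x $ i $ j" for i j unfolding transpose_def by (metis vec_lambda_beta)
   have "(\<Sum>i\<in>UNIV. \<Sum>j\<in>UNIV. of_real (a x $ i $ j) * r x $ j * cnj (p x $ i)) = (\<Sum>j\<in>UNIV. \<Sum>i\<in>UNIV. of_real (a x $ i $ j) * r x $ j * cnj (p x $ i))" by (rule sum.swap)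
   also have "... = (\<Sum>i\<in>UNIV. \<Sum>j\<in>UNIV. cnj (of_real (a x $ i $ j) * p x $ j * cnj (r x $ i)))"
    using s by (intro sum.cong refl) simp
   finally show "I w r u p x = cnj (I u p w r x)" by (simp add: I_def)
  qed
  then show ?thesis unfolding form'[OF g] by simp
 qed
 show "0 < Re (A v v)" if "v \<in> H01 \<Omega>" "L2_norm \<Omega> v ~= 0" using A that by (simp add: elliptic_form_def)
qed

text \<open>The set where v does not vanish is open and a Lebesgue null set, hence empty.\<close>

lemma L2_norm_zero_imp_zero:
 fixes v :: "real^'d::finite => complex"
 assumes \<Omega>: "open \<Omega>" and v: "v \<in> L2 \<Omega>" "continuous_on \<Omega> v" "L2_norm \<Omega> v = 0" and x: "x \<in> \<Omega>"
 shows "v x = 0"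
proof (rule ccontr)
 assume nz: "v x ~= 0"
 define Z where "Z = {y \<in> \<Omega>. v y ~= 0}"
 have "open (\<Omega> \<inter> v -` (- {0}))" by (rule continuous_open_preimage[OF v(2) \<Omega>]) auto
 then have Z: "open Z" by (simp add: Z_def Int_def vimage_def)
 have "(LINT y|lebesgue_on \<Omega>. (cmod (v y))\<^sup>2) = 0" using v(3) by (simp add: L2_norm_def)
 then have "AE y in lebesgue_on \<Omega>. (cmod (v y))\<^sup>2 = 0"
  using integral_nonneg_eq_0_iff_AE[OF L2_square_integrable[OF v(1)]] by simp
 then have "AE y in lebesgue. y \<in> \<Omega> --> v y = 0" using \<Omega> by (subst (asm) AE_restrict_space_iff) auto
 then have "Z \<in> null_sets lebesgue" using Z by (subst AE_iff_null_sets[of Z]) (auto simp: Z_def)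
 then have "negligible Z" by (simp add: negligible_iff_null_sets)
 then show False using open_not_negligible[OF Z] x nz by (auto simp: Z_def)
qed

text \<open>The vertices of the simplices serve as \<open>P\<close>: on a simplex a finite element
  function is affine, and the zero set of an affine function is convex, so it contains the simplex
  once it contains the vertices. Continuity together with the zero extension makes the inner product
  definite on the space.\<close>

lemma fe_space_form_space:
 fixes \<Omega> :: "(real^'d::finite) set"
 assumes \<Omega>: "open \<Omega>" "bounded \<Omega>" and A: "elliptic_form \<Omega> A" and T: "regular_triangulation \<Omega> \<gamma> h \<T>"
 obtains P where "form_space (L2 \<Omega>) (fe_space \<Omega> \<T>) (L2_inner \<Omega>) A P"
proof -
 let ?X = "fe_space \<Omega> \<T>"
 have XH: "u \<in> H01 \<Omega>" if "u \<in> ?X" for u using that by (simp add: fe_space_def)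
 have HL: "u \<in> L2 \<Omega>" if "u \<in> H01 \<Omega>" for u using that by (auto simp: H01_def has_H01_gradient_def)
 have tri: "finite \<T>" "!!K. K \<in> \<T> ==> \<exists>n. n simplex K" "\<Union>\<T> = closure \<Omega>" using T by (auto simp: regular_triangulation_def triangulation_def)
 obtain C where C: "!!K. K \<in> \<T> ==> finite (C K) \<and> K = convex hull (C K)" using tri(2) unfolding simplex by metis
 define P where "P = (\<Union>K\<in>\<T>. C K)"
 have add: "(%x. u x + v x) \<in> ?X" if u: "u \<in> ?X" and v: "v \<in> ?X" for u v
 proof -
  have "(%x. u x + v x) \<in> H01 \<Omega>" using XH[OF u] XH[OF v] has_H01_gradient_add[OF \<Omega>] unfolding H01_def by blast
  moreover have "\<exists>c L. linear L \<and> (\<forall>x\<in>K. u x + v x = c + L x)" if K: "K \<in> \<T>" for K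
  proof -
   obtain c L where "linear L" "\<forall>x\<in>K. u x = c + L x" using u K unfolding fe_space_def by blast
   moreover obtain d M where "linear M" "\<forall>x\<in>K. v x = d + M x" using v K unfolding fe_space_def by blast
   ultimately show ?thesis by (intro exI[of _ "c + d"] exI[of _ "%x. L x + M x"]) (auto intro: linear_compose_add)
  qed
  ultimately show ?thesis using u v by (auto simp: fe_space_def intro!: continuous_intros)
 qed
 have scale: "(%x. c * u x) \<in> ?X" if u: "u \<in> ?X" for c u
 proof -
  have "(%x. c * u x) \<in> H01 \<Omega>" using XH[OF u] has_H01_gradient_scale unfolding H01_def by blast
  moreover have "\<exists>d L. linear L \<and> (\<forall>x\<in>K. c * u x = d + L x)" if K: "K \<in> \<T>" for K
  proof -
   obtain d L where L: "linear L" "\<forall>x\<in>K. u x = d + L x" using u K unfolding fe_space_def by blast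
   have "linear (%x. c * L x)" using linear_compose[OF L(1), of "%y. c * y"] by (simp add: o_def linear_times)
   then show ?thesis using L by (intro exI[of _ "c * d"] exI[of _ "%x. c * L x"]) (auto simp: distrib_left)
  qed
  ultimately show ?thesis using u by (auto simp: fe_space_def intro!: continuous_intros)
 qed
 have zero: "(%_. 0) \<in> ?X"
 proof -
  have "\<exists>c L. linear L \<and> (\<forall>x\<in>K. (0::complex) = c + L x)" for K :: "(real^'d) set" by (intro exI[of _ 0] exI[of _ "%_. 0"]) (simp add: linear_zero)
  then show ?thesis using has_H01_gradient_zero[of \<Omega>] unfolding fe_space_def H01_def by auto
 qed
 have definite: "u = (%_. 0)" if u: "u \<in> ?X" "L2_norm \<Omega> u = 0" for u
 proof
  fix x
  have "continuous_on (closure \<Omega>) u" using u(1) by (simp add: fe_space_def)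
  then have "continuous_on \<Omega> u" using closure_subset by (rule continuous_on_subset)
  then show "u x = 0" using L2_norm_zero_imp_zero[OF \<Omega>(1) HL[OF XH[OF u(1)]] _ u(2)] u(1) by (cases "x \<in> \<Omega>") (auto simp: fe_space_def)
 qed
 have sep: "u = (%_. 0)" if u: "u \<in> ?X" and p: "!!p. p \<in> P ==> u p = 0" for u
 proof
  fix x
  show "u x = 0"
  proof (cases "x \<in> \<Omega>")
   case True
   then obtain K where K: "K \<in> \<T>" "x \<in> K" using tri(3) closure_subset by blast
   obtain c L where L: "linear L" "\<forall>x\<in>K. u x = c + L x" using u K unfolding fe_space_def by blast
   have Ck: "C K \<subseteq> K" using C[OF K(1)] hull_subset[of "C K" convex] by simp
   have "convex {y. c + L y = 0}"
   proof (rule convexI)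
    fix y z and s t :: real assume yz: "y \<in> {y. c + L y = 0}" "z \<in> {y. c + L y = 0}" and st: "s + t = 1"
    have "c + L (s *\<^sub>R y + t *\<^sub>R z) = (s + t) *\<^sub>R c + (s *\<^sub>R L y + t *\<^sub>R L z)" using st by (simp add: linear_add[OF L(1)] linear_scale[OF L(1)])
    also have "... = s *\<^sub>R (c + L y) + t *\<^sub>R (c + L z)" by (simp add: algebra_simps)
    finally show "s *\<^sub>R y + t *\<^sub>R z \<in> {y. c + L y = 0}" using yz by simp
   qed
   moreover have "C K \<subseteq> {y. c + L y = 0}"
   proof
    fix y assume y: "y \<in> C K"
    then have "u y = 0" using K by (intro p) (auto simp: P_def)
    then show "y \<in> {y. c + L y = 0}" using L(2) Ck y by auto
   qed
   ultimately have "convex hull C K \<subseteq> {y. c + L y = 0}" by (intro hull_minimal)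
   then show ?thesis using C[OF K(1)] K(2) L(2) by auto
  qed (use u in \<open>simp add: fe_space_def\<close>)
 qed
 have "form_space (L2 \<Omega>) ?X (L2_inner \<Omega>) A P"
 proof unfold_locales
  show "finite P" unfolding P_def using tri(1) C by auto
  show "u = (%_. 0)" if "u \<in> ?X" "L2_inner \<Omega> u u = 0" for u using that by (intro definite) (auto simp: L2_inner_self)
  show "0 < Re (A u u)" if "u \<in> ?X" "u ~= (%_. 0)" for u
   using elliptic_form_properties(4)[OF \<Omega> A XH[OF that(1)]] definite that by blast
  show "?X \<subseteq> L2 \<Omega>" using XH HL by blast
  show "L2_inner \<Omega> (%x. u x + v x) w = L2_inner \<Omega> u w + L2_inner \<Omega> v w" if "u \<in> L2 \<Omega>" "v \<in> L2 \<Omega>" "w \<in> L2 \<Omega>" for u v w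
   by (rule L2_inner_add[OF that])
  show "L2_inner \<Omega> w u = cnj (L2_inner \<Omega> u w)" for u w by (rule L2_inner_cnj)
  show "A (%x. u x + v x) w = A u w + A v w" if "u \<in> ?X" "v \<in> ?X" "w \<in> ?X" for u v w
   by (rule elliptic_form_properties(1)[OF \<Omega> A that[THEN XH]])
  show "A (%x. c * u x) w = c * A u w" if "u \<in> ?X" "w \<in> ?X" for c u w
   by (rule elliptic_form_properties(2)[OF \<Omega> A that[THEN XH]])
  show "A w u = cnj (A u w)" if "u \<in> ?X" "w \<in> ?X" for u w
   by (rule elliptic_form_properties(3)[OF \<Omega> A that[THEN XH]])
 qed (fact L2_add L2_scale zero add scale sep | simp add: L2_inner_self L2_inner_scale)+
 then show ?thesis by (rule that)
qed

section \<open>The scheme in one eigencomponent\<close>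

definition cfps :: "real fps => complex fps" where "cfps F = Abs_fps (%n. of_real (fps_nth F n))"

lemma cfps_nth [simp]: "fps_nth (cfps F) n = of_real (fps_nth F n)" by (simp add: cfps_def)
lemma cfps_mult: "cfps (F * G) = cfps F * cfps G" by (simp add: fps_eq_iff fps_mult_nth)
lemma cfps_add: "cfps (F + G) = cfps F + cfps G" by (simp add: fps_eq_iff)
lemma cfps_diff: "cfps (F - G) = cfps F - cfps G" by (simp add: fps_eq_iff)
lemma cfps_const: "cfps (fps_const c) = fps_const (of_real c)" by (simp add: fps_eq_iff)
lemma cfps_X: "cfps fps_X = fps_X" by (simp add: fps_eq_iff fps_X_def)
lemma cfps_numeral: "cfps (numeral k) = numeral k" by (simp add: fps_eq_iff fps_numeral_nth)

lemma fps_mult_nth_eq_0: "(!!i. i <= n ==> fps_nth E i = 0) ==> fps_nth (G * E :: 'a::comm_ring_1 fps) n = 0"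
 by (simp add: fps_mult_nth)

text \<open>Because y vanishes for k <= 0, multiplication by a power of the variable agrees with the
  shift also where the shifted index is negative.\<close>

lemma fps_shift_nth_int:
 assumes "!!k. k <= 0 ==> (y :: int => complex) k = 0"
 shows "fps_nth (fps_X * Abs_fps (%n. y (int n))) n = y (int n - 1)"
  and "fps_nth (fps_X\<^sup>2 * Abs_fps (%n. y (int n))) n = y (int n - 2)"
  and "fps_nth (fps_X ^ 3 * Abs_fps (%n. y (int n))) n = y (int n - 3)"
 using assms by (auto simp: fps_X_power_mult_nth of_nat_diff)

context
 fixes a l \<tau> :: real
 assumes a: "0 < a" "a < 1" and l: "0 < l" and \<tau>: "0 < \<tau>"
begin

text \<open>The equations hold only up to N, so the residual \<open>E\<close> is not zero but has
  vanishing coefficients up to N. This suffices, since coefficient n of a product depends only on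
  the coefficients up to n of its factors. Multiplication by \<tau>^a turns the eigenvalue into l
  \<tau>^a.\<close>

lemma cn_scheme_solution:
 fixes y \<Phi> :: "int => complex"
 assumes y0: "!!k. k <= 0 ==> y k = 0" and \<Phi>0: "!!k. k <= 0 ==> \<Phi> k = 0"
  and scheme: "!!n. 1 <= n ==> n <= N ==>
   of_real (\<tau> powr (- a)) * (\<Sum>j\<le>n. of_real (cn_weight a j) * y (int n - int j)) + of_real (1 - a/2) * (of_real l * y (int n)) + of_real (a/2) * (of_real l * y (int n - 1))
   = of_real (1 - a/2) * (1 / of_real \<tau> * (3/2 * \<Phi> (int n) - 2 * \<Phi> (int n - 1) + 1/2 * \<Phi> (int n - 2)))
    + of_real (a/2) * (1 / of_real \<tau> * (3/2 * \<Phi> (int n - 1) - 2 * \<Phi> (int n - 2) + 1/2 * \<Phi> (int n - 3)))"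
  and n: "n <= N"
 shows "1 / of_real \<tau> * (3/2 * y (int n) - 2 * y (int n - 1) + 1/2 * y (int n - 2))
  = of_real (\<tau> powr (a - 2)) * (\<Sum>j\<le>n. of_real (fps_nth (mlk_fps a (l * \<tau> powr a)) j) * (\<Phi> (int n - int j + 1) - 2 * \<Phi> (int n - int j) + \<Phi> (int n - int j - 1)))"
proof -
 define s where "s = \<tau> powr a"
 have s: "0 < s" using \<tau> by (simp add: s_def)
 define Y where "Y = Abs_fps (%n. y (int n))"
 define P where "P = Abs_fps (%n. \<Phi> (int n))"
 have Yn: "fps_nth Y i = y (int i)" and Pn: "fps_nth P i = \<Phi> (int i)" for i by (simp_all add: Y_def P_def)
 note ys = fps_shift_nth_int[of y, OF y0, folded Y_def] and ps = fps_shift_nth_int[of \<Phi>, OF \<Phi>0, folded P_def]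
 define A where "A = cfps (cn_fps a (l * s))"
 define C where "C = fps_const (of_real (1 - a/2)) + fps_const (of_real (a/2)) * (fps_X :: complex fps)"
 define D where "D = fps_const (3/2) - fps_const 2 * fps_X + fps_const (1/2) * (fps_X :: complex fps)\<^sup>2"
 define M where "M = cfps (mlk_fps a (l * s))"
 have ls: "0 < l * s" using l s by simp
 have A0: "fps_nth A 0 ~= 0" using cn_fps_nth_0[OF a ls] by (simp add: A_def)
 have MA: "M * A = fps_const (1/4) * fps_X * (3 - fps_X)\<^sup>2 * C"
 proof -
  have "mlk_fps a (l * s) * cn_fps a (l * s) = fps_const (1/4) * fps_X * (3 - fps_X)^2 * (fps_const (1 - a/2) + fps_const (a/2) * fps_X)"
   using inverse_mult_eq_1[OF cn_fps_nth_0[OF a ls]] by (simp add: mlk_fps_def mult.assoc)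
  then show ?thesis unfolding M_def A_def cfps_mult[symmetric]
   by (simp add: cfps_mult cfps_add cfps_diff cfps_const cfps_X cfps_numeral power2_eq_square C_def)
 qed
 \<comment> \<open>The identity behind \<open>mlk_fps\<close>: four times the squared BDF symbol is
   ((1 - z)(3 - z))^2.\<close>
 have D2: "fps_X * C * D\<^sup>2 = (1 - fps_X)\<^sup>2 * M * A"
 proof -
  have two: "fps_const (2::complex) * D = (1 - fps_X) * (3 - fps_X)"
   by (rule fps_ext) (auto simp: D_def algebra_simps power2_eq_square fps_numeral_nth fps_X_def fps_mult_nth_1 numeral_fps_const)
  have four: "fps_const (4::complex) * D\<^sup>2 = ((1 - fps_X) * (3 - fps_X))\<^sup>2"
   unfolding two[symmetric] by (simp add: power_mult_distrib)
  have D': "D\<^sup>2 = fps_const (1/4) * ((1 - fps_X) * (3 - fps_X))\<^sup>2"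
  proof -
   have "D\<^sup>2 = (fps_const (1/4) * fps_const 4) * D\<^sup>2" by simp
   also have "... = fps_const (1/4) * ((1 - fps_X) * (3 - fps_X))\<^sup>2" unfolding mult.assoc four ..
   finally show ?thesis .
  qed
  show ?thesis unfolding D' mult.assoc MA by (simp add: power_mult_distrib mult_ac)
 qed
 define E where "E = A * Y - fps_const (of_real (s / \<tau>)) * (C * (D * P))"
 have E0: "fps_nth E i = 0" if "i <= N" for i
 proof -
  have AY: "fps_nth (A * Y) i = (\<Sum>j\<le>i. of_real (cn_weight a j) * y (int i - int j)) + of_real (l * s) * (of_real (1 - a/2) * y (int i) + of_real (a/2) * y (int i - 1))"
  proof -
   have "A = Abs_fps (%n. of_real (cn_weight a n)) + fps_const (of_real (l * s)) * C"
    unfolding A_def cn_fps_def C_def cfps_add cfps_mult cfps_const cfps_X by (simp add: fps_eq_iff)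
   then have "A * Y = Abs_fps (%n. of_real (cn_weight a n)) * Y + fps_const (of_real (l * s)) * (fps_const (of_real (1 - a/2)) * Y + fps_const (of_real (a/2)) * (fps_X * Y))"
    by (simp add: C_def algebra_simps)
   moreover have "fps_nth (Abs_fps (%n. of_real (cn_weight a n)) * Y) i = (\<Sum>j\<le>i. of_real (cn_weight a j) * y (int i - int j))"
    unfolding fps_mult_nth Y_def by (intro sum.cong) (auto simp: of_nat_diff)
   ultimately show ?thesis by (simp only: fps_add_nth fps_mult_left_const_nth ys Yn)
  qed
  have CDP: "fps_nth (C * (D * P)) i = of_real (1 - a/2) * (3/2 * \<Phi> (int i) - 2 * \<Phi> (int i - 1) + 1/2 * \<Phi> (int i - 2))
    + of_real (a/2) * (3/2 * \<Phi> (int i - 1) - 2 * \<Phi> (int i - 2) + 1/2 * \<Phi> (int i - 3))"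
  proof -
   have "C * (D * P) = fps_const (of_real (1 - a/2)) * (fps_const (3/2) * P - fps_const 2 * (fps_X * P) + fps_const (1/2) * (fps_X\<^sup>2 * P))
     + fps_const (of_real (a/2)) * (fps_const (3/2) * (fps_X * P) - fps_const 2 * (fps_X\<^sup>2 * P) + fps_const (1/2) * (fps_X ^ 3 * P))"
    by (simp add: C_def D_def algebra_simps power2_eq_square power3_eq_cube)
   then show ?thesis by (simp only: fps_add_nth fps_sub_nth fps_mult_left_const_nth ps Pn)
  qed
  show ?thesis
  proof (cases "i = 0")
   case True
   then show ?thesis unfolding E_def fps_sub_nth AY fps_mult_left_const_nth CDP using y0 \<Phi>0 by simp
  next
   case False
   define S where "S = (\<Sum>j\<le>i. of_real (cn_weight a j) * y (int i - int j))"
   define R1 where "R1 = 3/2 * \<Phi> (int i) - 2 * \<Phi> (int i - 1) + 1/2 * \<Phi> (int i - 2)"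
   define R2 where "R2 = 3/2 * \<Phi> (int i - 1) - 2 * \<Phi> (int i - 2) + 1/2 * \<Phi> (int i - 3)"
   define T where "T = (of_real \<tau> :: complex)"
   define c where "c = (of_real s :: complex)"
   define L where "L = (of_real l :: complex)"
   define b1 where "b1 = (of_real (1 - a/2) :: complex)"
   define b2 where "b2 = (of_real (a/2) :: complex)"
   have c: "c ~= 0" using s by (simp add: c_def)
   have "of_real (\<tau> powr (- a)) = 1 / c" by (simp add: c_def s_def powr_minus_divide)
   then have eq: "1 / c * S + b1 * (L * y (int i)) + b2 * (L * y (int i - 1)) = b1 * (1 / T * R1) + b2 * (1 / T * R2)"
    using scheme[of i] that False unfolding S_def R1_def R2_def T_def L_def b1_def b2_def by simp
   have "S + L * c * (b1 * y (int i) + b2 * y (int i - 1)) = c * (1 / c * S + b1 * (L * y (int i)) + b2 * (L * y (int i - 1)))"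
    using c by (simp add: distrib_left mult_ac)
   also have "... = c / T * (b1 * R1 + b2 * R2)" unfolding eq by (simp add: distrib_left mult_ac)
   finally have "S + L * c * (b1 * y (int i) + b2 * y (int i - 1)) - c / T * (b1 * R1 + b2 * R2) = 0" by simp
   then show ?thesis
    unfolding E_def fps_sub_nth AY fps_mult_left_const_nth CDP unfolding S_def R1_def R2_def T_def L_def b1_def b2_def c_def of_real_mult of_real_divide .
  qed
 qed
 define G where "G = D * inverse A"
 have iA: "inverse A * A = 1" using A0 by (rule inverse_mult_eq_1)
 \<comment> \<open>Both sides are kept multiplied by the variable, so the wanted coefficient n
   stands at \<open>Suc n\<close>. On the right this shift centres the second difference of
   \<Phi>.\<close>
 have main: "fps_X * (D * Y) = fps_const (of_real (s / \<tau>)) * ((1 - fps_X)\<^sup>2 * M * P) + fps_X * (G * E)"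
 proof -
  have "fps_X * (G * E) = fps_X * D * (inverse A * A) * Y - fps_const (of_real (s / \<tau>)) * (inverse A * (fps_X * C * D\<^sup>2) * P)"
   by (simp add: G_def E_def right_diff_distrib power2_eq_square mult_ac)
  also have "inverse A * (fps_X * C * D\<^sup>2) = (1 - fps_X)\<^sup>2 * M * (inverse A * A)" unfolding D2 by (simp only: mult_ac)
  finally show ?thesis unfolding iA by (simp add: mult.assoc)
 qed
 have lhs: "fps_nth (fps_X * (D * Y)) (Suc n) = 3/2 * y (int n) - 2 * y (int n - 1) + 1/2 * y (int n - 2)"
 proof -
  have "D * Y = fps_const (3/2) * Y - fps_const 2 * (fps_X * Y) + fps_const (1/2) * (fps_X\<^sup>2 * Y)" by (simp add: D_def algebra_simps)
  then have "fps_nth (D * Y) n = 3/2 * y (int n) - 2 * y (int n - 1) + 1/2 * y (int n - 2)" by (simp only: fps_add_nth fps_sub_nth fps_mult_left_const_nth ys Yn)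
  then show ?thesis by simp
 qed
 have "fps_nth (fps_X * (G * E)) (Suc n) = fps_nth (G * E) n" by simp
 also have "... = 0" by (rule fps_mult_nth_eq_0) (use E0 n in auto)
 finally have err: "fps_nth (fps_X * (G * E)) (Suc n) = 0" .
 have rhs: "fps_nth ((1 - fps_X)\<^sup>2 * M * P) (Suc n) = (\<Sum>j\<le>n. fps_nth M j * (\<Phi> (int n - int j + 1) - 2 * \<Phi> (int n - int j) + \<Phi> (int n - int j - 1)))"
 proof -
  have "(1 - fps_X)\<^sup>2 * M * P = M * (P - fps_const 2 * (fps_X * P) + fps_X\<^sup>2 * P)"
   by (simp add: power2_eq_square algebra_simps numeral_fps_const flip: fps_const_add) 
  then have "fps_nth ((1 - fps_X)\<^sup>2 * M * P) (Suc n) = (\<Sum>j\<le>Suc n. fps_nth M j * (\<Phi> (int (Suc n - j)) - 2 * \<Phi> (int (Suc n - j) - 1) + \<Phi> (int (Suc n - j) - 2)))"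
   by (simp only: fps_mult_nth[of M] fps_add_nth fps_sub_nth fps_mult_left_const_nth ps Pn atLeast0AtMost)
  also have "... = (\<Sum>j\<le>n. fps_nth M j * (\<Phi> (int (Suc n - j)) - 2 * \<Phi> (int (Suc n - j) - 1) + \<Phi> (int (Suc n - j) - 2)))" using \<Phi>0 by simp
  also have "... = (\<Sum>j\<le>n. fps_nth M j * (\<Phi> (int n - int j + 1) - 2 * \<Phi> (int n - int j) + \<Phi> (int n - int j - 1)))"
  proof (intro sum.cong refl)
   fix j assume "j \<in> {..n}"
   then have "int (Suc n - j) = int n - int j + 1" "int (Suc n - j) - 1 = int n - int j" "int (Suc n - j) - 2 = int n - int j - 1" by auto
   then show "fps_nth M j * (\<Phi> (int (Suc n - j)) - 2 * \<Phi> (int (Suc n - j) - 1) + \<Phi> (int (Suc n - j) - 2)) = fps_nth M j * (\<Phi> (int n - int j + 1) - 2 * \<Phi> (int n - int j) + \<Phi> (int n - int j - 1))" by (simp only:)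
  qed
  finally show ?thesis .
 qed
 have "s / \<tau> / \<tau> = \<tau> powr (a - 2)" using \<tau> powr_diff[of \<tau> a 2] by (simp add: s_def power2_eq_square)
 then have st: "1 / of_real \<tau> * of_real (s / \<tau>) = (of_real (\<tau> powr (a - 2)) :: complex)" by (metis of_real_1 of_real_divide of_real_mult times_divide_eq_left mult_1)
 show ?thesis
  using arg_cong[OF main, of "%F. fps_nth F (Suc n)"] unfolding lhs fps_add_nth err fps_mult_left_const_nth rhs
  by (simp add: st[symmetric] M_def s_def del: of_real_divide)
qed

text \<open>The bracket is the hat function centred at j, evaluated at x; on a cell only the hats of
  its two nodes are nonzero.\<close>

lemma sum_hat_eq_pl_interp:
 assumes x: "0 <= x" "x < real n"
 shows "(\<Sum>j\<le>n. c j * (max 0 (x + 1 - real j) - 2 * max 0 (x - real j) + max 0 (x - 1 - real j))) = pl_interp c x"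
proof -
 define m where "m = nat \<lfloor>x\<rfloor>"
 have m: "real m <= x" "x < real m + 1" using x by (auto simp: m_def of_nat_nat)
 have mn: "Suc m <= n" using m x by linarith
 have hat: "max 0 (x + 1 - real j) - 2 * max 0 (x - real j) + max 0 (x - 1 - real j) = (if j = m then 1 - (x - real m) else 0) + (if j = Suc m then x - real m else 0)" for j
 proof -
  consider "j < m" | "j = m" | "j = Suc m" | "Suc m < j" by linarith
  then show ?thesis
  proof cases
   case 1 then have "real j + 1 <= real m" by linarith then show ?thesis using m 1 by simp
  next
   case 4 then have "real m + 2 <= real j" by linarith then show ?thesis using m 4 by simp
  qed (use m in auto)
 qed
 have "(\<Sum>j\<le>n. c j * (max 0 (x + 1 - real j) - 2 * max 0 (x - real j) + max 0 (x - 1 - real j))) = (\<Sum>j\<le>n. (if j = m then c m * (1 - (x - real m)) else 0) + (if j = Suc m then c (Suc m) * (x - real m) else 0))"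
  unfolding hat by (intro sum.cong) auto
 also have "... = c m * (1 - (x - real m)) + c (Suc m) * (x - real m)" using mn by (simp add: sum.distrib)
 also have "... = pl_interp c x" using m by (subst pl_interp_cell[of m x]) auto
 finally show ?thesis .
qed

text \<open>\<Phi> is a convolution of \<open>F\<close> with ramps, so its second differences are
  convolutions with hat functions. For j = 0 the value at n + 1 lies beyond the range in which
  \<Phi> is prescribed; \<open>c 0 = 0\<close> removes this term.\<close>

lemma cn_scheme_convolution:
 fixes F :: "real => complex" and c :: "nat => real"
 assumes F: "set_lint {0<..real n * \<tau>} F" and c0: "c 0 = 0"
  and \<Phi>: "!!k. k <= int n ==> \<Phi> k = (if k <= 0 then 0 else (LBINT r:{0<..of_int k * \<tau>}. of_real (of_int k * \<tau> - r) * F r))"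
 shows "(\<Sum>j\<le>n. of_real (c j) * (\<Phi> (int n - int j + 1) - 2 * \<Phi> (int n - int j) + \<Phi> (int n - int j - 1)))
  = (LBINT r:{0<..real n * \<tau>}. of_real (\<tau> * pl_interp c ((real n * \<tau> - r) / \<tau>)) * F r)"
proof -
 define b where "b = real n * \<tau>"
 define H where "H k r = max 0 (of_int k * \<tau> - r)" for k :: int and r :: real
 have Hi: "set_lint {0<..b} (%r. of_real (H k r) * F r)" for k
 proof -
  have "set_lint {0<..b} (%r. of_real (\<bar>of_int k * \<tau>\<bar>) * F r)" using F unfolding b_def by (rule set_integrable_mult_right)
  then show ?thesis unfolding set_integrable_def
  proof (rule Bochner_Integration.integrable_bound)
   have fm: "(%r. indicator {0<..b} r *\<^sub>R F r) \<in> borel_measurable lborel" using F unfolding b_def set_integrable_def by (rule borel_measurable_integrable)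
   have "(%r. complex_of_real (H k r) * (indicator {0<..b} r *\<^sub>R F r)) \<in> borel_measurable lborel"
    by (intro borel_measurable_times fm) (unfold H_def, measurable)
   then show "(%r. indicator {0<..b} r *\<^sub>R (complex_of_real (H k r) * F r)) \<in> borel_measurable lborel" by simp
   have "norm (indicator {0<..b} r *\<^sub>R (complex_of_real (H k r) * F r)) <= norm (indicator {0<..b} r *\<^sub>R (complex_of_real \<bar>of_int k * \<tau>\<bar> * F r))" for r
   proof (cases "r \<in> {0<..b}")
    case True
    then have "\<bar>H k r\<bar> <= \<bar>of_int k * \<tau>\<bar>" by (auto simp: H_def)
    then have "\<bar>H k r\<bar> * cmod (F r) <= \<bar>of_int k * \<tau>\<bar> * cmod (F r)" by (rule mult_right_mono) simp
    then show ?thesis using True by (simp add: norm_mult abs_mult)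
   qed simp
   then show "AE r in lborel. norm (indicator {0<..b} r *\<^sub>R (complex_of_real (H k r) * F r)) <= norm (indicator {0<..b} r *\<^sub>R (complex_of_real \<bar>of_int k * \<tau>\<bar> * F r))" by blast
  qed
 qed
 have \<Phi>H: "\<Phi> k = (LBINT r:{0<..b}. of_real (H k r) * F r)" if k: "k <= int n" for k
 proof -
  have kb: "of_int k * \<tau> <= b" using k \<tau> unfolding b_def by (intro mult_right_mono) (auto simp: of_int_le_iff[of k "int n", where ?'a = real, simplified])
  have "(LBINT r:{0<..b}. of_real (H k r) * F r) = (if k <= 0 then 0 else (LBINT r:{0<..of_int k * \<tau>}. of_real (of_int k * \<tau> - r) * F r))"
  proof (cases "k <= 0")
   case True
   then have "of_int k * \<tau> <= 0" using \<tau> by (simp add: mult_nonpos_nonneg)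
   then have z: "indicator {0<..b} r *\<^sub>R (complex_of_real (H k r) * F r) = 0" for r by (auto simp: indicator_def H_def)
   show ?thesis using True unfolding set_lebesgue_integral_def z by simp
  next
   case False
   have z: "indicator {0<..b} r *\<^sub>R (complex_of_real (H k r) * F r) = indicator {0<..of_int k * \<tau>} r *\<^sub>R (of_real (of_int k * \<tau> - r) * F r)" for r
    using kb by (auto simp: indicator_def H_def)
   show ?thesis using False unfolding set_lebesgue_integral_def z by simp
  qed
  then show ?thesis using \<Phi>[OF k] by simp
 qed
 define h where "h j r = H (int n - int j + 1) r - 2 * H (int n - int j) r + H (int n - int j - 1) r" for j r
 have hi: "set_lint {0<..b} (%r. of_real (h j r) * F r)"
  and hI: "(LBINT r:{0<..b}. of_real (h j r) * F r) = (LBINT r:{0<..b}. of_real (H (int n - int j + 1) r) * F r) - 2 * (LBINT r:{0<..b}. of_real (H (int n - int j) r) * F r) + (LBINT r:{0<..b}. of_real (H (int n - int j - 1) r) * F r)" for j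
 proof -
  have eq: "of_real (h j r) * F r = (of_real (H (int n - int j + 1) r) * F r - 2 * (of_real (H (int n - int j) r) * F r)) + of_real (H (int n - int j - 1) r) * F r" for r
   by (simp add: h_def algebra_simps)
  show "set_lint {0<..b} (%r. of_real (h j r) * F r)" unfolding eq
   by (intro set_integral_add(1) set_integral_diff(1) set_integrable_mult_right Hi)
  show "(LBINT r:{0<..b}. of_real (h j r) * F r) = (LBINT r:{0<..b}. of_real (H (int n - int j + 1) r) * F r) - 2 * (LBINT r:{0<..b}. of_real (H (int n - int j) r) * F r) + (LBINT r:{0<..b}. of_real (H (int n - int j - 1) r) * F r)"
   unfolding eq by (subst set_integral_add(2), intro set_integral_diff(1) set_integrable_mult_right Hi, rule Hi, subst set_integral_diff(2), rule Hi, intro set_integrable_mult_right Hi) simp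
 qed
 have "(\<Sum>j\<le>n. of_real (c j) * (\<Phi> (int n - int j + 1) - 2 * \<Phi> (int n - int j) + \<Phi> (int n - int j - 1))) = (\<Sum>j\<le>n. of_real (c j) * (LBINT r:{0<..b}. of_real (h j r) * F r))"
 proof (intro sum.cong refl)
  fix j assume j: "j \<in> {..n}"
  show "of_real (c j) * (\<Phi> (int n - int j + 1) - 2 * \<Phi> (int n - int j) + \<Phi> (int n - int j - 1)) = of_real (c j) * (LBINT r:{0<..b}. of_real (h j r) * F r)"
   by (cases "j = 0") (simp_all add: c0 hI \<Phi>H)
 qed
 also have "... = (\<Sum>j\<le>n. (LBINT r. indicator {0<..b} r *\<^sub>R (of_real (c j) * (of_real (h j r) * F r))))"
  unfolding set_lebesgue_integral_def by (intro sum.cong refl) (simp flip: integral_mult_right_zero add: mult.left_commute)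
 also have "... = (LBINT r. (\<Sum>j\<le>n. indicator {0<..b} r *\<^sub>R (of_real (c j) * (of_real (h j r) * F r))))"
  using set_integrable_mult_right[OF hi] by (intro Bochner_Integration.integral_sum[symmetric]) (simp add: set_integrable_def)
 also have "... = (LBINT r:{0<..b}. of_real (\<tau> * pl_interp c ((b - r) / \<tau>)) * F r)"
  unfolding set_lebesgue_integral_def
 proof (intro Bochner_Integration.integral_cong refl)
  fix r
  show "(\<Sum>j\<le>n. indicator {0<..b} r *\<^sub>R (of_real (c j) * (of_real (h j r) * F r))) = indicator {0<..b} r *\<^sub>R (of_real (\<tau> * pl_interp c ((b - r) / \<tau>)) * F r)"
  proof (cases "r \<in> {0<..b}")
   case True
   define x where "x = (b - r) / \<tau>"
   have x: "0 <= x" "x < real n" using True \<tau> by (auto simp: x_def b_def pos_divide_less_eq)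
   have tx: "\<tau> * x = b - r" using \<tau> by (simp add: x_def)
   have "max 0 (\<tau> * z) = \<tau> * max 0 z" for z using \<tau> by (auto simp: max_def zero_le_mult_iff mult_le_0_iff)
   moreover have "of_int (int n - int j + 1) * \<tau> - r = \<tau> * (x + 1 - real j)" "of_int (int n - int j) * \<tau> - r = \<tau> * (x - real j)" "of_int (int n - int j - 1) * \<tau> - r = \<tau> * (x - 1 - real j)" for j
    using tx by (simp_all add: b_def algebra_simps)
   ultimately have hj: "h j r = \<tau> * (max 0 (x + 1 - real j) - 2 * max 0 (x - real j) + max 0 (x - 1 - real j))" for j
    unfolding h_def H_def by (simp only:) (simp add: algebra_simps)
   have "(\<Sum>j\<le>n. c j * h j r) = \<tau> * pl_interp c x"
    unfolding hj sum_hat_eq_pl_interp[OF x, symmetric] by (simp add: sum_distrib_left mult_ac)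
   then have "(\<Sum>j\<le>n. of_real (c j) * (of_real (h j r) * F r)) = of_real (\<tau> * pl_interp c x) * F r"
    by (simp flip: of_real_mult of_real_sum sum_distrib_right mult.assoc)
   then show ?thesis using True by (simp add: x_def)
  qed simp
 qed
 finally show ?thesis by (simp add: b_def)
qed

end

section \<open>The error estimate\<close>

lemma integral_running_measurable:
 fixes F :: "real => complex"
 assumes F [measurable]: "F \<in> borel_measurable borel"
 shows "(%s. LBINT r:{0<..s}. F r) \<in> borel_measurable borel"
proof -
 have "(%s. LBINT r. (if 0 < r \<and> r <= s then F r else 0)) \<in> borel_measurable borel"
  by (rule lborel.borel_measurable_lebesgue_integral) measurable
 moreover have "(LBINT r:{0<..s}. F r) = (LBINT r. (if 0 < r \<and> r <= s then F r else 0))" for s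
  unfolding set_lebesgue_integral_def by (intro Bochner_Integration.integral_cong) auto
 ultimately show ?thesis by simp
qed

text \<open>Cauchy's formula for repeated integration, by exchanging the integrals over the triangle
  r <= y <= t.\<close>

lemma double_primitive:
 fixes F :: "real => complex"
 assumes F [measurable]: "F \<in> borel_measurable borel" and int: "set_lint {0<..t} F"
 shows "set_lint {0<..t} (%s. LBINT r:{0<..s}. F r)"
  and "(LBINT s:{0<..t}. (LBINT r:{0<..s}. F r)) = (LBINT r:{0<..t}. of_real (t - r) * F r)"
proof -
 define J where "J = (LBINT r:{0<..t}. cmod (F r))"
 define G where "G r y = (if 0 < r \<and> r <= y \<and> y <= t then F r else 0)" for r y :: real
 have meas: "(%(r, y). G r y) \<in> borel_measurable (borel \<Otimes>\<^sub>M borel)" unfolding G_def by measurable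
 have Gle: "norm (G r y) <= norm (indicator {0<..t} r *\<^sub>R F r)" for r y by (auto simp: G_def)
 have Gi: "integrable lborel (%r. G r y)" for y
  using int unfolding set_integrable_def
  by (rule Bochner_Integration.integrable_bound) (unfold G_def, measurable, use Gle[unfolded G_def] in auto)
 have Gt: "integrable lborel (%y. J * indicator {0..t} y)"
  using integrable_real_indicator[of "{0..t}" lborel] by (intro integrable_mult_right) (simp add: emeasure_lborel_Icc_eq)
 have Gb: "(LBINT r. cmod (G r y)) <= J * indicator {0..t} y" for y
 proof (cases "0 <= y \<and> y <= t")
  case True
  have "(LBINT r. cmod (G r y)) <= (LBINT r. cmod (indicator {0<..t} r *\<^sub>R F r))"
   using Gi int by (intro integral_mono integrable_norm Gle) (simp_all add: set_integrable_def)
  also have "... = J" unfolding J_def set_lebesgue_integral_def by (intro Bochner_Integration.integral_cong) auto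
  finally show ?thesis using True by simp
 next
  case False
  then have "G r y = 0" for r by (auto simp: G_def)
  then show ?thesis using False by simp
 qed
 have inner: "(LBINT r. G r y) = indicator {0<..t} y *\<^sub>R (LBINT r:{0<..y}. F r)" for y
 proof (cases "0 < y \<and> y <= t")
  case True
  then show ?thesis unfolding set_lebesgue_integral_def by (simp, intro Bochner_Integration.integral_cong) (auto simp: G_def)
 next
  case False
  then have "G r y = 0" for r by (auto simp: G_def)
  then show ?thesis using False by auto
 qed
 have outer: "(LBINT y. G r y) = indicator {0<..t} r *\<^sub>R (of_real (t - r) * F r)" for r
 proof (cases "0 < r \<and> r <= t")
  case True
  then have "G r y = indicator {r..t} y *\<^sub>R F r" for y by (auto simp: G_def indicator_def)
  then show ?thesis using True by (simp add: scaleR_conv_of_real)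
 next
  case False
  then have "G r y = 0" for y by (auto simp: G_def)
  then show ?thesis using False by auto
 qed
 note fs = fubini_swap[OF meas Gi Gt Gb]
 show "set_lint {0<..t} (%s. LBINT r:{0<..s}. F r)" using fs(3) unfolding inner set_integrable_def .
 show "(LBINT s:{0<..t}. (LBINT r:{0<..s}. F r)) = (LBINT r:{0<..t}. of_real (t - r) * F r)"
  using fs(2) unfolding inner outer unfolding set_lebesgue_integral_def[of _ "{0<..t}"] by (rule sym)
qed

text \<open>With m = -cot \<theta> the rays of the contour are parallel to the boundary of the
  sector: at angle \<phi> one has cos \<phi> + m sin \<phi> = sin(\<theta> - \<phi>) / sin \<theta>,
  which is nonpositive for \<theta> <= \<phi> <= pi. The offset (1 + m) \<epsilon> excludes the disc
  |s| < \<epsilon>, where Re s + m |Im s| cannot exceed it.\<close>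

lemma cone_subset_trunc_sector:
 assumes th: "pi / 2 < \<theta>" "\<theta> < pi" and eps: "0 < \<epsilon>"
 defines "m \<equiv> - cos \<theta> / sin \<theta>"
 shows "0 < m" and "{s. (1 + m) * \<epsilon> - m * \<bar>Im s\<bar> < Re s} \<subseteq> trunc_sector \<theta> \<epsilon>"
proof -
 have sn: "0 < sin \<theta>" using th by (intro sin_gt_zero) (auto intro: less_trans[OF _ th(1)])
 have "cos \<theta> < cos (pi / 2)" using th by (intro cos_monotone_0_pi) auto
 then have cs: "cos \<theta> < 0" by simp
 show m: "0 < m" using sn cs by (simp add: m_def divide_neg_pos)
 show "{s. (1 + m) * \<epsilon> - m * \<bar>Im s\<bar> < Re s} \<subseteq> trunc_sector \<theta> \<epsilon>"
 proof
  fix s assume "s \<in> {s. (1 + m) * \<epsilon> - m * \<bar>Im s\<bar> < Re s}"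
  then have s: "(1 + m) * \<epsilon> < Re s + m * \<bar>Im s\<bar>" by simp
  have "\<epsilon> <= cmod s"
  proof (rule ccontr)
   assume "\<not> \<epsilon> <= cmod s"
   then have "Re s < \<epsilon>" "\<bar>Im s\<bar> < \<epsilon>" using complex_Re_le_cmod[of s] abs_Im_le_cmod[of s] by auto
   then have "Re s + m * \<bar>Im s\<bar> <= \<epsilon> + m * \<epsilon>" using m by (intro add_mono mult_left_mono) auto
   then show False using s by (simp add: distrib_right)
  qed
  moreover have "\<bar>Arg s\<bar> < \<theta>"
  proof (rule ccontr)
   assume "\<not> \<bar>Arg s\<bar> < \<theta>"
   define \<phi> where "\<phi> = \<bar>Arg s\<bar>"
   have ph: "\<theta> <= \<phi>" "\<phi> <= pi" using \<open>\<not> \<bar>Arg s\<bar> < \<theta>\<close> mpi_less_Arg[of s] Arg_le_pi[of s] by (auto simp: \<phi>_def)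
   have s0: "s ~= 0" using \<open>\<epsilon> <= cmod s\<close> eps by auto
   have polar: "s = of_real (cmod s) * exp (\<i> * of_real (Arg s))" using Arg_eq[OF s0] by simp
   have re: "Re s = cmod s * cos (Arg s)" by (subst polar) (simp add: Re_exp)
   have im: "Im s = cmod s * sin (Arg s)" by (subst polar) (simp add: Im_exp)
   have "cos (Arg s) = cos \<phi>" "\<bar>sin (Arg s)\<bar> = sin \<phi>"
    using ph sin_ge_zero[of \<phi>] th by (cases "0 <= Arg s"; simp add: \<phi>_def)+
   then have "Re s + m * \<bar>Im s\<bar> = cmod s * (cos \<phi> + m * sin \<phi>)" by (simp add: re im abs_mult distrib_left)
   also have "cos \<phi> + m * sin \<phi> = sin (\<theta> - \<phi>) / sin \<theta>" using sn by (simp add: m_def sin_diff field_simps)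
   also have "sin (\<theta> - \<phi>) <= 0" using sin_ge_zero[of "\<phi> - \<theta>"] ph th by (simp add: sin_diff mult.commute)
   then have "cmod s * (sin (\<theta> - \<phi>) / sin \<theta>) <= 0" using sn by (intro mult_nonneg_nonpos divide_nonpos_pos) auto
   finally have "Re s + m * \<bar>Im s\<bar> <= 0" .
   moreover have "0 < (1 + m) * \<epsilon>" using m eps by simp
   ultimately show False using s by linarith
  qed
  ultimately show "s \<in> trunc_sector \<theta> \<epsilon>" by (simp add: trunc_sector_def)
 qed
qed

lemma complex_borel_version:
 fixes G :: "real => complex"
 assumes G: "G \<in> borel_measurable lebesgue"
 obtains H where "H \<in> borel_measurable borel" "AE r in lborel. G r = H r"
proof -
 have "(%r. Re (G r)) \<in> borel_measurable lebesgue" "(%r. Im (G r)) \<in> borel_measurable lebesgue"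
  using G by (auto intro: measurable_compose[OF G])
 then obtain p q where pq: "p \<in> borel_measurable lborel" "AE r in lborel. Re (G r) = p r" "q \<in> borel_measurable lborel" "AE r in lborel. Im (G r) = q r"
  using completion_ex_borel_measurable_real by metis
 have [measurable]: "p \<in> borel_measurable borel" "q \<in> borel_measurable borel" using pq by simp_all
 show ?thesis
 proof
  show "(%r. complex_of_real (p r) + \<i> * complex_of_real (q r)) \<in> borel_measurable borel" by measurable
  show "AE r in lborel. G r = complex_of_real (p r) + \<i> * complex_of_real (q r)"
   using pq(2,4) by eventually_elim (simp add: complex_eq_iff)
 qed
qed

text \<open>Measurability is at hand for the pairing weighted by e^(-b r). A Borel version is chosen
  there and the weight is divided out; the resulting representative then serves the whole line Re s
  = b.\<close>

lemma L2_component: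
 fixes f :: "real => real^'d::finite => complex"
 assumes lap: "!!s. Re s = b ==> has_L2_integral \<Omega> (lebesgue_on {0<..}) (%t x. exp (- s * of_real t) * f t x) (F s)" and e: "e \<in> L2 \<Omega>"
 obtains g where "g \<in> borel_measurable borel" "AE r in lborel. 0 < r --> L2_inner \<Omega> (f r) e = g r"
  "set_lint {0<..} (%r. of_real (exp (- b * r)) * g r)"
  "!!y. L2_inner \<Omega> (F (Complex b y)) e = (LBINT r:{0<..}. exp (- Complex b y * of_real r) * g r)"
proof -
 let ?S = "{0<..} :: real set"
 have S: "?S \<in> sets lebesgue" by simp
 note ci = has_L2_integral_inner[OF S lap e, unfolded L2_inner_scale]
 define G where "G s r = indicator ?S r *\<^sub>R (exp (- s * of_real r) * L2_inner \<Omega> (f r) e)" for s r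
 have Gi: "integrable lebesgue (G s)" and GI: "(LINT r|lebesgue. G s r) = L2_inner \<Omega> (F s) e" if "Re s = b" for s
  using ci[OF that] unfolding G_def by (simp_all add: integrable_restrict_space integral_restrict_space)
 obtain H where H [measurable]: "H \<in> borel_measurable borel" "AE r in lborel. G (of_real b) r = H r"
  using complex_borel_version[OF borel_measurable_integrable[OF Gi[of "of_real b"]]] by auto
 define g where "g r = of_real (exp (b * r)) * H r" for r
 have gm [measurable]: "g \<in> borel_measurable borel" unfolding g_def by measurable
 have ae: "AE r in lborel. 0 < r --> L2_inner \<Omega> (f r) e = g r"
  using H(2)
 proof eventually_elim
  case (elim r)
  show ?case
  proof
   assume "0 < r"
   then have "H r = exp (- of_real b * of_real r) * L2_inner \<Omega> (f r) e" using elim by (simp add: G_def)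
   moreover have "complex_of_real (exp (b * r)) * exp (- of_real b * of_real r) = 1" by (simp add: exp_of_real[symmetric] exp_minus flip: of_real_mult)
   ultimately show "L2_inner \<Omega> (f r) e = g r" by (simp add: g_def mult.assoc[symmetric])
  qed
 qed
 have Gg: "AE r in lborel. G s r = indicator ?S r *\<^sub>R (exp (- s * of_real r) * g r)" for s
  using ae by eventually_elim (auto simp: G_def indicator_def)
 have gi: "integrable lborel (%r. indicator ?S r *\<^sub>R (exp (- s * of_real r) * g r))" and gI: "(LBINT r. indicator ?S r *\<^sub>R (exp (- s * of_real r) * g r)) = L2_inner \<Omega> (F s) e" if s: "Re s = b" for s
 proof -
  have m: "(%r. indicator ?S r *\<^sub>R (exp (- s * of_real r) * g r)) \<in> borel_measurable lborel" by measurable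
  have ml: "(%r. indicator ?S r *\<^sub>R (exp (- s * of_real r) * g r)) \<in> borel_measurable lebesgue" by (rule measurable_completion[OF m])
  note ael = AE_completion[OF Gg[of s]]
  have "integrable lebesgue (%r. indicator ?S r *\<^sub>R (exp (- s * of_real r) * g r))"
   using Gi[OF s] integrable_cong_AE[OF borel_measurable_integrable[OF Gi[OF s]] ml ael] by simp
  then show "integrable lborel (%r. indicator ?S r *\<^sub>R (exp (- s * of_real r) * g r))" using integrable_completion[OF m] by simp
  have "(LINT r|lebesgue. indicator ?S r *\<^sub>R (exp (- s * of_real r) * g r)) = L2_inner \<Omega> (F s) e"
   using GI[OF s] integral_cong_AE[OF borel_measurable_integrable[OF Gi[OF s]] ml ael] by simp
  then show "(LBINT r. indicator ?S r *\<^sub>R (exp (- s * of_real r) * g r)) = L2_inner \<Omega> (F s) e" using integral_completion[OF m] by simp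
 qed
 show ?thesis
 proof (rule that[OF gm ae])
  have "exp (- of_real b * of_real r) = complex_of_real (exp (- b * r))" for r by (simp add: exp_of_real[symmetric])
  then show "set_lint ?S (%r. of_real (exp (- b * r)) * g r)" using gi[of "of_real b"] by (simp add: set_integrable_def)
  show "L2_inner \<Omega> (F (Complex b y)) e = (LBINT r:?S. exp (- Complex b y * of_real r) * g r)" for y
   using gI[of "Complex b y"] by (simp add: set_lebesgue_integral_def)
 qed
qed

text \<open>The argument of s^a is a times that of s, hence still below pi / 2 in modulus. Thus s^a
  never meets a pole of the discrete resolvent, all of which are negative.\<close>

lemma Re_powr_pos:
 assumes "0 < a" "a < 1" "0 < Re s" shows "0 < Re (s powr of_real a)"
proof -
 have s: "s ~= 0" using assms by auto
 then have "\<bar>Im (Ln s)\<bar> < pi / 2" using Re_Ln_pos_lt[of s] assms by simp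
 then have "a * \<bar>Im (Ln s)\<bar> < 1 * (pi / 2)" using assms by (intro mult_less_le_imp_less mult_strict_mono') auto
 then have "\<bar>a * Im (Ln s)\<bar> < pi / 2" using assms by (simp add: abs_mult)
 then have "0 < cos (a * Im (Ln s))" by (intro cos_gt_zero_pi) auto
 then show ?thesis using s by (simp add: powr_def Re_exp)
qed

text \<open>\<open>R\<close> is the resolvent at a fixed point x, given by its partial fractions,
  and each fraction is an instance of \<open>bromwich_mlk\<close>. The formula for \<open>R\<close>
  is asked only in the right half plane, where s^a stays.\<close>

lemma (in eigenbasis) bromwich_resolvent:
 assumes al: "0 < \<alpha>" "\<alpha> < 1" and \<sigma>: "0 < \<sigma>" and t: "0 < t"
  and R: "!!z. 0 < Re z ==> R z = (\<Sum>k<n. c k / (z + of_real (l k)) * e k x)"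
 shows "Lim at_top (%r. 1 / (2 * of_real pi * \<i>) * contour_integral (vline \<sigma> r) (%s. exp (s * of_real t) * R (s powr of_real \<alpha>)))
  = (\<Sum>k<n. of_real (mlk \<alpha> (l k) t) * c k * e k x)"
proof (rule tendsto_Lim)
 define I where "I k r = 1 / (2 * of_real pi * \<i>) * contour_integral (vline \<sigma> r) (%s. exp (s * of_real t) / (s powr of_real \<alpha> + of_real (l k)))" for k r
 have Re: "Re s = \<sigma>" if s: "s \<in> closed_segment (Complex \<sigma> (- r)) (Complex \<sigma> r)" for r s
  using s by (auto simp: in_segment left_diff_distrib)
 have nz: "s powr of_real \<alpha> + of_real (l k) ~= 0" if "0 < Re s" "k < n" for s k
 proof -
  have "0 < Re (s powr of_real \<alpha> + of_real (l k))" using Re_powr_pos[OF al that(1)] l_pos[OF that(2)] by simp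
  then show ?thesis by (metis less_irrefl zero_complex.sel(1))
 qed
 have ci: "(%s. exp (s * of_real t) / (s powr of_real \<alpha> + of_real (l k))) contour_integrable_on vline \<sigma> r" if k: "k < n" for k r
 proof (rule contour_integrable_continuous_linepath)
  show "continuous_on (closed_segment (Complex \<sigma> (- r)) (Complex \<sigma> r)) (%s. exp (s * of_real t) / (s powr of_real \<alpha> + of_real (l k)))"
  proof -
   have s: "0 < Re s" if "s \<in> closed_segment (Complex \<sigma> (- r)) (Complex \<sigma> r)" for s using Re[OF that] \<sigma> by simp
   have "continuous_on (closed_segment (Complex \<sigma> (- r)) (Complex \<sigma> r)) (%s. exp (of_real \<alpha> * Ln s))"
    by (intro continuous_on_exp continuous_on_mult continuous_on_const continuous_on_Ln) (auto simp: complex_nonpos_Reals_iff dest: s)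
   then have "continuous_on (closed_segment (Complex \<sigma> (- r)) (Complex \<sigma> r)) (%s. s powr of_real \<alpha>)"
    by (rule continuous_on_eq) (use s in \<open>fastforce simp: powr_def\<close>)
   then show ?thesis by (intro continuous_on_divide continuous_on_add continuous_on_const continuous_on_exp continuous_on_mult continuous_on_id ballI nz[OF s k])
  qed
 qed
 have eq: "1 / (2 * of_real pi * \<i>) * contour_integral (vline \<sigma> r) (%s. exp (s * of_real t) * R (s powr of_real \<alpha>)) = (\<Sum>k<n. c k * e k x * I k r)" for r
 proof -
  have "contour_integral (vline \<sigma> r) (%s. exp (s * of_real t) * R (s powr of_real \<alpha>))
    = contour_integral (vline \<sigma> r) (%s. \<Sum>k<n. c k * e k x * (exp (s * of_real t) / (s powr of_real \<alpha> + of_real (l k))))"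
  proof (rule contour_integral_cong[OF refl])
   fix s assume "s \<in> path_image (vline \<sigma> r)"
   then have "0 < Re s" using Re \<sigma> by simp
   then show "exp (s * of_real t) * R (s powr of_real \<alpha>) = (\<Sum>k<n. c k * e k x * (exp (s * of_real t) / (s powr of_real \<alpha> + of_real (l k))))"
    using R[OF Re_powr_pos[OF al \<open>0 < Re s\<close>]] by (simp add: sum_distrib_left mult_ac)
  qed
  also have "... = (\<Sum>k<n. contour_integral (vline \<sigma> r) (%s. c k * e k x * (exp (s * of_real t) / (s powr of_real \<alpha> + of_real (l k)))))"
   by (intro contour_integral_sum contour_integrable_lmul ci) auto
  also have "... = (\<Sum>k<n. c k * e k x * contour_integral (vline \<sigma> r) (%s. exp (s * of_real t) / (s powr of_real \<alpha> + of_real (l k))))"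
   by (intro sum.cong refl contour_integral_lmul ci) auto
  finally show ?thesis by (simp add: I_def sum_distrib_left mult.left_commute)
 qed
 have "((%r. \<Sum>k<n. c k * e k x * I k r) \<longlongrightarrow> (\<Sum>k<n. c k * e k x * of_real (mlk \<alpha> (l k) t))) at_top"
  unfolding I_def using al \<sigma> t l_pos by (intro tendsto_sum tendsto_mult tendsto_const bromwich_mlk) auto
 then show "((%r. 1 / (2 * of_real pi * \<i>) * contour_integral (vline \<sigma> r) (%s. exp (s * of_real t) * R (s powr of_real \<alpha>))) \<longlongrightarrow> (\<Sum>k<n. of_real (mlk \<alpha> (l k) t) * c k * e k x)) at_top"
  unfolding eq by (simp add: mult_ac)
qed simp

context eigenbasis
begin

text \<open>An exact identity between the difference of the two solutions and one convolution: the
  interpolated kernel produced by the scheme and \<open>mlk\<close> combine to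
  \<open>cn_kernel\<close>. All estimation is thus left to
  \<open>cn_convolution_error\<close>.\<close>

lemma component_error:
 fixes F :: "nat => real => complex" and y :: "nat => int => complex"
 assumes al: "0 < \<alpha>" "\<alpha> < 1" and \<tau>: "0 < \<tau>" and k: "k < n" and j: "1 <= j" "j <= N"
  and ld: "laplace_data (F k) g b a1 m c \<mu>"
  and y0: "!!i. i <= 0 ==> y k i = 0"
  and \<Phi>: "!!i. \<Phi> k i = (if i <= 0 then 0 else (LBINT r:{0<..of_int i * \<tau>}. of_real (of_int i * \<tau> - r) * F k r))"
  and scheme: "!!i. 1 <= i ==> i <= N ==>
   of_real (\<tau> powr (- \<alpha>)) * (\<Sum>j\<le>i. of_real (cn_weight \<alpha> j) * y k (int i - int j)) + of_real (1 - \<alpha>/2) * (of_real (l k) * y k (int i)) + of_real (\<alpha>/2) * (of_real (l k) * y k (int i - 1))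
   = of_real (1 - \<alpha>/2) * (1 / of_real \<tau> * (3/2 * \<Phi> k (int i) - 2 * \<Phi> k (int i - 1) + 1/2 * \<Phi> k (int i - 2)))
    + of_real (\<alpha>/2) * (1 / of_real \<tau> * (3/2 * \<Phi> k (int i - 1) - 2 * \<Phi> k (int i - 2) + 1/2 * \<Phi> k (int i - 3)))"
 shows "(LBINT r:{0<..real j * \<tau>}. of_real (mlk \<alpha> (l k) (real j * \<tau> - r)) * F k r) - 1 / of_real \<tau> * (3/2 * y k (int j) - 2 * y k (int j - 1) + 1/2 * y k (int j - 2))
  = (LBINT r:{0<..real j * \<tau>}. of_real (cn_kernel \<alpha> \<tau> (l k) (real j * \<tau> - r)) * F k r)"
  and "set_lint {0<..real j * \<tau>} (%r. of_real (mlk \<alpha> (l k) (real j * \<tau> - r)) * F k r)"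
proof -
 interpret laplace_data "F k" g b a1 m c \<mu> by (rule ld)
 define t where "t = real j * \<tau>"
 have t: "0 < t" using j \<tau> by (simp add: t_def)
 have lk: "0 < l k" by (rule l_pos[OF k])
 define M where "M = fps_nth (mlk_fps \<alpha> (l k * \<tau> powr \<alpha>))"
 obtain C where C: "!!x. 0 < x ==> \<bar>cn_kernel \<alpha> \<tau> (l k) x\<bar> <= C * x powr (\<alpha> - 1)"
  using cn_kernel_properties[OF al] lk \<tau> by metis
 have mb: "\<bar>mlk \<alpha> (l k) x\<bar> <= Gamma (1 - \<alpha>) / sin (\<alpha> * pi) * x powr (\<alpha> - 1)" if "0 < x" for x
  using mlk_le[OF al lk that] mlk_nonneg[OF al lk, of x] by simp
 \<comment> \<open>Any vertex inside the cone will do, as only integrability is taken from the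
   representation.\<close>
 have v: "a1 < a1 + 1" by simp
 have mi: "set_lint {0<..t} (%r. of_real (mlk \<alpha> (l k) (t - r)) * F k r)"
  by (rule convolution_representation(1)[OF al t mlk_measurable mb v])
 have ki: "set_lint {0<..t} (%r. of_real (cn_kernel \<alpha> \<tau> (l k) (t - r)) * F k r)"
  by (rule convolution_representation(1)[OF al t cn_kernel_measurable C v])
 have Fi: "set_lint {0<..t} (F k)" by (rule locally_integrable[OF t])
 have "1 / of_real \<tau> * (3/2 * y k (int j) - 2 * y k (int j - 1) + 1/2 * y k (int j - 2))
  = of_real (\<tau> powr (\<alpha> - 2)) * (\<Sum>i\<le>j. of_real (M i) * (\<Phi> k (int j - int i + 1) - 2 * \<Phi> k (int j - int i) + \<Phi> k (int j - int i - 1)))"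
  unfolding M_def by (rule cn_scheme_solution[OF al lk \<tau> y0 _ scheme j(2)]) (simp_all add: \<Phi>)
 also have "(\<Sum>i\<le>j. of_real (M i) * (\<Phi> k (int j - int i + 1) - 2 * \<Phi> k (int j - int i) + \<Phi> k (int j - int i - 1)))
  = (LBINT r:{0<..t}. of_real (\<tau> * pl_interp M ((t - r) / \<tau>)) * F k r)"
  unfolding t_def by (rule cn_scheme_convolution[OF al lk \<tau> Fi[unfolded t_def] _ \<Phi>]) (simp add: M_def mlk_fps_def mult.assoc)
 also have "of_real (\<tau> powr (\<alpha> - 2)) * ... = (LBINT r:{0<..t}. of_real (\<tau> powr (\<alpha> - 1) * pl_interp M ((t - r) / \<tau>)) * F k r)"
 proof -
  have tp: "\<tau> powr (\<alpha> - 2) * \<tau> = \<tau> powr (\<alpha> - 1)" using \<tau> powr_add[of \<tau> "\<alpha> - 2" 1] by simp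
  have eq: "complex_of_real (\<tau> powr (\<alpha> - 2)) * (of_real (\<tau> * z) * w) = of_real (\<tau> powr (\<alpha> - 1) * z) * w" for z w
   unfolding tp[symmetric] by simp
  show ?thesis unfolding set_integral_mult_right[symmetric] eq ..
 qed
 also have "... = (LBINT r:{0<..t}. of_real (mlk \<alpha> (l k) (t - r)) * F k r - of_real (cn_kernel \<alpha> \<tau> (l k) (t - r)) * F k r)"
  by (simp add: cn_kernel_def M_def left_diff_distrib)
 also have "... = (LBINT r:{0<..t}. of_real (mlk \<alpha> (l k) (t - r)) * F k r) - (LBINT r:{0<..t}. of_real (cn_kernel \<alpha> \<tau> (l k) (t - r)) * F k r)"
  by (rule set_integral_diff(2)[OF mi ki])
 finally show "(LBINT r:{0<..real j * \<tau>}. of_real (mlk \<alpha> (l k) (real j * \<tau> - r)) * F k r) - 1 / of_real \<tau> * (3/2 * y k (int j) - 2 * y k (int j - 1) + 1/2 * y k (int j - 2))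
  = (LBINT r:{0<..real j * \<tau>}. of_real (cn_kernel \<alpha> \<tau> (l k) (real j * \<tau> - r)) * F k r)" by (simp add: t_def)
 show "set_lint {0<..real j * \<tau>} (%r. of_real (mlk \<alpha> (l k) (real j * \<tau> - r)) * F k r)" using mi by (simp add: t_def)
qed

end

lemma set_integral_sum_mult:
 fixes G :: "'i => real => complex"
 assumes "!!k. k \<in> I ==> set_lint S (G k)"
 shows "(LBINT r:S. (\<Sum>k\<in>I. G k r * c k)) = (\<Sum>k\<in>I. (LBINT r:S. G k r) * c k)"
proof -
 have "(LBINT r:S. (\<Sum>k\<in>I. G k r * c k)) = (LBINT r. (\<Sum>k\<in>I. (indicator S r *\<^sub>R G k r) * c k))"
  unfolding set_lebesgue_integral_def by (intro Bochner_Integration.integral_cong refl) (simp add: scaleR_sum_right)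
 also have "... = (\<Sum>k\<in>I. (LBINT r. (indicator S r *\<^sub>R G k r) * c k))"
  using assms unfolding set_integrable_def by (intro Bochner_Integration.integral_sum integrable_mult_left) auto
 also have "... = (\<Sum>k\<in>I. (LBINT r:S. G k r) * c k)"
  unfolding set_lebesgue_integral_def by (intro sum.cong refl integral_mult_left_zero)
 finally show ?thesis .
qed

lemma sum_combination3:
 fixes A B C c :: "nat => complex"
 shows "(\<Sum>k\<in>I. (p * A k + q * B k + r * C k) * c k) = p * (\<Sum>k\<in>I. A k * c k) + q * (\<Sum>k\<in>I. B k * c k) + r * (\<Sum>k\<in>I. C k * c k)"
 by (simp add: distrib_right sum.distrib sum_distrib_left mult.assoc)

text \<open>The scheme passes to coefficients because expansions in the eigenbasis are unique, and
  Parseval turns the norm of the error into a Euclidean norm. The Borel representatives agree with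
  the pairings outside one null set common to the finitely many components.\<close>

lemma scheme_error_eq:
 fixes f :: "real => real^'d::finite => complex" and F :: "nat => real => complex"
 assumes eb: "eigenbasis (L2 \<Omega>) X (L2_inner \<Omega>) A P n e l"
  and al: "0 < \<alpha>" "\<alpha> < 1" and \<tau>: "0 < \<tau>" and \<sigma>: "0 < \<sigma>"
  and fL: "!!r. 0 < r ==> f r \<in> L2 \<Omega>"
  and Fm: "!!k. k < n ==> F k \<in> borel_measurable borel"
  and Fae: "!!k. k < n ==> AE r in lborel. 0 < r --> L2_inner \<Omega> (f r) (e k) = F k r"
  and ld: "!!k. k < n ==> laplace_data (F k) (g k) b a1 m c \<mu>"
  and CN: "CN_II \<Omega> A X \<alpha> \<tau> N f (%_. 0) U u" and j: "1 <= j" "j <= N"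
 shows "L2_norm \<Omega> (%x. semidiscrete_solution \<Omega> A X \<alpha> \<sigma> f (real j * \<tau>) x - u j x)
  = L2_set (%k. cmod (LBINT r:{0<..real j * \<tau>}. of_real (cn_kernel \<alpha> \<tau> (l k) (real j * \<tau> - r)) * F k r)) {..<n}"
proof -
 interpret eigenbasis "L2 \<Omega>" X "L2_inner \<Omega>" A P n e l by (rule eb)
 define t where "t = real j * \<tau>"
 have t: "0 < t" using j \<tau> by (simp add: t_def)
 have proj: "L2_proj \<Omega> X v = (%x. \<Sum>k<n. L2_inner \<Omega> v (e k) * e k x)" if "v \<in> L2 \<Omega>" for v
  unfolding L2_proj_def by (rule projection_eq[OF that])
 have op: "discrete_op \<Omega> A X \<phi> = (%x. \<Sum>k<n. (of_real (l k) * L2_inner \<Omega> \<phi> (e k)) * e k x)" if "\<phi> \<in> X" for \<phi>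
  unfolding discrete_op_def by (rule operator_eq[OF that])
 have "AE r in lborel. \<forall>k\<in>{..<n}. 0 < r --> L2_inner \<Omega> (f r) (e k) = F k r"
  by (rule AE_finite_allI) (use Fae in auto)
 then have Fall: "AE r in lborel. 0 < r --> (\<forall>k<n. L2_inner \<Omega> (f r) (e k) = F k r)" by eventually_elim auto
 have Fint: "set_lint {0<..s} (F k)" if k: "k < n" for k s
 proof (cases "0 < s")
  case True
  interpret laplace_data "F k" "g k" b a1 m c \<mu> by (rule ld[OF k])
  show ?thesis by (rule locally_integrable[OF True])
 qed (simp add: set_integrable_def)

 have sol: "solution_op \<Omega> A X \<alpha> \<sigma> s (L2_proj \<Omega> X v) x = (\<Sum>k<n. of_real (mlk \<alpha> (l k) s) * L2_inner \<Omega> v (e k) * e k x)"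
  if v: "v \<in> L2 \<Omega>" and s: "0 < s" for v s x
  unfolding solution_op_def
 proof (rule bromwich_resolvent[OF al \<sigma> s])
  fix z :: complex assume z: "0 < Re z"
  have nz: "z + of_real (l k) ~= 0" if "k < n" for k
  proof -
   have "0 < Re (z + of_real (l k))" using z l_pos[OF that] by simp
   then show ?thesis by (metis less_irrefl zero_complex.sel(1))
  qed
  have "discrete_resolvent \<Omega> A X z (L2_proj \<Omega> X v) = (%x. \<Sum>k<n. (L2_inner \<Omega> (L2_proj \<Omega> X v) (e k) / (z + of_real (l k))) * e k x)"
   unfolding discrete_resolvent_def by (rule resolvent_eq[OF _ nz op]) (simp_all add: proj[OF v] combination_in_X)
  then show "discrete_resolvent \<Omega> A X z (L2_proj \<Omega> X v) x = (\<Sum>k<n. L2_inner \<Omega> v (e k) / (z + of_real (l k)) * e k x)"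
   by (simp add: proj[OF v] ip_orthonormal_sum[OF e])
 qed

 define y where "y k i = L2_inner \<Omega> (U i) (e k)" for k i
 define \<Phi> where "\<Phi> k i = (if i <= 0 then 0 else (LBINT r:{0<..of_int i * \<tau>}. of_real (of_int i * \<tau> - r) * F k r))" for k and i :: int
 define Ft where "Ft = primitive (primitive (%t. L2_proj \<Omega> X (f t)))"
 have prim: "primitive (%t. L2_proj \<Omega> X (f t)) s x = (\<Sum>k<n. (LBINT r:{0<..s}. F k r) * e k x)" for s x
 proof -
  have "primitive (%t. L2_proj \<Omega> X (f t)) s x = (LBINT r:{0<..s}. (\<Sum>k<n. F k r * e k x))"
   unfolding primitive_def
  proof (rule integral_lebesgue_on_eq_lborel)
   show "(%r. \<Sum>k<n. F k r * e k x) \<in> borel_measurable borel" using Fm by (intro borel_measurable_sum borel_measurable_times) auto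
   show "AE r in lborel. 0 < r --> r < s --> L2_proj \<Omega> X (f r) x = (\<Sum>k<n. F k r * e k x)"
    using Fall by eventually_elim (simp add: proj fL)
  qed
  also have "... = (\<Sum>k<n. (LBINT r:{0<..s}. F k r) * e k x)" by (rule set_integral_sum_mult) (use Fint in auto)
  finally show ?thesis .
 qed
 have Ft: "Ft (of_int i * \<tau>) x = (\<Sum>k<n. \<Phi> k i * e k x)" for i x
 proof -
  define s where "s = of_int i * \<tau>"
  have "Ft s x = (LBINT r:{0<..s}. (\<Sum>k<n. (LBINT q:{0<..r}. F k q) * e k x))"
   unfolding Ft_def primitive_def[of "primitive _"] prim
   by (rule integral_lebesgue_on_eq_lborel) (use Fm in \<open>auto intro!: borel_measurable_sum borel_measurable_times integral_running_measurable\<close>)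
  also have "... = (\<Sum>k<n. (LBINT r:{0<..s}. (LBINT q:{0<..r}. F k q)) * e k x)"
   by (rule set_integral_sum_mult) (use double_primitive(1)[OF Fm Fint] in auto)
  also have "... = (\<Sum>k<n. \<Phi> k i * e k x)"
  proof (intro sum.cong refl)
   fix k assume "k \<in> {..<n}"
   then have k: "k < n" by simp
   have "(LBINT r:{0<..s}. (LBINT q:{0<..r}. F k q)) = (LBINT r:{0<..s}. of_real (s - r) * F k r)"
    by (rule double_primitive(2)[OF Fm[OF k] Fint[OF k]])
   also have "... = \<Phi> k i"
   proof (cases "i <= 0")
    case True
    then have "s <= 0" using \<tau> by (simp add: s_def mult_nonpos_nonneg)
    then show ?thesis using True by (simp add: \<Phi>_def set_lebesgue_integral_def)
   qed (simp add: \<Phi>_def s_def)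
   finally show "(LBINT r:{0<..s}. (LBINT q:{0<..r}. F k q)) * e k x = \<Phi> k i * e k x" by simp
  qed
  finally show ?thesis by (simp add: s_def)
 qed

 \<comment> \<open>Vanishing initial data remove the two terms \<open>DG\<close> of the
   scheme.\<close>
 have uh0: "L2_proj \<Omega> X (%_. 0) = (%_. 0)" by (simp add: proj L2_zero ip_zero eH)
 have U0: "U i = (%_. 0)" if "i <= 0" for i using CN that by (simp add: CN_II_def Let_def)
 have UX: "U (int i) \<in> X" if "1 <= i" "i <= N" for i using CN that by (simp add: CN_II_def Let_def)
 have ueq: "u j x = 1 / of_real \<tau> * (3/2 * U (int j) x - 2 * U (int j - 1) x + 1/2 * U (int j - 2) x)" for x
  using CN j by (simp add: CN_II_def Let_def)
 have CNeq: "of_real (\<tau> powr (- \<alpha>)) * (\<Sum>j\<le>i. of_real (cn_weight \<alpha> j) * U (int i - int j) x)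
   + of_real (1 - \<alpha>/2) * discrete_op \<Omega> A X (U (int i)) x + of_real (\<alpha>/2) * discrete_op \<Omega> A X (U (int i - 1)) x
   = of_real (1 - \<alpha>/2) * bdf2 \<tau> (%t. Ft t x) (of_int (int i) * \<tau>) + of_real (\<alpha>/2) * bdf2 \<tau> (%t. Ft t x) (of_int (int i - 1) * \<tau>)"
  if "1 <= i" "i <= N" for i x
 proof -
  have z: "bdf2 \<tau> (%t. of_real (power_pos (2 - \<alpha>) t / Gamma (3 - \<alpha>)) * 0) s = 0" for s by (simp add: bdf2_def)
  have i: "i \<in> {1..N}" using that by simp
  show ?thesis
   using CN unfolding CN_II_def Let_def uh0 z Ft_def[symmetric]
   by (elim conjE) (drule bspec[OF _ i], elim conjE, drule spec[of _ x], simp only: mult_zero_right add_0_right)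
 qed
 have UX': "U i \<in> X" if "i <= int N" for i
  using U0[of i] UX[of "nat i"] that X_zero by (cases "i <= 0") auto
 have Uexp: "U i x = (\<Sum>k<n. y k i * e k x)" if "i <= int N" for i x
  using fun_cong[OF expansion[OF UX'[OF that]], of x] by (simp add: y_def)
 have y0: "y k i = 0" if "i <= 0" for k i using U0[OF that] by (simp add: y_def L2_inner_def)
 have Aexp: "discrete_op \<Omega> A X (U i) x = (\<Sum>k<n. (of_real (l k) * y k i) * e k x)" if "i <= int N" for i x
  by (simp add: op[OF UX'[OF that]] y_def)
 define D\<Phi> where "D\<Phi> k i = 1 / of_real \<tau> * (3/2 * \<Phi> k i - 2 * \<Phi> k (i - 1) + 1/2 * \<Phi> k (i - 2))" for k i
 have Dexp: "bdf2 \<tau> (%t. Ft t x) (of_int i * \<tau>) = (\<Sum>k<n. D\<Phi> k i * e k x)" for i x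
 proof -
  have "of_int i * \<tau> - \<tau> = of_int (i - 1) * \<tau>" "of_int i * \<tau> - 2 * \<tau> = of_int (i - 2) * \<tau>" by (simp_all add: algebra_simps)
  then have "bdf2 \<tau> (%t. Ft t x) (of_int i * \<tau>) = 1 / of_real \<tau> * (3/2 * (\<Sum>k<n. \<Phi> k i * e k x) - 2 * (\<Sum>k<n. \<Phi> k (i - 1) * e k x) + 1/2 * (\<Sum>k<n. \<Phi> k (i - 2) * e k x))"
   unfolding bdf2_def by (simp only: Ft)
  also have "... = (\<Sum>k<n. D\<Phi> k i * e k x)"
   by (simp add: D\<Phi>_def sum_distrib_left sum_subtractf[symmetric] sum.distrib[symmetric] algebra_simps)
  finally show ?thesis .
 qed
 have scheme: "of_real (\<tau> powr (- \<alpha>)) * (\<Sum>j\<le>i. of_real (cn_weight \<alpha> j) * y k (int i - int j)) + of_real (1 - \<alpha>/2) * (of_real (l k) * y k (int i)) + of_real (\<alpha>/2) * (of_real (l k) * y k (int i - 1))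
   = of_real (1 - \<alpha>/2) * D\<Phi> k (int i) + of_real (\<alpha>/2) * D\<Phi> k (int i - 1)" if i: "1 <= i" "i <= N" and k: "k < n" for i k
 proof -
  define L where "L k = of_real (\<tau> powr (- \<alpha>)) * (\<Sum>j\<le>i. of_real (cn_weight \<alpha> j) * y k (int i - int j)) + of_real (1 - \<alpha>/2) * (of_real (l k) * y k (int i)) + of_real (\<alpha>/2) * (of_real (l k) * y k (int i - 1))" for k
  define R where "R k = of_real (1 - \<alpha>/2) * D\<Phi> k (int i) + of_real (\<alpha>/2) * D\<Phi> k (int i - 1)" for k
  have "(\<Sum>k<n. L k * e k x) = (\<Sum>k<n. R k * e k x)" for x
  proof -
   have "(\<Sum>j\<le>i. of_real (cn_weight \<alpha> j) * U (int i - int j) x) = (\<Sum>j\<le>i. \<Sum>k<n. of_real (cn_weight \<alpha> j) * y k (int i - int j) * e k x)"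
    using i by (intro sum.cong refl) (simp add: Uexp sum_distrib_left mult.assoc)
   also have "... = (\<Sum>k<n. \<Sum>j\<le>i. of_real (cn_weight \<alpha> j) * y k (int i - int j) * e k x)" by (rule sum.swap)
   also have "... = (\<Sum>k<n. (\<Sum>j\<le>i. of_real (cn_weight \<alpha> j) * y k (int i - int j)) * e k x)" by (simp only: sum_distrib_right)
   finally have T1: "(\<Sum>j\<le>i. of_real (cn_weight \<alpha> j) * U (int i - int j) x) = (\<Sum>k<n. (\<Sum>j\<le>i. of_real (cn_weight \<alpha> j) * y k (int i - int j)) * e k x)" .
   have i1: "int i <= int N" "int i - 1 <= int N" using i by auto
   have "(\<Sum>k<n. L k * e k x) = of_real (\<tau> powr (- \<alpha>)) * (\<Sum>k<n. (\<Sum>j\<le>i. of_real (cn_weight \<alpha> j) * y k (int i - int j)) * e k x)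
     + of_real (1 - \<alpha>/2) * (\<Sum>k<n. (of_real (l k) * y k (int i)) * e k x) + of_real (\<alpha>/2) * (\<Sum>k<n. (of_real (l k) * y k (int i - 1)) * e k x)"
    unfolding L_def by (rule sum_combination3)
   also have "... = of_real (1 - \<alpha>/2) * (\<Sum>k<n. D\<Phi> k (int i) * e k x) + of_real (\<alpha>/2) * (\<Sum>k<n. D\<Phi> k (int i - 1) * e k x)"
    using CNeq[OF i, of x] unfolding T1 Aexp[OF i1(1)] Aexp[OF i1(2)] Dexp .
   also have "... = (\<Sum>k<n. R k * e k x)" using sum_combination3[where r = 0] unfolding R_def by (simp only: mult_zero_left add_0_right)
   finally show ?thesis .
  qed
  then have "(%x. \<Sum>k<n. L k * e k x) = (%x. \<Sum>k<n. R k * e k x)" by (rule HOL.ext)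
  then have "L k = R k" by (rule coefficient_unique[OF _ k])
  then show ?thesis unfolding L_def R_def .
 qed

 define I where "I k = (LBINT r:{0<..t}. of_real (mlk \<alpha> (l k) (t - r)) * F k r)" for k
 define z where "z k = 1 / of_real \<tau> * (3/2 * y k (int j) - 2 * y k (int j - 1) + 1/2 * y k (int j - 2))" for k
 define E where "E k = (LBINT r:{0<..t}. of_real (cn_kernel \<alpha> \<tau> (l k) (t - r)) * F k r)" for k
 have err: "I k - z k = E k" and mint: "set_lint {0<..t} (%r. of_real (mlk \<alpha> (l k) (t - r)) * F k r)" if k: "k < n" for k
 proof -
  have sch: "of_real (\<tau> powr (- \<alpha>)) * (\<Sum>j\<le>i. of_real (cn_weight \<alpha> j) * y k (int i - int j)) + of_real (1 - \<alpha>/2) * (of_real (l k) * y k (int i)) + of_real (\<alpha>/2) * (of_real (l k) * y k (int i - 1))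
   = of_real (1 - \<alpha>/2) * (1 / of_real \<tau> * (3/2 * \<Phi> k (int i) - 2 * \<Phi> k (int i - 1) + 1/2 * \<Phi> k (int i - 2)))
    + of_real (\<alpha>/2) * (1 / of_real \<tau> * (3/2 * \<Phi> k (int i - 1) - 2 * \<Phi> k (int i - 2) + 1/2 * \<Phi> k (int i - 3)))" if i: "1 <= i" "i <= N" for i
  proof -
   have s1: "int i - 1 - 1 = int i - 2" "int i - 1 - 2 = int i - 3" by simp_all
   show ?thesis using scheme[OF i k] unfolding D\<Phi>_def s1 .
  qed
  note ce = component_error[where F = F and y = y and \<Phi> = \<Phi> and k = k, OF al \<tau> k j ld[OF k] y0 \<Phi>_def sch]
  show "I k - z k = E k" unfolding I_def z_def E_def t_def by (rule ce(1))
  show "set_lint {0<..t} (%r. of_real (mlk \<alpha> (l k) (t - r)) * F k r)" unfolding t_def by (rule ce(2))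
 qed
 have sd: "semidiscrete_solution \<Omega> A X \<alpha> \<sigma> f t x = (\<Sum>k<n. I k * e k x)" for x
 proof -
  have "semidiscrete_solution \<Omega> A X \<alpha> \<sigma> f t x = (LBINT r:{0<..t}. (\<Sum>k<n. (of_real (mlk \<alpha> (l k) (t - r)) * F k r) * e k x))"
   unfolding semidiscrete_solution_def
  proof (rule integral_lebesgue_on_eq_lborel)
   show "(%r. \<Sum>k<n. of_real (mlk \<alpha> (l k) (t - r)) * F k r * e k x) \<in> borel_measurable borel"
    using Fm by (intro borel_measurable_sum borel_measurable_times measurable_compose[OF _ borel_measurable_of_real] measurable_compose[OF _ mlk_measurable]) auto
   show "AE r in lborel. 0 < r --> r < t --> solution_op \<Omega> A X \<alpha> \<sigma> (t - r) (L2_proj \<Omega> X (f r)) x = (\<Sum>k<n. of_real (mlk \<alpha> (l k) (t - r)) * F k r * e k x)"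
    using Fall by eventually_elim (simp add: sol fL)
  qed
  also have "... = (\<Sum>k<n. I k * e k x)" unfolding I_def by (rule set_integral_sum_mult) (use mint in auto)
  finally show ?thesis .
 qed
 have uexp: "u j x = (\<Sum>k<n. z k * e k x)" for x
 proof -
  have "u j x = 1 / of_real \<tau> * (3/2 * (\<Sum>k<n. y k (int j) * e k x) - 2 * (\<Sum>k<n. y k (int j - 1) * e k x) + 1/2 * (\<Sum>k<n. y k (int j - 2) * e k x))"
   unfolding ueq using j by (simp add: Uexp)
  also have "... = (\<Sum>k<n. z k * e k x)"
   by (simp add: z_def sum_distrib_left sum_subtractf[symmetric] sum.distrib[symmetric] algebra_simps)
  finally show ?thesis .
 qed
 have "(%x. semidiscrete_solution \<Omega> A X \<alpha> \<sigma> f t x - u j x) = (%x. \<Sum>k<n. E k * e k x)"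
 proof
  fix x
  have "semidiscrete_solution \<Omega> A X \<alpha> \<sigma> f t x - u j x = (\<Sum>k<n. (I k - z k) * e k x)" unfolding sd uexp by (simp add: left_diff_distrib sum_subtractf)
  then show "semidiscrete_solution \<Omega> A X \<alpha> \<sigma> f t x - u j x = (\<Sum>k<n. E k * e k x)" using err by simp
 qed
 moreover have "L2_norm \<Omega> (%x. \<Sum>k<n. E k * e k x) = L2_set (%k. cmod (E k)) {..<n}"
 proof -
  have "(L2_norm \<Omega> (%x. \<Sum>k<n. E k * e k x))\<^sup>2 = (\<Sum>k<n. (cmod (E k))\<^sup>2)"
   using parseval[of E] unfolding L2_inner_self of_real_eq_iff .
  then show ?thesis unfolding L2_set_def using L2_norm_nonneg by (rule real_sqrt_unique[symmetric])
 qed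
 ultimately show ?thesis by (simp add: E_def t_def)
qed

theorem theorem4p1:
  fixes \<Omega> :: "(real^'d::finite) set"
    and A :: "(real^'d \<Rightarrow> complex) \<Rightarrow> (real^'d \<Rightarrow> complex) \<Rightarrow> complex"
    and f :: "real \<Rightarrow> real^'d \<Rightarrow> complex"
    and fhat :: "complex \<Rightarrow> real^'d \<Rightarrow> complex"
    and u0 :: "real^'d \<Rightarrow> complex"
    and \<alpha> T \<mu> \<theta> \<epsilon> cf \<gamma> \<sigma> :: real
  assumes dim: "CARD('d) = 1 \<or> CARD('d) = 2"
    and domain: "open \<Omega>" "connected \<Omega>" "\<Omega> \<noteq> {}" "bounded \<Omega>"
    and A: "elliptic_form \<Omega> A"
    and alpha: "0 < \<alpha>" "\<alpha> < 1"
    and T: "0 < T"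
    and sigma: "0 < \<sigma>"
    and u0: "u0 = (\<lambda>_. 0)"
    and mu: "\<mu> > -1"
    and f: "L2_integrable \<Omega> (lebesgue_on {0<..<T}) f"
    and theta: "pi / 2 < \<theta>" "\<theta> < pi"
    and eps: "0 < \<epsilon>"
    and laplace: "L2_laplace_transform \<Omega> f fhat"
    and analytic: "L2_holomorphic_on \<Omega> fhat (trunc_sector \<theta> \<epsilon>)"
    and bound: "\<And>s. s \<in> trunc_sector \<theta> \<epsilon> \<Longrightarrow> L2_norm \<Omega> (fhat s) \<le> cf * cmod s powr (- \<mu> - 1)"
  shows "\<exists>c>0. \<forall>h \<T> N \<tau> U u.
           regular_triangulation \<Omega> \<gamma> h \<T> \<longrightarrow> N \<ge> 1 \<longrightarrow> \<tau> = T / real N \<longrightarrow>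
           CN_II \<Omega> A (fe_space \<Omega> \<T>) \<alpha> \<tau> N f u0 U u \<longrightarrow>
           (\<forall>n\<in>{1..N}.
              L2_norm \<Omega> (\<lambda>x. semidiscrete_solution \<Omega> A (fe_space \<Omega> \<T>) \<alpha> \<sigma> f (real n * \<tau>) x - u n x)
                \<le> c * (real n * \<tau>) powr (\<alpha> + \<mu> - 2) * \<tau>\<^sup>2)"
proof -
 define m where "m = - cos \<theta> / sin \<theta>"
 define a1 where "a1 = (1 + m) * \<epsilon>"
 \<comment> \<open>For 0 < t <= T this gives a1 < A0 / t, so the contour with vertex A0 / t lies
   inside the cone.\<close>
 define A0 where "A0 = (a1 + 1) * T"
 have m: "0 < m" and cone: "!!s. a1 - m * \<bar>Im s\<bar> < Re s ==> s \<in> trunc_sector \<theta> \<epsilon>"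
  using cone_subset_trunc_sector[OF theta eps] by (auto simp: m_def a1_def)
 have a1: "0 < a1" using m eps by (simp add: a1_def)
 have A0: "0 < A0" using a1 T by (simp add: A0_def)
 obtain \<rho> where \<rho>: "!!s. \<rho> < Re s ==> has_L2_integral \<Omega> (lebesgue_on {0<..}) (%t x. exp (- s * of_real t) * f t x) (fhat s)"
  using laplace unfolding L2_laplace_transform_def by blast
 \<comment> \<open>To the right both of the half plane bound \<rho> for the Laplace integral and of
   the vertex of the cone.\<close>
 define b where "b = max \<rho> a1 + 1"
 have b: "\<rho> < b" "a1 < b" by (auto simp: b_def)
 have lap: "has_L2_integral \<Omega> (lebesgue_on {0<..}) (%t x. exp (- s * of_real t) * f t x) (fhat s)" if "Re s = b" for s
  using \<rho> that b by simp
 have fL: "f r \<in> L2 \<Omega>" if r: "0 < r" for r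
 proof -
  have "(%x. exp (- of_real b * of_real r) * f r x) \<in> L2 \<Omega>"
   using lap[of "of_real b"] r unfolding has_L2_integral_def L2_integrable_def L2_strongly_measurable_def by (simp add: space_restrict_space)
  then have "(%x. exp (of_real b * of_real r) * (exp (- of_real b * of_real r) * f r x)) \<in> L2 \<Omega>" by (rule L2_scale)
  then show ?thesis by (simp add: mult.assoc[symmetric] flip: exp_add)
 qed
 have fhL: "fhat s \<in> L2 \<Omega>" if "s \<in> trunc_sector \<theta> \<epsilon>" for s using analytic that by (simp add: L2_holomorphic_on_def)
 \<comment> \<open>Chosen before the triangulation and the step size, which makes the constant
   independent of h, \<tau> and n.\<close>
 obtain K where K: "0 < K"
  "!!I l f g c c' b a1 t \<tau>. [|finite (I :: nat set); !!k. k \<in> I ==> 0 < l k; !!k. k \<in> I ==> laplace_data (f k) (g k) b a1 m c' \<mu>;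
   !!s. a1 - m * \<bar>Im s\<bar> < Re s ==> L2_set (%k. cmod (g k s)) I <= c * cmod s powr (- \<mu> - 1); 0 <= c; 0 < t; 0 < \<tau>; a1 < A0 / t|] ==>
   L2_set (%k. cmod (LBINT r:{0<..t}. of_real (cn_kernel \<alpha> \<tau> (l k) (t - r)) * f k r)) I <= K * c * t powr (\<alpha> + \<mu> - 2) * \<tau>\<^sup>2"
  by (fact cn_convolution_error[OF alpha mu m A0])
 have "L2_norm \<Omega> (%x. semidiscrete_solution \<Omega> A (fe_space \<Omega> \<T>) \<alpha> \<sigma> f (real j * \<tau>) x - u j x)
     <= K * (\<bar>cf\<bar> + 1) * (real j * \<tau>) powr (\<alpha> + \<mu> - 2) * \<tau>\<^sup>2"
  if tri: "regular_triangulation \<Omega> \<gamma> h \<T>" and N: "1 <= N" and \<tau>: "\<tau> = T / real N"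
   and CN: "CN_II \<Omega> A (fe_space \<Omega> \<T>) \<alpha> \<tau> N f u0 U u" and j: "j \<in> {1..N}" for h \<T> N \<tau> U u j
 proof -
  define X where "X = fe_space \<Omega> \<T>"
  obtain P where "form_space (L2 \<Omega>) X (L2_inner \<Omega>) A P"
   using fe_space_form_space[OF domain(1,4) A tri] unfolding X_def by blast
  then interpret fs: form_space "L2 \<Omega>" X "L2_inner \<Omega>" A P .
  obtain n e l where eb: "eigenbasis (L2 \<Omega>) X (L2_inner \<Omega>) A P n e l" by (rule fs.eigenbasis_exists)
  interpret eigenbasis "L2 \<Omega>" X "L2_inner \<Omega>" A P n e l by (rule eb)
  have \<tau>0: "0 < \<tau>" using \<tau> T N by simp
  define t where "t = real j * \<tau>"
  have t: "0 < t" using j \<tau>0 by (simp add: t_def)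
  have "t <= real N * \<tau>" unfolding t_def using j \<tau>0 by (intro mult_right_mono) auto
  then have tT: "t <= T" using \<tau> N by simp
  define g where "g k s = L2_inner \<Omega> (fhat s) (e k)" for k s
  have "\<forall>k\<in>{..<n}. \<exists>F. F \<in> borel_measurable borel \<and> (AE r in lborel. 0 < r --> L2_inner \<Omega> (f r) (e k) = F r) \<and>
   set_lint {0<..} (%r. of_real (exp (- b * r)) * F r) \<and>
   (\<forall>y. g k (Complex b y) = (LBINT r:{0<..}. exp (- Complex b y * of_real r) * F r))"
  proof
   fix k assume "k \<in> {..<n}"
   then have "e k \<in> L2 \<Omega>" using eH by simp
   from L2_component[OF lap this] show "\<exists>F. F \<in> borel_measurable borel \<and> (AE r in lborel. 0 < r --> L2_inner \<Omega> (f r) (e k) = F r) \<and>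
    set_lint {0<..} (%r. of_real (exp (- b * r)) * F r) \<and>
    (\<forall>y. g k (Complex b y) = (LBINT r:{0<..}. exp (- Complex b y * of_real r) * F r))" unfolding g_def by blast
  qed
  from bchoice[OF this] obtain F where F: "!!k. k < n ==> F k \<in> borel_measurable borel" "!!k. k < n ==> AE r in lborel. 0 < r --> L2_inner \<Omega> (f r) (e k) = F k r"
   "!!k. k < n ==> set_lint {0<..} (%r. of_real (exp (- b * r)) * F k r)"
   "!!k y. k < n ==> g k (Complex b y) = (LBINT r:{0<..}. exp (- Complex b y * of_real r) * F k r)"
   by auto
  \<comment> \<open>Bessel's inequality bounds the coefficient vector by the L2 norm of the
    transform, uniformly over all discrete spaces. Passing to \<open>\<bar>cf\<bar> + 1\<close>
    makes the constant positive.\<close>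
  have gb: "L2_set (%k. cmod (g k s)) {..<n} <= (\<bar>cf\<bar> + 1) * cmod s powr (- \<mu> - 1)" if "a1 - m * \<bar>Im s\<bar> < Re s" for s
  proof -
   have s: "s \<in> trunc_sector \<theta> \<epsilon>" by (rule cone[OF that])
   have "(\<Sum>k<n. (cmod (g k s))\<^sup>2) <= (L2_norm \<Omega> (fhat s))\<^sup>2"
    using bessel[OF fhL[OF s]] unfolding L2_inner_self g_def by simp
   then have "L2_set (%k. cmod (g k s)) {..<n} <= L2_norm \<Omega> (fhat s)"
    unfolding L2_set_def by (rule real_le_lsqrt[OF L2_norm_nonneg])
   also have "... <= cf * cmod s powr (- \<mu> - 1)" by (rule bound[OF s])
   also have "... <= (\<bar>cf\<bar> + 1) * cmod s powr (- \<mu> - 1)" by (intro mult_right_mono) auto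
   finally show ?thesis .
  qed
  have ld: "laplace_data (F k) (g k) b a1 m (\<bar>cf\<bar> + 1) \<mu>" if k: "k < n" for k
  proof
   show "F k \<in> borel_measurable borel" by (rule F(1)[OF k])
   show "set_lint {0<..} (%r. of_real (exp (- b * r)) * F k r)" by (rule F(3)[OF k])
   show "g k (Complex b y) = (LBINT r:{0<..}. exp (- Complex b y * of_real r) * F k r)" for y by (rule F(4)[OF k])
   show "g k holomorphic_on {s. a1 - m * \<bar>Im s\<bar> < Re s}"
    unfolding g_def by (rule holomorphic_on_subset[OF L2_holomorphic_on_inner[OF analytic eH[OF k]]]) (use cone in auto)
   fix s assume s: "a1 - m * \<bar>Im s\<bar> < Re s"
   have "cmod (g k s) <= L2_set (%k. cmod (g k s)) {..<n}" using k by (intro member_le_L2_set) auto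
   then show "cmod (g k s) <= (\<bar>cf\<bar> + 1) * cmod s powr (- \<mu> - 1)" using gb[OF s] by linarith
  qed (rule m a1 b mu)+
  have "L2_norm \<Omega> (%x. semidiscrete_solution \<Omega> A X \<alpha> \<sigma> f t x - u j x)
   = L2_set (%k. cmod (LBINT r:{0<..t}. of_real (cn_kernel \<alpha> \<tau> (l k) (t - r)) * F k r)) {..<n}"
   unfolding t_def
   by (rule scheme_error_eq[OF eb alpha \<tau>0 sigma fL F(1,2) ld CN[folded X_def, unfolded u0]]) (use j in auto)
  also have "... <= K * (\<bar>cf\<bar> + 1) * t powr (\<alpha> + \<mu> - 2) * \<tau>\<^sup>2"
  proof (rule K(2)[where g = g and c' = "\<bar>cf\<bar> + 1" and b = b and ?a1.0 = a1])
   have "a1 * t < A0"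
   proof -
    have "a1 * t <= a1 * T" using a1 tT by simp
    also have "... < A0" using T by (simp add: A0_def distrib_right)
    finally show ?thesis .
   qed
   then show "a1 < A0 / t" using t by (simp add: pos_less_divide_eq)
  qed (use l_pos ld gb t \<tau>0 in auto)
  finally show ?thesis by (simp add: X_def t_def)
 qed
 moreover have "0 < K * (\<bar>cf\<bar> + 1)" using K(1) by (intro mult_pos_pos) auto
 ultimately show ?thesis by (intro exI[of _ "K * (\<bar>cf\<bar> + 1)"] conjI allI impI ballI)
qed

end
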